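(* Let $n \in \mathbb{N}$ and let $q \in [4,\sqrt{n}]$ be a positive integer. Let $\mathcal{L}\subset\mathbb{R}^n$ be a lattice of rank $n$. There is a randomized algorithm that solves $\mathsf{SVP}$ on $\mathcal{L}$ in time $q^{13n+o(n)}$ and in space $\mathrm{poly}(n)\cdot q^{16n/q^2}$.
   Context: $\mathsf{SVP}$ (Shortest Vector Problem): given a basis of a lattice $\mathcal{L}\subset\mathbb{R}^n$, output a vector $\mathbf{y}\in\mathcal{L}$ with $\|\mathbf{y}\|=\lambda_1(\mathcal{L})$, where $\lambda_1(\mathcal{L})$ is the Euclidean length of a shortest nonzero vector of $\mathcal{L}$ (the output must be a nonzero shortest vector). Running times ignore polynomial factors in the bit-length of the input basis. *)

theory Defs
  imports
    "HOL-Probability.Probability_Mass_Function"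
    "HOL-Library.Landau_Symbols"
    "HOL-Library.Log_Nat"
    "HOL-Computational_Algebra.Polynomial"
    "Jordan_Normal_Form.Matrix"
begin

section \<open>Lattices\<close>

text \<open>A basis is given by the columns of a matrix.\<close>

definition lattice :: "real mat \<Rightarrow> real vec set" where
  "lattice B = {B *\<^sub>v map_vec of_int z | z :: int vec. z \<in> carrier_vec (dim_col B)}"

definition cols_lin_indep :: "real mat \<Rightarrow> bool" where
  "cols_lin_indep B \<longleftrightarrow>
     (\<forall>c \<in> carrier_vec (dim_col B). B *\<^sub>v c = 0\<^sub>v (dim_row B) \<longrightarrow> c = 0\<^sub>v (dim_col B))"

text \<open>
  \<open>L\<close> is a lattice of rank \<open>n\<close> in \<open>n\<close>-space with basis \<open>B\<close>. Bases are rational because they are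
  inputs of an algorithm and must have a bit-length; the lattice itself lives in real space.
\<close>

definition is_lattice_basis :: "nat \<Rightarrow> rat mat \<Rightarrow> real vec set \<Rightarrow> bool" where
  "is_lattice_basis n B L \<longleftrightarrow>
     B \<in> carrier_mat n n \<and> cols_lin_indep (map_mat of_rat B) \<and> L = lattice (map_mat of_rat B)"

definition euclidean_norm :: "real vec \<Rightarrow> real" where
  "euclidean_norm v = sqrt (v \<bullet> v)"

definition lambda1 :: "nat \<Rightarrow> real vec set \<Rightarrow> real" where
  "lambda1 n L = (INF v \<in> L - {0\<^sub>v n}. euclidean_norm v)"

definition svp_solution :: "nat \<Rightarrow> real vec set \<Rightarrow> real vec \<Rightarrow> bool" where
  "svp_solution n L y \<longleftrightarrow> y \<in> L \<and> y \<noteq> 0\<^sub>v n \<and> euclidean_norm y = lambda1 n L"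


section \<open>Randomized word-RAM programs\<close>

text \<open>
  The memory consists of integer arrays; a program names its arrays by constants, so it has access
  to a fixed finite number of them, and scalar variables are cells of arrays. Each operation is
  charged one step. What prevents this from being abused is that the bit-length of the memory words
  is bounded separately (see \<open>words_bounded_by\<close>).
\<close>

type_synonym state = "nat \<Rightarrow> nat \<Rightarrow> int"

datatype aexp =
    Const int
  | Cell nat aexp
  | Plus aexp aexp
  | Minus aexp aexp
  | Times aexp aexp
  | Div aexp aexp
  | Mod aexp aexp
  | Less aexp aexp

text \<open>Negative indices address cell \<open>0\<close>.\<close>

primrec aval :: "aexp \<Rightarrow> state \<Rightarrow> int" where
  "aval (Const k) s = k"
| "aval (Cell a e) s = s a (nat (aval e s))"
| "aval (Plus e1 e2) s = aval e1 s + aval e2 s"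
| "aval (Minus e1 e2) s = aval e1 s - aval e2 s"
| "aval (Times e1 e2) s = aval e1 s * aval e2 s"
| "aval (Div e1 e2) s = aval e1 s div aval e2 s"
| "aval (Mod e1 e2) s = aval e1 s mod aval e2 s"
| "aval (Less e1 e2) s = (if aval e1 s < aval e2 s then 1 else 0)"

datatype com =
    Skip
  | Store nat aexp aexp
  | Flip nat aexp
  | Seq com com
  | Cond aexp com com
  | While aexp com

definition store_at :: "state \<Rightarrow> nat \<Rightarrow> int \<Rightarrow> int \<Rightarrow> state" where
  "store_at s a i v = s(a := (s a)(nat i := v))"

text \<open>
  \<open>Flip\<close> stores a fresh fair random bit. Conditions are true when nonzero. The halted program is
  \<open>Skip\<close>; it stays halted.
\<close>

primrec step :: "com \<Rightarrow> state \<Rightarrow> (com \<times> state) pmf" where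
  "step Skip s = return_pmf (Skip, s)"
| "step (Store a i e) s = return_pmf (Skip, store_at s a (aval i s) (aval e s))"
| "step (Flip a i) s =
     map_pmf (\<lambda>b. (Skip, store_at s a (aval i s) (of_bool b))) (bernoulli_pmf (1/2))"
| "step (Seq c1 c2) s =
     (if c1 = Skip then return_pmf (c2, s)
      else map_pmf (\<lambda>(c1', s'). (Seq c1' c2, s')) (step c1 s))"
| "step (Cond e c1 c2) s = return_pmf (if aval e s \<noteq> 0 then c1 else c2, s)"
| "step (While e c) s = return_pmf (if aval e s \<noteq> 0 then Seq c (While e c) else Skip, s)"

primrec run :: "com \<Rightarrow> state \<Rightarrow> nat \<Rightarrow> (com \<times> state) pmf" where
  "run P s 0 = return_pmf (P, s)"
| "run P s (Suc t) = bind_pmf (run P s t) (\<lambda>(c, s'). step c s')"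

definition halted_after :: "com \<Rightarrow> state \<Rightarrow> nat \<Rightarrow> bool" where
  "halted_after P s t \<longleftrightarrow> (\<forall>(c, s') \<in> set_pmf (run P s t). c = Skip)"

text \<open>Running time is worst case over the random bits.\<close>

definition runs_in_time :: "com \<Rightarrow> state \<Rightarrow> real \<Rightarrow> bool" where
  "runs_in_time P s T \<longleftrightarrow> (\<exists>t. real t \<le> T \<and> halted_after P s t)"

text \<open>Meaningful only for programs that halt from \<open>s\<close> within some fixed number of steps.\<close>

definition final_state :: "com \<Rightarrow> state \<Rightarrow> state pmf" where
  "final_state P s = map_pmf snd (run P s (LEAST t. halted_after P s t))"

definition reachable :: "com \<Rightarrow> state \<Rightarrow> state set" where
  "reachable P s = (\<Union>t. snd ` set_pmf (run P s t))"

text \<open>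
  An array occupies all its cells up to the last nonzero one, so that cells holding \<open>0\<close> inside
  an array are not free. Input and output count as occupied space.
\<close>

definition occupied :: "state \<Rightarrow> (nat \<times> nat) set" where
  "occupied s = {(a, i). \<exists>j\<ge>i. s a j \<noteq> 0}"

definition runs_in_space :: "com \<Rightarrow> state \<Rightarrow> real \<Rightarrow> bool" where
  "runs_in_space P s S \<longleftrightarrow>
     (\<forall>s' \<in> reachable P s. finite (occupied s') \<and> real (card (occupied s')) \<le> S)"

definition int_bits :: "int \<Rightarrow> nat" where
  "int_bits k = Suc (nat (bitlen \<bar>k\<bar>))"

definition words_bounded_by :: "com \<Rightarrow> state \<Rightarrow> nat \<Rightarrow> bool" where
  "words_bounded_by P s w \<longleftrightarrow> (\<forall>s' \<in> reachable P s. \<forall>a i. int_bits (s' a i) \<le> w)"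


section \<open>Input and output\<close>

definition basis_bits :: "nat \<Rightarrow> rat mat \<Rightarrow> nat" where
  "basis_bits n B = (\<Sum>i<n. \<Sum>j<n.
     int_bits (fst (quotient_of (B $$ (i, j)))) + int_bits (snd (quotient_of (B $$ (i, j)))))"

text \<open>
  Array 0 holds \<open>n\<close> and \<open>q\<close>; arrays 1 and 2 hold the numerators and denominators of the basis
  vectors, one vector after the other.
\<close>

definition input_state :: "nat \<Rightarrow> nat \<Rightarrow> rat mat \<Rightarrow> state" where
  "input_state n q B = (\<lambda>a k.
     if a = 0 \<and> k = 0 then int n
     else if a = 0 \<and> k = 1 then int q
     else if a = 1 \<and> k < n * n then fst (quotient_of (B $$ (k mod n, k div n)))
     else if a = 2 \<and> k < n * n then snd (quotient_of (B $$ (k mod n, k div n)))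
     else 0)"

text \<open>
  The output vector is read from array 3 (numerators) and array 4 (denominators, which must be
  positive).
\<close>

definition outputs_svp_solution :: "nat \<Rightarrow> real vec set \<Rightarrow> state \<Rightarrow> bool" where
  "outputs_svp_solution n L s \<longleftrightarrow>
     (\<forall>i<n. 0 < s 4 i) \<and> svp_solution n L (Matrix.vec n (\<lambda>i. of_int (s 3 i) / of_int (s 4 i)))"

definition solves_svp :: "com \<Rightarrow> nat \<Rightarrow> nat \<Rightarrow> rat mat \<Rightarrow> real vec set \<Rightarrow> bool" where
  "solves_svp P n q B L \<longleftrightarrow>
     measure_pmf.prob (final_state P (input_state n q B)) {s. outputs_svp_solution n L s} \<ge> 2/3"

end

theory Submission
  imports Defs "HOL-Analysis.L2_Norm" "Jordan_Normal_Form.Determinant"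
begin

text \<open>
  Idea: a sieve with tuples instead of pairs of vectors, in a deterministic form. Identify the lattice with
  the integer vectors, and let \<open>Ball \<sigma> t\<close> consist of those \<open>u\<close> with coefficients at most \<open>t\<close> and image of length at
  most \<open>t \<sigma>\<close>. For each \<open>j\<close> keep a list such that every vector of \<open>Ball \<sigma> (2^j)\<close> is within \<open>Ball \<sigma> (2^j / 2)\<close>
  of a signed sum of \<open>k = 2 x - 1\<close> list elements. For large \<open>\<sigma>\<close> the balls are cubes and a grid will do.
  Then \<open>\<sigma>\<close> is decreased by factors of about \<open>64/65\<close>. The sums over tuples from the levels \<open>j\<close> and \<open>j - 1\<close> are
  so dense that new lists can be selected greedily among them, taking only those that are not
  already close to a \<open>k\<close>-tuple sum of the new list. As \<open>k = 2 x - 1\<close>, this makes the sums over the \<open>x\<close>-subsets of the list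
  pairwise distant, so that a packing argument bounds the length \<open>N\<close> of the list by
  \<open>(N choose x) \<le> (1 + 2 x \<rho> / \<delta>)^n\<close>. For \<open>\<sigma> \<le> 64\<close> a shortest vector is a \<open>2 k\<close>-tuple sum.

  With \<open>x\<close> about \<open>q\<^sup>2 / 7\<close>, the lists have length \<open>q powr (16 n / q\<^sup>2)\<close> and the \<open>3 k\<close> nested loops
  over them take \<open>q powr (13 n)\<close> steps, up to polynomial factors.
\<close>

section \<open>Packing and covering in normed lattices\<close>

text \<open>Only the lists fit into memory. The candidates for a new list, one for each choice of
  \<open>2 * k\<close> signed entries, are far too many to store, so they are numbered, recomputed
  from their number and examined one by one. An error of one half, all that one tuple achieves,
  would use up the whole of the permitted error and leave no room for a selection. Tuples from two
  levels bring it down to a quarter, because half the radius of a level is the radius of the level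
  below. The descent ends by integrality: the balls also bound the coefficients, and a vector with
  coefficients at most 1/2 is zero. If \<open>\<sigma>\<close> did not move, candidates of norm 5/4
  would be separated by 1/4 and the base of the packing bound would be \<open>1 + 10 * x\<close>.
  The factor \<open>64/65\<close> turns this into \<open>1 + 214/21 * x\<close>, while the number of
  rounds stays linear in the bit length of the first \<open>\<sigma>\<close>. With the
  \<open>2 * k\<close> loops for a candidate and \<open>k\<close> more for comparing it with the new
  list, the exponent is just below 13.\<close>

definition ivecs :: "nat \<Rightarrow> (nat \<Rightarrow> int) set" where
  "ivecs n = {z. \<forall>i\<ge>n. z i = 0}"

definition vadd :: "(nat \<Rightarrow> int) \<Rightarrow> (nat \<Rightarrow> int) \<Rightarrow> nat \<Rightarrow> int" where
  "vadd u v = (\<lambda>i. u i + v i)"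

definition vscale :: "int \<Rightarrow> (nat \<Rightarrow> int) \<Rightarrow> nat \<Rightarrow> int" where
  "vscale c u = (\<lambda>i. c * u i)"

definition vsub :: "(nat \<Rightarrow> int) \<Rightarrow> (nat \<Rightarrow> int) \<Rightarrow> nat \<Rightarrow> int" where
  "vsub u v = (\<lambda>i. u i - v i)"

definition vsum :: "('a \<Rightarrow> nat \<Rightarrow> int) \<Rightarrow> 'a set \<Rightarrow> nat \<Rightarrow> int" where
  "vsum f S = (\<lambda>i. \<Sum>a\<in>S. f a i)"

abbreviation vzero :: "nat \<Rightarrow> int" where "vzero \<equiv> \<lambda>_. 0"

lemma ivecs_simps [simp]:
  "vzero \<in> ivecs n"
  "u \<in> ivecs n \<Longrightarrow> v \<in> ivecs n \<Longrightarrow> vadd u v \<in> ivecs n"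
  "u \<in> ivecs n \<Longrightarrow> v \<in> ivecs n \<Longrightarrow> vsub u v \<in> ivecs n"
  "u \<in> ivecs n \<Longrightarrow> vscale c u \<in> ivecs n"
  by (auto simp: ivecs_def vadd_def vsub_def vscale_def)

lemma vsum_ivecs: "(\<And>a. a \<in> S \<Longrightarrow> f a \<in> ivecs n) \<Longrightarrow> vsum f S \<in> ivecs n"
  by (auto simp: ivecs_def vsum_def)

text \<open>The balls \<open>Ball t\<close> of a norm on the lattice of integer vectors.\<close>

locale norm_balls =
  fixes n :: nat and Ball :: "real \<Rightarrow> (nat \<Rightarrow> int) \<Rightarrow> bool"
  assumes ball_add: "Ball a u \<Longrightarrow> Ball b v \<Longrightarrow> Ball (a + b) (vadd u v)"
    and ball_scale: "Ball a u \<Longrightarrow> Ball (\<bar>of_int c\<bar> * a) (vscale c u)"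
    and ball_unscale: "Ball (\<bar>of_int c\<bar> * a) (vscale c u) \<Longrightarrow> c \<noteq> 0 \<Longrightarrow> Ball a u"
    and ball_mono: "Ball a u \<Longrightarrow> a \<le> b \<Longrightarrow> Ball b u"
    and ball_coord: "Ball a u \<Longrightarrow> i < n \<Longrightarrow> \<bar>real_of_int (u i)\<bar> \<le> a"
    and ball_zero: "0 \<le> a \<Longrightarrow> Ball a vzero"
begin

lemma ball_sub: "Ball a u \<Longrightarrow> Ball b v \<Longrightarrow> Ball (a + b) (vsub u v)"
  using ball_add[of a u b "vscale (-1) v"] ball_scale[of b v "-1"]
  by (simp add: vadd_def vsub_def vscale_def)

text \<open>Point counts of large balls stand in for volumes.\<close>

definition npts :: "real \<Rightarrow> nat" where
  "npts t = card {z \<in> ivecs n. Ball t z}"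

lemma card_box: "finite {z \<in> ivecs n. \<forall>i<n. z i \<in> {-m..m}} \<and>
  card {z \<in> ivecs n. \<forall>i<n. z i \<in> {-m..m}} \<le> nat (2 * m + 1) ^ n"
proof -
  have "{z \<in> ivecs n. \<forall>i<n. z i \<in> {-m..m}} =
    (\<lambda>f i. if i < n then f i else 0) ` (PiE {..<n} (\<lambda>_. {-m..m}))" (is "?L = ?h ` ?R")
  proof
    show "?L \<subseteq> ?h ` ?R"
    proof
      fix z assume "z \<in> ?L"
      then have "z = ?h (restrict z {..<n})" "restrict z {..<n} \<in> ?R"
        by (auto simp: ivecs_def fun_eq_iff)
      then show "z \<in> ?h ` ?R" by blast
    qed
  qed (auto simp: ivecs_def PiE_def Pi_def)
  moreover have fin: "finite ?R" by (auto intro: finite_PiE)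
  moreover have "card ?R = nat (2 * m + 1) ^ n" by (simp add: card_PiE)
  ultimately show ?thesis using card_image_le[OF fin, of ?h] by simp
qed

lemma ball_subset_box: "{z \<in> ivecs n. Ball t z} \<subseteq> {z \<in> ivecs n. \<forall>i<n. z i \<in> {-\<lfloor>t\<rfloor>..\<lfloor>t\<rfloor>}}"
proof (clarify)
  fix z i assume "Ball t z" "i < n"
  from ball_coord[OF this] show "z i \<in> {-\<lfloor>t\<rfloor>..\<lfloor>t\<rfloor>}" by (auto simp: abs_le_iff; linarith)
qed

lemma finite_ball: "finite {z \<in> ivecs n. Ball t z}"
  using ball_subset_box card_box finite_subset by blast

lemma npts_le: assumes "t \<ge> 0" shows "real (npts t) \<le> (2 * t + 1) ^ n"
proof -
  have "npts t \<le> nat (2 * \<lfloor>t\<rfloor> + 1) ^ n"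
    unfolding npts_def using card_mono[OF _ ball_subset_box] card_box le_trans by blast
  then have "real (npts t) \<le> real (nat (2 * \<lfloor>t\<rfloor> + 1)) ^ n"
    by (metis of_nat_le_iff of_nat_power)
  also have "\<dots> \<le> (2 * t + 1) ^ n"
  proof (rule power_mono)
    show "real (nat (2 * \<lfloor>t\<rfloor> + 1)) \<le> 2 * t + 1" using assms by linarith
  qed simp
  finally show ?thesis .
qed

lemma npts_mono: "a \<le> b \<Longrightarrow> npts a \<le> npts b"
  unfolding npts_def by (intro card_mono finite_ball) (auto intro: ball_mono)

lemma npts_pos: "0 \<le> t \<Longrightarrow> npts t > 0"
  unfolding npts_def using finite_ball ball_zero[of t] ivecs_simps(1)[of n] by (subst card_gt_0_iff) blast

text \<open>Balls of radius \<open>k d / 2\<close> around the points \<open>k p\<close> are disjoint.\<close>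

lemma npts_packing:
  assumes P: "finite P" "P \<subseteq> ivecs n" "\<And>p. p \<in> P \<Longrightarrow> Ball r p"
    and sep: "\<And>p p'. p \<in> P \<Longrightarrow> p' \<in> P \<Longrightarrow> p \<noteq> p' \<Longrightarrow> \<not> Ball d (vsub p p')"
    and k: "k \<ge> 1"
  shows "card P * npts (real k * (d/2)) \<le> npts (real k * (r + d/2))"
proof -
  let ?B = "{z \<in> ivecs n. Ball (real k * (d/2)) z}"
  let ?f = "\<lambda>(p, z). vadd (vscale (int k) p) z"
  have inj: "inj_on ?f (P \<times> ?B)"
  proof (rule inj_onI, clarify)
    fix p z p' z'
    assume *: "p \<in> P" "p' \<in> P" "Ball (real k * (d/2)) z" "Ball (real k * (d/2)) z'"
      and eq: "vadd (vscale (int k) p) z = vadd (vscale (int k) p') z'"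
    have "p = p'"
    proof (rule ccontr)
      assume "p \<noteq> p'"
      have "vscale (int k) (vsub p p') = vsub z' z"
        using eq by (auto simp: fun_eq_iff vadd_def vsub_def vscale_def algebra_simps)
      moreover have "Ball (real k * d) (vsub z' z)"
        using ball_sub[OF *(4) *(3)] by (simp add: field_simps)
      ultimately have "Ball d (vsub p p')"
        using ball_unscale[of "int k" d "vsub p p'"] k by simp
      with sep * \<open>p \<noteq> p'\<close> show False by blast
    qed
    moreover have "z = z'"
    proof
      fix c
      from \<open>p = p'\<close> fun_cong[OF eq, of c] show "z c = z' c" by (simp add: vadd_def)
    qed
    ultimately show "p = p' \<and> z = z'" by simp
  qed
  have sub: "?f ` (P \<times> ?B) \<subseteq> {z \<in> ivecs n. Ball (real k * (r + d/2)) z}"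
  proof (clarify)
    fix p z assume *: "p \<in> P" "z \<in> ivecs n" "Ball (real k * (d/2)) z"
    have "Ball (real k * r) (vscale (int k) p)" using ball_scale[OF P(3)[OF *(1)], of "int k"] by simp
    from ball_add[OF this *(3)]
    show "vadd (vscale (int k) p) z \<in> ivecs n \<and> Ball (real k * (r + d/2)) (vadd (vscale (int k) p) z)"
      using *(1,2) P(2) by (simp add: distrib_left subset_iff)
  qed
  have "card P * npts (real k * (d/2)) = card (?f ` (P \<times> ?B))"
    unfolding npts_def card_image[OF inj] by (simp only: card_cartesian_product)
  also have "\<dots> \<le> npts (real k * (r + d/2))"
    unfolding npts_def by (rule card_mono[OF finite_ball sub])
  finally show ?thesis .
qed

text \<open>The volume argument, with counts of lattice points for volumes. Small balls contain too
  few points for one count to be sharp, so the radii are blown up: with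
  \<open>\<alpha> = 1 + 2 * r / d\<close>, \<open>npts_packing\<close> says that enlarging the
  radius by the factor \<open>\<alpha>\<close> multiplies the count by at least
  \<open>card P\<close>. After \<open>t\<close> enlargements the count is at least
  \<open>card P ^ t\<close> and at most a constant times \<open>\<alpha> ^ (n * t)\<close>. The
  constant disappears as \<open>t\<close> grows.\<close>

lemma card_packing:
  assumes P: "finite P" "P \<subseteq> ivecs n" "\<And>p. p \<in> P \<Longrightarrow> Ball r p"
    and sep: "\<And>p p'. p \<in> P \<Longrightarrow> p' \<in> P \<Longrightarrow> p \<noteq> p' \<Longrightarrow> \<not> Ball d (vsub p p')"
    and "r > 0" "d > 0"
  shows "real (card P) \<le> (1 + 2 * r / d) ^ n"
proof -
  define \<alpha> where "\<alpha> = 1 + 2 * r / d"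
  have \<alpha>: "\<alpha> > 1" using assms by (simp add: \<alpha>_def)
  \<comment> \<open>The multipliers of \<open>npts_packing\<close> are integers, so each enlargement
    is rounded up and adds up to 1. As \<open>\<alpha> * b = b + 1\<close>, the shifted value
    \<open>\<kappa> t + b\<close> still grows by at most the factor \<open>\<alpha>\<close>, so the
    roundings together cost only a constant.\<close>
  define b where "b = 1 / (\<alpha> - 1)"
  have b: "b > 0" "\<alpha> * b = b + 1" using \<alpha> by (auto simp: b_def field_simps)
  define \<kappa> where "\<kappa> = rec_nat (1::nat) (\<lambda>_ k. nat \<lceil>\<alpha> * real k\<rceil>)"
  have \<kappa>0: "\<kappa> 0 = 1" and \<kappa>S: "\<kappa> (Suc t) = nat \<lceil>\<alpha> * real (\<kappa> t)\<rceil>" for t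
    by (simp_all add: \<kappa>_def)
  have \<kappa>1: "\<kappa> t \<ge> 1" for t
  proof (induction t)
    case (Suc t)
    have "\<alpha> * real (\<kappa> t) > 0" using \<alpha> Suc by simp
    then show ?case unfolding \<kappa>S by linarith
  qed (simp add: \<kappa>0)
  have growth: "real (\<kappa> t) + b \<le> \<alpha> ^ t * (1 + b)" for t
  proof (induction t)
    case (Suc t)
    have "\<alpha> * real (\<kappa> t) \<ge> 0" using \<alpha> by simp
    then have "real (\<kappa> (Suc t)) + b \<le> \<alpha> * real (\<kappa> t) + 1 + b" unfolding \<kappa>S by linarith
    also have "\<dots> = \<alpha> * (real (\<kappa> t) + b)" using b by (simp add: algebra_simps)
    also have "\<dots> \<le> \<alpha> * (\<alpha> ^ t * (1 + b))" using Suc \<alpha> by (intro mult_left_mono) auto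
    finally show ?case by simp
  qed (simp add: \<kappa>0)
  have pw: "card P ^ t \<le> npts (real (\<kappa> t) * (d/2))" for t
  proof (induction t)
    case 0 then show ?case using npts_pos[of "d/2"] assms by (simp add: \<kappa>0)
  next
    case (Suc t)
    have "card P ^ Suc t \<le> card P * npts (real (\<kappa> t) * (d/2))" using Suc by simp
    also have "\<dots> \<le> npts (real (\<kappa> t) * (r + d/2))"
      by (rule npts_packing[OF P sep \<kappa>1])
    also have "\<dots> \<le> npts (real (\<kappa> (Suc t)) * (d/2))"
    proof (rule npts_mono)
      have "real (\<kappa> t) * (r + d/2) = (\<alpha> * real (\<kappa> t)) * (d/2)"
        using assms by (simp add: \<alpha>_def field_simps)
      also have "\<dots> \<le> real (\<kappa> (Suc t)) * (d/2)"
        using assms unfolding \<kappa>S by (intro mult_right_mono) (auto, linarith)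
      finally show "real (\<kappa> t) * (r + d/2) \<le> real (\<kappa> (Suc t)) * (d/2)" .
    qed
    finally show ?case .
  qed
  define C where "C = (1 + d) * (1 + b)"
  have C: "C > 0" using b assms by (simp add: C_def)
  have bnd: "real (card P) ^ t \<le> C ^ n * (\<alpha> ^ n) ^ t" for t
  proof -
    have "real (card P) ^ t \<le> real (npts (real (\<kappa> t) * (d/2)))" using pw[of t]
      by (metis of_nat_le_iff of_nat_power)
    also have "\<dots> \<le> (2 * (real (\<kappa> t) * (d/2)) + 1) ^ n" using assms by (intro npts_le) auto
    also have "\<dots> \<le> (C * \<alpha> ^ t) ^ n"
    proof (rule power_mono)
      have "2 * (real (\<kappa> t) * (d/2)) + 1 \<le> real (\<kappa> t) * d + real (\<kappa> t)" using \<kappa>1[of t] by simp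
      also have "\<dots> = (1 + d) * real (\<kappa> t)" by (simp add: algebra_simps)
      also have "\<dots> \<le> (1 + d) * (\<alpha> ^ t * (1 + b))" using growth[of t] b assms by (intro mult_left_mono) auto
      finally show "2 * (real (\<kappa> t) * (d/2)) + 1 \<le> C * \<alpha> ^ t" by (simp add: C_def algebra_simps)
    qed (use assms in auto)
    also have "\<dots> = C ^ n * (\<alpha> ^ n) ^ t" by (simp add: power_mult_distrib power_mult[symmetric] mult.commute)
    finally show ?thesis .
  qed
  show ?thesis
  proof (rule ccontr)
    assume "\<not> ?thesis"
    then have gt: "real (card P) / \<alpha> ^ n > 1" using \<alpha> by (simp add: \<alpha>_def[symmetric])
    obtain t where t: "C ^ n < (real (card P) / \<alpha> ^ n) ^ t" using real_arch_pow[OF gt] by blast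
    have "C ^ n * (\<alpha> ^ n) ^ t < real (card P) ^ t"
      using t \<alpha> by (simp add: power_divide field_simps)
    with bnd[of t] show False by linarith
  qed
qed

end

section \<open>Sums of tuples and lists separated from them\<close>

primrec sumset :: "(nat \<Rightarrow> (nat \<Rightarrow> int) set) \<Rightarrow> nat \<Rightarrow> (nat \<Rightarrow> int) set" where
  "sumset X 0 = {vzero}"
| "sumset X (Suc m) = {vadd u e | u e. u \<in> sumset X m \<and> e \<in> X m}"

text \<open>The zero vector lets sums of \<open>k\<close> entries include those of fewer, and
  closure under negation means that a list need hold only one of \<open>u\<close> and
  \<open>-u\<close>.\<close>

definition signed :: "(nat \<Rightarrow> int) list \<Rightarrow> (nat \<Rightarrow> int) set" where
  "signed C = insert vzero (set C \<union> vscale (-1) ` set C)"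

abbreviation combs :: "(nat \<Rightarrow> int) list \<Rightarrow> nat \<Rightarrow> (nat \<Rightarrow> int) set" where
  "combs C k \<equiv> sumset (\<lambda>_. signed C) k"

lemma vsum_insert: "finite S \<Longrightarrow> a \<notin> S \<Longrightarrow> vsum f (insert a S) = vadd (f a) (vsum f S)"
  by (auto simp: vsum_def vadd_def)

lemma combs_mono: "k \<le> m \<Longrightarrow> combs C k \<subseteq> combs C m"
proof (induction m)
  case (Suc m)
  have "combs C m \<subseteq> combs C (Suc m)"
  proof
    fix u assume "u \<in> combs C m"
    moreover have "u = vadd u vzero" by (simp add: vadd_def)
    ultimately show "u \<in> combs C (Suc m)" by (auto simp: signed_def)
  qed
  with Suc show ?case by (cases "k = Suc m") auto
qed auto

lemma combs_vsum:
  assumes "finite S" "\<And>a. a \<in> S \<Longrightarrow> f a \<in> signed C"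
  shows "vsum f S \<in> combs C (card S)"
  using assms
proof (induction S)
  case empty then show ?case by (simp add: vsum_def)
next
  case (insert a S)
  then have "vsum f S \<in> combs C (card S)" by simp
  moreover have "vsum f (insert a S) = vadd (vsum f S) (f a)"
    using insert by (simp add: vsum_insert) (simp add: vadd_def add.commute)
  ultimately show ?case using insert by auto
qed

lemma signed_mono: "set C \<subseteq> set C' \<Longrightarrow> signed C \<subseteq> signed C'"
  by (auto simp: signed_def)

context norm_balls
begin

text \<open>What greedy selection guarantees. Only sums of earlier elements are avoided, so the
  order of the list matters.\<close>

definition separated :: "nat \<Rightarrow> real \<Rightarrow> (nat \<Rightarrow> int) list \<Rightarrow> bool" where
  "separated k d C \<longleftrightarrow> (\<forall>i<length C. \<forall>v \<in> combs (take i C) k. \<not> Ball d (vsub (C ! i) v))"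

lemma separated_Nil [simp]: "separated k d []"
  by (simp add: separated_def)

lemma separated_snoc:
  "separated k d C \<Longrightarrow> (\<And>v. v \<in> combs C k \<Longrightarrow> \<not> Ball d (vsub u v)) \<Longrightarrow> separated k d (C @ [u])"
  by (auto simp: separated_def nth_append less_Suc_eq)

lemma ball_vsum:
  assumes "finite S" "\<And>a. a \<in> S \<Longrightarrow> Ball r (f a)" "r \<ge> 0"
  shows "Ball (real (card S) * r) (vsum f S)"
  using assms
proof (induction S)
  case empty then show ?case using ball_zero by (simp add: vsum_def)
next
  case (insert a S)
  then show ?case using ball_add[of r "f a" "real (card S) * r" "vsum f S"]
    by (simp add: vsum_insert algebra_simps)
qed

text \<open>
  The element of largest index in which two index sets differ would be close to a signed sum of
  earlier elements if the two subset sums were close.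
\<close>

lemma subset_sums_separated:
  assumes sep: "separated (2 * x - 1) d C"
    and S: "S \<subseteq> {..<length C}" "T \<subseteq> {..<length C}" "card S = x" "card T = x"
    and i: "i \<in> S" "i \<notin> T" and max: "\<And>j. j \<in> S - T \<union> (T - S) \<Longrightarrow> j \<le> i"
  shows "\<not> Ball d (vsub (vsum ((!) C) S) (vsum ((!) C) T))"
proof -
  have fin: "finite S" "finite T" using S finite_subset by blast+
  let ?U = "(S - T - {i}) \<union> (T - S)"
  let ?f = "\<lambda>j. if j \<in> T then C ! j else vscale (-1) (C ! j)"
  have fU: "finite ?U" using fin by auto
  have lt: "j < i" if "j \<in> ?U" for j
  proof -
    have "j \<noteq> i" "j \<le> i" using that i max[of j] by blast+
    then show ?thesis by simp
  qed
  have "i < length C" using S i by auto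
  have sg: "?f j \<in> signed (take i C)" if "j \<in> ?U" for j
  proof -
    have "C ! j \<in> set (take i C)" using lt[OF that] \<open>i < length C\<close>
      by (metis length_take min.absorb4 nth_mem nth_take)
    then show ?thesis by (auto simp: signed_def)
  qed
  \<comment> \<open>Common elements cancel in the difference of the two sums. Of the
    \<open>2 * x\<close> elements of \<open>S\<close> and \<open>T\<close>, the element
    \<open>i\<close> itself is not counted, which is where \<open>2 * x - 1\<close> comes
    from.\<close>
  have "card ?U \<le> card (S - {i}) + card T"
  proof -
    have "card ?U \<le> card (S - T - {i}) + card (T - S)" by (rule card_Un_le)
    also have "\<dots> \<le> card (S - {i}) + card T" by (intro add_mono card_mono) (use fin in auto)
    finally show ?thesis .
  qed
  also have "\<dots> = 2 * x - 1"
  proof -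
    have "card S > 0" using i fin by (auto simp: card_gt_0_iff)
    moreover have "card (S - {i}) = card S - 1" using i fin by simp
    ultimately show ?thesis using S by simp
  qed
  finally have cU: "card ?U \<le> 2 * x - 1" .
  have "vsum ?f ?U \<in> combs (take i C) (card ?U)" by (rule combs_vsum[OF fU sg])
  then have in_combs: "vsum ?f ?U \<in> combs (take i C) (2 * x - 1)" using combs_mono[OF cU] by blast
  have "vsub (vsum ((!) C) S) (vsum ((!) C) T) = vsub (C ! i) (vsum ?f ?U)"
  proof
    fix c
    have 1: "(\<Sum>a\<in>S. (C ! a) c) = (\<Sum>a\<in>S - T - {i}. (C ! a) c) + (C ! i) c + (\<Sum>a\<in>S \<inter> T. (C ! a) c)"
    proof -
      have "S = insert i ((S - T - {i}) \<union> (S \<inter> T))" using i by auto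
      then have "(\<Sum>a\<in>S. (C ! a) c) = (\<Sum>a\<in>insert i ((S - T - {i}) \<union> (S \<inter> T)). (C ! a) c)" by simp
      also have "\<dots> = (C ! i) c + (\<Sum>a\<in>(S - T - {i}) \<union> (S \<inter> T). (C ! a) c)"
        using fin i by (subst sum.insert) auto
      also have "(\<Sum>a\<in>(S - T - {i}) \<union> (S \<inter> T). (C ! a) c) =
          (\<Sum>a\<in>S - T - {i}. (C ! a) c) + (\<Sum>a\<in>S \<inter> T. (C ! a) c)"
        using fin by (intro sum.union_disjoint) auto
      finally show ?thesis by simp
    qed
    have 2: "(\<Sum>a\<in>T. (C ! a) c) = (\<Sum>a\<in>T - S. (C ! a) c) + (\<Sum>a\<in>S \<inter> T. (C ! a) c)"
    proof -
      have "T = (T - S) \<union> (S \<inter> T)" by auto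
      then have "(\<Sum>a\<in>T. (C ! a) c) = (\<Sum>a\<in>(T - S) \<union> (S \<inter> T). (C ! a) c)" by simp
      also have "\<dots> = (\<Sum>a\<in>T - S. (C ! a) c) + (\<Sum>a\<in>S \<inter> T. (C ! a) c)"
        using fin by (intro sum.union_disjoint) auto
      finally show ?thesis .
    qed
    have 3: "(\<Sum>a\<in>?U. ?f a c) = - (\<Sum>a\<in>S - T - {i}. (C ! a) c) + (\<Sum>a\<in>T - S. (C ! a) c)"
    proof -
      have "(\<Sum>a\<in>?U. ?f a c) = (\<Sum>a\<in>S - T - {i}. ?f a c) + (\<Sum>a\<in>T - S. ?f a c)"
        using fin by (intro sum.union_disjoint) auto
      also have "(\<Sum>a\<in>S - T - {i}. ?f a c) = (\<Sum>a\<in>S - T - {i}. - (C ! a) c)"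
        by (intro sum.cong) (auto simp: vscale_def)
      also have "(\<Sum>a\<in>T - S. ?f a c) = (\<Sum>a\<in>T - S. (C ! a) c)"
        by (intro sum.cong) auto
      finally show ?thesis by (simp add: sum_negf)
    qed
    show "vsub (vsum ((!) C) S) (vsum ((!) C) T) c = vsub (C ! i) (vsum ?f ?U) c"
      unfolding vsub_def vsum_def using 1 2 3 by simp
  qed
  then show ?thesis using sep in_combs \<open>i < length C\<close> by (auto simp: separated_def)
qed

text \<open>The sums over the \<open>x\<close>-subsets lie in a ball of radius \<open>x * r\<close>
  and are pairwise not within \<open>d\<close> of each other. In particular they are distinct, so
  \<open>card_packing\<close> counts the subsets.\<close>

lemma separated_choose:
  assumes sep: "separated (2 * x - 1) d C" and C: "\<And>c. c \<in> set C \<Longrightarrow> c \<in> ivecs n \<and> Ball r c"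
    and pos: "x \<ge> 1" "r > 0" "d > 0"
  shows "real (length C choose x) \<le> (1 + 2 * (real x * r) / d) ^ n"
proof -
  let ?SS = "{S. S \<subseteq> {..<length C} \<and> card S = x}"
  let ?P = "(\<lambda>S. vsum ((!) C) S) ` ?SS"
  have key: "\<not> Ball d (vsub (vsum ((!) C) S) (vsum ((!) C) T))"
    if ST: "S \<in> ?SS" "T \<in> ?SS" "S \<noteq> T" for S T
  proof -
    have fin: "finite S" "finite T" using ST finite_subset by blast+
    let ?D = "S - T \<union> (T - S)"
    have "?D \<noteq> {}" "finite ?D" using ST fin by auto
    define i where "i = Max ?D"
    have i: "i \<in> ?D" "\<And>j. j \<in> ?D \<Longrightarrow> j \<le> i"
      using Max_in[OF \<open>finite ?D\<close> \<open>?D \<noteq> {}\<close>] Max_ge[OF \<open>finite ?D\<close>] by (auto simp: i_def)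
    show ?thesis
    proof (cases "i \<in> S")
      case True
      then show ?thesis using subset_sums_separated[OF sep, of S T i] ST i by auto
    next
      case False
      have "\<not> Ball d (vsub (vsum ((!) C) T) (vsum ((!) C) S))"
        using subset_sums_separated[OF sep, of T S i] ST i False by auto
      moreover have "vsub (vsum ((!) C) T) (vsum ((!) C) S) =
          vscale (-1) (vsub (vsum ((!) C) S) (vsum ((!) C) T))"
        by (simp add: vsub_def vscale_def)
      ultimately show ?thesis using ball_scale[of d _ "-1"] by force
    qed
  qed
  have inj: "inj_on (\<lambda>S. vsum ((!) C) S) ?SS"
  proof (rule inj_onI, rule ccontr)
    fix S T assume ST: "S \<in> ?SS" "T \<in> ?SS" "vsum ((!) C) S = vsum ((!) C) T" "S \<noteq> T"
    have "Ball d (vsub (vsum ((!) C) S) (vsum ((!) C) T))"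
      unfolding ST(3) using ball_zero[of d] pos by (simp add: vsub_def)
    with key[OF ST(1,2,4)] show False by simp
  qed
  have "real (card ?P) \<le> (1 + 2 * (real x * r) / d) ^ n"
  proof (rule card_packing)
    show "finite ?P" by (rule finite_imageI) (rule finite_subset[of _ "Pow {..<length C}"], auto)
    show "?P \<subseteq> ivecs n" using C by (auto intro!: vsum_ivecs simp: subset_iff)
    show "Ball (real x * r) p" if p: "p \<in> ?P" for p
    proof -
      obtain S where S: "p = vsum ((!) C) S" "S \<subseteq> {..<length C}" "card S = x" using p by blast
      have "finite S" using S finite_subset by blast
      moreover have "Ball r (C ! a)" if "a \<in> S" for a using C S that by (meson lessThan_iff nth_mem subsetD)
      ultimately show ?thesis using ball_vsum[of S r "(!) C"] S pos by simp
    qed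
    show "\<not> Ball d (vsub p p')" if p: "p \<in> ?P" "p' \<in> ?P" "p \<noteq> p'" for p p'
    proof -
      obtain S where S: "p = vsum ((!) C) S" "S \<in> ?SS" using p(1) by auto
      obtain T where T: "p' = vsum ((!) C) T" "T \<in> ?SS" using p(2) by auto
      have "S \<noteq> T" using p(3) S T by auto
      with key S T show ?thesis by blast
    qed
  qed (use pos in auto)
  also have "card ?P = card ?SS" by (rule card_image[OF inj])
  also have "card ?SS = length C choose x" using n_subsets[of "{..<length C}" x] by simp
  finally show ?thesis .
qed

text \<open>The \<open>x\<close>-th root of the previous bound, by
  \<open>(N / x) ^ x \<le> (N choose x)\<close>. Lists shorter than \<open>x\<close> satisfy it
  because the second factor is at least 1.\<close>

lemma separated_length:
  assumes sep: "separated (2 * x - 1) d C" and C: "\<And>c. c \<in> set C \<Longrightarrow> c \<in> ivecs n \<and> Ball r c"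
    and pos: "x \<ge> 1" "r > 0" "d > 0"
  shows "real (length C) \<le> real x * (1 + 2 * (real x * r) / d) powr (real n / real x)"
proof -
  let ?l = "1 + 2 * (real x * r) / d"
  have l: "?l \<ge> 1" using pos by simp
  show ?thesis
  proof (cases "x \<le> length C")
    case False
    have "real x * 1 \<le> real x * ?l powr (real n / real x)"
      using l by (intro mult_left_mono ge_one_powr_ge_zero) auto
    moreover have "real (length C) \<le> real x" using False by simp
    ultimately show ?thesis by linarith
  next
    case True
    have "(real (length C) / real x) ^ x \<le> real (length C choose x)"
      using binomial_ge_n_over_k_pow_k[OF True, where 'a=real] by simp
    also have "\<dots> \<le> ?l ^ n" by (rule separated_choose[OF sep C pos])
    finally have "(real (length C) / real x) ^ x \<le> ?l ^ n" .
    then have "((real (length C) / real x) ^ x) powr (1 / real x) \<le> (?l ^ n) powr (1 / real x)"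
      by (intro powr_mono2) auto
    moreover have "((real (length C) / real x) ^ x) powr (1 / real x) = real (length C) / real x"
    proof -
      have "real (length C) / real x > 0" using True pos by (intro divide_pos_pos) auto
      then have "(real (length C) / real x) ^ x = (real (length C) / real x) powr real x"
        by (rule powr_realpow[symmetric])
      then show ?thesis using pos \<open>real (length C) / real x > 0\<close> by (simp only: powr_powr) simp
    qed
    moreover have "(?l ^ n) powr (1 / real x) = ?l powr (real n / real x)"
    proof -
      have "?l ^ n = ?l powr real n" using l by (intro powr_realpow[symmetric]) linarith
      then show ?thesis by (simp only: powr_powr) simp
    qed
    ultimately have "real (length C) / real x \<le> ?l powr (real n / real x)" by simp
    then show ?thesis using pos by (simp add: pos_divide_le_eq mult.commute)
  qed
qed

end

section \<open>Deterministic runs\<close>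

text \<open>Each step taken has a point mass as its distribution, so no coin is flipped and the
  whole run is a point mass too. The invariant is asserted of each state passed through because
  space and word length are claimed for all reachable states.\<close>

inductive exec :: "(state \<Rightarrow> bool) \<Rightarrow> com \<Rightarrow> state \<Rightarrow> nat \<Rightarrow> com \<Rightarrow> state \<Rightarrow> bool" for I where
  refl: "I s \<Longrightarrow> exec I c s 0 c s"
| step: "I s \<Longrightarrow> c \<noteq> Skip \<Longrightarrow> step c s = return_pmf (c1, s1) \<Longrightarrow> exec I c1 s1 t c' s' \<Longrightarrow>
    exec I c s (Suc t) c' s'"

lemma exec_I: "exec I c s t c' s' \<Longrightarrow> I s \<and> I s'"
  by (induction rule: exec.induct) auto

lemma run_step: "step c s = return_pmf (c1, s1) \<Longrightarrow> run c s (Suc t) = run c1 s1 t"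
  by (induction t) (simp_all add: bind_return_pmf)

lemma run_Skip: "run Skip s t = return_pmf (Skip, s)"
  by (induction t) (simp_all add: bind_return_pmf)

text \<open>\<open>final_state\<close> refers to the least halting time and \<open>reachable\<close>
  to all times, so the claim is about an arbitrary \<open>u\<close>. Fixing the state whenever the
  program has become \<open>Skip\<close> makes it unnecessary to identify the least halting
  time.\<close>

lemma exec_run:
  "exec I c s t c' s' \<Longrightarrow> c' = Skip \<Longrightarrow>
    (\<exists>d r. run c s u = return_pmf (d, r) \<and> I r \<and> (d = Skip \<longrightarrow> r = s') \<and> (t \<le> u \<longrightarrow> d = Skip))"
proof (induction arbitrary: u rule: exec.induct)
  case (refl s c)
  then show ?case by (auto simp: run_Skip)
next
  case (step s c c1 s1 t c' s')
  show ?case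
  proof (cases u)
    case 0
    then show ?thesis using step by auto
  next
    case (Suc v)
    then show ?thesis using step.IH[of v] step.prems run_step[OF step.hyps(3), of v] by auto
  qed
qed

lemma exec_Seq:
  "exec I c1 s t d s1 \<Longrightarrow> d = Skip \<Longrightarrow> exec I c2 s1 t2 Skip s2 \<Longrightarrow> exec I (Seq c1 c2) s (Suc (t + t2)) Skip s2"
proof (induction rule: exec.induct)
  case (refl s c)
  then show ?case by (auto intro!: exec.step)
next
  case (step s c c1 s1 t c' s')
  show ?case
    using step by (auto intro!: exec.step[where ?c1.0 = "Seq c1 c2" and ?s1.0 = s1] simp: map_pmf_def bind_return_pmf)
qed

text \<open>Total correctness within \<open>T\<close> steps, with \<open>I\<close> holding in every state passed through.\<close>

definition wp :: "(state \<Rightarrow> bool) \<Rightarrow> com \<Rightarrow> nat \<Rightarrow> (state \<Rightarrow> bool) \<Rightarrow> state \<Rightarrow> bool" where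
  "wp I c T Q s \<longleftrightarrow> (\<exists>t\<le>T. \<exists>s'. exec I c s t Skip s' \<and> Q s')"

lemma wp_mono: "wp I c T Q s \<Longrightarrow> T \<le> T' \<Longrightarrow> (\<And>s'. I s' \<Longrightarrow> Q s' \<Longrightarrow> Q' s') \<Longrightarrow> wp I c T' Q' s"
  unfolding wp_def using exec_I by (meson le_trans)

lemma wp_skip: "I s \<Longrightarrow> Q s \<Longrightarrow> wp I Skip T Q s"
  unfolding wp_def using exec.refl by blast

lemma wp_store:
  assumes "I s" "I (store_at s a (aval i s) (aval e s))" "Q (store_at s a (aval i s) (aval e s))" "1 \<le> T"
  shows "wp I (Store a i e) T Q s"
proof -
  have "exec I (Store a i e) s (Suc 0) Skip (store_at s a (aval i s) (aval e s))"
    using assms by (auto intro!: exec.intros)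
  then show ?thesis unfolding wp_def using assms by (metis One_nat_def)
qed

lemma wp_seq:
  assumes "wp I c1 T1 (wp I c2 T2 Q) s" "T1 + T2 + 1 \<le> T"
  shows "wp I (Seq c1 c2) T Q s"
proof -
  obtain t1 s1 where 1: "t1 \<le> T1" "exec I c1 s t1 Skip s1" "wp I c2 T2 Q s1"
    using assms by (auto simp: wp_def)
  obtain t2 s2 where 2: "t2 \<le> T2" "exec I c2 s1 t2 Skip s2" "Q s2"
    using 1 by (auto simp: wp_def)
  have "exec I (Seq c1 c2) s (Suc (t1 + t2)) Skip s2" by (rule exec_Seq[OF 1(2) _ 2(2)]) simp
  then show ?thesis unfolding wp_def using 1 2 assms by (intro exI[of _ "Suc (t1 + t2)"]) auto
qed

lemma wp_cond:
  assumes "I s" "aval e s \<noteq> 0 \<Longrightarrow> wp I c1 T1 Q s" "aval e s = 0 \<Longrightarrow> wp I c2 T1 Q s" "Suc T1 \<le> T"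
  shows "wp I (Cond e c1 c2) T Q s"
proof -
  have "wp I (if aval e s \<noteq> 0 then c1 else c2) T1 Q s" using assms by auto
  then obtain t s' where t: "t \<le> T1" "exec I (if aval e s \<noteq> 0 then c1 else c2) s t Skip s'" "Q s'"
    by (auto simp: wp_def)
  have "exec I (Cond e c1 c2) s (Suc t) Skip s'"
    by (rule exec.step[OF assms(1) _ _ t(2)]) auto
  then show ?thesis unfolding wp_def using t assms by (meson Suc_le_mono le_trans)
qed

lemma wp_while_exit:
  assumes "I s" "aval e s = 0" "Q s" "1 \<le> T"
  shows "wp I (While e c) T Q s"
proof -
  have "exec I (While e c) s (Suc 0) Skip s"
    using assms by (auto intro!: exec.intros)
  then show ?thesis unfolding wp_def using assms by (metis One_nat_def)
qed

lemma wp_while_step: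
  assumes "I s" "aval e s \<noteq> 0" "wp I c T1 (wp I (While e c) T2 Q) s" "T1 + T2 + 2 \<le> T"
  shows "wp I (While e c) T Q s"
proof -
  have "wp I (Seq c (While e c)) (T1 + T2 + 1) Q s" using wp_seq assms(3) by blast
  then obtain t s' where t: "t \<le> T1 + T2 + 1" "exec I (Seq c (While e c)) s t Skip s'" "Q s'"
    by (auto simp: wp_def)
  have "exec I (While e c) s (Suc t) Skip s'"
    by (rule exec.step[OF assms(1) _ _ t(2)]) (use assms in auto)
  then show ?thesis unfolding wp_def using t assms by (intro exI[of _ "Suc t"]) auto
qed

text \<open>The invariant \<open>V m\<close> describes the states from which at most \<open>m\<close> iterations remain.\<close>

lemma wp_while:
  assumes V: "V N s"
    and step: "\<And>m s. V m s \<Longrightarrow> I s \<Longrightarrow> aval e s \<noteq> 0 \<Longrightarrow> m > 0 \<and> wp I c T1 (V (m - 1)) s"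
    and exit: "\<And>m s. V m s \<Longrightarrow> I s \<Longrightarrow> aval e s = 0 \<Longrightarrow> Q s"
    and T: "N * (T1 + 2) + 1 \<le> T" and I: "I s"
  shows "wp I (While e c) T Q s"
  using V T I
proof (induction N arbitrary: s T)
  case 0
  have "aval e s = 0" using step[OF 0(1) 0(3)] by auto
  then show ?case using 0 exit by (intro wp_while_exit) auto
next
  case (Suc N)
  show ?case
  proof (cases "aval e s = 0")
    case True
    then show ?thesis using Suc.prems exit by (intro wp_while_exit) auto
  next
    case False
    have 1: "wp I c T1 (V N) s" using step[OF Suc.prems(1,3) False] by simp
    have "wp I c T1 (wp I (While e c) (N * (T1 + 2) + 1) Q) s"
      by (rule wp_mono[OF 1 order.refl]) (rule Suc.IH, auto)
    then show ?thesis
      by (rule wp_while_step[where c = c and e = e and s = s, rotated 2]) (use Suc.prems False in auto)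
  qed
qed

abbreviation "Var v \<equiv> Cell v (Const 0)"
abbreviation "Assign v e \<equiv> Store v (Const 0) e"

definition For :: "nat \<Rightarrow> aexp \<Rightarrow> com \<Rightarrow> com" where
  "For v e c = Seq (Assign v (Const 0)) (While (Less (Var v) e) (Seq c (Assign v (Plus (Var v) (Const 1)))))"

text \<open>\<open>V m\<close> describes the state at the head of the loop with counter
  \<open>m\<close>. The limit \<open>e\<close> is evaluated anew in each round, hence
  \<open>bound\<close> for every such state. The four additional steps per round are the test, the
  increment and two reductions of \<open>Seq\<close>.\<close>

lemma wp_for:
  assumes I: "I s" "\<And>s' m. I s' \<Longrightarrow> m \<le> N \<Longrightarrow> I (store_at s' v 0 (int m))"
    and start: "V 0 (store_at s v 0 0)"
    and bound: "\<And>m s. V m s \<Longrightarrow> aval e s = int N" and cnt: "\<And>m s. V m s \<Longrightarrow> s v 0 = int m"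
    and body: "\<And>m s. m < N \<Longrightarrow> V m s \<Longrightarrow> I s \<Longrightarrow>
      wp I c T1 (\<lambda>s'. s' v 0 = int m \<and> V (Suc m) (store_at s' v 0 (int (Suc m)))) s"
    and exit: "\<And>s. V N s \<Longrightarrow> I s \<Longrightarrow> Q s"
    and T: "N * (T1 + 4) + 3 \<le> T"
  shows "wp I (For v e c) T Q s"
  unfolding For_def
proof (rule wp_seq[where ?T1.0 = 1 and ?T2.0 = "N * (T1 + 4) + 1"])
  have "wp I (While (Less (Var v) e) (Seq c (Assign v (Plus (Var v) (Const 1))))) (N * (T1 + 4) + 1) Q
      (store_at s v 0 0)"
  proof (rule wp_while[where V = "\<lambda>r s. r \<le> N \<and> V (N - r) s" and N = N and ?T1.0 = "T1 + 2"])
    fix r s assume V: "r \<le> N \<and> V (N - r) s" and "I s"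
    let ?m = "N - r"
    have val: "aval e s = int N" "s v 0 = int ?m" using V bound[of ?m s] cnt[of ?m s] by blast+
    show "r > 0 \<and> wp I (Seq c (Assign v (Plus (Var v) (Const 1)))) (T1 + 2)
        (\<lambda>s. r - 1 \<le> N \<and> V (N - (r - 1)) s) s" if "aval (Less (Var v) e) s \<noteq> 0"
    proof -
      from that have lt: "?m < N" using val by (auto split: if_splits)
      then have r: "r > 0" by simp
      have "wp I c T1 (wp I (Assign v (Plus (Var v) (Const 1))) 1 (\<lambda>s. r - 1 \<le> N \<and> V (N - (r - 1)) s)) s"
      proof (rule wp_mono[OF body[OF lt _ \<open>I s\<close>] order.refl])
        show "V ?m s" using V by simp
        fix s' assume s': "I s'" "s' v 0 = int ?m \<and> V (Suc ?m) (store_at s' v 0 (int (Suc ?m)))"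
        have eq: "N - (r - 1) = Suc ?m" using r V by auto
        show "wp I (Assign v (Plus (Var v) (Const 1))) 1 (\<lambda>s. r - 1 \<le> N \<and> V (N - (r - 1)) s) s'"
        proof (rule wp_store)
          have *: "store_at s' v (aval (Const 0) s') (aval (Plus (Var v) (Const 1)) s') =
              store_at s' v 0 (int (Suc ?m))" using s' by (simp add: algebra_simps)
          show "I (store_at s' v (aval (Const 0) s') (aval (Plus (Var v) (Const 1)) s'))"
            unfolding * using I(2)[OF s'(1), of "Suc ?m"] lt by simp
          show "r - 1 \<le> N \<and> V (N - (r - 1)) (store_at s' v (aval (Const 0) s') (aval (Plus (Var v) (Const 1)) s'))"
            unfolding * eq using s' V by auto
        qed (use s' in auto)
      qed
      with r show ?thesis by (auto intro!: wp_seq[where ?T1.0 = T1 and ?T2.0 = 1])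
    qed
    show "Q s" if "aval (Less (Var v) e) s = 0"
      using that val V exit[of s] \<open>I s\<close> by (cases "r = 0") (auto split: if_splits)
  qed (use start I(1) I(2)[of s 0] in \<open>auto simp: algebra_simps\<close>)
  then show "wp I (Assign v (Const 0)) 1
      (wp I (While (Less (Var v) e) (Seq c (Assign v (Plus (Var v) (Const 1))))) (N * (T1 + 4) + 1) Q) s"
    using I(1) I(2)[of s 0] by (intro wp_store) auto
qed (use T in auto)

lemma wp_program:
  assumes "wp I P T Q s"
  shows "runs_in_time P s (real T)"
    and "\<exists>s'. final_state P s = return_pmf s' \<and> Q s' \<and> I s'"
    and "\<And>r. r \<in> reachable P s \<Longrightarrow> I r"
proof -
  obtain t s' where t: "t \<le> T" "exec I P s t Skip s'" "Q s'" using assms by (auto simp: wp_def)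
  have run: "\<exists>d r. run P s u = return_pmf (d, r) \<and> I r \<and> (d = Skip \<longrightarrow> r = s') \<and> (t \<le> u \<longrightarrow> d = Skip)" for u
    by (rule exec_run[OF t(2)]) simp
  have halt: "halted_after P s t" using run[of t] by (auto simp: halted_after_def)
  then show "runs_in_time P s (real T)" using t by (auto simp: runs_in_time_def)
  let ?u = "LEAST t. halted_after P s t"
  have "halted_after P s ?u" using halt by (rule LeastI)
  then have "run P s ?u = return_pmf (Skip, s')"
    using run[of ?u] by (auto simp: halted_after_def)
  then show "\<exists>s'. final_state P s = return_pmf s' \<and> Q s' \<and> I s'"
    using t exec_I[OF t(2)] by (auto simp: final_state_def)
  show "I r" if r: "r \<in> reachable P s" for r
  proof -
    obtain u where "r \<in> snd ` set_pmf (run P s u)" using r unfolding reachable_def by blast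
    then show ?thesis using run[of u] by auto
  qed
qed

section \<open>Space and word length from a single invariant\<close>

definition inbounds :: "int \<Rightarrow> (nat \<Rightarrow> nat) \<Rightarrow> state \<Rightarrow> bool" where
  "inbounds b len s \<longleftrightarrow> (\<forall>a i. \<bar>s a i\<bar> \<le> b \<and> (len a \<le> i \<longrightarrow> s a i = 0))"

lemma inbounds_store:
  "inbounds b len s \<Longrightarrow> nat i < len a \<Longrightarrow> \<bar>v\<bar> \<le> b \<Longrightarrow> inbounds b len (store_at s a i v)"
  by (auto simp: inbounds_def store_at_def)

lemma inbounds_space:
  assumes "\<And>r. r \<in> reachable P s \<Longrightarrow> inbounds b len r" and len: "\<And>a. a \<ge> m \<Longrightarrow> len a = 0"
    and S: "real (\<Sum>a<m. len a) \<le> S"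
  shows "runs_in_space P s S"
  unfolding runs_in_space_def
proof
  fix r assume "r \<in> reachable P s"
  then have r: "inbounds b len r" using assms by blast
  let ?X = "SIGMA a:{..<m}. {..<len a}"
  have sub: "occupied r \<subseteq> ?X"
  proof
    fix y assume "y \<in> occupied r"
    then obtain a i j where y: "y = (a, i)" "i \<le> j" "r a j \<noteq> 0" by (auto simp: occupied_def)
    then have "j < len a" using r by (meson inbounds_def not_le)
    moreover have "a < m" using len[of a] \<open>j < len a\<close> by (cases "a < m") auto
    ultimately show "y \<in> ?X" using y by auto
  qed
  have "card (occupied r) \<le> card ?X" by (rule card_mono[OF _ sub]) auto
  then have "card (occupied r) \<le> (\<Sum>a<m. len a)" by simp
  then have "real (card (occupied r)) \<le> S" using S by linarith
  moreover have "finite (occupied r)" by (rule finite_subset[OF sub]) auto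
  ultimately show "finite (occupied r) \<and> real (card (occupied r)) \<le> S" by simp
qed

lemma int_bits_mono: "\<bar>a\<bar> \<le> \<bar>b\<bar> \<Longrightarrow> int_bits a \<le> int_bits b"
  unfolding int_bits_def bitlen_def by (simp add: floorlog_mono nat_mono)

lemma int_bits_le: assumes "\<bar>a\<bar> < 2 ^ m" shows "int_bits a \<le> Suc m"
proof -
  have "bitlen \<bar>a\<bar> \<le> int m" using assms bitlen_le_iff_power[of "\<bar>a\<bar>" m] by simp
  then show ?thesis by (simp add: int_bits_def)
qed

lemma abs_less_int_bits: "\<bar>a\<bar> < 2 ^ int_bits a"
proof -
  have "\<bar>a\<bar> < 2 ^ nat (bitlen \<bar>a\<bar>)" using bitlen_bounds[of "\<bar>a\<bar>"]
    by (cases "a = 0") (auto simp: bitlen_def)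
  also have "\<dots> \<le> (2::int) ^ int_bits a" by (intro power_increasing) (auto simp: int_bits_def)
  finally show ?thesis .
qed

lemma inbounds_words:
  assumes "\<And>r. r \<in> reachable P s \<Longrightarrow> inbounds b len r" "int_bits b \<le> w" "0 \<le> b"
  shows "words_bounded_by P s w"
  unfolding words_bounded_by_def
proof (intro ballI allI)
  fix r a i assume "r \<in> reachable P s"
  then have "\<bar>r a i\<bar> \<le> \<bar>b\<bar>" using assms(1,3) by (auto simp: inbounds_def)
  from int_bits_mono[OF this] assms(2) show "int_bits (r a i) \<le> w" by simp
qed

section \<open>Positional encodings\<close>

text \<open>Used in two ways. With balanced digits to base \<open>P\<close> it holds the coordinates
  of one vector, and addition and negation act digitwise. With nonnegative digits to base
  \<open>G\<close> it holds one entry of each level, and a digit can be read at any position by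
  \<open>div\<close> and \<open>mod\<close>.\<close>

definition enc :: "int \<Rightarrow> (nat \<Rightarrow> int) \<Rightarrow> nat \<Rightarrow> int" where
  "enc P v l = (\<Sum>i<l. v i * P ^ i)"

lemma enc_0 [simp]: "enc P v 0 = 0"
  by (simp add: enc_def)

lemma enc_Suc: "enc P v (Suc l) = v 0 + P * enc P (\<lambda>i. v (Suc i)) l"
  unfolding enc_def by (subst sum.lessThan_Suc_shift) (simp add: sum_distrib_left mult_ac)

lemma enc_bound:
  assumes "\<And>i. i < l \<Longrightarrow> 2 * \<bar>v i\<bar> < P" "P \<ge> 1"
  shows "\<bar>enc P v l\<bar> < P ^ l"
  using assms(1)
proof (induction l arbitrary: v)
  case (Suc l)
  let ?e = "enc P (\<lambda>i. v (Suc i)) l"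
  have IH: "\<bar>?e\<bar> < P ^ l" by (rule Suc.IH) (use Suc.prems in auto)
  have 0: "2 * \<bar>v 0\<bar> < P" using Suc.prems by simp
  show ?case
  proof (cases "?e = 0")
    case True
    have "P * 1 \<le> P * P ^ l" using assms(2) by (intro mult_left_mono one_le_power) auto
    then show ?thesis using 0 True by (simp add: enc_Suc)
  next
    case False
    have "\<bar>P * ?e\<bar> \<le> P * (P ^ l - 1)"
      using IH assms(2) by (simp add: abs_mult mult_left_mono)
    then have "\<bar>P * ?e\<bar> \<le> P * P ^ l - P" by (simp add: right_diff_distrib)
    then show ?thesis using 0 unfolding enc_Suc power_Suc by linarith
  qed
qed simp

text \<open>Adding half the base makes the lowest digit a residue. As \<open>P\<close> is even, that
  half is exact.\<close>

lemma balanced_digit: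
  assumes "even P" "2 * \<bar>v 0\<bar> < P"
  shows "(enc P v (Suc l) + P div 2) mod P - P div 2 = v 0"
    and "(enc P v (Suc l) - v 0) div P = enc P (\<lambda>i. v (Suc i)) l"
proof -
  obtain h where h: "P = 2 * h" using assms(1) by blast
  have "enc P v (Suc l) + P div 2 = (v 0 + h) + P * enc P (\<lambda>i. v (Suc i)) l"
    unfolding enc_Suc using h by simp
  then have "(enc P v (Suc l) + P div 2) mod P = (v 0 + h) mod P" by simp
  also have "\<dots> = v 0 + h" using assms(2) h by (intro mod_pos_pos_trivial) auto
  finally show "(enc P v (Suc l) + P div 2) mod P - P div 2 = v 0" using h by simp
  show "(enc P v (Suc l) - v 0) div P = enc P (\<lambda>i. v (Suc i)) l"
    using assms by (simp add: enc_Suc)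
qed

lemma enc_nonneg: "(\<And>i. i < l \<Longrightarrow> 0 \<le> v i) \<Longrightarrow> 0 \<le> P \<Longrightarrow> 0 \<le> enc P v l"
  unfolding enc_def by (intro sum_nonneg mult_nonneg_nonneg) auto

lemma enc_less:
  assumes "\<And>i. i < l \<Longrightarrow> 0 \<le> v i \<and> v i < P" "P \<ge> 1"
  shows "enc P v l < P ^ l"
  using assms(1)
proof (induction l arbitrary: v)
  case (Suc l)
  have "enc P (\<lambda>i. v (Suc i)) l \<le> P ^ l - 1" using Suc.IH[of "\<lambda>i. v (Suc i)"] Suc.prems by fastforce
  then have "P * enc P (\<lambda>i. v (Suc i)) l \<le> P * P ^ l - P"
    using assms(2) mult_left_mono[of _ "P ^ l - 1" P] by (simp add: right_diff_distrib)
  then show ?case using Suc.prems[of 0] by (simp add: enc_Suc)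
qed simp

lemma enc_digit:
  assumes "\<And>i. i < l \<Longrightarrow> 0 \<le> v i \<and> v i < P" "P \<ge> 1" "p < l"
  shows "enc P v l div P ^ p mod P = v p"
  using assms(1,3)
proof (induction p arbitrary: v l)
  case 0
  then obtain m where "l = Suc m" by (cases l) auto
  then show ?case using 0 by (simp add: enc_Suc)
next
  case (Suc p)
  then obtain m where m: "l = Suc m" by (cases l) auto
  have "enc P v l div P ^ Suc p = enc P v l div P div P ^ p"
    using assms(2) by (simp add: zdiv_zmult2_eq)
  also have "enc P v l div P = enc P (\<lambda>i. v (Suc i)) m"
    using Suc.prems(1)[of 0] m by (simp add: enc_Suc)
  finally show ?case using Suc.IH[of m "\<lambda>i. v (Suc i)"] Suc.prems m by auto
qed

lemma enc_upd: "p < l \<Longrightarrow> enc P (v(p := y)) l = enc P v l + (y - v p) * P ^ p"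
  unfolding enc_def
  by (simp add: sum.remove[of "{..<l}" p] left_diff_distrib cong: sum.cong_simp)

text \<open>The summand \<open>t * b ^ m\<close> is the part of a number above the \<open>m\<close>
  digits. In the number of a candidate this part carries the grid point, and it must not disturb the
  choice of the tuple.\<close>

lemma ex_digits:
  assumes "\<And>i. i < m \<Longrightarrow> d i < b" "b \<ge> 1"
  shows "\<exists>I<(b::nat) ^ m. \<forall>t. \<forall>i<m. ((I + t * b ^ m) div b ^ i) mod b = d i"
  using assms(1)
proof (induction m arbitrary: d)
  case (Suc m)
  obtain I where I: "I < b ^ m" "\<And>t i. i < m \<Longrightarrow> ((I + t * b ^ m) div b ^ i) mod b = d (Suc i)"
    using Suc.IH[of "\<lambda>i. d (Suc i)"] Suc.prems by auto
  let ?I = "d 0 + b * I"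
  have "?I < b + b * I" using Suc.prems by simp
  also have "\<dots> = b * (I + 1)" by simp
  also have "\<dots> \<le> b * b ^ m" using I(1) by (intro mult_left_mono) auto
  finally have "?I < b ^ Suc m" by simp
  moreover have "((?I + t * b ^ Suc m) div b ^ i) mod b = d i" if "i < Suc m" for t i
  proof (cases i)
    case 0
    have "(?I + t * b ^ Suc m) mod b = d 0" using Suc.prems by (simp add: mult.assoc mult.left_commute)
    then show ?thesis using 0 by simp
  next
    case (Suc j)
    have "?I + t * b ^ Suc m = d 0 + b * (I + t * b ^ m)" by (simp add: algebra_simps)
    moreover have "(d 0 + b * (I + t * b ^ m)) div b = I + t * b ^ m" using Suc.prems[of 0] by simp
    ultimately have "(?I + t * b ^ Suc m) div b = I + t * b ^ m" by (simp only:)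
    then have "(?I + t * b ^ Suc m) div b ^ i = (I + t * b ^ m) div b ^ j"
      using Suc by (simp add: div_mult2_eq)
    then show ?thesis using I(2)[of j t] that Suc by simp
  qed
  ultimately show ?case by blast
qed simp

section \<open>Packed vectors\<close>

text \<open>
  A vector \<open>u\<close> is stored together with its image under the integer matrix \<open>A\<close>, as an integer
  whose balanced digits to base \<open>P\<close> are these \<open>2 n\<close> coordinates. Sums of vectors become sums of
  integers.
\<close>

definition image :: "nat \<Rightarrow> (nat \<Rightarrow> nat \<Rightarrow> int) \<Rightarrow> (nat \<Rightarrow> int) \<Rightarrow> nat \<Rightarrow> int" where
  "image n A u r = (\<Sum>c<n. A r c * u c)"

definition full :: "nat \<Rightarrow> (nat \<Rightarrow> nat \<Rightarrow> int) \<Rightarrow> (nat \<Rightarrow> int) \<Rightarrow> nat \<Rightarrow> int" where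
  "full n A u i = (if i < n then u i else image n A u (i - n))"

definition sqn :: "nat \<Rightarrow> (nat \<Rightarrow> nat \<Rightarrow> int) \<Rightarrow> (nat \<Rightarrow> int) \<Rightarrow> int" where
  "sqn n A u = (\<Sum>r<n. (image n A u r)\<^sup>2)"

primrec vmax :: "(nat \<Rightarrow> int) \<Rightarrow> nat \<Rightarrow> int" where
  "vmax v 0 = 0"
| "vmax v (Suc m) = max (vmax v m) \<bar>v m\<bar>"

lemma vmax_le: "0 \<le> t \<Longrightarrow> vmax v m \<le> t \<longleftrightarrow> (\<forall>i<m. \<bar>v i\<bar> \<le> t)"
  by (induction m) (auto simp: less_Suc_eq)

lemma vmax_nonneg: "0 \<le> vmax v m"
  by (induction m) auto

definition pk :: "nat \<Rightarrow> (nat \<Rightarrow> nat \<Rightarrow> int) \<Rightarrow> int \<Rightarrow> (nat \<Rightarrow> int) \<Rightarrow> int" where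
  "pk n A P u = enc P (full n A u) (2 * n)"

text \<open>The packing of a unit vector, that is, its own coordinate and a column of
  \<open>A\<close>. Adding multiples of it changes a packed vector and its image together, without
  another product with the matrix.\<close>

definition unit_pk :: "nat \<Rightarrow> (nat \<Rightarrow> nat \<Rightarrow> int) \<Rightarrow> int \<Rightarrow> nat \<Rightarrow> int" where
  "unit_pk n A P c = P ^ c + (\<Sum>r<n. A r c * P ^ (n + r))"

lemma full_add: "full n A (vadd u v) i = full n A u i + full n A v i"
  by (simp add: full_def vadd_def image_def sum.distrib distrib_left)

lemma full_scale: "full n A (vscale c u) i = c * full n A u i"
  by (simp add: full_def vscale_def image_def sum_distrib_left mult_ac)

lemma full_zero [simp]: "full n A vzero i = 0"
  by (simp add: full_def image_def)

lemma pk_add: "pk n A P (vadd u v) = pk n A P u + pk n A P v"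
  by (simp add: pk_def enc_def full_add distrib_right sum.distrib)

lemma pk_scale: "pk n A P (vscale c u) = c * pk n A P u"
  by (simp add: pk_def enc_def full_scale sum_distrib_left mult_ac)

lemma pk_zero [simp]: "pk n A P vzero = 0"
  by (simp add: pk_def enc_def)

lemma sum_split: "(\<Sum>i<n + m. f i) = (\<Sum>i<n. f i) + (\<Sum>r<m. (f (n + r) :: int))" for n m :: nat
  by (induction m) auto

lemma pk_unit: "pk n A P u = (\<Sum>c<n. u c * unit_pk n A P c)"
proof -
  have "(\<Sum>i<2*n. full n A u i * P ^ i) =
      (\<Sum>i<n. full n A u i * P ^ i) + (\<Sum>r<n. full n A u (n + r) * P ^ (n + r))"
    unfolding mult_2 by (rule sum_split)
  also have "(\<Sum>r<n. full n A u (n + r) * P ^ (n + r)) = (\<Sum>r<n. \<Sum>c<n. u c * (A r c * P ^ (n + r)))"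
    by (simp add: full_def image_def sum_distrib_left mult_ac)
  also have "\<dots> = (\<Sum>c<n. \<Sum>r<n. u c * (A r c * P ^ (n + r)))" by (rule sum.swap)
  finally show ?thesis
    by (simp add: pk_def enc_def unit_pk_def full_def distrib_left sum.distrib sum_distrib_left)
qed

section \<open>Numbering the signed tuples and the grid points\<close>

definition pick :: "(nat \<Rightarrow> int) list \<Rightarrow> nat \<Rightarrow> nat \<Rightarrow> nat \<Rightarrow> int" where
  "pick C M d = (if d mod M < length C then
      vscale (if d < M then 1 else -1) (C ! (d mod M)) else vzero)"

primrec decode :: "(nat \<Rightarrow> (nat \<Rightarrow> int) list) \<Rightarrow> nat \<Rightarrow> nat \<Rightarrow> nat \<Rightarrow> nat \<Rightarrow> int" where
  "decode X M 0 I = vzero"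
| "decode X M (Suc m) I = vadd (decode X M m I) (pick (X m) M ((I div (2*M)^m) mod (2*M)))"

lemma pick_signed: "pick C M d \<in> signed C"
  by (auto simp: pick_def signed_def vscale_def)

lemma decode_sumset: "decode X M m I \<in> sumset (\<lambda>i. signed (X i)) m"
  by (induction m) (auto intro!: exI pick_signed)

lemma decode_ivecs: "(\<And>i c. i < m \<Longrightarrow> c \<in> set (X i) \<Longrightarrow> c \<in> ivecs n) \<Longrightarrow> decode X M m I \<in> ivecs n"
proof (induction m)
  case (Suc m)
  have "pick (X m) M d \<in> ivecs n" for d using Suc.prems[of m] by (auto simp: pick_def)
  moreover have "decode X M m I \<in> ivecs n" by (rule Suc.IH) (rule Suc.prems[rotated], assumption, simp)
  ultimately show ?case by (simp only: decode.simps ivecs_simps)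
qed simp

text \<open>The index \<open>length C\<close> is below \<open>M\<close> but past the end of the
  list, so it encodes the zero vector. This is why \<open>M\<close> has to exceed the
  length.\<close>

lemma signed_pick:
  assumes "e \<in> signed C" "length C < M"
  shows "\<exists>d<2*M. pick C M d = e"
proof -
  consider "e = vzero" | i where "i < length C" "e = C ! i" | i where "i < length C" "e = vscale (-1) (C ! i)"
    using assms(1) by (auto simp: signed_def in_set_conv_nth)
  then show ?thesis
  proof cases
    case 1
    then show ?thesis using assms(2) by (intro exI[of _ "length C"]) (auto simp: pick_def)
  next
    case 2
    then show ?thesis using assms(2) by (intro exI[of _ i]) (auto simp: pick_def vscale_def)
  next
    case 3
    then show ?thesis using assms(2) by (intro exI[of _ "M + i"]) (auto simp: pick_def)
  qed
qed

lemma decode_surj: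
  assumes "e \<in> sumset (\<lambda>i. signed (X i)) m" "\<And>i. i < m \<Longrightarrow> length (X i) < M" "M \<ge> 1"
  shows "\<exists>I<(2*M)^m. \<forall>t. decode X M m (I + t * (2*M)^m) = e"
proof -
  have "\<exists>d. (\<forall>i<m. d i < 2*M) \<and> (\<forall>I. (\<forall>i<m. (I div (2*M)^i) mod (2*M) = d i) \<longrightarrow> decode X M m I = e)"
    using assms(1,2)
  proof (induction m arbitrary: e)
    case (Suc m)
    obtain u f where uf: "e = vadd u f" "u \<in> sumset (\<lambda>i. signed (X i)) m" "f \<in> signed (X m)"
      using Suc.prems(1) by auto
    obtain d where d: "\<forall>i<m. d i < 2*M"
        "\<And>I. (\<forall>i<m. (I div (2*M)^i) mod (2*M) = d i) \<Longrightarrow> decode X M m I = u"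
      using Suc.IH[OF uf(2)] Suc.prems(2) by (metis less_Suc_eq)
    obtain a where a: "a < 2*M" "pick (X m) M a = f"
      using signed_pick[OF uf(3)] Suc.prems(2)[of m] by auto
    have "(\<forall>i<Suc m. (d(m := a)) i < 2*M)" using d a by (auto simp: less_Suc_eq)
    moreover have "decode X M (Suc m) I = e"
      if I: "\<forall>i<Suc m. (I div (2*M)^i) mod (2*M) = (d(m := a)) i" for I
    proof -
      have "decode X M m I = u" using d(2)[of I] I by (auto simp: less_Suc_eq)
      moreover have "(I div (2*M)^m) mod (2*M) = a" using I by auto
      ultimately show ?thesis using a uf by simp
    qed
    ultimately show ?case by blast
  qed simp
  then obtain d where d: "\<And>i. i < m \<Longrightarrow> d i < 2*M"
    "\<And>I. (\<forall>i<m. (I div (2*M)^i) mod (2*M) = d i) \<Longrightarrow> decode X M m I = e" by blast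
  show ?thesis using ex_digits[of m d "2*M"] d assms(3) by auto
qed

text \<open>The base 5 digits 0, 1, 2, 3, 4 stand for 0, 1, 2, -2, -1. With this order the number 0
  is the zero vector, so the grid part vanishes as soon as 0 is the only grid number left.\<close>

definition grid :: "nat \<Rightarrow> int \<Rightarrow> nat \<Rightarrow> nat \<Rightarrow> int" where
  "grid n g t = (\<lambda>i. if i < n then (int (t div 5 ^ i + 2) mod 5 - 2) * g else 0)"

lemma grid_0: "grid n g 0 = vzero"
  by (auto simp: grid_def)

lemma grid_ivecs [simp]: "grid n g t \<in> ivecs n"
  by (simp add: grid_def ivecs_def)

lemma grid_surj:
  assumes "\<And>i. i < n \<Longrightarrow> y i \<in> {-2..2}"
  shows "\<exists>t<5^n. grid n g t = (\<lambda>i. if i < n then y i * g else 0)"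
proof -
  have "nat (y i mod 5) < 5" for i by (simp add: nat_less_iff)
  then obtain t where t: "t < 5 ^ n" "\<And>i. i < n \<Longrightarrow> (t div 5 ^ i) mod 5 = nat (y i mod 5)"
    using ex_digits[of n "\<lambda>i. nat (y i mod 5)" 5] by (metis add.right_neutral mult_0 one_le_numeral)
  have "int (t div 5 ^ i + 2) mod 5 - 2 = y i" if "i < n" for i
  proof -
    have "int (t div 5 ^ i + 2) mod 5 = (int ((t div 5 ^ i) mod 5) + 2) mod 5"
      by (simp only: zmod_int of_nat_add of_nat_numeral mod_add_left_eq)
    also have "\<dots> = (y i + 2) mod 5" using t(2)[OF that] by (simp add: mod_add_left_eq)
    also have "\<dots> = y i + 2" using assms[OF that] by (intro mod_pos_pos_trivial) auto
    finally show ?thesis by simp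
  qed
  then show ?thesis using t(1) by (intro exI[of _ t]) (auto simp: grid_def)
qed

section \<open>Loop-free code\<close>

primrec cost :: "com \<Rightarrow> nat" where
  "cost Skip = 0"
| "cost (Store a i e) = 1"
| "cost (Flip a i) = 0"
| "cost (Seq c1 c2) = cost c1 + cost c2 + 1"
| "cost (Cond e c1 c2) = max (cost c1) (cost c2) + 1"
| "cost (While e c) = 0"

text \<open>A weakest precondition that the simplifier can unfold. Each store must stay inside its
  array and within the word bound, so \<open>inbounds\<close> is preserved automatically.\<close>

primrec vc :: "int \<Rightarrow> (nat \<Rightarrow> nat) \<Rightarrow> com \<Rightarrow> (state \<Rightarrow> bool) \<Rightarrow> state \<Rightarrow> bool" where
  "vc b len Skip Q s = Q s"
| "vc b len (Store a i e) Q s =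
    (nat (aval i s) < len a \<and> \<bar>aval e s\<bar> \<le> b \<and> Q (store_at s a (aval i s) (aval e s)))"
| "vc b len (Flip a i) Q s = False"
| "vc b len (Seq c1 c2) Q s = vc b len c1 (vc b len c2 Q) s"
| "vc b len (Cond e c1 c2) Q s = (if aval e s \<noteq> 0 then vc b len c1 Q s else vc b len c2 Q s)"
| "vc b len (While e c) Q s = False"

lemma wp_vc: "inbounds b len s \<Longrightarrow> vc b len c Q s \<Longrightarrow> cost c \<le> T \<Longrightarrow> wp (inbounds b len) c T Q s"
proof (induction c arbitrary: Q s T)
  case (Seq c1 c2)
  have "wp (inbounds b len) c1 (cost c1) (wp (inbounds b len) c2 (cost c2) Q) s"
  proof (rule wp_mono)
    show "wp (inbounds b len) c1 (cost c1) (vc b len c2 Q) s"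
      by (rule Seq.IH(1)) (use Seq.prems in auto)
  qed (auto intro: Seq.IH(2))
  then show ?case by (rule wp_seq) (use Seq.prems in auto)
next
  case (Cond e c1 c2)
  show ?case
    by (rule wp_cond[where ?T1.0 = "max (cost c1) (cost c2)"])
      (use Cond in \<open>auto split: if_splits\<close>)
qed (auto intro!: wp_skip wp_store inbounds_store)

lemma wp_seq':
  assumes "wp I c1 T1 R s" "\<And>s'. I s' \<Longrightarrow> R s' \<Longrightarrow> wp I c2 T2 Q s'" "T1 + T2 + 1 \<le> T"
  shows "wp I (Seq c1 c2) T Q s"
  by (rule wp_seq[OF _ assms(3)]) (rule wp_mono[OF assms(1)], use assms(2) in auto)

definition same :: "nat set \<Rightarrow> state \<Rightarrow> state \<Rightarrow> bool" where
  "same X s s' \<longleftrightarrow> (\<forall>a. a \<notin> X \<longrightarrow> s' a = s a)"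

lemma sameD: "same X s s' \<Longrightarrow> a \<notin> X \<Longrightarrow> s' a = s a"
  by (simp add: same_def)

lemma same_refl [simp]: "same X s s"
  by (simp add: same_def)

lemma same_trans: "same X s s' \<Longrightarrow> same Y s' s'' \<Longrightarrow> X \<union> Y \<subseteq> Z \<Longrightarrow> same Z s s''"
  unfolding same_def by (metis UnI1 UnI2 subsetD)

lemma same_store: "same X s s' \<Longrightarrow> a \<in> X \<Longrightarrow> same X s (store_at s' a i v)"
  by (auto simp: same_def store_at_def)

section \<open>The sieving program\<close>

text \<open>
  Arrays 10 to 47 serve as registers, of which only cell 0 is used. Cell \<open>i\<close> of \<open>aW\<close> holds the packed
  \<open>i\<close>-th elements of the lists of all levels at once, as digits to base \<open>rG\<close>: digit \<open>j + 1\<close> belongs to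
  level \<open>j\<close>, and digit 0 to an empty list below level 0. Hence the space does not grow with the number
  of levels. The list under construction is in \<open>aZ\<close>.
\<close>

abbreviation (input) "cN \<equiv> Cell 0 (Const 0)"
abbreviation (input) "cQ \<equiv> Cell 0 (Const 1)"
abbreviation (input) "aNum \<equiv> 1 :: nat"
abbreviation (input) "aDen \<equiv> 2 :: nat"
abbreviation (input) "aOut \<equiv> 3 :: nat"
abbreviation (input) "aOutDen \<equiv> 4 :: nat"
abbreviation (input) "aW \<equiv> 5 :: nat"
abbreviation (input) "aZ \<equiv> 6 :: nat"
abbreviation (input) "aE \<equiv> 7 :: nat"
abbreviation (input) "rD \<equiv> 10 :: nat"
abbreviation (input) "rM \<equiv> 11 :: nat"
abbreviation (input) "rF \<equiv> 12 :: nat"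
abbreviation (input) "rY \<equiv> 13 :: nat"
abbreviation (input) "rP \<equiv> 14 :: nat"
abbreviation (input) "rG \<equiv> 15 :: nat"
abbreviation (input) "rK \<equiv> 16 :: nat"
abbreviation (input) "rC5 \<equiv> 17 :: nat"
abbreviation (input) "rRT \<equiv> 18 :: nat"
abbreviation (input) "rPT \<equiv> 19 :: nat"
abbreviation (input) "rS \<equiv> 20 :: nat"
abbreviation (input) "rNm \<equiv> 21 :: nat"
abbreviation (input) "rBest \<equiv> 22 :: nat"
abbreviation (input) "rBu \<equiv> 23 :: nat"
abbreviation (input) "rI \<equiv> 24 :: nat"
abbreviation (input) "rT \<equiv> 25 :: nat"
abbreviation (input) "rMx \<equiv> 26 :: nat"
abbreviation (input) "rSq \<equiv> 27 :: nat"
abbreviation (input) "rDg \<equiv> 28 :: nat"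
abbreviation (input) "rV \<equiv> 29 :: nat"
abbreviation (input) "rMc \<equiv> 30 :: nat"
abbreviation (input) "rCnt \<equiv> 31 :: nat"
abbreviation (input) "rR \<equiv> 32 :: nat"
abbreviation (input) "rPw \<equiv> 33 :: nat"
abbreviation (input) "rCz \<equiv> 34 :: nat"
abbreviation (input) "rII \<equiv> 35 :: nat"
abbreviation (input) "rU \<equiv> 36 :: nat"
abbreviation (input) "rCov \<equiv> 37 :: nat"
abbreviation (input) "rC3 \<equiv> 38 :: nat"
abbreviation (input) "rJJ \<equiv> 39 :: nat"
abbreviation (input) "rA \<equiv> 40 :: nat"
abbreviation (input) "rX \<equiv> 41 :: nat"
abbreviation (input) "rPn \<equiv> 42 :: nat"
abbreviation (input) "rPi \<equiv> 43 :: nat"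
abbreviation (input) "rPr \<equiv> 44 :: nat"
abbreviation (input) "rAcc \<equiv> 45 :: nat"
abbreviation (input) "rRow \<equiv> 46 :: nat"
abbreviation (input) "rM3 \<equiv> 47 :: nat"

definition lens :: "nat \<Rightarrow> nat \<Rightarrow> nat \<Rightarrow> nat" where
  "lens n Nb a = (if a = 0 then 2 else if a \<le> 2 then n * n else if a \<le> 4 then n
     else if a \<le> 6 then Nb + 1 else if a = 7 then n else if a < 48 then 1 else 0)"

definition absE :: "aexp \<Rightarrow> aexp" where
  "absE e = Times e (Minus (Const 1) (Times (Const 2) (Less e (Const 0))))"

lemma aval_absE [simp]: "aval (absE e) s = \<bar>aval e s\<bar>"
  by (simp add: absE_def)

text \<open>
  The digits of \<open>rV\<close> are coordinates for \<open>i < n\<close>, of which \<open>rMx\<close> collects the maximum norm, and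
  entries of the image after that, of which \<open>rSq\<close> collects the squares.
\<close>

definition norm_body :: com where
  "norm_body =
    Seq (Assign rDg (Minus (Mod (Plus (Var rT) (Div (Var rP) (Const 2))) (Var rP)) (Div (Var rP) (Const 2))))
   (Seq (Assign rT (Div (Minus (Var rT) (Var rDg)) (Var rP)))
    (Cond (Less (Var rI) cN)
      (Cond (Less (Var rMx) (absE (Var rDg))) (Assign rMx (absE (Var rDg))) Skip)
      (Assign rSq (Plus (Var rSq) (Times (Var rDg) (Var rDg))))))"

definition norm_com :: com where
  "norm_com = Seq (Seq (Assign rT (Var rV)) (Seq (Assign rMx (Const 0)) (Assign rSq (Const 0))))
     (For rI (Times (Const 2) cN) norm_body)"

text \<open>Adds to \<open>rV\<close> the signed entries selected by the digits of \<open>rT\<close> to base \<open>2 m\<close>.\<close>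

definition dec_body :: "nat \<Rightarrow> aexp \<Rightarrow> com" where
  "dec_body m e =
    Seq (Assign rA (Mod (Var rT) (Times (Const 2) (Var m))))
   (Seq (Assign rT (Div (Var rT) (Times (Const 2) (Var m))))
    (Assign rV (Plus (Var rV) (Times (Minus (Times (Const 2) (Less (Var rA) (Var m))) (Const 1)) e))))"

text \<open>Tests the ball of radius \<open>t * rR / 256\<close> for the \<open>\<sigma>\<close>
  held in \<open>rS\<close>. Lengths are compared through their squares and denominators are
  cleared; 256 is the common denominator of all radii used. The added 1 turns the strict comparison
  of integers into a weak one.\<close>

definition inball :: "int \<Rightarrow> aexp" where
  "inball t = Times
    (Less (Times (Const 256) (Var rMx)) (Plus (Const 1) (Times (Const t) (Var rR))))
    (Less (Times (Const 65536) (Var rSq))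
      (Plus (Const 1) (Times (Times (Times (Const t) (Var rR)) (Times (Const t) (Var rR))) (Times (Var rS) (Var rS)))))"

text \<open>The tuple sum is added to the candidate rather than subtracted. Signed sums are closed
  under negation, so the search is the same.\<close>

definition chk_body :: com where
  "chk_body =
    Seq (Seq (Assign rT (Var rJJ)) (Assign rV (Var rU)))
   (Seq (For rI (Var rK) (dec_body rM3 (Cell aZ (Mod (Var rA) (Var rM3)))))
   (Seq norm_com
    (Cond (inball 63) (Assign rCov (Const 1)) Skip)))"

definition chk_com :: com where
  "chk_com =
    Seq (Seq (Assign rM3 (Plus (Var rCz) (Const 1))) (Seq (Assign rCov (Const 0)) (Assign rC3 (Const 1))))
   (Seq (For rI (Var rK) (Assign rC3 (Times (Var rC3) (Times (Const 2) (Var rM3)))))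
    (For rJJ (Var rC3) chk_body))"

text \<open>The spacing of the grid is half the radius rounded up; rounding down would make it 0 at
  radius 1.\<close>

definition grid_body :: com where
  "grid_body =
    Seq (Assign rV (Plus (Var rV) (Times (Times
      (Minus (Mod (Plus (Var rT) (Const 2)) (Const 5)) (Const 2))
      (Minus (Var rR) (Div (Var rR) (Const 2)))) (Cell aE (Var rI)))))
    (Assign rT (Div (Var rT) (Const 5)))"

definition digE :: "aexp \<Rightarrow> aexp \<Rightarrow> aexp" where
  "digE i p = Mod (Div (Cell aW i) p) (Var rG)"

text \<open>
  The number \<open>rII\<close> of a candidate consists of \<open>2 k\<close> digits selecting signed list elements, the first \<open>k\<close>
  from the current level and the others from the level below, and then the base 5 digits of a grid point.
\<close>

definition candE :: aexp where
  "candE = digE (Mod (Var rA) (Var rMc))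
     (Times (Var rPw) (Plus (Const 1) (Times (Less (Var rI) (Var rK)) (Minus (Var rG) (Const 1)))))"

text \<open>Entries become digits of the cells of \<open>aW\<close> and must be nonnegative. Packing
  commutes with negation, and \<open>-u\<close> serves as well as \<open>u\<close>, so the absolute
  value is stored.\<close>

definition insert_com :: com where
  "insert_com = Cond (Var rCov) Skip
    (Seq (Store aZ (Var rCz) (absE (Var rU))) (Assign rCz (Plus (Var rCz) (Const 1))))"

text \<open>Every candidate competes, also those outside the ball that are never considered for the
  list. The value 0 of \<open>rBest\<close> means that no nonzero vector has been met.\<close>

definition best_com :: com where
  "best_com = Cond (Var rMx)
    (Cond (Plus (Less (Var rBest) (Const 1)) (Less (Var rSq) (Var rBest)))
      (Seq (Assign rBest (Var rSq)) (Assign rBu (Var rU))) Skip) Skip"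

definition cand_body :: com where
  "cand_body =
    Seq (Seq (Assign rT (Var rII)) (Assign rV (Const 0)))
   (Seq (For rI (Times (Const 2) (Var rK)) (dec_body rMc candE))
   (Seq (For rI cN grid_body)
   (Seq (Assign rU (Var rV))
   (Seq norm_com
   (Seq best_com
    (Cond (inball 321) (Seq chk_com insert_com) Skip))))))"

text \<open>Exchanges one digit of a cell of \<open>aW\<close> and leaves the other levels alone.
  The loop over it runs up to \<open>rNm\<close>, the largest length of any list so far, so that the
  surplus entries of a longer old list are overwritten by 0.\<close>

definition wb_body :: com where
  "wb_body =
    Seq (Store aW (Var rI) (Plus (Cell aW (Var rI))
      (Times (Minus (Cell aZ (Var rI)) (digE (Var rI) (Times (Var rPw) (Var rG)))) (Times (Var rPw) (Var rG)))))
    (Store aZ (Var rI) (Const 0))"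

definition level_body :: com where
  "level_body =
    Seq (Seq (Assign rR (Div (Var rR) (Const 2))) (Seq (Assign rPw (Div (Var rPw) (Var rG))) (Assign rCz (Const 0))))
   (Seq (For rII (Var rCnt) cand_body)
   (Seq (Cond (Less (Var rNm) (Var rCz)) (Assign rNm (Var rCz)) Skip)
    (For rI (Var rNm) wb_body)))"

text \<open>The levels are rebuilt from the top down. A level reads the old lists of itself and of
  the level below, and when its turn comes only lists above it have been replaced. The base
  \<open>rMc\<close> is fixed at the start since it has to fit the old lists, even if
  \<open>rNm\<close> grows in between.\<close>

definition build :: com where
  "build =
    Seq (Seq (Assign rMc (Plus (Var rNm) (Const 1))) (Seq (Assign rCnt (Var rC5))
      (Seq (Assign rR (Var rRT)) (Assign rPw (Var rPT)))))
   (Seq (For rI (Times (Const 2) (Var rK)) (Assign rCnt (Times (Var rCnt) (Times (Const 2) (Var rMc)))))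
    (While (Less (Const 1) (Var rR)) level_body))"

section \<open>Arithmetic on packed vectors, as done by the program\<close>

lemma store_at_apply: "store_at s a i v a' j = (if a' = a \<and> j = nat i then v else s a' j)"
  by (simp add: store_at_def)

lemmas state_simps = store_at_apply same_store

text \<open>\<open>digits\<close> leaves room for the sum of \<open>2 * k\<close> list elements and
  a grid point, each of norm at most \<open>2 * 2 ^ J\<close>. The word bound \<open>b\<close> has
  to cover the squares of up to \<open>n\<close> image entries, partial sums of up to
  \<open>2 * n\<close> packed vectors, the cells of \<open>aW\<close> with their
  \<open>J + 1\<close> digits to base \<open>G\<close>, and the numbers of the candidates.\<close>

locale machine =
  fixes n k J Nb :: nat and A :: "nat \<Rightarrow> nat \<Rightarrow> int" and P G b s0 :: int
  assumes n1: "n \<ge> 1" and k1: "k \<ge> 1" "k \<le> n" and P: "even P" "P > 0" and G: "G = P ^ (2 * n)"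
    and s0: "s0 \<ge> 1"
    and digits: "(4 * int n + 4) * 2 ^ J * s0 * 2 < P"
    and b: "int n * P * P \<le> b" "(2 * int n + 4) * G \<le> b" "G ^ (J + 1) \<le> b"
      "int (5 ^ n * (2 * (Nb + 1)) ^ (2 * k)) \<le> b"
begin

abbreviation (input) "I \<equiv> inbounds b (lens n Nb)"
abbreviation (input) "pack \<equiv> pk n A P"
abbreviation (input) "sq \<equiv> sqn n A"

lemma P1: "P \<ge> 1" "P \<ge> 2" using P by (auto elim!: evenE)

lemma G1: "G \<ge> 1" unfolding G using P1 by simp

lemma b0: "b \<ge> 0" "b \<ge> 1" "int n \<le> b" "2 * int n + 4 \<le> b" "G \<le> b"
proof -
  have *: "(2 * int n + 4) * 1 \<le> (2 * int n + 4) * G" using G1 by (intro mult_left_mono) auto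
  from order_trans[OF * b(2)] have "2 * int n + 4 \<le> b" by simp
  then show "b \<ge> 0" "b \<ge> 1" "int n \<le> b" "2 * int n + 4 \<le> b" by simp_all
  have "1 * G \<le> (2 * int n + 4) * G" using G1 by (intro mult_right_mono) auto
  then show "G \<le> b" using b(2) by auto
qed

definition params :: "state \<Rightarrow> bool" where
  "params s \<longleftrightarrow> s 0 0 = int n \<and> s rK 0 = int k \<and> s rP 0 = P \<and> s rG 0 = G \<and>
     s rRT 0 = 2 ^ J \<and> s rPT 0 = G ^ J \<and> (\<forall>c<n. s aE c = unit_pk n A P c)"

lemma params_same: "params s \<Longrightarrow> same X s s' \<Longrightarrow> X \<inter> {0, rK, rP, rG, rRT, rPT, aE} = {} \<Longrightarrow> params s'"
  unfolding params_def same_def by (metis disjoint_insert(2))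

lemma I_reg: "I s \<Longrightarrow> 10 \<le> v \<Longrightarrow> v < 48 \<Longrightarrow> \<bar>y\<bar> \<le> b \<Longrightarrow> I (store_at s v 0 y)"
  by (rule inbounds_store) (auto simp: lens_def)

lemma for_rule:
  assumes I: "I s" "10 \<le> v" "v < 48" "int N \<le> b"
    and start: "V 0 (store_at s v 0 0)"
    and bound: "\<And>m s. V m s \<Longrightarrow> aval e s = int N" and cnt: "\<And>m s. V m s \<Longrightarrow> s v 0 = int m"
    and body: "\<And>m s. m < N \<Longrightarrow> V m s \<Longrightarrow> I s \<Longrightarrow>
      wp I c T1 (\<lambda>s'. s' v 0 = int m \<and> V (Suc m) (store_at s' v 0 (int (Suc m)))) s"
    and exit: "\<And>s. V N s \<Longrightarrow> I s \<Longrightarrow> Q s"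
    and T: "N * (T1 + 4) + 3 \<le> T"
  shows "wp I (For v e c) T Q s"
proof (rule wp_for[where I = I and V = V and N = N and ?T1.0 = T1], goal_cases)
  case (2 s' m)
  then show ?case using I by (intro I_reg) auto
next
  case (4 m s) then show ?case by (rule bound)
next
  case (5 m s) then show ?case by (rule cnt[of m s])
next
  case (6 m s) then show ?case by (rule body)
next
  case (7 s) then show ?case by (rule exit)
qed (rule I(1) start T)+

text \<open>The vectors that can be unpacked again.\<close>

definition small :: "(nat \<Rightarrow> int) \<Rightarrow> bool" where
  "small u \<longleftrightarrow> (\<forall>i<2*n. 2 * \<bar>full n A u i\<bar> < P)"

lemma pack_less: "small u \<Longrightarrow> \<bar>pack u\<bar> < G"
  unfolding pk_def G by (rule enc_bound) (use P1 in \<open>auto simp: small_def\<close>)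

abbreviation (input) "norm_regs \<equiv> {rT, rMx, rSq, rDg, rI}"

definition "T_norm = 2 * n * 13 + 10"

lemma norm_spec:
  assumes s: "I s" "params s" "s rV 0 = pack u" "small u"
  shows "wp I norm_com T_norm (\<lambda>s'. same norm_regs s s' \<and> s' rMx 0 = vmax u n \<and> s' rSq 0 = sq u) s"
  unfolding norm_com_def
proof (rule wp_seq')
  let ?f = "full n A u"
  let ?R = "\<lambda>s'. same norm_regs s s' \<and> s' rT 0 = pack u \<and> s' rMx 0 = 0 \<and> s' rSq 0 = 0"
  have pl: "\<bar>pack u\<bar> \<le> b" using pack_less[OF s(4)] b0 by linarith
  show "wp I (Seq (Assign rT (Var rV)) (Seq (Assign rMx (Const 0)) (Assign rSq (Const 0)))) 5 ?R s"
    by (rule wp_vc) (use s pl b0 in \<open>auto simp: state_simps lens_def\<close>)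
  fix s1 assume s1: "I s1" "?R s1"
  \<comment> \<open>The first \<open>n\<close> rounds read coefficients and the other
    \<open>n\<close> the image. \<open>min m n\<close> freezes the maximum in the second half, and
    truncated subtraction keeps the sum of squares empty in the first.\<close>
  let ?V = "\<lambda>m s'. same norm_regs s s' \<and> m \<le> 2 * n \<and> s' rI 0 = int m \<and>
     s' rT 0 = enc P (\<lambda>i. ?f (m + i)) (2 * n - m) \<and>
     s' rMx 0 = vmax u (min m n) \<and> s' rSq 0 = (\<Sum>r<m - n. (image n A u r)\<^sup>2)"
  show "wp I (For rI (Times (Const 2) cN) norm_body) (2 * n * (9 + 4) + 3)
     (\<lambda>s'. same norm_regs s s' \<and> s' rMx 0 = vmax u n \<and> s' rSq 0 = sq u) s1"
  proof (rule for_rule[where V = ?V and N = "2 * n" and ?T1.0 = 9])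
    show "?V 0 (store_at s1 rI 0 0)" using s1 by (auto simp: state_simps pk_def)
    show "aval (Times (Const 2) cN) s' = int (2 * n)" if "?V m s'" for m s'
      using that s(2) sameD[of norm_regs s s' 0] by (auto simp: params_def)
    show "wp I norm_body 9 (\<lambda>s'. s' rI 0 = int m \<and> ?V (Suc m) (store_at s' rI 0 (int (Suc m)))) s'"
      if m: "m < 2 * n" and V: "?V m s'" and I': "I s'" for m s'
    proof (rule wp_vc[OF I'])
      have c: "s' 0 0 = int n" "s' rP 0 = P"
        using V s(2) sameD[of norm_regs s s'] by (auto simp: params_def)
      let ?g = "\<lambda>i. ?f (m + i)"
      obtain l where l: "2 * n - m = Suc l" using m by (metis Suc_diff_Suc)
      have l': "2 * n - Suc m = l" using l by simp
      have sm: "2 * \<bar>?f m\<bar> < P" using s(4) m by (simp add: small_def)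
      have T: "s' rT 0 = enc P ?g (Suc l)" using V l by simp
      obtain h where h: "P div 2 = h" by simp
      have V': "same norm_regs s s'" "s' rI 0 = int m" "s' rMx 0 = vmax u (min m n)"
          "s' rSq 0 = (\<Sum>r<m - n. (image n A u r)\<^sup>2)"
        using V by auto
      have dg: "(s' rT 0 + h) mod P - h = ?f m"
        unfolding T h[symmetric] using balanced_digit(1)[OF P(1), of ?g l] sm by simp
      have tl: "(s' rT 0 - ?f m) div P = enc P (\<lambda>i. ?f (Suc m + i)) l"
        unfolding T using balanced_digit(2)[OF P(1), of ?g l] sm by simp
      have tb: "\<bar>enc P (\<lambda>i. ?f (Suc m + i)) l\<bar> \<le> b"
      proof -
        have "\<bar>enc P (\<lambda>i. ?f (Suc m + i)) l\<bar> < P ^ l"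
          by (rule enc_bound) (use s(4) l P1 in \<open>auto simp: small_def\<close>)
        also have "\<dots> \<le> G" unfolding G using l P1 by (intro power_increasing) auto
        finally show ?thesis using b0 by linarith
      qed
      have PPb: "P \<le> b" "P * P \<le> b"
      proof -
        have "1 * (P * P) \<le> int n * (P * P)" using n1 P by (intro mult_right_mono) auto
        then show "P * P \<le> b" using b(1) by (simp add: mult.assoc)
        moreover have "P * 1 \<le> P * P" using P1 by (intro mult_left_mono) auto
        ultimately show "P \<le> b" by simp
      qed
      have fb: "\<bar>?f m\<bar> \<le> b" using sm PPb by linarith
      have sqb: "\<bar>(\<Sum>r<m - n. (image n A u r)\<^sup>2) + ?f m * ?f m\<bar> \<le> b" if "\<not> m < n"
      proof -
        have le: "y * y \<le> P * P" if "2 * \<bar>y\<bar> < P" for y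
          using that abs_le_square_iff[of y P] unfolding power2_eq_square by linarith
        have i: "?f (n + r) = image n A u r" for r by (simp add: full_def)
        have "(\<Sum>r<Suc (m - n). (image n A u r)\<^sup>2) \<le> (\<Sum>r<Suc (m - n). P * P)"
        proof (rule sum_mono)
          fix r assume "r \<in> {..<Suc (m - n)}"
          then have "2 * \<bar>?f (n + r)\<bar> < P" using s(4) m that by (simp add: small_def)
          then show "(image n A u r)\<^sup>2 \<le> P * P" using le unfolding i by (simp add: power2_eq_square)
        qed
        also have "\<dots> = int (Suc (m - n)) * (P * P)" by simp
        also have "\<dots> \<le> int n * (P * P)" using m that P by (intro mult_right_mono) auto
        also have "\<dots> \<le> b" using b(1) by (simp add: mult.assoc)
        finally have "(\<Sum>r<m - n. (image n A u r)\<^sup>2) + ?f m * ?f m \<le> b"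
          using i[of "m - n"] that by (simp add: power2_eq_square)
        moreover have "(\<Sum>r<m - n. (image n A u r)\<^sup>2) \<ge> 0" by (intro sum_nonneg) auto
        moreover have "?f m * ?f m \<ge> 0" by simp
        ultimately show ?thesis by linarith
      qed
      have mn: "min (Suc m) n = Suc m" "min m n = m" "?f m = u m" if "m < n"
        using that by (auto simp: full_def)
      have mn': "min (Suc m) n = n" "min m n = n" "Suc m - n = Suc (m - n)" "?f m = image n A u (m - n)" if "\<not> m < n"
        using that by (auto simp: full_def)
      show "vc b (lens n Nb) norm_body
          (\<lambda>s'. s' rI 0 = int m \<and> ?V (Suc m) (store_at s' rI 0 (int (Suc m)))) s'"
      proof (cases "m < n")
        case True
        have "vmax u (Suc m) = max (s' rMx 0) \<bar>?f m\<bar>" using V' True mn by simp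
        moreover have "s' rSq 0 = 0" using V' True by simp
        ultimately show ?thesis
          using V'(1,2) m True mn(1)[OF True] fb tb
          by (simp add: norm_body_def state_simps lens_def c dg tl l' h max_def del: vmax.simps)
      next
        case False
        have "(\<Sum>r<Suc m - n. (image n A u r)\<^sup>2) = s' rSq 0 + ?f m * ?f m"
          using V' mn'(3,4)[OF False] by (simp add: power2_eq_square)
        moreover have "\<bar>s' rSq 0 + ?f m * ?f m\<bar> \<le> b" using V' sqb[OF False] by simp
        moreover have "s' rMx 0 = vmax u n" using V' mn'(2)[OF False] by simp
        ultimately show ?thesis
          using V'(1,2) m False mn'(1)[OF False] fb tb
          by (simp add: norm_body_def state_simps lens_def c dg tl l' h)
      qed
    qed (simp add: norm_body_def)
    show "same norm_regs s s' \<and> s' rMx 0 = vmax u n \<and> s' rSq 0 = sq u" if "?V (2 * n) s'" for s'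
      using that by (auto simp: sqn_def)
  qed (use s1 b0 in auto)
qed (simp add: T_norm_def)

definition ent :: "(nat \<Rightarrow> int) list \<Rightarrow> nat \<Rightarrow> int" where
  "ent C a = (if a < length C then pack (C ! a) else 0)"

lemma pack_pick: "pack (pick C M d) = (if d < M then 1 else -1) * ent C (d mod M)"
  by (auto simp: pick_def ent_def pk_scale)

abbreviation "dec_regs \<equiv> {rA, rT, rV, rI}"

definition "T_dec N = N * 9 + (3::nat)"

text \<open>Covers both uses of the loop, on the list under construction and on the two stored
  levels; they differ only in how the entry is read, which is the premise on \<open>e\<close>. The
  partial sums are bounded by counting terms, so nothing has to be known about the norms of the
  vectors they represent.\<close>

lemma dec_spec:
  assumes s: "I s" "s rT 0 = int t" "s rV 0 = pack u" and M: "s m 0 = int M" "M \<ge> 1" "m \<notin> dec_regs"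
    and cnt: "\<And>s'. same dec_regs s s' \<Longrightarrow> aval ce s' = int N"
    and ent: "\<And>s' i d. same dec_regs s s' \<Longrightarrow> i < N \<Longrightarrow> d < 2 * M \<Longrightarrow> s' rI 0 = int i \<Longrightarrow> s' rA 0 = int d \<Longrightarrow>
      aval e s' = ent (X i) (d mod M)"
    and bd: "\<And>i a. i < N \<Longrightarrow> \<bar>ent (X i) a\<bar> \<le> G" "\<bar>pack u\<bar> + int N * G \<le> b"
      "int (2 * M) \<le> b" "int t \<le> b" "int N \<le> b"
  shows "wp I (For rI ce (dec_body m e)) (T_dec N)
    (\<lambda>s'. same dec_regs s s' \<and> s' rV 0 = pack (vadd u (decode X M N t)) \<and> s' rT 0 = int (t div (2*M)^N)) s"
proof -
  let ?V = "\<lambda>i s'. i \<le> N \<and> same dec_regs s s' \<and> s' rI 0 = int i \<and>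
    s' rV 0 = pack (vadd u (decode X M i t)) \<and> s' rT 0 = int (t div (2*M)^i) \<and>
    \<bar>s' rV 0\<bar> \<le> \<bar>pack u\<bar> + int i * G"
  show ?thesis
  proof (rule for_rule[where V = ?V and N = N and ?T1.0 = 5])
    show "?V 0 (store_at s rI 0 0)" using s by (simp add: state_simps vadd_def)
    show "aval ce s' = int N" if "?V i s'" for i s' using that cnt by blast
    show "wp I (dec_body m e) 5 (\<lambda>s'. s' rI 0 = int i \<and> ?V (Suc i) (store_at s' rI 0 (int (Suc i)))) s'"
      if i: "i < N" and V: "?V i s'" and I': "I s'" for i s'
    proof (rule wp_vc[OF I'])
      have V': "same dec_regs s s'" "s' rI 0 = int i" "s' rV 0 = pack (vadd u (decode X M i t))"
          "s' rT 0 = int (t div (2*M)^i)" "\<bar>s' rV 0\<bar> \<le> \<bar>pack u\<bar> + int i * G"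
        using V by blast+
      have m: "s' m 0 = int M" using M V'(1) by (simp add: same_def)
      obtain d where d: "d = t div (2*M)^i mod (2*M)" by simp
      have d2: "d < 2 * M" using d M by simp
      obtain q where q: "q = t div (2*M)^i div (2*M)" by simp
      have q': "t div (2*M)^Suc i = q" unfolding q power_Suc2 div_mult2_eq ..
      have qb: "int q \<le> b"
      proof -
        have "q \<le> t" unfolding q by (meson div_le_dividend le_trans)
        then show ?thesis using bd(4) by simp
      qed
      have Tm: "s' rT 0 mod (2 * int M) = int d" "s' rT 0 div (2 * int M) = int q"
        unfolding V'(4) d q by (simp_all add: zmod_int zdiv_int)
      obtain s1 where s1: "s1 = store_at (store_at s' rA 0 (int d)) rT 0 (int q)" by simp
      have e: "aval e s1 = ent (X i) (d mod M)"
        by (rule ent[OF _ i d2]) (use V' s1 in \<open>simp_all add: state_simps\<close>)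
      define sg where "sg = (if int d < int M then 1 else - 1 :: int)"
      have nv: "s' rV 0 + sg * ent (X i) (d mod M) = pack (vadd u (decode X M (Suc i) t))"
        unfolding V'(3) decode.simps d[symmetric] pk_add pack_pick by (simp add: sg_def)
      have vb: "\<bar>s' rV 0 + sg * ent (X i) (d mod M)\<bar> \<le> \<bar>pack u\<bar> + int (Suc i) * G"
      proof -
        have "\<bar>sg * y\<bar> = \<bar>y\<bar>" for y by (simp add: sg_def)
        then have "\<bar>sg * ent (X i) (d mod M)\<bar> \<le> G" using bd(1)[OF i, of "d mod M"] by (simp only:)
        moreover have "int (Suc i) * G = int i * G + G" by (simp add: distrib_right)
        ultimately show ?thesis using V'(5) by linarith
      qed
      have "int (Suc i) * G \<le> int N * G" using i G1 by (intro mult_right_mono) auto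
      then have vb2: "\<bar>s' rV 0 + sg * ent (X i) (d mod M)\<bar> \<le> b" using vb bd(2) by linarith
      have db: "int d \<le> b" using d2 bd(3) by simp
      have a1: "aval (Mod (Var rT) (Times (Const 2) (Var m))) s' = int d" using m by (simp add: Tm)
      have a2: "aval (Div (Var rT) (Times (Const 2) (Var m))) (store_at s' rA 0 (int d)) = int q"
        using m M(3) by (simp add: state_simps Tm)
      have a3: "aval (Plus (Var rV) (Times (Minus (Times (Const 2) (Less (Var rA) (Var m))) (Const 1)) e)) s1 =
          s' rV 0 + sg * ent (X i) (d mod M)"
        unfolding aval.simps e using m M(3) by (simp add: s1 state_simps sg_def)
      show "vc b (lens n Nb) (dec_body m e)
          (\<lambda>s'. s' rI 0 = int i \<and> ?V (Suc i) (store_at s' rI 0 (int (Suc i)))) s'"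
        using vb2 db qb i V'(1,2)
        unfolding dec_body_def vc.simps aval.simps(1) a1 a2 s1[symmetric] a3
        unfolding nv[symmetric] q'
        by (simp add: lens_def s1 state_simps vb del: of_nat_Suc)
    qed (simp add: dec_body_def)
    show "same dec_regs s s' \<and> s' rV 0 = pack (vadd u (decode X M N t)) \<and> s' rT 0 = int (t div (2*M)^N)"
      if "?V N s'" for s' using that by blast
  qed (use s bd in \<open>auto simp: T_dec_def\<close>)
qed

abbreviation "grid_regs \<equiv> {rT, rV, rI}"

definition "T_grid = n * 7 + (3::nat)"

lemma grid_spec:
  assumes s: "I s" "params s" "s rT 0 = int t" "s rV 0 = pack u" "int t \<le> b"
    and g: "s rR 0 - s rR 0 div 2 = g"
    and bd: "\<And>c. c < n \<Longrightarrow> \<bar>2 * g * unit_pk n A P c\<bar> \<le> G" "\<bar>pack u\<bar> + int n * G \<le> b"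
  shows "wp I (For rI cN grid_body) T_grid
    (\<lambda>s'. same grid_regs s s' \<and> s' rV 0 = pack (vadd u (grid n g t))) s"
proof -
  let ?w = "\<lambda>c. (int (t div 5 ^ c + 2) mod 5 - 2) * g * unit_pk n A P c"
  let ?V = "\<lambda>i s'. i \<le> n \<and> same grid_regs s s' \<and> s' rI 0 = int i \<and>
    s' rV 0 = pack u + (\<Sum>c<i. ?w c) \<and> s' rT 0 = int (t div 5^i) \<and>
    \<bar>s' rV 0\<bar> \<le> \<bar>pack u\<bar> + int i * G"
  show ?thesis
  proof (rule for_rule[where V = ?V and N = n and ?T1.0 = 3])
    show "?V 0 (store_at s rI 0 0)" using s by (simp add: state_simps)
    show "aval cN s' = int n" if "?V i s'" for i s'
      using that s(2) sameD[of grid_regs s s' 0] by (simp add: params_def)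
    show "wp I grid_body 3 (\<lambda>s'. s' rI 0 = int i \<and> ?V (Suc i) (store_at s' rI 0 (int (Suc i)))) s'"
      if i: "i < n" and V: "?V i s'" and I': "I s'" for i s'
    proof (rule wp_vc[OF I'])
      have V': "same grid_regs s s'" "s' rI 0 = int i" "s' rV 0 = pack u + (\<Sum>c<i. ?w c)"
          "s' rT 0 = int (t div 5^i)" "\<bar>s' rV 0\<bar> \<le> \<bar>pack u\<bar> + int i * G"
        using V by blast+
      have E: "s' aE i = unit_pk n A P i" and R: "s' rR = s rR"
        using V'(1) s(2) i by (auto simp: params_def same_def)
      obtain y where y: "y = int (t div 5 ^ i + 2) mod 5 - 2" by simp
      have y2: "\<bar>y\<bar> \<le> 2" unfolding y using pos_mod_bound[of 5 "int (t div 5 ^ i + 2)"]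
          pos_mod_sign[of 5 "int (t div 5 ^ i + 2)"] by linarith
      have yT: "(s' rT 0 + 2) mod 5 - 2 = y" unfolding V'(4) y by (simp add: add.commute)
      obtain q where q: "q = t div 5^i div 5" by simp
      have q': "t div 5 ^ Suc i = q" unfolding q power_Suc2 div_mult2_eq ..
      have qT: "s' rT 0 div 5 = int q" unfolding V'(4) q by (simp add: zdiv_int)
      have "q \<le> t" unfolding q by (meson div_le_dividend le_trans)
      then have qb: "int q \<le> b" using s(5) by simp
      obtain z where z: "z = y * g * unit_pk n A P i" by simp
      have zb: "\<bar>z\<bar> \<le> G"
      proof -
        have "\<bar>z\<bar> = \<bar>y\<bar> * \<bar>g * unit_pk n A P i\<bar>" by (simp add: z abs_mult)
        also have "\<dots> \<le> 2 * \<bar>g * unit_pk n A P i\<bar>" using y2 by (intro mult_right_mono) auto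
        also have "\<dots> = \<bar>2 * g * unit_pk n A P i\<bar>" by (simp add: abs_mult)
        finally show ?thesis using bd(1)[OF i] by linarith
      qed
      have vb: "\<bar>s' rV 0 + z\<bar> \<le> \<bar>pack u\<bar> + int (Suc i) * G"
      proof -
        have "int (Suc i) * G = int i * G + G" by (simp add: distrib_right)
        then show ?thesis using V'(5) zb by linarith
      qed
      have "int (Suc i) * G \<le> int n * G" using i G1 by (intro mult_right_mono) auto
      then have vb2: "\<bar>s' rV 0 + z\<bar> \<le> b" using vb bd(2) by linarith
      have a1: "aval (Plus (Var rV) (Times (Times (Minus (Mod (Plus (Var rT) (Const 2)) (Const 5)) (Const 2))
          (Minus (Var rR) (Div (Var rR) (Const 2)))) (Cell aE (Var rI)))) s' = s' rV 0 + z"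
        by (simp add: yT g R E V'(2) z)
      have a2: "aval (Div (Var rT) (Const 5)) (store_at s' rV (nat 0) y) = int q" for y
        by (simp add: state_simps qT)
      have nv: "s' rV 0 + z = pack u + (\<Sum>c<Suc i. ?w c)" unfolding V'(3) z y by simp
      show "vc b (lens n Nb) grid_body
          (\<lambda>s'. s' rI 0 = int i \<and> ?V (Suc i) (store_at s' rI 0 (int (Suc i)))) s'"
        using vb2 qb i V'(1,2)
        unfolding grid_body_def vc.simps aval.simps(1) a1 a2
        unfolding nv[symmetric] q'
        by (simp add: lens_def state_simps vb qT del: of_nat_Suc)
    qed (simp add: grid_body_def)
    show "same grid_regs s s' \<and> s' rV 0 = pack (vadd u (grid n g t))" if "?V n s'" for s'
    proof -
      have "pack (grid n g t) = (\<Sum>c<n. ?w c)" unfolding pk_unit by (intro sum.cong) (auto simp: grid_def)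
      then show ?thesis using that by (simp add: pk_add)
    qed
  qed (use s b0 in \<open>auto simp: T_grid_def\<close>)
qed

section \<open>The norms, and their test by the program\<close>

definition Ball :: "int \<Rightarrow> real \<Rightarrow> (nat \<Rightarrow> int) \<Rightarrow> bool" where
  "Ball \<sigma> t u \<longleftrightarrow> (\<forall>i<n. \<bar>real_of_int (u i)\<bar> \<le> t) \<and>
     L2_set (\<lambda>r. real_of_int (image n A u r)) {..<n} \<le> t * of_int \<sigma>"

lemma norm_balls: assumes "\<sigma> > 0" shows "norm_balls n (Ball \<sigma>)"
proof
  fix a b :: real and u v :: "nat \<Rightarrow> int" and c :: int
  have im: "image n A (vadd u v) r = image n A u r + image n A v r" for r
    by (simp add: image_def vadd_def distrib_left sum.distrib)
  have ims: "L2_set (\<lambda>r. real_of_int (image n A (vscale c u) r)) {..<n} =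
      \<bar>of_int c\<bar> * L2_set (\<lambda>r. real_of_int (image n A u r)) {..<n}"
  proof -
    have "image n A (vscale c u) r = c * image n A u r" for r
      by (simp add: image_def vscale_def sum_distrib_left mult_ac)
    then have "L2_set (\<lambda>r. real_of_int (image n A (vscale c u) r)) {..<n} =
        sqrt ((of_int c)\<^sup>2 * (\<Sum>r<n. (real_of_int (image n A u r))\<^sup>2))"
      by (simp add: L2_set_def power_mult_distrib sum_distrib_left)
    then show ?thesis by (simp add: L2_set_def real_sqrt_mult)
  qed
  show "Ball \<sigma> (a + b) (vadd u v)" if "Ball \<sigma> a u" "Ball \<sigma> b v"
  proof -
    have "L2_set (\<lambda>r. real_of_int (image n A (vadd u v) r)) {..<n} \<le>
        L2_set (\<lambda>r. real_of_int (image n A u r)) {..<n} + L2_set (\<lambda>r. real_of_int (image n A v r)) {..<n}"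
      unfolding im of_int_add by (rule L2_set_triangle_ineq)
    moreover have "\<bar>real_of_int (vadd u v i)\<bar> \<le> a + b" if "i < n" for i
      using \<open>Ball \<sigma> a u\<close> \<open>Ball \<sigma> b v\<close> that abs_triangle_ineq[of "real_of_int (u i)" "of_int (v i)"]
      unfolding Ball_def vadd_def of_int_add by (meson add_mono order_trans)
    ultimately show ?thesis using that by (auto simp: Ball_def distrib_right)
  qed
  show "Ball \<sigma> (\<bar>of_int c\<bar> * a) (vscale c u)" if "Ball \<sigma> a u"
    using that unfolding Ball_def ims
    by (auto simp: vscale_def abs_mult mult.assoc intro: mult_left_mono)
  show "Ball \<sigma> a u" if "Ball \<sigma> (\<bar>of_int c\<bar> * a) (vscale c u)" "c \<noteq> 0"
    using that unfolding Ball_def ims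
    by (auto simp: vscale_def abs_mult mult.assoc)
  show "Ball \<sigma> b u" if "Ball \<sigma> a u" "a \<le> b"
    using that assms unfolding Ball_def by (meson le_less mult_right_mono of_int_0_le_iff order_trans)
  show "\<bar>real_of_int (u i)\<bar> \<le> a" if "Ball \<sigma> a u" "i < n" for i
    using that by (simp add: Ball_def)
  show "Ball \<sigma> a vzero" if "0 \<le> a"
    using that assms by (simp add: Ball_def image_def L2_set_def)
qed

lemma Ball_inc: "Ball \<sigma> t u \<Longrightarrow> \<sigma> \<le> \<sigma>' \<Longrightarrow> 0 \<le> t \<Longrightarrow> Ball \<sigma>' t u"
  unfolding Ball_def by (meson mult_left_mono of_int_le_iff order_trans)

lemma L2_sq: "L2_set (\<lambda>r. real_of_int (image n A u r)) {..<n} = sqrt (of_int (sq u))"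
  by (simp add: L2_set_def sqn_def)

lemma vmax_le_scaled: "0 \<le> t \<Longrightarrow> 256 * vmax v m \<le> t \<longleftrightarrow> (\<forall>i<m. 256 * \<bar>v i\<bar> \<le> t)"
  by (induction m) (auto simp: less_Suc_eq max_def)

lemma inball_iff:
  assumes "s rMx 0 = vmax u n" "s rSq 0 = sq u" "s rR 0 = R" "s rS 0 = \<sigma>" "R > 0" "\<sigma> > 0" "\<tau> > 0"
  shows "aval (inball \<tau>) s \<noteq> 0 \<longleftrightarrow> Ball \<sigma> (of_int (\<tau> * R) / 256) u"
proof -
  have "256 * vmax u n < 1 + \<tau> * R \<longleftrightarrow> 256 * vmax u n \<le> \<tau> * R" by linarith
  also have "\<dots> \<longleftrightarrow> (\<forall>i<n. 256 * \<bar>u i\<bar> \<le> \<tau> * R)"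
    by (rule vmax_le_scaled) (use assms in simp)
  also have "\<dots> \<longleftrightarrow> (\<forall>i<n. \<bar>real_of_int (u i)\<bar> \<le> of_int (\<tau> * R) / 256)"
  proof -
    have "256 * \<bar>y\<bar> \<le> \<tau> * R \<longleftrightarrow> \<bar>real_of_int y\<bar> \<le> of_int (\<tau> * R) / 256" for y
    proof -
      have "256 * \<bar>y\<bar> \<le> \<tau> * R \<longleftrightarrow> real_of_int (256 * \<bar>y\<bar>) \<le> of_int (\<tau> * R)"
        by (simp only: of_int_le_iff)
      also have "\<dots> \<longleftrightarrow> \<bar>real_of_int y\<bar> \<le> of_int (\<tau> * R) / 256"
        by (simp add: pos_le_divide_eq mult.commute)
      finally show ?thesis .
    qed
    then show ?thesis by blast
  qed
  finally have 1: "256 * vmax u n < 1 + \<tau> * R \<longleftrightarrow> (\<forall>i<n. \<bar>real_of_int (u i)\<bar> \<le> of_int (\<tau> * R) / 256)" .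
  have pos: "\<tau> * R * \<sigma> > 0" using assms by simp
  have "65536 * sq u < 1 + (\<tau> * R) * (\<tau> * R) * (\<sigma> * \<sigma>) \<longleftrightarrow> 65536 * sq u \<le> (\<tau> * R * \<sigma>)\<^sup>2"
    by (simp add: power2_eq_square mult_ac) linarith
  also have "\<dots> \<longleftrightarrow> real_of_int (65536 * sq u) \<le> of_int ((\<tau> * R * \<sigma>)\<^sup>2)"
    by (simp only: of_int_le_iff)
  also have "\<dots> \<longleftrightarrow> of_int (sq u) \<le> (of_int (\<tau> * R * \<sigma>) / 256 :: real)\<^sup>2"
    by (simp add: power_divide field_simps)
  also have "\<dots> \<longleftrightarrow> sqrt (of_int (sq u)) \<le> of_int (\<tau> * R * \<sigma>) / 256"
    using pos by (intro real_sqrt_le_iff'[symmetric]) (auto simp: sqn_def sum_nonneg simp del: of_int_mult)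
  finally have 2: "65536 * sq u < 1 + (\<tau> * R) * (\<tau> * R) * (\<sigma> * \<sigma>) \<longleftrightarrow>
      sqrt (of_int (sq u)) \<le> of_int (\<tau> * R) / 256 * of_int \<sigma>" by simp
  show ?thesis
    unfolding Ball_def L2_sq 1[symmetric] 2[symmetric] inball_def using assms by simp
qed

lemma small_Ball: assumes "Ball s0 t u" "t \<le> (4 * real n + 4) * 2 ^ J" shows "small u"
  unfolding small_def
proof (intro allI impI)
  fix i assume i: "i < 2 * n"
  let ?t = "(4 * real n + 4) * 2 ^ J"
  have B: "Ball s0 ?t u" using norm_balls.ball_mono[OF norm_balls assms] s0 by simp
  have "?t * of_int s0 * 2 < of_int P"
  proof -
    have "real_of_int ((4 * int n + 4) * 2 ^ J * s0 * 2) < of_int P" using digits by (simp only: of_int_less_iff)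
    then show ?thesis by simp
  qed
  moreover have "?t \<le> ?t * of_int s0"
  proof -
    have "?t * 1 \<le> ?t * of_int s0" using s0 by (intro mult_left_mono) auto
    then show ?thesis by simp
  qed
  moreover have "\<bar>real_of_int (full n A u i)\<bar> \<le> ?t * of_int s0"
  proof (cases "i < n")
    case True
    then have "\<bar>real_of_int (full n A u i)\<bar> \<le> ?t" using B by (simp add: Ball_def full_def)
    then show ?thesis using \<open>?t \<le> ?t * of_int s0\<close> by linarith
  next
    case False
    have "\<bar>real_of_int (image n A u (i - n))\<bar> \<le> L2_set (\<lambda>r. real_of_int (image n A u r)) {..<n}"
      using member_le_L2_set[of "{..<n}" "i - n" "\<lambda>r. \<bar>real_of_int (image n A u r)\<bar>"] i False
      by (simp add: L2_set_def)
    then show ?thesis using B False by (simp add: Ball_def full_def)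
  qed
  ultimately have "real_of_int (2 * \<bar>full n A u i\<bar>) < of_int P" by simp
  then show "2 * \<bar>full n A u i\<bar> < P" by (simp only: of_int_less_iff)
qed

end

text \<open>By \<open>box\<close>, for the first value \<open>s0\<close> the condition on the image
  follows from that on the coefficients, so the ball is a cube. By \<open>inj\<close>, a nonzero
  coefficient vector never has a zero image, so comparing squared lengths is meaningful.
  \<open>Nb\<close> is the bound of \<open>separated_length\<close>, rounded down.\<close>

locale sieve = machine +
  fixes x :: nat
  assumes x: "x \<ge> 1" "k = 2 * x - 1"
    and Nb: "real x * (1 + 2 * (real x * (321/256)) / (63/256)) powr (real n / real x) < real Nb + 1"
    and box: "\<And>u t. \<forall>i<n. \<bar>real_of_int (u i)\<bar> \<le> t \<Longrightarrow>
      L2_set (\<lambda>r. real_of_int (image n A u r)) {..<n} \<le> t * of_int s0"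
    and inj: "\<And>u. u \<in> ivecs n \<Longrightarrow> u \<noteq> vzero \<Longrightarrow> sq u > 0"
begin

text \<open>
  Passing from \<open>\<sigma>\<close> to \<open>\<sigma> - \<sigma> div 65\<close> stretches the norm by at most \<open>65/64\<close>. So if a vector of the ball of radius
  \<open>2 ^ j\<close> was approximated up to \<open>2 ^ j / 4\<close>, by tuples from two levels, then it now is up to
  \<open>65/256 * 2 ^ j\<close>, and its approximation has norm at most \<open>\<rho> j\<close>. This leaves \<open>\<delta> j\<close> of the total error
  \<open>2 ^ j / 2\<close> for approximating the candidate by the new list.
\<close>

definition \<rho> :: "nat \<Rightarrow> real" where "\<rho> j = 321 / 256 * 2 ^ j"
definition \<delta> :: "nat \<Rightarrow> real" where "\<delta> j = 63 / 256 * 2 ^ j"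

section \<open>Selecting one list\<close>

lemma same_reg: "same X s s' \<Longrightarrow> a \<notin> X \<Longrightarrow> s' a i = s a i"
  by (simp add: same_def)

lemma params_k: "params s \<Longrightarrow> s rK 0 = int k"
  by (simp add: params_def)

lemma rd_pos [simp]: "\<rho> j > 0" "\<delta> j > 0" "\<rho> j \<ge> 0" "\<delta> j \<ge> 0"
  by (simp_all add: \<rho>_def \<delta>_def)

lemma \<rho>_le: "j < J \<Longrightarrow> \<rho> j \<le> 2 ^ J"
proof -
  assume "j < J"
  then have "(2::real) ^ Suc j \<le> 2 ^ J" by (intro power_increasing) auto
  moreover have "\<rho> j \<le> 2 ^ Suc j" by (simp add: \<rho>_def)
  ultimately show ?thesis by linarith
qed

definition listok :: "int \<Rightarrow> nat \<Rightarrow> (nat \<Rightarrow> int) list \<Rightarrow> bool" where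
  "listok \<sigma> j C \<longleftrightarrow> (\<forall>c\<in>set C. c \<in> ivecs n \<and> Ball \<sigma> (\<rho> j) c \<and> 0 \<le> pack c) \<and>
     norm_balls.separated (Ball \<sigma>) k (\<delta> j) C"

definition covered :: "int \<Rightarrow> nat \<Rightarrow> (nat \<Rightarrow> int) list \<Rightarrow> (nat \<Rightarrow> int) \<Rightarrow> bool" where
  "covered \<sigma> j C u \<longleftrightarrow> (\<exists>v\<in>combs C k. Ball \<sigma> (\<delta> j) (vsub u v))"

text \<open>The ratio of \<open>\<rho> j\<close> to \<open>\<delta> j\<close> is the same on all
  levels, so one bound serves for all lists and all values of \<open>\<sigma>\<close>.\<close>

lemma listok_length: assumes "\<sigma> > 0" "listok \<sigma> j C" shows "length C \<le> Nb"
proof -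
  have "real (length C) \<le> real x * (1 + 2 * (real x * \<rho> j) / \<delta> j) powr (real n / real x)"
  proof (rule norm_balls.separated_length[OF norm_balls[OF assms(1)]])
    show "norm_balls.separated (Ball \<sigma>) (2 * x - 1) (\<delta> j) C"
      using assms(2) unfolding x(2)[symmetric] listok_def by simp
    show "c \<in> ivecs n \<and> Ball \<sigma> (\<rho> j) c" if "c \<in> set C" for c
      using assms(2) that unfolding listok_def by simp
  qed (use x in simp_all)
  also have "(real x * \<rho> j) / \<delta> j = (real x * (321/256)) / (63/256)" by (simp add: \<rho>_def \<delta>_def)
  then have "2 * (real x * \<rho> j) / \<delta> j = 2 * (real x * (321/256)) / (63/256)" by simp
  finally show ?thesis using Nb by simp
qed

lemma Ball_neg: "Ball \<sigma> t u \<Longrightarrow> Ball \<sigma> t (vscale (-1) u)"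
proof -
  have im: "image n A (vscale (-1) u) r = - image n A u r" for r
    by (simp add: image_def vscale_def sum_negf)
  show "Ball \<sigma> t u \<Longrightarrow> Ball \<sigma> t (vscale (-1) u)"
    unfolding Ball_def im by (simp add: L2_set_def vscale_def)
qed

lemma signed_ball:
  assumes "\<sigma> > 0" "\<And>c. c \<in> set C \<Longrightarrow> Ball \<sigma> r c" "r \<ge> 0" "e \<in> signed C"
  shows "Ball \<sigma> r e"
  using assms norm_balls.ball_zero[OF norm_balls[OF assms(1)]] Ball_neg by (auto simp: signed_def)

lemma sumset_ball:
  assumes \<sigma>: "\<sigma> > 0" and X: "\<And>i e. i < m \<Longrightarrow> e \<in> X i \<Longrightarrow> Ball \<sigma> r e" and u: "u \<in> sumset X m"
  shows "Ball \<sigma> (real m * r) u"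
  using X u
proof (induction m arbitrary: u)
  case 0
  then show ?case using norm_balls.ball_zero[OF norm_balls[OF \<sigma>]] by simp
next
  case (Suc m)
  then obtain v e where ve: "u = vadd v e" "v \<in> sumset X m" "e \<in> X m" by auto
  have "Ball \<sigma> (real m * r) v" by (rule Suc.IH[OF _ ve(2)], rule Suc.prems(1)[rotated], assumption, simp)
  moreover have "Ball \<sigma> r e" by (rule Suc.prems(1)[OF lessI ve(3)])
  ultimately show ?case
    using norm_balls.ball_add[OF norm_balls[OF \<sigma>], of "real m * r" v r e] ve(1)
    by (simp add: distrib_right add.commute)
qed

lemma combs_neg: "v \<in> combs C m \<Longrightarrow> vscale (-1) v \<in> combs C m"
proof (induction m arbitrary: v)
  case 0
  then show ?case by (simp add: vscale_def)
next
  case (Suc m)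
  then obtain u e where ue: "v = vadd u e" "u \<in> combs C m" "e \<in> signed C" by auto
  have "vscale (-1) e \<in> signed C" using ue(3) by (auto simp: signed_def vscale_def)
  moreover have "vscale (-1) v = vadd (vscale (-1) u) (vscale (-1) e)"
    using ue(1) by (simp add: vscale_def vadd_def)
  ultimately show ?case using Suc.IH[OF ue(2)] by auto
qed

lemma covered_iff:
  assumes "length C < M"
  shows "covered \<sigma> j C u \<longleftrightarrow> (\<exists>I<(2*M)^k. Ball \<sigma> (\<delta> j) (vadd u (decode (\<lambda>_. C) M k I)))"
proof
  assume "covered \<sigma> j C u"
  then obtain v where v: "v \<in> combs C k" "Ball \<sigma> (\<delta> j) (vsub u v)" by (auto simp: covered_def)
  obtain I where I: "I < (2*M)^k" "\<And>t. decode (\<lambda>_. C) M k (I + t * (2*M)^k) = vscale (-1) v"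
    using decode_surj[of "vscale (-1) v" "\<lambda>_. C" k M] combs_neg[OF v(1)] assms by auto
  have "decode (\<lambda>_. C) M k I = vscale (-1) v" using I(2)[of 0] by simp
  moreover have "vadd u (vscale (-1) v) = vsub u v" by (simp add: vadd_def vscale_def vsub_def)
  ultimately show "\<exists>I<(2*M)^k. Ball \<sigma> (\<delta> j) (vadd u (decode (\<lambda>_. C) M k I))" using I v by auto
next
  assume "\<exists>I<(2*M)^k. Ball \<sigma> (\<delta> j) (vadd u (decode (\<lambda>_. C) M k I))"
  then obtain I where I: "Ball \<sigma> (\<delta> j) (vadd u (decode (\<lambda>_. C) M k I))" by auto
  let ?v = "vscale (-1) (decode (\<lambda>_. C) M k I)"
  have "?v \<in> combs C k" by (rule combs_neg) (rule decode_sumset)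
  moreover have "vsub u ?v = vadd u (decode (\<lambda>_. C) M k I)" by (simp add: vadd_def vscale_def vsub_def)
  ultimately show "covered \<sigma> j C u" unfolding covered_def using I by (intro bexI[of _ ?v]) simp_all
qed

lemma power_bound: assumes "M \<le> Nb + 1" "i \<le> 2 * k" "f \<le> 5 ^ n" shows "int (f * (2 * M) ^ i) \<le> b"
proof -
  have "(2 * M) ^ i \<le> (2 * (Nb + 1)) ^ i" using assms by (intro power_mono) auto
  also have "\<dots> \<le> (2 * (Nb + 1)) ^ (2 * k)" using assms by (intro power_increasing) auto
  finally have "f * (2 * M) ^ i \<le> 5 ^ n * (2 * (Nb + 1)) ^ (2 * k)" using assms(3) by (intro mult_le_mono)
  then have "int (f * (2 * M) ^ i) \<le> int (5 ^ n * (2 * (Nb + 1)) ^ (2 * k))" by (simp only: of_nat_le_iff)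
  then show ?thesis using b(4) by linarith
qed

lemma pow_spec:
  assumes s: "I s" "s c 0 = int f" "s m 0 = int M" and reg: "10 \<le> c" "c < 48" "m \<noteq> c" "m \<noteq> rI" "c \<noteq> rI"
    and cnt: "\<And>s'. same {c, rI} s s' \<Longrightarrow> aval e s' = int N"
    and bd: "M \<le> Nb + 1" "N \<le> 2 * k" "f \<le> 5 ^ n"
  shows "wp I (For rI e (Assign c (Times (Var c) (Times (Const 2) (Var m))))) (N * 5 + 3)
    (\<lambda>s'. same {c, rI} s s' \<and> s' c 0 = int (f * (2 * M) ^ N)) s"
proof -
  let ?V = "\<lambda>i s'. i \<le> N \<and> same {c, rI} s s' \<and> s' rI 0 = int i \<and> s' c 0 = int (f * (2 * M) ^ i)"
  show ?thesis
  proof (rule for_rule[where V = ?V and N = N and ?T1.0 = 1])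
    show "int N \<le> b" using bd(2) k1(2) b0(4) by linarith
    show "?V 0 (store_at s rI 0 0)" using s reg by (simp add: state_simps)
    show "aval e s' = int N" if "?V i s'" for i s' using that cnt by blast
    show "wp I (Assign c (Times (Var c) (Times (Const 2) (Var m)))) 1
        (\<lambda>s'. s' rI 0 = int i \<and> ?V (Suc i) (store_at s' rI 0 (int (Suc i)))) s'"
      if i: "i < N" and V: "?V i s'" and I': "I s'" for i s'
    proof (rule wp_vc[OF I'])
      have V': "same {c, rI} s s'" "s' rI 0 = int i" "s' c 0 = int (f * (2 * M) ^ i)" using V by blast+
      have m: "s' m 0 = int M" using V'(1) s reg by (simp add: same_def)
      obtain y where y: "y = f * (2 * M) ^ Suc i" by simp
      have a: "aval (Times (Var c) (Times (Const 2) (Var m))) s' = int y"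
        using V'(3) m by (simp add: y)
      have yb: "int y \<le> b" unfolding y by (rule power_bound) (use bd i in auto)
      show "vc b (lens n Nb) (Assign c (Times (Var c) (Times (Const 2) (Var m))))
          (\<lambda>s'. s' rI 0 = int i \<and> ?V (Suc i) (store_at s' rI 0 (int (Suc i)))) s'"
        unfolding vc.simps a aval.simps(1) y[symmetric]
        using V'(1,2) reg i yb by (simp add: state_simps lens_def del: of_nat_Suc)
    qed simp
    show "same {c, rI} s s' \<and> s' c 0 = int (f * (2 * M) ^ N)" if "?V N s'" for s' using that by blast
  qed (use s in auto)
qed

abbreviation "chkb_regs \<equiv> {rCov, rI, rT, rV, rA, rMx, rSq, rDg}"
abbreviation "chk_regs \<equiv> {rM3, rC3, rJJ, rCov, rI, rT, rV, rA, rMx, rSq, rDg}"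

definition "T_chkb = T_dec k + T_norm + 10"
definition "T_chk = (2 * (Nb + 1)) ^ k * (T_chkb + 4) + 5 * k + 20"

lemma chk_spec:
  assumes s: "I s" "params s" "s rU 0 = pack u" "s rCz 0 = int (length C)" "\<And>a. s aZ a = ent C a"
      "s rR 0 = 2 ^ j" "s rS 0 = \<sigma>"
    and \<sigma>: "0 < \<sigma>" "\<sigma> \<le> s0" and j: "j < J" and C: "listok \<sigma> j C" and u: "Ball \<sigma> (\<rho> j) u"
  shows "wp I chk_com T_chk (\<lambda>s'. same chk_regs s s' \<and> (s' rCov 0 \<noteq> 0 \<longleftrightarrow> covered \<sigma> j C u)) s"
proof -
  note nb = norm_balls[OF \<sigma>(1)]
  define M where "M = length C + 1"
  have len: "length C \<le> Nb" by (rule listok_length[OF \<sigma>(1) C])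
  have M: "M \<ge> 1" "M \<le> Nb + 1" "length C < M" using len by (auto simp: M_def)
  define hit where "hit I = Ball \<sigma> (\<delta> j) (vadd u (decode (\<lambda>_. C) M k I))" for I
  have ballC: "Ball \<sigma> (\<rho> j) c" if "c \<in> set C" for c using C that by (auto simp: listok_def)
  have rj: "\<rho> j \<le> 2 ^ J" by (rule \<rho>_le[OF j])
  have smallI: "small v" if "Ball \<sigma> ((real k + 1) * \<rho> j) v" for v
  proof (rule small_Ball)
    show "Ball s0 ((real k + 1) * \<rho> j) v" by (rule Ball_inc[OF that \<sigma>(2)]) simp
    show "(real k + 1) * \<rho> j \<le> (4 * real n + 4) * 2 ^ J" using k1 rj by (intro mult_mono) auto
  qed
  have k1r: "\<rho> j \<le> (real k + 1) * \<rho> j"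
  proof -
    have "1 * \<rho> j \<le> (real k + 1) * \<rho> j" by (intro mult_right_mono) simp_all
    then show ?thesis by simp
  qed
  have smallu: "small u"
    by (rule smallI, rule norm_balls.ball_mono[OF nb u k1r])
  have smallC: "small c" if "c \<in> set C" for c
    by (rule smallI, rule norm_balls.ball_mono[OF nb ballC[OF that] k1r])
  have dec_ball: "Ball \<sigma> ((real k + 1) * \<rho> j) (vadd u (decode (\<lambda>_. C) M k I))" for I
  proof -
    have "Ball \<sigma> (real k * \<rho> j) (decode (\<lambda>_. C) M k I)"
      by (rule sumset_ball[OF \<sigma>(1) _ decode_sumset]) (rule signed_ball[OF \<sigma>(1)], auto intro: ballC)
    from norm_balls.ball_add[OF nb u this] show ?thesis by (simp add: distrib_right add.commute)
  qed
  have entb: "\<bar>ent C a\<bar> \<le> G" for a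
    using pack_less[OF smallC] G1 by (auto simp: ent_def intro: less_imp_le)
  have Mb: "int (2 * M) \<le> b" using power_bound[of M 1 1] M k1 by simp
  have Mb': "int M \<le> b" using Mb by simp
  have pu: "\<bar>pack u\<bar> \<le> b" using pack_less[OF smallu] b0 by linarith
  have kb: "int k \<le> b" using k1 b0 by simp
  have cntb: "int ((2*M)^k) \<le> b" using power_bound[of M k 1] M by simp
  have sumb: "\<bar>pack u\<bar> + int k * G \<le> b"
  proof -
    have "int k * G \<le> int n * G" using k1 G1 by (intro mult_right_mono) auto
    moreover have "(2 * int n + 4) * G = 2 * (int n * G) + 4 * G" by (simp add: algebra_simps)
    moreover have "int n * G \<ge> 0" using G1 by simp
    ultimately show ?thesis using b(2) pack_less[OF smallu] G1 by linarith
  qed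
  show ?thesis
    unfolding chk_com_def
  proof (rule wp_seq')
    let ?R1 = "\<lambda>s'. same {rM3, rCov, rC3} s s' \<and> s' rM3 0 = int M \<and> s' rCov 0 = 0 \<and> s' rC3 0 = 1"
    show "wp I (Seq (Assign rM3 (Plus (Var rCz) (Const 1))) (Seq (Assign rCov (Const 0)) (Assign rC3 (Const 1)))) 5 ?R1 s"
      by (rule wp_vc) (use s Mb' b0 in \<open>auto simp: state_simps lens_def M_def\<close>)
    fix s1 assume s1: "I s1" "?R1 s1"
    show "wp I (Seq (For rI (Var rK) (Assign rC3 (Times (Var rC3) (Times (Const 2) (Var rM3))))) (For rJJ (Var rC3) chk_body))
        (k * 5 + 3 + ((2 * M) ^ k * (T_chkb + 4) + 3) + 1)
        (\<lambda>s'. same chk_regs s s' \<and> (s' rCov 0 \<noteq> 0 \<longleftrightarrow> covered \<sigma> j C u)) s1"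
    proof (rule wp_seq'[OF pow_spec[where f = 1 and M = M and N = k and e = "Var rK"] _ order.refl])
      have p1: "params s1" by (rule params_same[OF s(2) conjunct1[OF s1(2)]]) simp
      show "aval (Var rK) s' = int k" if "same {rC3, rI} s1 s'" for s'
        using same_reg[OF that, of rK 0] params_k[OF p1] by simp
      fix s2 assume s2: "I s2" "same {rC3, rI} s1 s2 \<and> s2 rC3 0 = int (1 * (2 * M) ^ k)"
      have sm2: "same {rM3, rCov, rC3, rI} s s2"
        by (rule same_trans[of "{rM3, rCov, rC3}" s s1 "{rC3, rI}"]) (use s1 s2 in auto)
      have r2: "s2 rCov 0 = 0" "s2 rM3 0 = int M" "s2 rC3 0 = int ((2 * M) ^ k)"
        using s2(2) s1(2) by (auto simp: same_def)
      let ?V = "\<lambda>i s'. i \<le> (2*M)^k \<and> same (insert rJJ chkb_regs) s2 s' \<and> s' rJJ 0 = int i \<and>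
        (s' rCov 0 \<noteq> 0 \<longleftrightarrow> (\<exists>I<i. hit I))"
      show "wp I (For rJJ (Var rC3) chk_body) ((2 * M) ^ k * (T_chkb + 4) + 3)
          (\<lambda>s'. same chk_regs s s' \<and> (s' rCov 0 \<noteq> 0 \<longleftrightarrow> covered \<sigma> j C u)) s2"
      proof (rule for_rule[where V = ?V and N = "(2*M)^k" and ?T1.0 = T_chkb])
        show "?V 0 (store_at s2 rJJ 0 0)" using r2 by (simp add: state_simps)
        show "aval (Var rC3) s' = int ((2*M)^k)" if "?V i s'" for i s'
          using that r2 by (simp add: same_def)
        show "wp I chk_body T_chkb (\<lambda>s'. s' rJJ 0 = int i \<and> ?V (Suc i) (store_at s' rJJ 0 (int (Suc i)))) s3"
          if i: "i < (2*M)^k" and V: "?V i s3" and I3: "I s3" for i s3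
          unfolding chk_body_def
        proof (rule wp_seq')
          have V': "same (insert rJJ chkb_regs) s2 s3" "s3 rJJ 0 = int i" "s3 rCov 0 \<noteq> 0 \<longleftrightarrow> (\<exists>I<i. hit I)"
            using V by blast+
          have sm3: "same chk_regs s s3"
            by (rule same_trans[OF sm2 V'(1)]) auto
          have r3: "s3 rU 0 = pack u" "s3 rM3 0 = int M" using sm3 s V'(1) r2 by (auto simp: same_def)
          have ib: "int i \<le> b" using i cntb by linarith
          let ?R4 = "\<lambda>s'. same {rT, rV} s3 s' \<and> s' rT 0 = int i \<and> s' rV 0 = pack u"
          show "wp I (Seq (Assign rT (Var rJJ)) (Assign rV (Var rU))) 3 ?R4 s3"
            by (rule wp_vc[OF I3]) (use V' r3 pu ib in \<open>auto simp: state_simps lens_def\<close>)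
          fix s4 assume s4: "I s4" "?R4 s4"
          have sm4: "same chk_regs s s4" by (rule same_trans[OF sm3]) (use s4 in auto)
          have M4: "s4 rM3 0 = int M" using s4(2) r3 by (simp add: same_def)
          show "wp I (Seq (For rI (Var rK) (dec_body rM3 (Cell aZ (Mod (Var rA) (Var rM3)))))
              (Seq norm_com (Cond (inball 63) (Assign rCov (Const 1)) Skip))) (T_dec k + (T_norm + 2 + 1) + 1)
              (\<lambda>s'. s' rJJ 0 = int i \<and> ?V (Suc i) (store_at s' rJJ 0 (int (Suc i)))) s4"
          proof (rule wp_seq'[OF dec_spec[where t = i and u = u and M = M and X = "\<lambda>_. C"] _ order.refl])
            have p4: "params s4" by (rule params_same[OF s(2) sm4]) simp
            show "aval (Var rK) s' = int k" if "same dec_regs s4 s'" for s'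
              using same_reg[OF that, of rK 0] params_k[OF p4] by simp
            show "aval (Cell aZ (Mod (Var rA) (Var rM3))) s' = ent C (d mod M)"
              if "same dec_regs s4 s'" "s' rA 0 = int d" for s' d
            proof -
              have "s' rM3 0 = int M" using same_reg[OF that(1), of rM3 0] M4 by simp
              moreover have "s' aZ a = ent C a" for a
                using same_reg[OF that(1), of aZ a] same_reg[OF sm4, of aZ a] s(5) by simp
              moreover have "nat (int d mod int M) = d mod M" by (metis nat_int zmod_int)
              ultimately show ?thesis using that(2) by simp
            qed
            fix s5 assume s5: "I s5" "same dec_regs s4 s5 \<and> s5 rV 0 = pack (vadd u (decode (\<lambda>_. C) M k i)) \<and>
              s5 rT 0 = int (i div (2 * M) ^ k)"
            let ?w = "vadd u (decode (\<lambda>_. C) M k i)"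
            have sm5: "same chk_regs s s5" by (rule same_trans[OF sm4]) (use s5 in auto)
            have p5: "params s5" by (rule params_same[OF s(2) sm5]) simp
            show "wp I (Seq norm_com (Cond (inball 63) (Assign rCov (Const 1)) Skip)) (T_norm + 2 + 1)
                (\<lambda>s'. s' rJJ 0 = int i \<and> ?V (Suc i) (store_at s' rJJ 0 (int (Suc i)))) s5"
            proof (rule wp_seq'[OF norm_spec[where u = ?w] _ order.refl])
              show "small ?w" by (rule smallI[OF dec_ball])
              fix s6 assume s6: "I s6" "same norm_regs s5 s6 \<and> s6 rMx 0 = vmax ?w n \<and> s6 rSq 0 = sq ?w"
              have sm6: "same chk_regs s s6" by (rule same_trans[OF sm5]) (use s6 in auto)
              have sm36: "same chkb_regs s3 s6"
                using s6(2) s5(2) s4(2) by (auto simp: same_def)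
              have sm26: "same (insert rJJ chkb_regs) s2 s6" by (rule same_trans[OF V'(1) sm36]) auto
              have jj: "s6 rJJ 0 = int i" using sm36 V'(2) by (simp add: same_def)
              have cov: "s6 rCov 0 = s3 rCov 0" using s6(2) s5(2) s4(2) by (simp add: same_def)
              have inb: "aval (inball 63) s6 \<noteq> 0 \<longleftrightarrow> hit i"
              proof -
                have "aval (inball 63) s6 \<noteq> 0 \<longleftrightarrow> Ball \<sigma> (of_int (63 * 2 ^ j) / 256) ?w"
                  by (rule inball_iff) (use s6(2) sm6 s(6,7) \<sigma> in \<open>auto simp: same_def\<close>)
                then show ?thesis by (simp add: hit_def \<delta>_def)
              qed
              have ex: "(\<exists>I<Suc i. hit I) \<longleftrightarrow> hit i \<or> (\<exists>I<i. hit I)" by (auto simp: less_Suc_eq)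
              show "wp I (Cond (inball 63) (Assign rCov (Const 1)) Skip) 2
                  (\<lambda>s'. s' rJJ 0 = int i \<and> ?V (Suc i) (store_at s' rJJ 0 (int (Suc i)))) s6"
              proof (rule wp_vc[OF s6(1)])
                show "vc b (lens n Nb) (Cond (inball 63) (Assign rCov (Const 1)) Skip)
                  (\<lambda>s'. s' rJJ 0 = int i \<and> ?V (Suc i) (store_at s' rJJ 0 (int (Suc i)))) s6"
                  unfolding vc.simps inb ex using jj sm26 cov V'(3) i b0(2)
                  by (simp add: state_simps lens_def del: of_nat_Suc)
              qed simp
            qed (use s5 p5 in auto)
          qed (use s4 M M4 entb sumb Mb ib kb in \<open>auto intro: ib\<close>)
        qed (simp add: T_chkb_def)
        show "same chk_regs s s' \<and> (s' rCov 0 \<noteq> 0 \<longleftrightarrow> covered \<sigma> j C u)" if "?V ((2*M)^k) s'" for s'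
        proof -
          have "same chk_regs s s'" by (rule same_trans[OF sm2, of "insert rJJ chkb_regs"]) (use that in auto)
          then show ?thesis using that covered_iff[OF M(3), of \<sigma> j u] by (simp add: hit_def)
        qed
      qed (use s2 cntb in auto)
    qed (use s1 M k1 in auto)
  next
    have "(2 * M) ^ k \<le> (2 * (Nb + 1)) ^ k" using M by (intro power_mono) auto
    then have "(2 * M) ^ k * (T_chkb + 4) \<le> (2 * (Nb + 1)) ^ k * (T_chkb + 4)" by (intro mult_le_mono1)
    then show "5 + (k * 5 + 3 + ((2 * M) ^ k * (T_chkb + 4) + 3) + 1) + 1 \<le> T_chk"
      unfolding T_chk_def by linarith
  qed
qed

definition bestok :: "state \<Rightarrow> bool" where
  "bestok s \<longleftrightarrow> s rBest 0 \<ge> 0 \<and> (s rBest 0 > 0 \<longrightarrow>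
     (\<exists>u\<in>ivecs n. u \<noteq> vzero \<and> small u \<and> s rBest 0 = sq u \<and> s rBu 0 = pack u))"

text \<open>The best vector so far is at least as short as the square root of \<open>y\<close>. This
  can only persist, so it survives all later candidates and builds.\<close>

definition lb :: "state \<Rightarrow> int \<Rightarrow> bool" where
  "lb s y \<longleftrightarrow> 0 < s rBest 0 \<and> s rBest 0 \<le> y"

text \<open>Index \<open>p\<close> of \<open>L\<close> belongs to level \<open>p - 1\<close>:
  \<open>Suc j\<close> is the current level and \<open>j\<close> the one below. What is left of
  \<open>t\<close> after removing \<open>2 * k\<close> digits numbers the grid point.\<close>

definition cand :: "(nat \<Rightarrow> (nat \<Rightarrow> int) list) \<Rightarrow> nat \<Rightarrow> nat \<Rightarrow> nat \<Rightarrow> nat \<Rightarrow> int" where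
  "cand L M j t = vadd (decode (\<lambda>i. L (if i < k then Suc j else j)) M (2 * k) t)
     (grid n (2 ^ j - 2 ^ j div 2) (t div (2 * M) ^ (2 * k)))"

text \<open>A crude bound on the size of the elements, stated in the norm of \<open>s0\<close> so
  that it does not change with \<open>\<sigma>\<close> or the level. It is what keeps packed
  arithmetic correct.\<close>

definition lists_ok :: "(nat \<Rightarrow> (nat \<Rightarrow> int) list) \<Rightarrow> nat \<Rightarrow> bool" where
  "lists_ok L N \<longleftrightarrow> N \<le> Nb \<and> (\<forall>p\<le>J. length (L p) \<le> N \<and>
     (\<forall>c\<in>set (L p). c \<in> ivecs n \<and> Ball s0 (2 * 2 ^ J) c \<and> 0 \<le> pack c))"

definition stored :: "state \<Rightarrow> (nat \<Rightarrow> (nat \<Rightarrow> int) list) \<Rightarrow> bool" where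
  "stored s L \<longleftrightarrow> (\<forall>a. s aW a = enc G (\<lambda>p. ent (L p) a) (Suc J))"

lemma box_Ball: "(\<And>i. i < n \<Longrightarrow> \<bar>real_of_int (u i)\<bar> \<le> t) \<Longrightarrow> Ball s0 t u"
  using box[of u t] by (simp add: Ball_def)

lemma s0_pos: "0 < s0" using s0 by simp

lemmas nb0 = norm_balls[OF s0_pos]

lemma small_2J: "Ball s0 (2 * 2 ^ J) c \<Longrightarrow> small c"
  by (rule small_Ball) (auto intro: mult_right_mono)

lemma ent_bounds:
  assumes "lists_ok L N" "p \<le> J"
  shows "0 \<le> ent (L p) a" "ent (L p) a < G"
proof -
  have "\<bar>pack c\<bar> < G" "0 \<le> pack c" if "c \<in> set (L p)" for c
    using assms that pack_less[OF small_2J] unfolding lists_ok_def by blast+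
  then have "0 \<le> ent (L p) a \<and> ent (L p) a < G"
    using G1 by (auto simp: ent_def dest: nth_mem)
  then show "0 \<le> ent (L p) a" "ent (L p) a < G" by auto
qed

lemma stored_digit:
  assumes "stored s L" "lists_ok L N" "p \<le> J"
  shows "s aW a div G ^ p mod G = ent (L p) a"
  using assms ent_bounds[OF assms(2)] G1 unfolding stored_def
  by (simp add: enc_digit)

text \<open>These facts concern all candidates, including those of large norm: a candidate has to be
  computed correctly before its norm can be tested.\<close>

lemma cand_props:
  assumes L: "lists_ok L N" and j: "j < J"
  defines "g \<equiv> 2 ^ j - 2 ^ j div 2 :: int" and "X \<equiv> \<lambda>i. L (if i < k then Suc j else j)"
  shows "cand L M j t \<in> ivecs n" "small (cand L M j t)"
    "small (decode X M (2 * k) t)"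
    "\<And>c. c < n \<Longrightarrow> \<bar>2 * g * unit_pk n A P c\<bar> \<le> G"
proof -
  have XL: "c \<in> ivecs n" "Ball s0 (2 * 2 ^ J) c" if "c \<in> set (X i)" for i c
  proof -
    have "(if i < k then Suc j else j) \<le> J" using j by simp
    then show "c \<in> ivecs n" "Ball s0 (2 * 2 ^ J) c"
      using L that unfolding lists_ok_def X_def by blast+
  qed
  have g: "0 \<le> g" "g \<le> 2 ^ j"
  proof -
    have "0 \<le> (2::int) ^ j" by simp
    then show "0 \<le> g" "g \<le> 2 ^ j" unfolding g_def by linarith+
  qed
  have gJ: "real_of_int (2 * g) \<le> 2 * 2 ^ J"
  proof -
    have "(2::int) ^ j \<le> 2 ^ J" using j by (intro power_increasing) auto
    then have "2 * g \<le> 2 * 2 ^ J" using g by linarith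
    then have "real_of_int (2 * g) \<le> real_of_int (2 * 2 ^ J)" by (simp only: of_int_le_iff)
    then show ?thesis by simp
  qed
  have d: "Ball s0 (real (2 * k) * (2 * 2 ^ J)) (decode X M (2 * k) t)"
    by (rule sumset_ball[OF s0_pos _ decode_sumset]) (rule signed_ball[OF s0_pos XL(2)], auto)
  have gr: "Ball s0 (2 * 2 ^ J) (grid n g t')" for t'
  proof (rule box_Ball)
    fix i assume i: "i < n"
    have "\<bar>int (t' div 5 ^ i + 2) mod 5 - 2\<bar> \<le> 2"
      using pos_mod_bound[of 5 "int (t' div 5 ^ i + 2)"] pos_mod_sign[of 5 "int (t' div 5 ^ i + 2)"] by linarith
    then have "\<bar>int (t' div 5 ^ i + 2) mod 5 - 2\<bar> * g \<le> 2 * g" using g by (intro mult_right_mono) auto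
    then have "\<bar>grid n g t' i\<bar> \<le> 2 * g" using g i by (simp add: grid_def abs_mult)
    then have "\<bar>real_of_int (grid n g t' i)\<bar> \<le> real_of_int (2 * g)" by linarith
    then show "\<bar>real_of_int (grid n g t' i)\<bar> \<le> 2 * 2 ^ J" using gJ by linarith
  qed
  have eq: "cand L M j t = vadd (decode X M (2 * k) t) (grid n g (t div (2 * M) ^ (2 * k)))"
    by (simp only: cand_def X_def g_def)
  show "cand L M j t \<in> ivecs n"
    unfolding eq by (intro ivecs_simps decode_ivecs grid_ivecs) (rule XL(1))
  have kn: "real k \<le> real n" using k1 by simp
  show "small (decode X M (2 * k) t)"
    by (rule small_Ball[OF d]) (use kn in \<open>simp add: mult_right_mono\<close>)
  have "Ball s0 (real (2 * k) * (2 * 2 ^ J) + 2 * 2 ^ J) (cand L M j t)"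
    unfolding eq by (rule norm_balls.ball_add[OF nb0 d gr])
  moreover have "real (2 * k) * (2 * 2 ^ J) + 2 * 2 ^ J = (4 * real k + 2) * (2::real) ^ J"
    by (simp add: algebra_simps)
  ultimately show "small (cand L M j t)"
    by (intro small_Ball) (use kn in \<open>auto intro!: mult_right_mono\<close>)
  show "\<bar>2 * g * unit_pk n A P c\<bar> \<le> G" if c: "c < n" for c
  proof -
    let ?e = "\<lambda>i. if i = c then 2 * g else 0"
    have "Ball s0 (2 * 2 ^ J) ?e"
      by (rule box_Ball) (use gJ g in auto)
    then have "\<bar>pack ?e\<bar> < G" by (rule pack_less[OF small_2J])
    moreover have "pack ?e = 2 * g * unit_pk n A P c"
    proof -
      have "pack ?e = (\<Sum>i<n. if i = c then 2 * g * unit_pk n A P i else 0)"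
        unfolding pk_unit by (intro sum.cong) auto
      then show ?thesis using c by simp
    qed
    ultimately show ?thesis by linarith
  qed
qed

lemma vmax_0_iff: "u \<in> ivecs n \<Longrightarrow> vmax u n = 0 \<longleftrightarrow> u = vzero"
  using vmax_le[of 0 u n] vmax_nonneg[of u n] by (auto simp: ivecs_def fun_eq_iff) (metis not_le)

lemma best_spec:
  assumes s: "I s" "bestok s" "u \<in> ivecs n" "small u" "s rMx 0 = vmax u n" "s rSq 0 = sq u" "s rU 0 = pack u"
    "\<bar>s rSq 0\<bar> \<le> b"
  shows "wp I best_com 5 (\<lambda>s'. same {rBest, rBu} s s' \<and> bestok s' \<and>
    (u \<noteq> vzero \<longrightarrow> lb s' (sq u)) \<and> (\<forall>y. lb s y \<longrightarrow> lb s' y)) s"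
proof (rule wp_vc[OF s(1)])
  have pu: "\<bar>pack u\<bar> \<le> b" using pack_less[OF s(4)] b0 by linarith
  have nz: "s rMx 0 = 0 \<longleftrightarrow> u = vzero" using vmax_0_iff[OF s(3)] s(5) by simp
  have sq: "u \<noteq> vzero \<Longrightarrow> 0 < sq u" using inj s(3) by blast
  show "vc b (lens n Nb) best_com (\<lambda>s'. same {rBest, rBu} s s' \<and> bestok s' \<and>
      (u \<noteq> vzero \<longrightarrow> lb s' (sq u)) \<and> (\<forall>y. lb s y \<longrightarrow> lb s' y)) s"
  proof (cases "u = vzero")
    case True
    then show ?thesis using s(2) nz by (simp add: best_com_def)
  next
    case False
    show ?thesis
    proof (cases "s rBest 0 < 1 \<or> s rSq 0 < s rBest 0")
      case True
      have ok: "bestok (store_at (store_at s rBest 0 (s rSq 0)) rBu 0 (s rU 0))"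
        using s sq[OF False] False by (auto simp: bestok_def state_simps)
      have "0 < sq u" by (rule sq[OF False])
      then show ?thesis
        using True False nz s(5-8) pu ok
        by (auto simp: best_com_def lens_def state_simps lb_def)
    next
      case F2: False
      then have "lb s (sq u)" using s(6) by (simp add: lb_def)
      then show ?thesis using F2 False nz s(2) by (simp add: best_com_def)
    qed
  qed
qed (simp add: best_com_def)

lemma candE_val:
  assumes s: "params s" "stored s L" "lists_ok L N" "j < J" "s rPw 0 = G ^ j"
    "s rMc 0 = int M" "s rI 0 = int i" "s rA 0 = int d"
  shows "aval candE s = ent (L (if i < k then Suc j else j)) (d mod M)"
proof -
  have ix: "nat (int d mod int M) = d mod M" by (metis nat_int zmod_int)
  show ?thesis
  proof (cases "i < k")
    case True
    then have "aval candE s = s aW (d mod M) div G ^ Suc j mod G"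
      using s by (simp add: candE_def digE_def params_def ix mult.commute)
    then show ?thesis using stored_digit[OF s(2,3), of "Suc j"] s(4) True by simp
  next
    case False
    then have "aval candE s = s aW (d mod M) div G ^ j mod G"
      using s by (simp add: candE_def digE_def params_def ix)
    then show ?thesis using stored_digit[OF s(2,3), of j] s(4) False by simp
  qed
qed

abbreviation "cand_regs \<equiv> {rU, rBest, rBu, rCz, aZ, rM3, rC3, rJJ, rCov, rI, rT, rV, rA, rMx, rSq, rDg}"

definition "T_cand = T_dec (2 * k) + T_grid + T_norm + T_chk + 30"

text \<open>One of \<open>u\<close> and \<open>-u\<close> is appended. Negation carries the distance
  of \<open>u\<close> from the signed sums over to \<open>-u\<close>, as these sums are closed under
  it. Afterwards \<open>u\<close> is itself a signed element of the list, and zeros extend it to a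
  sum of \<open>k\<close> elements.\<close>

lemma listok_add:
  assumes C: "listok \<sigma> j C" "\<sigma> > 0" and u: "u \<in> ivecs n" "Ball \<sigma> (\<rho> j) u" and un: "\<not> covered \<sigma> j C u"
  shows "\<exists>C'. listok \<sigma> j C' \<and> length C' = Suc (length C) \<and> covered \<sigma> j C' u \<and>
    (\<forall>v. covered \<sigma> j C v \<longrightarrow> covered \<sigma> j C' v) \<and> (\<forall>a. ent C' a = (if a = length C then \<bar>pack u\<bar> else ent C a))"
proof -
  note nb = norm_balls[OF C(2)]
  define w where "w = (if 0 \<le> pack u then u else vscale (-1) u)"
  have w: "w \<in> ivecs n" "Ball \<sigma> (\<rho> j) w" "pack w = \<bar>pack u\<bar>"
    using u Ball_neg by (auto simp: w_def pk_scale)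
  have sep: "\<not> Ball \<sigma> (\<delta> j) (vsub w v)" if v: "v \<in> combs C k" for v
  proof (cases "0 \<le> pack u")
    case True
    then show ?thesis using un v by (auto simp: covered_def w_def)
  next
    case False
    have "vsub w v = vscale (-1) (vsub u (vscale (-1) v))"
      using False by (simp add: w_def vsub_def vscale_def)
    then have eq: "vscale (-1) (vsub w v) = vsub u (vscale (-1) v)" by (simp add: vscale_def)
    show ?thesis
    proof
      assume "Ball \<sigma> (\<delta> j) (vsub w v)"
      from Ball_neg[OF this] have "Ball \<sigma> (\<delta> j) (vsub u (vscale (-1) v))" unfolding eq .
      then show False using un combs_neg[OF v] by (auto simp: covered_def)
    qed
  qed
  let ?C = "C @ [w]"
  have "listok \<sigma> j ?C"
  proof -
    have "norm_balls.separated (Ball \<sigma>) k (\<delta> j) ?C"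
      by (rule norm_balls.separated_snoc[OF nb]) (use C(1) sep in \<open>auto simp: listok_def\<close>)
    then show ?thesis using C(1) w by (auto simp: listok_def)
  qed
  moreover have "covered \<sigma> j ?C u"
  proof -
    have "u \<in> signed ?C" by (cases "0 \<le> pack u") (auto simp: signed_def w_def vscale_def)
    moreover have "vadd vzero u = u" by (simp add: vadd_def)
    ultimately have "u \<in> combs ?C 1" by force
    then have "u \<in> combs ?C k" using combs_mono[where k = 1 and m = k and C = ?C] k1(1) by blast
    moreover have "Ball \<sigma> (\<delta> j) (vsub u u)"
      using norm_balls.ball_zero[OF nb] by (simp add: vsub_def)
    ultimately show ?thesis by (auto simp: covered_def)
  qed
  moreover have "covered \<sigma> j ?C v" if "covered \<sigma> j C v" for v
  proof -
    have "combs C m \<subseteq> combs ?C m" for m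
    proof (induction m)
      case (Suc m)
      have "signed C \<subseteq> signed ?C" by (rule signed_mono) auto
      with Suc show ?case by (simp only: sumset.simps) blast
    qed simp
    then show ?thesis using that unfolding covered_def by blast
  qed
  moreover have "ent ?C a = (if a = length C then \<bar>pack u\<bar> else ent C a)" for a
    using w(3) by (auto simp: ent_def nth_append)
  ultimately show ?thesis by (intro exI[of _ ?C]) simp
qed

lemma cand_spec:
  assumes s: "I s" "params s" "stored s L" "lists_ok L N" "s rMc 0 = int M" "s rPw 0 = G ^ j" "s rR 0 = 2 ^ j"
      "s rS 0 = \<sigma>" "s rCz 0 = int (length C)" "\<And>a. s aZ a = ent C a" "s rII 0 = int t" "bestok s"
    and \<sigma>: "0 < \<sigma>" "\<sigma> \<le> s0" and j: "j < J" and C: "listok \<sigma> j C"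
    and M: "M \<ge> 1" "M \<le> Nb + 1" and t: "int t \<le> b"
  shows "wp I cand_body T_cand (\<lambda>s'. same cand_regs s s' \<and> bestok s' \<and>
    (cand L M j t \<noteq> vzero \<longrightarrow> lb s' (sq (cand L M j t))) \<and> (\<forall>y. lb s y \<longrightarrow> lb s' y) \<and>
    (\<exists>C'. s' rCz 0 = int (length C') \<and> (\<forall>a. s' aZ a = ent C' a) \<and> listok \<sigma> j C' \<and>
      (\<forall>v. covered \<sigma> j C v \<longrightarrow> covered \<sigma> j C' v) \<and>
      (Ball \<sigma> (\<rho> j) (cand L M j t) \<longrightarrow> covered \<sigma> j C' (cand L M j t)))) s"
    (is "wp I cand_body T_cand ?Q s")
proof -
  let ?X = "\<lambda>i. L (if i < k then Suc j else j)"
  let ?g = "2 ^ j - 2 ^ j div 2 :: int"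
  let ?d = "decode ?X M (2 * k) t"
  let ?u = "cand L M j t"
  note cp = cand_props(1-3)[OF s(4) j, of M t] cand_props(4)[OF s(4) j]
  have kb: "int (2 * k) \<le> b" using k1 b0 by simp
  have Gb: "0 + int (2 * k) * G \<le> b" "\<bar>pack ?d\<bar> + int n * G \<le> b"
  proof -
    have 1: "int k * G \<le> int n * G" using k1 G1 by (intro mult_right_mono) auto
    have 2: "(2 * int n + 4) * G = 2 * (int n * G) + 4 * G" by (simp add: algebra_simps)
    have 3: "int n * G \<ge> 0" using G1 by simp
    have 4: "int (2 * k) * G = 2 * (int k * G)" by simp
    show "0 + int (2 * k) * G \<le> b" using 1 2 4 b(2) G1 by linarith
    show "\<bar>pack ?d\<bar> + int n * G \<le> b" using 2 3 b(2) G1 pack_less[OF cp(3)] by linarith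
  qed
  have Mb: "int (2 * M) \<le> b" using power_bound[of M 1 1] M k1 by simp
  have ub: "\<bar>pack ?u\<bar> \<le> b" using pack_less[OF cp(2)] b0 by linarith
  show ?thesis
    unfolding cand_body_def
  proof (rule wp_seq')
    let ?R1 = "\<lambda>s'. same {rT, rV} s s' \<and> s' rT 0 = int t \<and> s' rV 0 = 0"
    show "wp I (Seq (Assign rT (Var rII)) (Assign rV (Const 0))) 3 ?R1 s"
      by (rule wp_vc[OF s(1)]) (use s t b0 in \<open>auto simp: state_simps lens_def\<close>)
    fix s1 assume s1: "I s1" "?R1 s1"
    have p1: "params s1" by (rule params_same[OF s(2)]) (use s1 in auto)
    show "wp I (Seq (For rI (Times (Const 2) (Var rK)) (dec_body rMc candE))
      (Seq (For rI cN grid_body) (Seq (Assign rU (Var rV)) (Seq norm_com (Seq best_com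
       (Cond (inball 321) (Seq chk_com insert_com) Skip))))))
      (T_dec (2 * k) + (T_grid + (1 + (T_norm + (5 + (T_chk + 6) + 1) + 1) + 1) + 1) + 1) ?Q s1"
    proof (rule wp_seq'[OF dec_spec[where t = t and u = vzero and M = M and X = ?X] _ order.refl])
      show "aval (Times (Const 2) (Var rK)) s' = int (2 * k)" if "same dec_regs s1 s'" for s'
        using same_reg[OF that, of rK 0] params_k[OF p1] by simp
      show "aval candE s' = ent (?X i) (d mod M)"
        if "same dec_regs s1 s'" "s' rI 0 = int i" "s' rA 0 = int d" for s' i d
      proof (rule candE_val[OF _ _ s(4) j])
        show "params s'" by (rule params_same[OF p1 that(1)]) simp
        show "stored s' L" using s(3) s1(2) that(1) by (simp add: stored_def same_def)
      qed (use that s(5,6) s1(2) in \<open>simp_all add: same_def\<close>)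
      show "\<bar>ent (?X i) a\<bar> \<le> G" for i a
        using ent_bounds[OF s(4), of "if i < k then Suc j else j" a] j by (simp add: less_imp_le)
      fix s2 assume s2: "I s2" "same dec_regs s1 s2 \<and> s2 rV 0 = pack (vadd vzero ?d) \<and> s2 rT 0 = int (t div (2 * M) ^ (2 * k))"
      have p2: "params s2" by (rule params_same[OF p1]) (use s2 in auto)
      have v2: "s2 rV 0 = pack ?d" using s2(2) by (simp add: vadd_def)
      have sm2: "same cand_regs s s2" using s1(2) s2(2) by (auto simp: same_def)
      show "wp I (Seq (For rI cN grid_body) (Seq (Assign rU (Var rV)) (Seq norm_com (Seq best_com
         (Cond (inball 321) (Seq chk_com insert_com) Skip)))))
        (T_grid + (1 + (T_norm + (5 + (T_chk + 6) + 1) + 1) + 1) + 1) ?Q s2"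
      proof (rule wp_seq'[OF grid_spec[where t = "t div (2 * M) ^ (2 * k)" and u = ?d and g = ?g] _ order.refl])
        show "s2 rR 0 - s2 rR 0 div 2 = ?g" using s(7) sm2 by (simp add: same_def)
        have "t div (2 * M) ^ (2 * k) \<le> t" by simp
        then show "int (t div (2 * M) ^ (2 * k)) \<le> b" using t by linarith
        fix s3 assume s3: "I s3" "same grid_regs s2 s3 \<and> s3 rV 0 = pack (vadd ?d (grid n ?g (t div (2 * M) ^ (2 * k))))"
        have p3: "params s3" by (rule params_same[OF p2]) (use s3 in auto)
        have v3: "s3 rV 0 = pack ?u" using s3(2) by (simp only: cand_def)
        have sm3: "same cand_regs s s3" using s3(2) sm2 by (auto simp: same_def)
        show "wp I (Seq (Assign rU (Var rV)) (Seq norm_com (Seq best_com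
            (Cond (inball 321) (Seq chk_com insert_com) Skip))))
          (1 + (T_norm + (5 + (T_chk + 6) + 1) + 1) + 1) ?Q s3"
        proof (rule wp_seq'[where R = "\<lambda>s'. same {rU} s3 s' \<and> s' rU 0 = pack ?u", OF _ _ order.refl])
          show "wp I (Assign rU (Var rV)) 1 (\<lambda>s'. same {rU} s3 s' \<and> s' rU 0 = pack ?u) s3"
            by (rule wp_vc[OF s3(1)]) (use v3 ub in \<open>auto simp: state_simps lens_def\<close>)
          fix s4 assume s4: "I s4" "same {rU} s3 s4 \<and> s4 rU 0 = pack ?u"
          have p4: "params s4" by (rule params_same[OF p3]) (use s4 in auto)
          have sm4: "same cand_regs s s4" using s4(2) sm3 by (auto simp: same_def)
          have v4: "s4 rV 0 = pack ?u" using s4(2) v3 by (simp add: same_def)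
          show "wp I (Seq norm_com (Seq best_com
              (Cond (inball 321) (Seq chk_com insert_com) Skip))) (T_norm + (5 + (T_chk + 6) + 1) + 1) ?Q s4"
          proof (rule wp_seq'[OF norm_spec[OF s4(1) p4 v4 cp(2)] _ order.refl])
            fix s5 assume s5: "I s5" "same norm_regs s4 s5 \<and> s5 rMx 0 = vmax ?u n \<and> s5 rSq 0 = sq ?u"
            have p5: "params s5" by (rule params_same[OF p4]) (use s5 in auto)
            have sm5: "same cand_regs s s5" using s5(2) sm4 by (auto simp: same_def)
            have core5: "s5 rBest = s rBest" "s5 rBu = s rBu" "s5 rCz = s rCz" "s5 aZ = s aZ" "s5 rU 0 = pack ?u"
              using s1(2) s2(2) s3(2) s4(2) s5(2) by (auto simp: same_def)
            have bo5: "bestok s5" using s(12) core5 by (simp add: bestok_def)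
            have lb5: "lb s5 y = lb s y" for y using core5 by (simp add: lb_def)
            have sqb: "\<bar>s5 rSq 0\<bar> \<le> b" using s5(1) by (simp add: inbounds_def)
            show "wp I (Seq best_com (Cond (inball 321) (Seq chk_com insert_com) Skip)) (5 + (T_chk + 6) + 1) ?Q s5"
            proof (rule wp_seq'[OF best_spec[OF s5(1) bo5 cp(1,2)] _ order.refl])
              fix s6 assume s6: "I s6" "same {rBest, rBu} s5 s6 \<and> bestok s6 \<and>
                (?u \<noteq> vzero \<longrightarrow> lb s6 (sq ?u)) \<and> (\<forall>y. lb s5 y \<longrightarrow> lb s6 y)"
              have p6: "params s6" by (rule params_same[OF p5]) (use s6 in auto)
              have sm6: "same cand_regs s s6" using s6(2) sm5 by (auto simp: same_def)
              have core6: "s6 rCz 0 = int (length C)" "\<And>a. s6 aZ a = ent C a" "s6 rU 0 = pack ?u"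
                  "s6 rR 0 = 2 ^ j" "s6 rS 0 = \<sigma>" "s6 rMx 0 = vmax ?u n" "s6 rSq 0 = sq ?u"
                using s6(2) core5 sm6 s5(2) s(7-10) by (auto simp: same_def)
              have inb: "aval (inball 321) s6 \<noteq> 0 \<longleftrightarrow> Ball \<sigma> (\<rho> j) ?u"
              proof -
                have "aval (inball 321) s6 \<noteq> 0 \<longleftrightarrow> Ball \<sigma> (of_int (321 * 2 ^ j) / 256) ?u"
                  by (rule inball_iff) (use core6 \<sigma> in auto)
                then show ?thesis by (simp add: \<rho>_def)
              qed
              show "wp I (Cond (inball 321) (Seq chk_com insert_com) Skip) (T_chk + 6) ?Q s6"
              proof (rule wp_cond[where ?T1.0 = "T_chk + 5"])
                assume "aval (inball 321) s6 = 0"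
                then have "\<not> Ball \<sigma> (\<rho> j) ?u" using inb by simp
                then show "wp I Skip (T_chk + 5) ?Q s6"
                  using s6 sm6 lb5 core6 C by (intro wp_skip) auto
              next
                assume "aval (inball 321) s6 \<noteq> 0"
                then have B: "Ball \<sigma> (\<rho> j) ?u" using inb by simp
                show "wp I (Seq chk_com insert_com) (T_chk + 5) ?Q s6"
                proof (rule wp_seq'[OF chk_spec[OF s6(1) p6 core6(3,1,2,4,5) \<sigma> j C B]])
                  fix s7 assume s7: "I s7" "same chk_regs s6 s7 \<and> (s7 rCov 0 \<noteq> 0 \<longleftrightarrow> covered \<sigma> j C ?u)"
                  have sm7: "same cand_regs s s7" using s7(2) sm6 by (auto simp: same_def)
                  have core7: "s7 rCz 0 = int (length C)" "\<And>a. s7 aZ a = ent C a" "s7 rU 0 = pack ?u"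
                      "s7 rBest = s6 rBest" "s7 rBu = s6 rBu"
                    using core6 s7(2) by (auto simp: same_def)
                  have bo7: "bestok s7" using s6(2) core7 by (simp add: bestok_def)
                  have lb7: "lb s7 y = lb s6 y" for y using core7 by (simp add: lb_def)
                  show "wp I insert_com 4 ?Q s7"
                  proof (rule wp_vc[OF s7(1)])
                    show "vc b (lens n Nb) insert_com ?Q s7"
                    proof (cases "covered \<sigma> j C ?u")
                      case True
                      then show ?thesis using s7(2) sm7 bo7 lb7 s6(2) lb5 core7 C
                        unfolding insert_com_def vc.simps aval.simps by auto
                    next
                      case False
                      obtain C' where C': "listok \<sigma> j C'" "length C' = Suc (length C)" "covered \<sigma> j C' ?u"
                          "\<forall>v. covered \<sigma> j C v \<longrightarrow> covered \<sigma> j C' v"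
                          "\<forall>a. ent C' a = (if a = length C then \<bar>pack ?u\<bar> else ent C a)"
                        using listok_add[OF C \<sigma>(1) cp(1) B False] by blast
                      have len: "Suc (length C) \<le> Nb" using listok_length[OF \<sigma>(1) C'(1)] C'(2) by simp
                      have lenb: "1 + int (length C) \<le> b"
                        using power_bound[of "Suc (length C)" 1 1] len k1 by simp
                      let ?s8 = "store_at (store_at s7 aZ (int (length C)) \<bar>pack ?u\<bar>) rCz 0 (1 + int (length C))"
                      have "?Q ?s8"
                      proof (intro conjI exI[of _ C'])
                        show "same cand_regs s ?s8" using sm7 by (simp add: same_store)
                        show "bestok ?s8" using bo7 by (simp add: bestok_def state_simps)
                        show "?u \<noteq> vzero \<longrightarrow> lb ?s8 (sq ?u)" "\<forall>y. lb s y \<longrightarrow> lb ?s8 y"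
                          using s6(2) lb7 lb5 by (auto simp: lb_def state_simps)
                        show "\<forall>a. ?s8 aZ a = ent C' a" using C'(5) core7(2) by (simp add: state_simps)
                      qed (use C' in \<open>auto simp: state_simps\<close>)
                      then show ?thesis using False s7(2) core7 ub len lenb
                        unfolding insert_com_def by (simp add: lens_def state_simps add.commute)
                    qed
                  qed (simp add: insert_com_def)
                qed simp
              qed (use s6(1) in simp_all)
            qed (use core5 s5 sqb in auto)
          qed
        qed
      qed (use s2 p2 v2 cp(4) Gb in auto)
    qed (use s1 s(5) M Gb Mb t kb in \<open>auto simp: same_def\<close>)
  qed (simp add: T_cand_def)
qed

definition "CN = (2 * (Nb + 1)) ^ (2 * k)"

lemma stored_less:
  assumes "lists_ok L N"
  shows "0 \<le> enc G (\<lambda>p. ent (L p) a) (Suc J)" "enc G (\<lambda>p. ent (L p) a) (Suc J) \<le> b"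
proof -
  show "0 \<le> enc G (\<lambda>p. ent (L p) a) (Suc J)"
    using ent_bounds[OF assms] G1 by (intro enc_nonneg) auto
  have "enc G (\<lambda>p. ent (L p) a) (Suc J) < G ^ Suc J"
    using ent_bounds[OF assms] G1 by (intro enc_less) auto
  then show "enc G (\<lambda>p. ent (L p) a) (Suc J) \<le> b" using b(3) by simp
qed

lemma ent_upd: "(\<lambda>p. ent ((L(q := C)) p) a) = (\<lambda>p. ent (L p) a)(q := ent C a)"
  by auto

definition "T_wb = Nb * 7 + (3::nat)"

lemma wb_spec:
  assumes s: "I s" "params s" "stored s L" "s rNm 0 = int N" "\<And>a. s aZ a = ent C a" "s rPw 0 = G ^ j"
    and L: "lists_ok L N" "lists_ok (L(Suc j := C)) N" and j: "j < J"
  shows "wp I (For rI (Var rNm) wb_body) T_wb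
    (\<lambda>s'. same {aW, aZ, rI} s s' \<and> stored s' (L(Suc j := C)) \<and> (\<forall>a. s' aZ a = 0)) s"
proof -
  let ?L = "L(Suc j := C)"
  let ?e = "\<lambda>L a. enc G (\<lambda>p. ent (L p) a) (Suc J)"
  let ?V = "\<lambda>i s'. i \<le> N \<and> same {aW, aZ, rI} s s' \<and> s' rI 0 = int i \<and>
    (\<forall>a. s' aW a = (if a < i then ?e ?L a else ?e L a)) \<and>
    (\<forall>a. s' aZ a = (if a < i then 0 else ent C a))"
  have NN: "N \<le> Nb" using L(1) by (simp add: lists_ok_def)
  have lenC: "length C \<le> N" using L(2) j by (auto simp: lists_ok_def dest: spec[of _ "Suc j"])
  have lenL: "length (L (Suc j)) \<le> N" using L(1) j by (simp add: lists_ok_def)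
  have upd: "?e ?L a = ?e L a + (ent C a - ent (L (Suc j)) a) * (G ^ j * G)" for a
    unfolding ent_upd using j by (subst enc_upd) (simp_all add: mult.commute)
  have T: "N * (3 + 4) + 3 \<le> T_wb" using NN by (simp add: T_wb_def)
  show ?thesis
  proof (rule for_rule[where V = ?V and N = N and ?T1.0 = 3, OF s(1) _ _ _ _ _ _ _ _ T])
    show "int N \<le> b" using power_bound[of N 1 1] NN k1 by simp
    show "?V 0 (store_at s rI 0 0)" using s(3,5) by (simp add: state_simps stored_def)
    show "aval (Var rNm) s' = int N" if "?V i s'" for i s'
    proof -
      have "same {aW, aZ, rI} s s'" using that by blast
      from same_reg[OF this, of rNm 0] s(4) show ?thesis by simp
    qed
    show "wp I wb_body 3 (\<lambda>s'. s' rI 0 = int i \<and> ?V (Suc i) (store_at s' rI 0 (int (Suc i)))) s1"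
      if i: "i < N" and V: "?V i s1" and I1: "I s1" for i s1
    proof (rule wp_vc[OF I1])
      have V': "same {aW, aZ, rI} s s1" "s1 rI 0 = int i" "\<And>a. s1 aW a = (if a < i then ?e ?L a else ?e L a)"
          "\<And>a. s1 aZ a = (if a < i then 0 else ent C a)" using V by blast+
      have p1: "params s1" by (rule params_same[OF s(2) V'(1)]) simp
      have Pw: "s1 rPw 0 = G ^ j" using same_reg[OF V'(1), of rPw 0] s(6) by simp
      have GG: "s1 rG 0 = G" using p1 by (simp add: params_def)
      have dig: "?e L i div (G ^ j * G) mod G = ent (L (Suc j)) i"
        using enc_digit[of "Suc J" "\<lambda>p. ent (L p) i" G "Suc j"] ent_bounds[OF L(1)] G1 j
        by (simp add: mult.commute)
      have a1: "aval (Plus (Cell aW (Var rI)) (Times (Minus (Cell aZ (Var rI))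
          (digE (Var rI) (Times (Var rPw) (Var rG)))) (Times (Var rPw) (Var rG)))) s1 = ?e ?L i"
        unfolding digE_def aval.simps using V'(2-4) Pw GG dig upd[of i] by simp
      have bd: "\<bar>?e ?L i\<bar> \<le> b" using stored_less[OF L(2), of i] by simp
      have iN: "i < Nb + 1" using i NN by simp
      obtain s2 where s2: "s2 = store_at (store_at s1 aW (int i) (?e ?L i)) aZ (int i) 0" by blast
      have V2: "s2 rI 0 = int i" "same {aW, aZ, rI} s s2"
        using V'(1,2) by (simp_all add: s2 state_simps)
      have W2: "s2 aW a = (if a < Suc i then ?e ?L a else ?e L a)" for a
        using V'(3)[of a] by (cases "a = i") (auto simp: s2 store_at_apply)
      have Z2: "s2 aZ a = (if a < Suc i then 0 else ent C a)" for a
        using V'(4)[of a] by (cases "a = i") (auto simp: s2 store_at_apply)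
      have fin: "?V (Suc i) (store_at s2 rI 0 (int (Suc i)))"
        using V2 W2 Z2 i by (simp add: state_simps del: of_nat_Suc)
      have v: "aval (Var rI) s1 = int i" "aval (Var rI) (store_at s1 aW (int i) y) = int i" for y
        using V'(2) by (simp_all add: store_at_apply)
      show "vc b (lens n Nb) wb_body (\<lambda>s'. s' rI 0 = int i \<and> ?V (Suc i) (store_at s' rI 0 (int (Suc i)))) s1"
        unfolding wb_body_def vc.simps a1 v aval.simps(1) s2[symmetric]
        using V2(1) fin bd b0(1) iN by (simp add: lens_def)
    qed (simp add: wb_body_def)
    show "same {aW, aZ, rI} s s' \<and> stored s' ?L \<and> (\<forall>a. s' aZ a = 0)" if "?V N s'" for s'
    proof -
      have V': "same {aW, aZ, rI} s s'" "\<And>a. s' aW a = (if a < N then ?e ?L a else ?e L a)"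
          "\<And>a. s' aZ a = (if a < N then 0 else ent C a)" using that by blast+
      \<comment> \<open>From \<open>N\<close> on both the old and the new list have ended, so the
        cells that the loop does not reach already hold the digit 0.\<close>
      have out: "ent C a = 0" "ent (L (Suc j)) a = 0" if "\<not> a < N" for a
        using that lenC lenL by (auto simp: ent_def)
      have "s' aW a = ?e ?L a" for a using V'(2)[of a] upd[of a] out[of a] by auto
      moreover have "s' aZ a = 0" for a using V'(3)[of a] out[of a] by auto
      ultimately show ?thesis using V'(1) by (simp add: stored_def)
    qed
  qed simp_all
qed

lemma cand_cong: "L (Suc j) = L' (Suc j) \<Longrightarrow> L j = L' j \<Longrightarrow> cand L M j t = cand L' M j t"
proof -
  assume "L (Suc j) = L' (Suc j)" "L j = L' j"
  then have "(\<lambda>i. L (if i < k then Suc j else j)) = (\<lambda>i. L' (if i < k then Suc j else j))" by auto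
  then show ?thesis by (simp only: cand_def)
qed

definition complete :: "int \<Rightarrow> (nat \<Rightarrow> (nat \<Rightarrow> int) list) \<Rightarrow> nat \<Rightarrow> nat \<Rightarrow> nat \<Rightarrow> (nat \<Rightarrow> int) list \<Rightarrow> bool" where
  "complete \<sigma> L M cnt j C \<longleftrightarrow> listok \<sigma> j C \<and>
     (\<forall>t<cnt. Ball \<sigma> (\<rho> j) (cand L M j t) \<longrightarrow> covered \<sigma> j C (cand L M j t))"

definition seen :: "state \<Rightarrow> (nat \<Rightarrow> (nat \<Rightarrow> int) list) \<Rightarrow> nat \<Rightarrow> nat \<Rightarrow> nat \<Rightarrow> bool" where
  "seen s L M cnt j \<longleftrightarrow> (\<forall>t<cnt. cand L M j t \<noteq> vzero \<longrightarrow> lb s (sq (cand L M j t)))"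

abbreviation "level_regs \<equiv> {rR, rPw, rNm, aW, rII} \<union> cand_regs"

definition "T_level = CN * (T_cand + 4) + T_wb + 20"

text \<open>\<open>L\<close> are the lists at the start of the build, which define the candidates.
  \<open>L'\<close> is what memory holds after the higher levels have been replaced. The two agree
  on the two levels that are read here.\<close>

lemma level_spec:
  assumes s: "I s" "params s" "stored s L'" "s rMc 0 = int M" "s rCnt 0 = int cnt" "s rPw 0 = G ^ Suc j"
      "s rR 0 = 2 ^ Suc j" "s rS 0 = \<sigma>" "\<And>a. s aZ a = 0" "bestok s" "s rNm 0 = int N"
    and L': "lists_ok L' N" "L' (Suc j) = L (Suc j)" "L' j = L j"
    and \<sigma>: "0 < \<sigma>" "\<sigma> \<le> s0" and j: "j < J"
    and M: "M \<ge> 1" "M \<le> Nb + 1" and cnt: "cnt \<le> CN" "int cnt \<le> b"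
  shows "wp I level_body T_level (\<lambda>s'. same level_regs s s' \<and> bestok s' \<and> seen s' L M cnt j \<and>
    (\<forall>y. lb s y \<longrightarrow> lb s' y) \<and> s' rPw 0 = G ^ j \<and> s' rR 0 = 2 ^ j \<and> (\<forall>a. s' aZ a = 0) \<and>
    (\<exists>C N'. N \<le> N' \<and> s' rNm 0 = int N' \<and> lists_ok (L'(Suc j := C)) N' \<and> stored s' (L'(Suc j := C)) \<and>
      complete \<sigma> L M cnt j C)) s"
    (is "wp I level_body T_level ?Q s")
proof -
  have cc: "cand L' M j t = cand L M j t" for t by (rule cand_cong) (use L' in auto)
  have Gj: "G ^ j \<le> b"
  proof -
    have "G ^ j \<le> G ^ (J + 1)" using j G1 by (intro power_increasing) auto
    then show ?thesis using b(3) by simp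
  qed
  have Gj0: "0 \<le> G ^ j" using G1 by simp
  have Rj: "(2::int) ^ j \<le> b"
  proof -
    have "(2::int) ^ j \<le> 2 ^ J" using j by (intro power_increasing) auto
    moreover have "(2::int) ^ J * 1 \<le> (4 * int n + 4) * 2 ^ J * s0 * 2"
    proof -
      have "(2::int) ^ J * 1 \<le> 2 ^ J * ((4 * int n + 4) * s0 * 2)"
      proof (rule mult_left_mono)
        have "1 * 1 \<le> (4 * int n + 4) * s0" using s0 by (intro mult_mono) auto
        then show "1 \<le> (4 * int n + 4) * s0 * 2" by linarith
      qed simp
      then show ?thesis by (simp add: mult_ac)
    qed
    moreover have "P \<le> b"
    proof -
      have "P ^ 1 \<le> P ^ (2 * n)" using P1 n1 by (intro power_increasing) auto
      then show ?thesis using b0(5) G by simp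
    qed
    ultimately show ?thesis using digits by linarith
  qed
  show ?thesis
    unfolding level_body_def
  proof (rule wp_seq')
    let ?R1 = "\<lambda>s'. same {rR, rPw, rCz} s s' \<and> s' rR 0 = 2 ^ j \<and> s' rPw 0 = G ^ j \<and> s' rCz 0 = 0"
    have G_ne: "G \<noteq> 0" using G1 by simp
    show "wp I (Seq (Assign rR (Div (Var rR) (Const 2))) (Seq (Assign rPw (Div (Var rPw) (Var rG))) (Assign rCz (Const 0)))) 5 ?R1 s"
      by (rule wp_vc[OF s(1)])
        (use s(2,6,7) Gj Gj0 Rj b0 G_ne in \<open>simp_all add: state_simps lens_def params_def\<close>)
    fix s1 assume s1: "I s1" "?R1 s1"
    have p1: "params s1" by (rule params_same[OF s(2) conjunct1[OF s1(2)]]) simp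
    let ?V = "\<lambda>t s'. t \<le> cnt \<and> same (insert rII cand_regs) s1 s' \<and> s' rII 0 = int t \<and> bestok s' \<and>
      (\<forall>y. lb s y \<longrightarrow> lb s' y) \<and> seen s' L M t j \<and>
      (\<exists>C. s' rCz 0 = int (length C) \<and> (\<forall>a. s' aZ a = ent C a) \<and> complete \<sigma> L M t j C)"
    show "wp I (Seq (For rII (Var rCnt) cand_body)
       (Seq (Cond (Less (Var rNm) (Var rCz)) (Assign rNm (Var rCz)) Skip) (For rI (Var rNm) wb_body)))
       (cnt * (T_cand + 4) + 3 + (2 + T_wb + 1) + 1) ?Q s1"
    proof (rule wp_seq'[where R = "?V cnt", OF _ _ order.refl])
      have noreg: "s1 rBest = s rBest" "s1 rBu = s rBu" "s1 aZ = s aZ" "s1 rCnt = s rCnt" "s1 rMc = s rMc"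
          "s1 rS = s rS" "s1 aW = s aW" "s1 rNm = s rNm"
        using s1(2) by (auto simp: same_def)
      show "wp I (For rII (Var rCnt) cand_body) (cnt * (T_cand + 4) + 3) (?V cnt) s1"
      proof (rule for_rule[where V = ?V and N = cnt and ?T1.0 = T_cand, OF s1(1) _ _ cnt(2)])
        let ?s = "store_at s1 rII 0 0"
        show "?V 0 ?s"
        proof (intro conjI exI[of _ "[]"])
          show "bestok ?s" using s(10) noreg by (simp add: bestok_def state_simps)
          show "\<forall>y. lb s y \<longrightarrow> lb ?s y" using noreg by (simp add: lb_def state_simps)
          show "complete \<sigma> L M 0 j []"
            using norm_balls.separated_Nil[OF norm_balls[OF \<sigma>(1)]] by (simp add: complete_def listok_def)
          show "\<forall>a. ?s aZ a = ent [] a" using s(9) noreg by (simp add: ent_def state_simps)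
        qed (use s1(2) in \<open>simp_all add: state_simps seen_def\<close>)
        show "aval (Var rCnt) s' = int cnt" if V: "?V t s'" for t s'
        proof -
          have "same (insert rII cand_regs) s1 s'" using V by blast
          from same_reg[OF this, of rCnt 0] s(5) noreg show ?thesis by simp
        qed
        show "wp I cand_body T_cand (\<lambda>s'. s' rII 0 = int t \<and> ?V (Suc t) (store_at s' rII 0 (int (Suc t)))) s2"
          if t: "t < cnt" and V: "?V t s2" and I2: "I s2" for t s2
        proof -
          have V': "same (insert rII cand_regs) s1 s2" "s2 rII 0 = int t" "bestok s2"
            "\<And>y. lb s y \<Longrightarrow> lb s2 y" "seen s2 L M t j" using V by blast+
          obtain C where C: "s2 rCz 0 = int (length C)" "\<And>a. s2 aZ a = ent C a" "complete \<sigma> L M t j C"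
            using V by blast
          have p2: "params s2" by (rule params_same[OF p1 V'(1)]) simp
          have regs: "s2 aW a = s aW a" "s2 rMc 0 = int M" "s2 rPw 0 = G ^ j" "s2 rR 0 = 2 ^ j" "s2 rS 0 = \<sigma>" for a
            using same_reg[OF V'(1), of aW a] same_reg[OF V'(1), of rMc 0] same_reg[OF V'(1), of rPw 0]
              same_reg[OF V'(1), of rR 0] same_reg[OF V'(1), of rS 0] noreg s(4,8) s1(2) by simp_all
          have st2: "stored s2 L'" using s(3) regs(1) by (simp add: stored_def)
          have lC: "listok \<sigma> j C" using C(3) by (simp add: complete_def)
          have tb: "int t \<le> b" using t cnt(2) by linarith
          show ?thesis
          proof (rule wp_mono[OF cand_spec[OF I2 p2 st2 L'(1) regs(2-5) C(1,2) V'(2,3) \<sigma> j lC M tb] order.refl])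
            fix s3 assume s3: "I s3" and Q: "same cand_regs s2 s3 \<and> bestok s3 \<and>
              (cand L' M j t \<noteq> vzero \<longrightarrow> lb s3 (sq (cand L' M j t))) \<and> (\<forall>y. lb s2 y \<longrightarrow> lb s3 y) \<and>
              (\<exists>C'. s3 rCz 0 = int (length C') \<and> (\<forall>a. s3 aZ a = ent C' a) \<and> listok \<sigma> j C' \<and>
                (\<forall>v. covered \<sigma> j C v \<longrightarrow> covered \<sigma> j C' v) \<and>
                (Ball \<sigma> (\<rho> j) (cand L' M j t) \<longrightarrow> covered \<sigma> j C' (cand L' M j t)))"
            have sm3: "same cand_regs s2 s3" using Q by blast
            obtain C' where C': "s3 rCz 0 = int (length C')" "\<And>a. s3 aZ a = ent C' a" "listok \<sigma> j C'"
              "\<And>v. covered \<sigma> j C v \<Longrightarrow> covered \<sigma> j C' v"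
              "Ball \<sigma> (\<rho> j) (cand L' M j t) \<Longrightarrow> covered \<sigma> j C' (cand L' M j t)" using Q by blast
            let ?s = "store_at s3 rII 0 (int (Suc t))"
            have lb': "lb ?s y = lb s3 y" for y by (simp add: lb_def store_at_apply)
            have "?V (Suc t) ?s"
            proof (intro conjI exI[of _ C'])
              show "same (insert rII cand_regs) s1 ?s"
                by (rule same_store[OF same_trans[OF V'(1) sm3]]) auto
              show "bestok ?s" using Q by (simp add: bestok_def store_at_apply)
              show "\<forall>y. lb s y \<longrightarrow> lb ?s y" using V'(4) Q unfolding lb' by blast
              show "seen ?s L M (Suc t) j"
                using V'(5) Q unfolding seen_def lb' cc by (auto simp: less_Suc_eq)
              show "complete \<sigma> L M (Suc t) j C'"
                using C(3) C'(3-5) unfolding complete_def cc by (auto simp: less_Suc_eq)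
            qed (use t C' in \<open>simp_all add: store_at_apply\<close>)
            moreover have "s3 rII 0 = int t" using same_reg[OF sm3, of rII 0] V'(2) by simp
            ultimately show "s3 rII 0 = int t \<and> ?V (Suc t) ?s" by blast
          qed
        qed
        show "?V cnt s'" if "?V cnt s'" for s' using that .
      qed simp_all
      fix s4 assume s4: "I s4" "?V cnt s4"
      have V': "same (insert rII cand_regs) s1 s4" "bestok s4" "\<And>y. lb s y \<Longrightarrow> lb s4 y" "seen s4 L M cnt j"
        using s4(2) by blast+
      obtain C where C: "s4 rCz 0 = int (length C)" "\<And>a. s4 aZ a = ent C a" "complete \<sigma> L M cnt j C"
        using s4(2) by blast
      have p4: "params s4" by (rule params_same[OF p1 V'(1)]) simp
      have regs: "s4 aW a = s aW a" "s4 rNm 0 = int N" "s4 rPw 0 = G ^ j" "s4 rR 0 = 2 ^ j" for a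
        using same_reg[OF V'(1), of aW a] same_reg[OF V'(1), of rNm 0] same_reg[OF V'(1), of rPw 0]
          same_reg[OF V'(1), of rR 0] noreg s(11) s1(2) by simp_all
      have lC: "listok \<sigma> j C" using C(3) by (simp add: complete_def)
      have lenC: "length C \<le> Nb" by (rule listok_length[OF \<sigma>(1) lC])
      define N' where "N' = max N (length C)"
      have lo: "lists_ok L' N'" "lists_ok (L'(Suc j := C)) N'"
      proof -
        show 1: "lists_ok L' N'" using L'(1) lenC unfolding lists_ok_def N'_def by fastforce
        have "c \<in> ivecs n \<and> Ball s0 (2 * 2 ^ J) c \<and> 0 \<le> pack c" if c: "c \<in> set C" for c
        proof -
          have "c \<in> ivecs n" "Ball \<sigma> (\<rho> j) c" "0 \<le> pack c" using lC c by (auto simp: listok_def)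
          moreover have "Ball s0 (2 * 2 ^ J) c"
          proof (rule norm_balls.ball_mono[OF nb0 Ball_inc[OF \<open>Ball \<sigma> (\<rho> j) c\<close> \<sigma>(2)]])
            have "\<rho> j \<le> 2 ^ J" by (rule \<rho>_le[OF j])
            moreover have "(0::real) \<le> 2 ^ J" by simp
            ultimately show "\<rho> j \<le> 2 * 2 ^ J" by linarith
          qed simp
          ultimately show ?thesis by blast
        qed
        then show "lists_ok (L'(Suc j := C)) N'" using 1 unfolding lists_ok_def N'_def by auto
      qed
      have N'b: "int (length C) \<le> b" using power_bound[of "length C" 1 1] lenC k1 by simp
      show "wp I (Seq (Cond (Less (Var rNm) (Var rCz)) (Assign rNm (Var rCz)) Skip) (For rI (Var rNm) wb_body))
        (2 + T_wb + 1) ?Q s4"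
      proof (rule wp_seq'[where R = "\<lambda>s'. same {rNm} s4 s' \<and> s' rNm 0 = int N'", OF _ _ order.refl])
        show "wp I (Cond (Less (Var rNm) (Var rCz)) (Assign rNm (Var rCz)) Skip) 2 (\<lambda>s'. same {rNm} s4 s' \<and> s' rNm 0 = int N') s4"
          by (rule wp_vc[OF s4(1)]) (use C(1) regs(2) N'b in \<open>auto simp: state_simps lens_def N'_def\<close>)
        fix s5 assume s5: "I s5" "same {rNm} s4 s5 \<and> s5 rNm 0 = int N'"
        have sm5: "same {rNm} s4 s5" using s5(2) by blast
        have p5: "params s5" by (rule params_same[OF p4 sm5]) simp
        have st5: "stored s5 L'" using s(3) same_reg[OF sm5, of aW] regs(1) by (simp add: stored_def)
        have Z5: "s5 aZ a = ent C a" for a using same_reg[OF sm5, of aZ a] C(2) by simp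
        have Pw5: "s5 rPw 0 = G ^ j" using same_reg[OF sm5, of rPw 0] regs(3) by simp
        show "wp I (For rI (Var rNm) wb_body) T_wb ?Q s5"
        proof (rule wp_mono[OF wb_spec[OF s5(1) p5 st5 conjunct2[OF s5(2)] Z5 Pw5 lo j] order.refl])
          fix s6 assume "I s6" and Q: "same {aW, aZ, rI} s5 s6 \<and> stored s6 (L'(Suc j := C)) \<and> (\<forall>a. s6 aZ a = 0)"
          have sm6: "same {aW, aZ, rI} s5 s6" using Q by blast
          have eq6: "s6 a i = s4 a i" if "a \<notin> {aW, aZ, rI, rNm}" for a i
            using same_reg[OF sm6, of a i] same_reg[OF sm5, of a i] that by simp
          have lb6: "lb s6 y = lb s4 y" for y by (simp add: lb_def eq6)
          have "same level_regs s s6"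
          proof -
            have 1: "same {rR, rPw, rCz} s s1" using s1(2) by blast
            have 2: "same ({rR, rPw} \<union> insert rII cand_regs) s s4" by (rule same_trans[OF 1 V'(1)]) auto
            have 3: "same ({rR, rPw, rNm} \<union> insert rII cand_regs) s s5" by (rule same_trans[OF 2 sm5]) auto
            show ?thesis by (rule same_trans[OF 3 sm6]) auto
          qed
          moreover have "bestok s6" using V'(2) by (simp add: bestok_def eq6)
          moreover have "seen s6 L M cnt j" using V'(4) unfolding seen_def lb6 .
          moreover have "\<forall>y. lb s y \<longrightarrow> lb s6 y" using V'(3) unfolding lb6 by blast
          moreover have "s6 rPw 0 = G ^ j" "s6 rR 0 = 2 ^ j" using regs(3,4) by (simp_all add: eq6)
          moreover have "s6 rNm 0 = int N'"
            using same_reg[OF sm6, of rNm 0] s5(2) by simp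
          moreover have "N \<le> N'" by (simp add: N'_def)
          ultimately show "?Q s6" using Q lo(2) C(3) by blast
        qed
      qed
    qed
  next
    have "cnt * (T_cand + 4) \<le> CN * (T_cand + 4)" using cnt(1) by (rule mult_le_mono1)
    then show "5 + (cnt * (T_cand + 4) + 3 + (2 + T_wb + 1) + 1) + 1 \<le> T_level"
      unfolding T_level_def by linarith
  qed
qed

end

text \<open>
  The first build starts from empty lists and lives on the grid points; the others use the tuples only,
  hence \<open>rC5 = 1\<close>. The last one serves to enumerate the tuples of the final lists.
\<close>

definition sieve_com :: com where
  "sieve_com = Seq build (Seq (Assign rC5 (Const 1))
     (Seq (While (Less (Const 64) (Var rS)) (Seq (Assign rS (Minus (Var rS) (Div (Var rS) (Const 65)))) build)) build))"

section \<open>Lists that cover all balls, and the candidates they make available\<close>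

lemma sumset_cong: "(\<And>i. i < m \<Longrightarrow> X i = Y i) \<Longrightarrow> sumset X m = sumset Y m"
  by (induction m) auto

lemma sumset_append:
  "u \<in> sumset X k \<Longrightarrow> v \<in> sumset (\<lambda>i. X (k + i)) m \<Longrightarrow> vadd u v \<in> sumset X (k + m)"
proof (induction m arbitrary: v)
  case 0
  then show ?case by (simp add: vadd_def)
next
  case (Suc m)
  then obtain w e where w: "v = vadd w e" "w \<in> sumset (\<lambda>i. X (k + i)) m" "e \<in> X (k + m)" by auto
  have "vadd u v = vadd (vadd u w) e" by (simp add: w(1) vadd_def add.assoc)
  then show ?case using Suc.IH[OF Suc.prems(1) w(2)] w(3) by auto
qed

lemma vzero_sumset: "vzero \<in> sumset (\<lambda>i. signed (X i)) m"
proof (induction m)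
  case (Suc m)
  have "vzero = vadd vzero vzero" by (simp add: vadd_def)
  moreover have "vzero \<in> signed (X m)" by (simp add: signed_def)
  ultimately show ?case using Suc by auto
qed simp

context sieve
begin

definition cover :: "int \<Rightarrow> (nat \<Rightarrow> (nat \<Rightarrow> int) list) \<Rightarrow> bool" where
  "cover \<sigma> L \<longleftrightarrow> (\<forall>j<J. \<forall>w\<in>ivecs n. Ball \<sigma> (2 ^ j) w \<longrightarrow>
     (\<exists>v\<in>combs (L (Suc j)) k. Ball \<sigma> (2 ^ j / 2) (vsub w v)))"

definition dense :: "int \<Rightarrow> (nat \<Rightarrow> (nat \<Rightarrow> int) list) \<Rightarrow> nat \<Rightarrow> nat \<Rightarrow> bool" where
  "dense \<sigma> L M cnt \<longleftrightarrow> (\<forall>j<J. \<forall>w\<in>ivecs n. Ball \<sigma> (2 ^ j) w \<longrightarrow>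
     (\<exists>t<cnt. Ball \<sigma> (65/256 * 2 ^ j) (vsub w (cand L M j t))))"

lemma complete_cover:
  assumes "\<And>j. j < J \<Longrightarrow> complete \<sigma> L M cnt j (L' (Suc j))" "dense \<sigma> L M cnt" "\<sigma> > 0"
  shows "cover \<sigma> L'"
  unfolding cover_def
proof (intro allI impI ballI)
  fix j w assume j: "j < J" and w: "w \<in> ivecs n" "Ball \<sigma> (2 ^ j) w"
  note nb = norm_balls[OF assms(3)]
  obtain t where t: "t < cnt" "Ball \<sigma> (65/256 * 2 ^ j) (vsub w (cand L M j t))"
    using assms(2) j w unfolding dense_def by blast
  let ?u = "cand L M j t"
  have "Ball \<sigma> (2 ^ j + 65/256 * 2 ^ j) (vsub w (vsub w ?u))"
    by (rule norm_balls.ball_sub[OF nb w(2) t(2)])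
  moreover have "vsub w (vsub w ?u) = ?u" by (simp add: vsub_def)
  moreover have "2 ^ j + 65/256 * 2 ^ j = \<rho> j" by (simp add: \<rho>_def)
  ultimately have "Ball \<sigma> (\<rho> j) ?u" by simp
  then obtain v where v: "v \<in> combs (L' (Suc j)) k" "Ball \<sigma> (\<delta> j) (vsub ?u v)"
    using assms(1)[OF j] t(1) unfolding complete_def covered_def by blast
  have "Ball \<sigma> (65/256 * 2 ^ j + \<delta> j) (vadd (vsub w ?u) (vsub ?u v))"
    by (rule norm_balls.ball_add[OF nb t(2) v(2)])
  moreover have "vadd (vsub w ?u) (vsub ?u v) = vsub w v" by (simp add: vadd_def vsub_def)
  moreover have "65/256 * 2 ^ j + \<delta> j = 2 ^ j / 2" by (simp add: \<delta>_def)
  ultimately have "Ball \<sigma> (2 ^ j / 2) (vsub w v)" by (simp only:)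
  then show "\<exists>v\<in>combs (L' (Suc j)) k. Ball \<sigma> (2 ^ j / 2) (vsub w v)" using v(1) by blast
qed

lemma Ball_half: "Ball \<sigma> (1/2) u \<Longrightarrow> u \<in> ivecs n \<Longrightarrow> u = vzero"
proof
  fix i assume B: "Ball \<sigma> (1/2) u" "u \<in> ivecs n"
  show "u i = 0"
  proof (cases "i < n")
    case True
    then have "\<bar>real_of_int (u i)\<bar> \<le> 1/2" using B(1) by (simp add: Ball_def)
    then show ?thesis by linarith
  qed (use B(2) in \<open>simp add: ivecs_def\<close>)
qed

lemma combs_ivecs: "(\<And>c. c \<in> set C \<Longrightarrow> c \<in> ivecs n) \<Longrightarrow> v \<in> combs C m \<Longrightarrow> v \<in> ivecs n"
proof (induction m arbitrary: v)
  case (Suc m)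
  then obtain u e where "v = vadd u e" "u \<in> combs C m" "e \<in> signed C" by auto
  moreover have "e \<in> ivecs n" using \<open>e \<in> signed C\<close> Suc.prems(1) by (auto simp: signed_def)
  ultimately show ?case using Suc.IH[OF Suc.prems(1)] by simp
qed simp

lemma cand_combs:
  assumes "v0 \<in> combs (L (Suc j)) k" "v1 \<in> combs (L j) k" "lists_ok L N" "j < J"
  shows "\<exists>t<(2 * (N + 1)) ^ (2 * k). cand L (N + 1) j t = vadd v0 v1"
proof -
  let ?X = "\<lambda>i. L (if i < k then Suc j else j)"
  have 0: "v0 \<in> sumset (\<lambda>i. signed (?X i)) k"
    using assms(1) sumset_cong[of k "\<lambda>i. signed (?X i)" "\<lambda>_. signed (L (Suc j))"] by simp
  have 1: "v1 \<in> sumset (\<lambda>i. signed (?X (k + i))) k"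
    using assms(2) by simp
  have "vadd v0 v1 \<in> sumset (\<lambda>i. signed (?X i)) (k + k)" by (rule sumset_append[OF 0 1])
  then have e: "vadd v0 v1 \<in> sumset (\<lambda>i. signed (?X i)) (2 * k)" by (simp only: mult_2)
  have "length (?X i) < N + 1" for i
  proof -
    have "(if i < k then Suc j else j) \<le> J" using assms(4) by simp
    then have "length (?X i) \<le> N" using assms(3) unfolding lists_ok_def by blast
    then show ?thesis by simp
  qed
  then obtain t where t: "t < (2 * (N + 1)) ^ (2 * k)"
      "\<And>t'. decode ?X (N + 1) (2 * k) (t + t' * (2 * (N + 1)) ^ (2 * k)) = vadd v0 v1"
    using decode_surj[OF e, of "N + 1"] by (metis le_add2)
  have "decode ?X (N + 1) (2 * k) t = vadd v0 v1" using t(2)[of 0] by (simp only: mult_0 add_0_right)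
  moreover have "t div (2 * (N + 1)) ^ (2 * k) = 0" by (rule div_less[OF t(1)])
  ultimately have "cand L (N + 1) j t = vadd (vadd v0 v1) (grid n (2 ^ j - 2 ^ j div 2) 0)"
    unfolding cand_def by (simp only:)
  then have "cand L (N + 1) j t = vadd v0 v1" by (simp add: grid_0) (simp add: vadd_def)
  with t(1) show ?thesis by blast
qed

text \<open>A tuple of level \<open>j\<close> leaves an error of norm \<open>2 ^ j / 2\<close>, the
  radius of the level below, and a tuple from there halves it again. At level 0 the first error has
  norm at most 1/2 and hence is zero, so the empty list below it suffices. Changing
  \<open>\<sigma>\<close> affects only the image part of the norm.\<close>

lemma cover_dense:
  assumes cov: "cover \<sigma> L" and L: "lists_ok L N" "L 0 = []"
    and \<sigma>: "0 < \<sigma>'" "\<sigma>' \<le> \<sigma>" "64 * \<sigma> \<le> 65 * \<sigma>'"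
  shows "dense \<sigma>' L (N + 1) (1 * (2 * (N + 1)) ^ (2 * k))"
  unfolding dense_def
proof (intro allI impI ballI)
  fix j w assume j: "j < J" and w: "w \<in> ivecs n" "Ball \<sigma>' (2 ^ j) w"
  have \<sigma>0: "0 < \<sigma>" using \<sigma> by linarith
  note nb = norm_balls[OF \<sigma>0]
  have wB: "Ball \<sigma> (2 ^ j) w" by (rule Ball_inc[OF w(2) \<sigma>(2)]) simp
  obtain v0 where v0: "v0 \<in> combs (L (Suc j)) k" "Ball \<sigma> (2 ^ j / 2) (vsub w v0)"
    using cov j w(1) wB unfolding cover_def by blast
  have v0i: "v0 \<in> ivecs n"
    by (rule combs_ivecs[OF _ v0(1)]) (use L(1) Suc_leI[OF j] in \<open>unfold lists_ok_def, blast\<close>)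
  have "\<exists>v1\<in>combs (L j) k. Ball \<sigma> (2 ^ j / 4) (vsub w (vadd v0 v1))"
  proof (cases j)
    case 0
    have "vsub w v0 = vzero" by (rule Ball_half) (use v0(2) v0i w(1) 0 in simp_all)
    then have "vsub w (vadd v0 vzero) = vzero" by (simp add: vsub_def vadd_def fun_eq_iff)
    then show ?thesis using vzero_sumset[of "\<lambda>_. L j" k] norm_balls.ball_zero[OF nb, of "2 ^ j / 4"]
      by (intro bexI[of _ vzero]) simp_all
  next
    case (Suc i)
    have "Ball \<sigma> (2 ^ i) (vsub w v0)" using v0(2) Suc by simp
    then obtain v1 where v1: "v1 \<in> combs (L (Suc i)) k" "Ball \<sigma> (2 ^ i / 2) (vsub (vsub w v0) v1)"
      using cov j Suc w(1) v0i unfolding cover_def by (metis Suc_lessD ivecs_simps(3))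
    moreover have "vsub (vsub w v0) v1 = vsub w (vadd v0 v1)" by (simp add: vsub_def vadd_def algebra_simps)
    ultimately show ?thesis using Suc by (intro bexI[of _ v1]) simp_all
  qed
  then obtain v1 where v1: "v1 \<in> combs (L j) k" "Ball \<sigma> (2 ^ j / 4) (vsub w (vadd v0 v1))" by blast
  obtain t where t: "t < (2 * (N + 1)) ^ (2 * k)" "cand L (N + 1) j t = vadd v0 v1"
    using cand_combs[OF v0(1) v1(1) L(1) j] by blast
  have "Ball \<sigma>' (65/256 * 2 ^ j) (vsub w (vadd v0 v1))"
    unfolding Ball_def
  proof (intro conjI allI impI)
    let ?x = "vsub w (vadd v0 v1)"
    fix i assume "i < n"
    then have "\<bar>real_of_int (?x i)\<bar> \<le> 2 ^ j / 4" using v1(2) by (simp add: Ball_def)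
    also have "\<dots> \<le> 65/256 * 2 ^ j" by simp
    finally show "\<bar>real_of_int (?x i)\<bar> \<le> 65/256 * 2 ^ j" .
  next
    let ?x = "vsub w (vadd v0 v1)"
    have "L2_set (\<lambda>r. real_of_int (image n A ?x r)) {..<n} \<le> 2 ^ j / 4 * of_int \<sigma>"
      using v1(2) by (simp add: Ball_def)
    also have "\<dots> = 2 ^ j / 256 * of_int (64 * \<sigma>)" by simp
    also have "\<dots> \<le> 2 ^ j / 256 * of_int (65 * \<sigma>')"
      by (intro mult_left_mono) (use \<sigma>(3) in \<open>simp_all only: of_int_le_iff\<close>, simp)
    finally show "L2_set (\<lambda>r. real_of_int (image n A ?x r)) {..<n} \<le> 65/256 * 2 ^ j * of_int \<sigma>'" by simp
  qed
  then show "\<exists>t<1 * (2 * (N + 1)) ^ (2 * k). Ball \<sigma>' (65/256 * 2 ^ j) (vsub w (cand L (N + 1) j t))"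
    using t by (intro exI[of _ t]) (simp only: mult_1 simp_thms)
qed

text \<open>For \<open>j \<le> 1\<close> the spacing is 1 and nothing is lost. Otherwise it is
  exactly half the radius, and the nearest multiple is off by at most a quarter of the radius; five
  multiples reach across the ball.\<close>

lemma grid_round:
  fixes w :: int
  assumes "\<bar>w\<bar> \<le> 2 ^ j"
  defines "g \<equiv> 2 ^ j - 2 ^ j div 2 :: int"
  shows "\<exists>y\<in>{-2..2}. 4 * \<bar>w - y * g\<bar> \<le> 2 ^ j"
proof (cases "j \<le> 1")
  case True
  then consider "j = 0" | "j = 1" by linarith
  then show ?thesis
  proof cases
    case 1
    then show ?thesis using assms(1) by (intro bexI[of _ w]) (auto simp: g_def abs_le_iff)
  next
    case 2
    then show ?thesis using assms(1) by (intro bexI[of _ w]) (auto simp: g_def abs_le_iff)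
  qed
next
  case False
  then obtain i where j: "j = Suc (Suc i)" by (metis not_less_eq_eq One_nat_def Suc_le_D)
  define h :: int where "h = 2 ^ i"
  have h: "h > 0" by (simp add: h_def)
  have g: "g = 2 * h" "2 ^ j = 4 * h" by (simp_all add: g_def j h_def)
  define y where "y = (w + h) div (2 * h)"
  have 1: "2 * h * y \<le> w + h" "w + h < 2 * h * y + 2 * h"
  proof -
    have "w + h = 2 * h * y + (w + h) mod (2 * h)" unfolding y_def by simp
    moreover have "0 \<le> (w + h) mod (2 * h)" "(w + h) mod (2 * h) < 2 * h" using h by simp_all
    ultimately show "2 * h * y \<le> w + h" "w + h < 2 * h * y + 2 * h" by linarith+
  qed
  have w: "-4 * h \<le> w" "w \<le> 4 * h" using assms(1) g by auto
  have "y \<le> 2"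
  proof (rule ccontr)
    assume "\<not> y \<le> 2"
    then have "2 * h * 3 \<le> 2 * h * y" using h by (intro mult_left_mono) auto
    with 1 w h show False by linarith
  qed
  moreover have "y \<ge> -2"
  proof (rule ccontr)
    assume "\<not> y \<ge> -2"
    then have "2 * h * y \<le> 2 * h * (-3)" using h by (intro mult_left_mono) auto
    with 1 w h show False by linarith
  qed
  moreover have "\<bar>w - y * g\<bar> \<le> h"
  proof -
    have "y * g = 2 * h * y" by (simp add: g)
    then show ?thesis using 1 by linarith
  qed
  ultimately show ?thesis using g by (intro bexI[of _ y]) auto
qed

text \<open>Tuples of empty lists sum to zero, so the candidates are exactly the grid points. The
  ball of \<open>s0\<close> is a cube, hence rounding each coefficient separately is enough.\<close>

lemma initial_dense: "dense s0 (\<lambda>_. []) 1 (5 ^ n * (2 * 1) ^ (2 * k))"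
  unfolding dense_def
proof (intro allI impI ballI)
  fix j w assume w: "w \<in> ivecs n" "Ball s0 (2 ^ j) w"
  define g :: int where "g = 2 ^ j - 2 ^ j div 2"
  have wb: "\<bar>w i\<bar> \<le> 2 ^ j" if "i < n" for i
  proof -
    have "\<bar>real_of_int (w i)\<bar> \<le> 2 ^ j" using w(2) that by (simp add: Ball_def)
    then have "real_of_int \<bar>w i\<bar> \<le> real_of_int (2 ^ j)" by simp
    then show ?thesis by (simp only: of_int_le_iff)
  qed
  have "\<forall>i. \<exists>y. i < n \<longrightarrow> y \<in> {-2..2} \<and> 4 * \<bar>w i - y * g\<bar> \<le> 2 ^ j"
    using grid_round[OF wb] unfolding g_def by blast
  then obtain y where y: "\<And>i. i < n \<Longrightarrow> y i \<in> {-2..2}" "\<And>i. i < n \<Longrightarrow> 4 * \<bar>w i - y i * g\<bar> \<le> 2 ^ j"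
    by metis
  obtain t where t: "t < 5 ^ n" "grid n g t = (\<lambda>i. if i < n then y i * g else 0)"
    using grid_surj[of n y g] y(1) by blast
  let ?t = "t * (2 * 1) ^ (2 * k)"
  have dec: "decode (\<lambda>_. []) 1 m I = vzero" for m I
    by (induction m) (simp_all add: pick_def vadd_def)
  have "cand (\<lambda>_. []) 1 j ?t = grid n g t"
  proof -
    have "?t div (2 * 1) ^ (2 * k) = t" by simp
    then show ?thesis unfolding cand_def dec g_def by (simp only:) (simp add: vadd_def)
  qed
  moreover have "Ball s0 (65/256 * 2 ^ j) (vsub w (grid n g t))"
  proof (rule box_Ball)
    fix i assume i: "i < n"
    have "real_of_int (4 * \<bar>w i - y i * g\<bar>) \<le> real_of_int (2 ^ j)" using y(2)[OF i] by (simp only: of_int_le_iff)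
    then have "4 * \<bar>real_of_int (vsub w (grid n g t) i)\<bar> \<le> 2 ^ j" using i by (simp add: vsub_def t(2))
    then have "\<bar>real_of_int (vsub w (grid n g t) i)\<bar> \<le> 64/256 * 2 ^ j" by simp
    also have "\<dots> \<le> 65/256 * 2 ^ j" by simp
    finally show "\<bar>real_of_int (vsub w (grid n g t) i)\<bar> \<le> 65/256 * 2 ^ j" .
  qed
  moreover have "?t < 5 ^ n * (2 * 1) ^ (2 * k)" using t(1) by simp
  ultimately show "\<exists>t<5 ^ n * (2 * 1) ^ (2 * k). Ball s0 (65/256 * 2 ^ j) (vsub w (cand (\<lambda>_. []) 1 j t))"
    by metis
qed

text \<open>Keeps the number of candidates of the first build, grid points included, below the bound
  \<open>CN\<close> for the later ones. It holds because \<open>Nb + 1\<close> exceeds the power of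
  a base of at least 5 with exponent \<open>n / x\<close>, and \<open>x \<le> 2 * k\<close>.\<close>

lemma five_le: "5 ^ n \<le> (Nb + 1) ^ (2 * k)"
proof -
  define l where "l = 1 + 2 * (real x * (321/256)) / (63/256)"
  have l: "5 \<le> l" using x(1) by (simp add: l_def)
  have "1 * l powr (real n / real x) \<le> real x * l powr (real n / real x)"
    using x(1) by (intro mult_right_mono) auto
  then have "l powr (real n / real x) \<le> real (Nb + 1)" using Nb[folded l_def] by linarith
  then have "(l powr (real n / real x)) ^ (2 * k) \<le> real (Nb + 1) ^ (2 * k)"
    by (intro power_mono) auto
  moreover have "(l powr (real n / real x)) ^ (2 * k) = l powr (real n / real x * real (2 * k))"
    using l by (simp add: powr_realpow[symmetric] powr_powr)
  moreover have "5 powr real n \<le> l powr (real n / real x * real (2 * k))"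
  proof -
    have "5 powr real n \<le> l powr real n" using l by (intro powr_mono2) auto
    also have "\<dots> \<le> l powr (real n / real x * real (2 * k))"
    proof (rule powr_mono)
      have "x \<le> 2 * k" using x by simp
      then have "real n * real x \<le> real n * real (2 * k)" by (intro mult_left_mono) simp_all
      then show "real n \<le> real n / real x * real (2 * k)" using x(1) by (simp add: pos_le_divide_eq)
    qed (use l in simp)
    finally show ?thesis .
  qed
  moreover have "5 powr real n = real (5 ^ n)" by (simp add: powr_realpow)
  ultimately have "real (5 ^ n) \<le> real ((Nb + 1) ^ (2 * k))" by simp
  then show ?thesis by (simp only: of_nat_le_iff)
qed

lemma CN_bounds:
  shows "N \<le> Nb \<Longrightarrow> 1 * (2 * (N + 1)) ^ (2 * k) \<le> CN" "5 ^ n * (2 * 1) ^ (2 * k) \<le> CN" "int CN \<le> b"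
proof -
  show "1 * (2 * (N + 1)) ^ (2 * k) \<le> CN" if "N \<le> Nb"
    unfolding CN_def mult_1 using that by (intro power_mono) auto
  have "5 ^ n * 2 ^ (2 * k) \<le> (Nb + 1) ^ (2 * k) * 2 ^ (2 * k)" using five_le by (intro mult_le_mono1)
  then show "5 ^ n * (2 * 1) ^ (2 * k) \<le> CN"
    unfolding CN_def power_mult_distrib by (simp add: mult.commute)
  show "int CN \<le> b" using power_bound[of "Nb + 1" "2 * k" 1] unfolding CN_def by simp
qed

section \<open>One build of all levels\<close>

abbreviation "build_regs \<equiv> {rMc, rCnt} \<union> level_regs"

definition "T_build = J * (T_level + 2) + 10 * k + 20"

definition status :: "state \<Rightarrow> (nat \<Rightarrow> (nat \<Rightarrow> int) list) \<Rightarrow> nat \<Rightarrow> bool" where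
  "status s L N \<longleftrightarrow> params s \<and> stored s L \<and> lists_ok L N \<and> L 0 = [] \<and> s rNm 0 = int N \<and>
     (\<forall>a. s aZ a = 0) \<and> bestok s"

lemma seen_mono: "seen s L M cnt j \<Longrightarrow> (\<And>y. lb s y \<Longrightarrow> lb s' y) \<Longrightarrow> seen s' L M cnt j"
  unfolding seen_def by blast

lemma build_spec:
  assumes s: "I s" "status s L N" "s rS 0 = \<sigma>" "s rC5 0 = int f" and \<sigma>: "0 < \<sigma>" "\<sigma> \<le> s0"
    and cnt: "f * (2 * (N + 1)) ^ (2 * k) \<le> CN" "f \<le> 5 ^ n"
    and dn: "dense \<sigma> L (N + 1) (f * (2 * (N + 1)) ^ (2 * k))"
  shows "wp I build T_build (\<lambda>s'. same build_regs s s' \<and> (\<forall>y. lb s y \<longrightarrow> lb s' y) \<and>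
    (\<forall>j<J. seen s' L (N + 1) (f * (2 * (N + 1)) ^ (2 * k)) j) \<and>
    (\<exists>L' N'. status s' L' N' \<and> cover \<sigma> L')) s"
    (is "wp I build T_build ?Q s")
proof -
  let ?c = "f * (2 * (N + 1)) ^ (2 * k)"
  define M where "M = N + 1"
  obtain cn where cn: "cn = ?c" by blast
  have st: "params s" "stored s L" "lists_ok L N" "L 0 = []" "s rNm 0 = int N" "\<And>a. s aZ a = 0" "bestok s"
    using s(2) by (auto simp: status_def)
  have M: "M \<ge> 1" "M \<le> Nb + 1" using st(3) by (auto simp: M_def lists_ok_def)
  have cnb: "cn \<le> CN" unfolding cn by (rule cnt(1))
  then have cnb: "cn \<le> CN" "int cn \<le> b" using CN_bounds(3) by linarith+
  have Mb: "int M \<le> b" using power_bound[of M 1 1] M k1 by simp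
  have GJ: "G ^ J \<le> b" "0 \<le> G ^ J"
  proof -
    have "G ^ J \<le> G ^ (J + 1)" using G1 by (intro power_increasing) auto
    then show "G ^ J \<le> b" using b(3) by simp
  qed (use G1 in simp)
  have RJ: "(2::int) ^ J \<le> b" using s(1) st(1) unfolding inbounds_def params_def by (metis abs_of_nonneg zero_le_numeral zero_le_power)
  have fb: "int f \<le> b" using power_bound[of 1 0 f] cnt(2) by simp
  show ?thesis
    unfolding build_def
  proof (rule wp_seq')
    let ?R1 = "\<lambda>s'. same {rMc, rCnt, rR, rPw} s s' \<and> s' rMc 0 = int M \<and> s' rCnt 0 = int f \<and> s' rR 0 = 2 ^ J \<and> s' rPw 0 = G ^ J"
    show "wp I (Seq (Assign rMc (Plus (Var rNm) (Const 1))) (Seq (Assign rCnt (Var rC5))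
      (Seq (Assign rR (Var rRT)) (Assign rPw (Var rPT))))) 7 ?R1 s"
      by (rule wp_vc[OF s(1)])
        (use st(1,5) s(4) Mb GJ RJ fb in \<open>simp_all add: state_simps lens_def params_def M_def\<close>)
    fix s1 assume s1: "I s1" "?R1 s1"
    have sm1: "same {rMc, rCnt, rR, rPw} s s1" using s1(2) by blast
    have p1: "params s1" by (rule params_same[OF st(1) sm1]) simp
    show "wp I (Seq (For rI (Times (Const 2) (Var rK)) (Assign rCnt (Times (Var rCnt) (Times (Const 2) (Var rMc)))))
       (While (Less (Const 1) (Var rR)) level_body))
       (2 * k * 5 + 3 + (J * (T_level + 2) + 1) + 1) ?Q s1"
    proof (rule wp_seq'[OF pow_spec[where f = f and M = M and N = "2 * k"] _ order.refl])
      show "aval (Times (Const 2) (Var rK)) s' = int (2 * k)" if "same {rCnt, rI} s1 s'" for s'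
        using same_reg[OF that, of rK 0] params_k[OF p1] by simp
      fix s2 assume s2: "I s2" "same {rCnt, rI} s1 s2 \<and> s2 rCnt 0 = int (f * (2 * M) ^ (2 * k))"
      have sm2: "same build_regs s s2" by (rule same_trans[OF sm1 conjunct1[OF s2(2)]]) auto
      have p2: "params s2" by (rule params_same[OF st(1) sm2]) simp
      have sm12: "same {rCnt, rI} s1 s2" using s2(2) by blast
      have eq2: "s2 a i = s a i" if "a \<notin> {rMc, rCnt, rR, rPw, rI}" for a i
        using same_reg[OF sm12, of a i] same_reg[OF sm1, of a i] that by simp
      have r2: "s2 rCnt 0 = int cn" "s2 rMc 0 = int M" "s2 rR 0 = 2 ^ J" "s2 rPw 0 = G ^ J"
        using s2(2) same_reg[OF sm12, of rMc 0] same_reg[OF sm12, of rR 0] same_reg[OF sm12, of rPw 0] s1(2)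
        by (simp_all add: cn M_def)
      \<comment> \<open>Here \<open>m\<close> is the number of levels still to do: those from
        \<open>m\<close> up have their new lists, while all lists with index at most
        \<open>m\<close> are still those of \<open>L\<close>, as the next candidates
        require.\<close>
      let ?V = "\<lambda>m s'. m \<le> J \<and> same level_regs s2 s' \<and> s' rR 0 = 2 ^ m \<and> s' rPw 0 = G ^ m \<and>
        (\<forall>a. s' aZ a = 0) \<and> bestok s' \<and> (\<forall>y. lb s y \<longrightarrow> lb s' y) \<and>
        (\<forall>j. m \<le> j \<and> j < J \<longrightarrow> seen s' L M cn j) \<and>
        (\<exists>L1 N1. s' rNm 0 = int N1 \<and> lists_ok L1 N1 \<and> stored s' L1 \<and> (\<forall>p\<le>m. L1 p = L p) \<and>
          (\<forall>j. m \<le> j \<and> j < J \<longrightarrow> complete \<sigma> L M cn j (L1 (Suc j))))"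
      show "wp I (While (Less (Const 1) (Var rR)) level_body) (J * (T_level + 2) + 1) ?Q s2"
      proof (rule wp_while[where V = ?V and N = J and ?T1.0 = T_level])
        show "?V J s2"
        proof (intro conjI exI[of _ L] exI[of _ N])
          show "bestok s2" using st(7) by (simp add: bestok_def eq2)
          show "\<forall>y. lb s y \<longrightarrow> lb s2 y" by (simp add: lb_def eq2)
          show "stored s2 L" using st(2) by (simp add: stored_def eq2)
        qed (use r2 st eq2 in auto)
        show "m > 0 \<and> wp I level_body T_level (?V (m - 1)) s3"
          if V: "?V m s3" and I3: "I s3" and c: "aval (Less (Const 1) (Var rR)) s3 \<noteq> 0" for m s3
        proof -
          have V': "m \<le> J" "same level_regs s2 s3" "s3 rR 0 = 2 ^ m" "s3 rPw 0 = G ^ m" "\<And>a. s3 aZ a = 0"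
              "bestok s3" "\<And>y. lb s y \<Longrightarrow> lb s3 y" "\<And>j. m \<le> j \<Longrightarrow> j < J \<Longrightarrow> seen s3 L M cn j"
            using V by blast+
          obtain L1 N1 where L1: "s3 rNm 0 = int N1" "lists_ok L1 N1" "stored s3 L1" "\<And>p. p \<le> m \<Longrightarrow> L1 p = L p"
              "\<And>j. m \<le> j \<Longrightarrow> j < J \<Longrightarrow> complete \<sigma> L M cn j (L1 (Suc j))" using V by blast
          have "m \<noteq> 0" using c V'(3) by (cases m) auto
          then obtain j where m: "m = Suc j" by (cases m) auto
          have j: "j < J" using V'(1) m by simp
          have p3: "params s3" by (rule params_same[OF p2 V'(2)]) simp
          have regs: "s3 rMc 0 = int M" "s3 rCnt 0 = int cn" "s3 rS 0 = \<sigma>"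
            using same_reg[OF V'(2), of rMc 0] same_reg[OF V'(2), of rCnt 0] same_reg[OF V'(2), of rS 0]
              r2 eq2[of rS 0] s(3) by simp_all
          have PR: "s3 rPw 0 = G ^ Suc j" "s3 rR 0 = 2 ^ Suc j" using V'(3,4) m by simp_all
          have L1j: "L1 (Suc j) = L (Suc j)" "L1 j = L j" using L1(4) m by simp_all
          have "wp I level_body T_level (?V j) s3"
          proof (rule wp_mono[OF level_spec[OF I3 p3 L1(3) regs(1,2) PR regs(3) V'(5,6) L1(1,2) L1j \<sigma> j M cnb] order.refl])
            fix s4 assume "I s4" and Q: "same level_regs s3 s4 \<and> bestok s4 \<and> seen s4 L M cn j \<and>
              (\<forall>y. lb s3 y \<longrightarrow> lb s4 y) \<and> s4 rPw 0 = G ^ j \<and> s4 rR 0 = 2 ^ j \<and> (\<forall>a. s4 aZ a = 0) \<and>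
              (\<exists>C N'. N1 \<le> N' \<and> s4 rNm 0 = int N' \<and> lists_ok (L1(Suc j := C)) N' \<and> stored s4 (L1(Suc j := C)) \<and>
                complete \<sigma> L M cn j C)"
            obtain C N' where C: "s4 rNm 0 = int N'" "lists_ok (L1(Suc j := C)) N'" "stored s4 (L1(Suc j := C))"
              "complete \<sigma> L M cn j C" using Q by blast
            have lbm: "lb s4 y" if "lb s3 y" for y using Q that by blast
            show "?V j s4"
            proof (intro conjI exI[of _ "L1(Suc j := C)"] exI[of _ N'])
              show "same level_regs s2 s4" by (rule same_trans[OF V'(2) conjunct1[OF Q]]) simp
              show "\<forall>i. j \<le> i \<and> i < J \<longrightarrow> seen s4 L M cn i"
              proof (intro allI impI)
                fix i assume i: "j \<le> i \<and> i < J"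
                show "seen s4 L M cn i"
                proof (cases "i = j")
                  case True
                  then show ?thesis using Q by blast
                next
                  case False
                  then show ?thesis using i m V'(8)[of i] seen_mono[OF _ lbm] by simp
                qed
              qed
              show "\<forall>p\<le>j. (L1(Suc j := C)) p = L p" using L1(4) m by simp
              show "\<forall>i. j \<le> i \<and> i < J \<longrightarrow> complete \<sigma> L M cn i ((L1(Suc j := C)) (Suc i))"
                using C(4) L1(5) m by auto
              show "\<forall>y. lb s y \<longrightarrow> lb s4 y" using V'(7) lbm by blast
            qed (use Q C j in auto)
          qed
          then show ?thesis using m by simp
        qed
        show "?Q s3" if V: "?V m s3" and I3: "I s3" and c: "aval (Less (Const 1) (Var rR)) s3 = 0" for m s3
        proof -
          have "s3 rR 0 = 2 ^ m" using V by blast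
          then have "\<not> (1::int) < 2 ^ m" using c by (auto split: if_splits)
          moreover have "m > 0 \<Longrightarrow> (1::int) < 2 ^ m" by (rule one_less_power) simp_all
          ultimately have m0: "m = 0" by blast
          have V': "same level_regs s2 s3" "\<And>a. s3 aZ a = 0"
              "bestok s3" "\<And>y. lb s y \<Longrightarrow> lb s3 y" "\<And>j. m \<le> j \<Longrightarrow> j < J \<Longrightarrow> seen s3 L M cn j"
            using V by blast+
          obtain L1 N1 where L1: "s3 rNm 0 = int N1" "lists_ok L1 N1" "stored s3 L1" "\<And>p. p \<le> m \<Longrightarrow> L1 p = L p"
              "\<And>j. m \<le> j \<Longrightarrow> j < J \<Longrightarrow> complete \<sigma> L M cn j (L1 (Suc j))" using V by blast
          have seen3: "\<forall>j<J. seen s3 L M cn j" using V'(5) m0 by simp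
          have comp: "complete \<sigma> L M cn j (L1 (Suc j))" if "j < J" for j using L1(5)[of j] m0 that by simp
          have L10: "L1 0 = []" using L1(4)[of 0] st(4) by simp
          have sm: "same build_regs s s3" by (rule same_trans[OF sm2 V'(1)]) auto
          have "params s3" by (rule params_same[OF p2 V'(1)]) simp
          then have "status s3 L1 N1" using L1(1-3) V'(2,3) L10 by (simp add: status_def)
          moreover have "cover \<sigma> L1"
            by (rule complete_cover[OF comp _ \<sigma>(1)]) (use dn in \<open>simp_all add: cn M_def\<close>)
          ultimately show ?thesis using sm V'(4) seen3 unfolding cn M_def by blast
        qed
      qed (use s2 in auto)
    qed (use s1 M cnt in auto)
  qed (simp add: T_build_def)
qed

text \<open>
  When \<open>\<sigma> \<le> 64\<close>, a shortest vector of the lattice is also shortest for the norm with balls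
  \<open>Ball \<sigma>\<close>, so that approximating it to within less than its length is finding it.
\<close>

lemma shortest_candidate:
  assumes cov: "cover \<sigma> L" and L: "lists_ok L N" "L 0 = []" and \<sigma>: "0 < \<sigma>" "\<sigma> \<le> 64"
    and z: "z \<in> ivecs n" "z \<noteq> vzero" and min: "\<And>u. u \<in> ivecs n \<Longrightarrow> u \<noteq> vzero \<Longrightarrow> sq z \<le> sq u"
    and zi: "\<And>i. i < n \<Longrightarrow> 4096 * (z i)\<^sup>2 \<le> sq z" and zJ: "sq z \<le> (2 ^ (J - 1))\<^sup>2" "J \<ge> 1"
  shows "\<exists>j<J. \<exists>t<1 * (2 * (N + 1)) ^ (2 * k). cand L (N + 1) j t = z"
proof -
  let ?n = "sqrt (of_int (sq z))"
  have sq0: "0 \<le> sq u" for u by (simp add: sqn_def sum_nonneg)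
  have zi': "\<bar>real_of_int (z i)\<bar> \<le> ?n / 64" if "i < n" for i
  proof -
    have "real_of_int (4096 * (z i)\<^sup>2) \<le> of_int (sq z)" using zi[OF that] by (simp only: of_int_le_iff)
    then have "(64 * real_of_int (z i))\<^sup>2 \<le> of_int (sq z)" by (simp add: power_mult_distrib)
    then have "\<bar>64 * real_of_int (z i)\<bar> \<le> ?n" by (metis real_sqrt_abs real_sqrt_le_mono)
    then show ?thesis by (simp add: abs_mult)
  qed
  \<comment> \<open>The coefficients are at most 1/64 of the length and
    \<open>\<sigma> \<le> 64\<close>, so the bound on the length implies the bound on the
    coefficients.\<close>
  have BallI: "Ball \<sigma> t z" if "?n \<le> t * of_int \<sigma>" "0 \<le> t" for t
  proof -
    have "t * of_int \<sigma> \<le> t * 64" using that(2) \<sigma>(2) by (intro mult_left_mono) auto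
    then have "?n / 64 \<le> t" using that(1) by simp
    then show ?thesis unfolding Ball_def L2_sq using zi' that(1) by force
  qed
  have "Ball \<sigma> (2 ^ (J - 1)) z"
  proof (rule BallI)
    have "real_of_int (sq z) \<le> real_of_int ((2 ^ (J - 1))\<^sup>2)" using zJ(1) by (simp only: of_int_le_iff)
    then have "?n \<le> 2 ^ (J - 1)" by (intro real_le_lsqrt) (use sq0 in auto)
    also have "\<dots> \<le> 2 ^ (J - 1) * of_int \<sigma>" using \<sigma>(1) by (simp add: mult_le_cancel_left1)
    finally show "?n \<le> 2 ^ (J - 1) * of_int \<sigma>" .
  qed simp
  \<comment> \<open>The least level whose ball contains \<open>z\<close>. If the error
    \<open>z - v\<close> were a nonzero vector, it would be at least as long as \<open>z\<close>,
    and its norm bound would put \<open>z\<close> into the ball of half the radius.\<close>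
  moreover define j where "j = (LEAST j. Ball \<sigma> (2 ^ j) z)"
  ultimately have j: "Ball \<sigma> (2 ^ j) z" "j \<le> J - 1" "\<And>i. i < j \<Longrightarrow> \<not> Ball \<sigma> (2 ^ i) z"
    by (auto intro: LeastI Least_le dest: not_less_Least)
  have jJ: "j < J" using j(2) zJ(2) by simp
  obtain v where v: "v \<in> combs (L (Suc j)) k" "Ball \<sigma> (2 ^ j / 2) (vsub z v)"
    using cov jJ z(1) j(1) unfolding cover_def by blast
  have vi: "v \<in> ivecs n"
    by (rule combs_ivecs[OF _ v(1)]) (use L(1) Suc_leI[OF jJ] in \<open>unfold lists_ok_def, blast\<close>)
  have "vsub z v = vzero"
  proof (rule ccontr)
    assume ne: "vsub z v \<noteq> vzero"
    show False
    proof (cases j)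
      case 0
      then show False using Ball_half[of \<sigma> "vsub z v"] v(2) vi z(1) ne by simp
    next
      case (Suc i)
      have "sq z \<le> sq (vsub z v)" by (rule min) (use ne z(1) vi in auto)
      then have "?n \<le> sqrt (of_int (sq (vsub z v)))" by simp
      also have "\<dots> \<le> 2 ^ i * of_int \<sigma>" using v(2) Suc unfolding Ball_def L2_sq by simp
      finally have "Ball \<sigma> (2 ^ i) z" by (rule BallI) simp
      then show False using j(3)[of i] Suc by simp
    qed
  qed
  then have "v = z" by (auto simp: vsub_def fun_eq_iff)
  then have "z \<in> combs (L (Suc j)) k" using v(1) by simp
  then obtain t where "t < (2 * (N + 1)) ^ (2 * k)" "cand L (N + 1) j t = vadd z vzero"
    using cand_combs[OF _ _ L(1) jJ, of z vzero] vzero_sumset[of "\<lambda>_. L j" k] by blast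
  moreover have "vadd z vzero = z" by (simp add: vadd_def)
  ultimately show ?thesis using jJ by (intro exI[of _ j] conjI exI[of _ t]) (simp_all only: mult_1)
qed

section \<open>Shrinking the parameter until length dominates\<close>

abbreviation "sieve_regs \<equiv> {rS, rC5} \<union> build_regs"

text \<open>A round multiplies \<open>\<sigma>\<close> by at most 129/130, and 129 rounds halve it
  because \<open>(1 + 1/129) ^ 129 \<ge> 2\<close>. Starting from at most \<open>2 ^ e\<close>, at
  most \<open>129 * e\<close> rounds take place; the other two builds are the first and the
  last.\<close>

definition "T_sieve e = 129 * e * (T_build + 4) + 2 * T_build + 10"

lemma sieve_spec:
  assumes s: "I s" "params s" "s rS 0 = s0" "s rC5 0 = 5 ^ n" "s rNm 0 = 0" "\<And>a. s aW a = 0" "\<And>a. s aZ a = 0"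
      "s rBest 0 = 0"
    and e: "s0 \<le> 2 ^ e"
    and z: "z \<in> ivecs n" "z \<noteq> vzero" and min: "\<And>u. u \<in> ivecs n \<Longrightarrow> u \<noteq> vzero \<Longrightarrow> sq z \<le> sq u"
    and zi: "\<And>i. i < n \<Longrightarrow> 4096 * (z i)\<^sup>2 \<le> sq z" and zJ: "sq z \<le> (2 ^ (J - 1))\<^sup>2" "J \<ge> 1"
  shows "wp I sieve_com (T_sieve e) (\<lambda>s'. same sieve_regs s s' \<and>
    (\<exists>u\<in>ivecs n. u \<noteq> vzero \<and> small u \<and> s' rBu 0 = pack u \<and> sq u = sq z)) s"
    (is "wp I sieve_com _ ?Q s")
proof -
  have st0: "status s (\<lambda>_. []) 0"
    unfolding status_def using s
    by (auto simp: stored_def lists_ok_def ent_def enc_def bestok_def)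
  have d0: "dense s0 (\<lambda>_. []) (0 + 1) (5 ^ n * (2 * (0 + 1)) ^ (2 * k))" using initial_dense by (simp only: add_0)
  have c0: "5 ^ n * (2 * (0 + 1)) ^ (2 * k) \<le> CN" using CN_bounds(2) by (simp only: add_0)
  have s05: "s rC5 0 = int (5 ^ n)" using s(4) by simp
  have I5: "inbounds b (lens n Nb) s \<Longrightarrow> \<bar>s rS 0 - y\<bar> \<le> b" if "0 \<le> y" "y \<le> s rS 0" for s y
  proof -
    assume "inbounds b (lens n Nb) s"
    then have "\<bar>s rS 0\<bar> \<le> b" by (simp add: inbounds_def)
    then show ?thesis using that by linarith
  qed
  have later: "wp I build T_build (\<lambda>s'. same build_regs r s' \<and>
      (\<forall>j<J. seen s' L (N + 1) (1 * (2 * (N + 1)) ^ (2 * k)) j) \<and> (\<exists>L' N'. status s' L' N' \<and> cover \<sigma>' L')) r"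
    if r: "I r" "status r L N" "r rS 0 = \<sigma>'" "r rC5 0 = 1" and cov: "cover \<sigma> L"
      and \<sigma>: "0 < \<sigma>'" "\<sigma>' \<le> \<sigma>" "\<sigma> \<le> s0" "64 * \<sigma> \<le> 65 * \<sigma>'" for r L N \<sigma> \<sigma>'
  proof (rule wp_mono[OF build_spec[where f = 1 and \<sigma> = \<sigma>', OF r(1,2,3)] order.refl])
    have L: "lists_ok L N" "L 0 = []" using r(2) by (auto simp: status_def)
    show "dense \<sigma>' L (N + 1) (1 * (2 * (N + 1)) ^ (2 * k))" by (rule cover_dense[OF cov L \<sigma>(1,2,4)])
    show "1 * (2 * (N + 1)) ^ (2 * k) \<le> CN" by (rule CN_bounds(1)) (use L(1) in \<open>simp add: lists_ok_def\<close>)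
  qed (use r \<sigma> in auto)
  show ?thesis
    unfolding sieve_com_def
  proof (rule wp_seq'[OF build_spec[where f = "5 ^ n", OF s(1) st0 s(3) s05 s0_pos order.refl c0 order.refl d0]])
    fix s1 assume s1: "I s1" and Q1: "same build_regs s s1 \<and> (\<forall>y. lb s y \<longrightarrow> lb s1 y) \<and>
      (\<forall>j<J. seen s1 (\<lambda>_. []) (0 + 1) (5 ^ n * (2 * (0 + 1)) ^ (2 * k)) j) \<and>
      (\<exists>L' N'. status s1 L' N' \<and> cover s0 L')"
    let ?R2 = "\<lambda>s'. same sieve_regs s s' \<and> s' rC5 0 = 1 \<and> s' rS 0 = s0 \<and> (\<exists>L N. status s' L N \<and> cover s0 L)"
    have sm1: "same build_regs s s1" using Q1 by blast
    have status_reg: "status (store_at r a 0 y) L N" if "status r L N" "a = rC5 \<or> a = rS" for r a y L N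
      using that unfolding status_def stored_def bestok_def params_def by (auto simp: store_at_apply)
    show "wp I (Seq (Assign rC5 (Const 1)) (Seq (While (Less (Const 64) (Var rS))
        (Seq (Assign rS (Minus (Var rS) (Div (Var rS) (Const 65)))) build)) build))
       (1 + (129 * e * (T_build + 4) + 1 + T_build + 1) + 1) ?Q s1"
    proof (rule wp_seq'[where R = ?R2, OF _ _ order.refl])
      have S1: "s1 rS 0 = s0" using same_reg[OF sm1, of rS 0] s(3) by simp
      have sm1': "same sieve_regs s s1" using sm1 by (auto simp: same_def)
      show "wp I (Assign rC5 (Const 1)) 1 ?R2 s1"
      proof (rule wp_vc[OF s1])
        have "?R2 (store_at s1 rC5 0 1)"
          using Q1 S1 status_reg[of s1 _ _ rC5 1] same_store[OF sm1', of rC5 0 1] by (auto simp: store_at_apply)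
        then show "vc b (lens n Nb) (Assign rC5 (Const 1)) ?R2 s1" using b0 by (simp add: lens_def)
      qed simp
      fix s2 assume s2: "I s2" and Q2: "?R2 s2"
      let ?V = "\<lambda>m s'. same sieve_regs s s' \<and> s' rC5 0 = 1 \<and> 0 < s' rS 0 \<and> s' rS 0 \<le> s0 \<and>
         (\<exists>L N. status s' L N \<and> cover (s' rS 0) L) \<and> (\<exists>i. i + m = 129 * e \<and> s' rS 0 * 130 ^ i \<le> s0 * 129 ^ i)"
      let ?R3 = "\<lambda>s'. (\<exists>m. ?V m s') \<and> s' rS 0 \<le> 64"
      show "wp I (Seq (While (Less (Const 64) (Var rS)) (Seq (Assign rS (Minus (Var rS) (Div (Var rS) (Const 65)))) build)) build)
         (129 * e * (T_build + 4) + 1 + T_build + 1) ?Q s2"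
      proof (rule wp_seq'[where R = ?R3, OF _ _ order.refl])
        show "wp I (While (Less (Const 64) (Var rS)) (Seq (Assign rS (Minus (Var rS) (Div (Var rS) (Const 65)))) build))
          (129 * e * (T_build + 4) + 1) ?R3 s2"
        proof (rule wp_while[where V = ?V and N = "129 * e" and ?T1.0 = "T_build + 2"])
          show "?V (129 * e) s2" using Q2 s0_pos by auto
          show "m > 0 \<and> wp I (Seq (Assign rS (Minus (Var rS) (Div (Var rS) (Const 65)))) build) (T_build + 2) (?V (m - 1)) s3"
            if V: "?V m s3" and I3: "I s3" and c: "aval (Less (Const 64) (Var rS)) s3 \<noteq> 0" for m s3
          proof
            have V': "same sieve_regs s s3" "s3 rC5 0 = 1" "0 < s3 rS 0" "s3 rS 0 \<le> s0" using V by blast+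
            obtain L N where L: "status s3 L N" "cover (s3 rS 0) L" using V by blast
            obtain i where i: "i + m = 129 * e" "s3 rS 0 * 130 ^ i \<le> s0 * 129 ^ i" using V by blast
            obtain \<sigma> where \<sigma>: "s3 rS 0 = \<sigma>" by blast
            have \<sigma>64: "64 < \<sigma>" using c \<sigma> by (auto split: if_splits)
            show m: "m > 0"
            proof (rule ccontr)
              assume "\<not> m > 0"
              then have ie: "i = 129 * e" using i by simp
              have "s0 * 129 ^ i \<le> 2 ^ e * 129 ^ i" using e by (intro mult_right_mono) auto
              also have "\<dots> = (2 * 129 ^ 129) ^ e" unfolding ie by (simp only: power_mult power_mult_distrib)
              also have "\<dots> \<le> (130 ^ 129) ^ e" by (intro power_mono) simp_all
              also have "\<dots> = 130 ^ i" unfolding ie by (simp only: power_mult)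
              finally have "\<sigma> * 130 ^ i \<le> 1 * 130 ^ i" using i(2) unfolding \<sigma> by linarith
              then have "\<sigma> \<le> 1" by (rule mult_right_le_imp_le) simp
              with \<sigma>64 show False by simp
            qed
            let ?y = "\<sigma> - \<sigma> div 65"
            have d: "65 * (\<sigma> div 65) \<le> \<sigma>" "\<sigma> < 65 * (\<sigma> div 65) + 65" by linarith+
            then have d1: "1 \<le> \<sigma> div 65" using \<sigma>64 by linarith
            \<comment> \<open>The loop runs for \<open>\<sigma> > 64\<close>, so the quotient is at
              least 1 and the remainder, being below 65, costs at most as much again as the quotient
              accounts for.\<close>
            have "\<sigma> \<le> 130 * (\<sigma> div 65)" using d d1 by linarith
            then have "130 * ?y \<le> 129 * \<sigma>" unfolding right_diff_distrib by linarith
            moreover have "64 * \<sigma> \<le> 65 * ?y" unfolding right_diff_distrib using d(1) by linarith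
            moreover have "0 < ?y" using d(1) d1 \<sigma>64 by linarith
            moreover have "?y \<le> \<sigma>" using d1 by linarith
            ultimately have y: "0 < ?y" "?y \<le> \<sigma>" "64 * \<sigma> \<le> 65 * ?y" "130 * ?y \<le> 129 * \<sigma>" by blast+
            have yb: "\<bar>?y\<bar> \<le> b" using I5[of "\<sigma> div 65" s3, OF _ _ I3] \<sigma>64 \<sigma> by auto
            let ?s4 = "store_at s3 rS 0 ?y"
            have I4: "I ?s4" by (rule I_reg[OF I3]) (use yb in auto)
            have "wp I build T_build (?V (m - 1)) ?s4"
            proof (rule wp_mono[OF later[OF I4 status_reg[OF L(1)] _ _ L(2)] order.refl])
              fix s5 assume "I s5" and Q5: "same build_regs ?s4 s5 \<and>
                 (\<forall>j<J. seen s5 L (N + 1) (1 * (2 * (N + 1)) ^ (2 * k)) j) \<and> (\<exists>L' N'. status s5 L' N' \<and> cover ?y L')"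
              have sm5: "same build_regs ?s4 s5" using Q5 by blast
              have S5: "s5 rS 0 = ?y" "s5 rC5 0 = 1"
                using same_reg[OF sm5, of rS 0] same_reg[OF sm5, of rC5 0] V'(2) by (simp_all add: store_at_apply)
              have sm4: "same sieve_regs s ?s4" by (rule same_store[OF V'(1)]) simp
              have sm: "same sieve_regs s s5" by (rule same_trans[OF sm4 sm5]) auto
              have "?y * 130 ^ Suc i \<le> s0 * 129 ^ Suc i"
              proof -
                have "?y * 130 ^ Suc i = (130 * ?y) * 130 ^ i" by simp
                also have "\<dots> \<le> (129 * \<sigma>) * 130 ^ i" using y(4) by (intro mult_right_mono) auto
                also have "\<dots> = 129 * (\<sigma> * 130 ^ i)" by simp
                also have "\<dots> \<le> 129 * (s0 * 129 ^ i)" using i(2) \<sigma> by (intro mult_left_mono) auto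
                finally show ?thesis by (simp add: mult_ac)
              qed
              moreover have "Suc i + (m - 1) = 129 * e" using i(1) m by simp
              ultimately have "\<exists>i. i + (m - 1) = 129 * e \<and> s5 rS 0 * 130 ^ i \<le> s0 * 129 ^ i"
                unfolding S5 by blast
              moreover have "s5 rS 0 \<le> s0" "0 < s5 rS 0" using S5 y V'(4) \<sigma> by auto
              moreover have "\<exists>L N. status s5 L N \<and> cover (s5 rS 0) L" using Q5 unfolding S5(1) by blast
              ultimately show "?V (m - 1) s5" using sm S5(2) by blast
            qed (use V' y \<sigma> in \<open>auto simp: store_at_apply\<close>)
            then show "wp I (Seq (Assign rS (Minus (Var rS) (Div (Var rS) (Const 65)))) build) (T_build + 2) (?V (m - 1)) s3"
              by (intro wp_seq[where ?T1.0 = 1 and ?T2.0 = T_build] wp_store) (use I3 I4 \<sigma> in simp_all)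
          qed
          show "?R3 s'" if "?V m s'" "aval (Less (Const 64) (Var rS)) s' = 0" for m s'
            using that by (auto split: if_splits)
        qed (use s2 in \<open>auto simp: algebra_simps\<close>)
        fix s3 assume I3: "I s3" and Q3: "?R3 s3"
        have V': "same sieve_regs s s3" "s3 rC5 0 = 1" "0 < s3 rS 0" "s3 rS 0 \<le> s0" "s3 rS 0 \<le> 64" using Q3 by blast+
        obtain L N where L: "status s3 L N" "cover (s3 rS 0) L" using Q3 by blast
        have Lok: "lists_ok L N" "L 0 = []" using L(1) by (auto simp: status_def)
        show "wp I build T_build ?Q s3"
        proof (rule wp_mono[OF later[OF I3 L(1) HOL.refl V'(2) L(2) V'(3) order.refl V'(4)] order.refl])
          fix s4 assume "I s4" and Q4: "same build_regs s3 s4 \<and>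
             (\<forall>j<J. seen s4 L (N + 1) (1 * (2 * (N + 1)) ^ (2 * k)) j) \<and> (\<exists>L' N'. status s4 L' N' \<and> cover (s3 rS 0) L')"
          have sm4: "same build_regs s3 s4" using Q4 by blast
          have sm: "same sieve_regs s s4" by (rule same_trans[OF V'(1) sm4]) auto
          obtain j t where jt: "j < J" "t < 1 * (2 * (N + 1)) ^ (2 * k)" "cand L (N + 1) j t = z"
            using shortest_candidate[OF L(2) Lok V'(3,5) z min zi zJ] by blast
          have seen: "seen s4 L (N + 1) (1 * (2 * (N + 1)) ^ (2 * k)) j" using Q4 jt(1) by blast
          have "lb s4 (sq z)" using seen jt(2,3) z(2) unfolding seen_def by metis
          then have bst: "0 < s4 rBest 0" "s4 rBest 0 \<le> sq z" by (auto simp: lb_def)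
          have "bestok s4" using Q4 by (auto simp: status_def)
          then obtain u where u: "u \<in> ivecs n" "u \<noteq> vzero" "small u" "s4 rBest 0 = sq u" "s4 rBu 0 = pack u"
            using bst(1) by (auto simp: bestok_def)
          have "sq u = sq z" using bst(2) u(4) min[OF u(1,2)] by linarith
          then show "?Q s4" using sm u by blast
        qed (use V'(3) in simp)
      qed
    qed
  qed (simp add: T_sieve_def)
qed

end

section \<open>Preparation of the input\<close>

definition init_scale :: com where
  "init_scale = Seq (Seq (Assign rD (Const 1)) (Assign rM cN))
     (For rI (Times cN cN)
       (Seq (Assign rD (Times (Var rD) (Cell aDen (Var rI))))
         (Assign rM (Times (Var rM) (Times (Cell aDen (Var rI)) (Plus (absE (Cell aNum (Var rI))) (Const 1)))))))"

definition init_factor :: com where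
  "init_factor = Seq (Assign rF (Const 64)) (For rI (Plus cN (Const 1)) (Assign rF (Times (Var rF) (Var rM))))"

definition init_base :: com where
  "init_base =
    Seq (Seq (Assign rY (Times (Times (Var rF) (Var rM)) (Var rM)))
        (Seq (Assign rP (Times (Const 64) (Times (Var rY) (Var rY)))) (Seq (Assign rPn (Const 1)) (Assign rC5 (Const 1)))))
   (Seq (For rI cN (Seq (Assign rPn (Times (Var rPn) (Var rP))) (Assign rC5 (Times (Var rC5) (Const 5)))))
    (Assign rG (Times (Var rPn) (Var rPn))))"

text \<open>\<open>J\<close> itself is never stored. Powers of 2 and of \<open>G\<close> are raised
  together, so the radius of the top level and the weight of its digit match without a
  logarithm.\<close>

definition init_top :: com where
  "init_top =
    Seq (Seq (Assign rRT (Const 1)) (Assign rPT (Const 1)))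
    (While (Less (Var rRT) (Times (Const 2) (Times (Var rF) (Var rM))))
      (Seq (Assign rRT (Times (Const 2) (Var rRT))) (Assign rPT (Times (Var rPT) (Var rG)))))"

definition init_row :: com where
  "init_row =
    Seq (Assign rAcc (Plus (Var rAcc) (Times (Times (Var rF)
        (Times (Cell aNum (Plus (Times cN (Var rI)) (Var rRow)))
          (Div (Var rD) (Cell aDen (Plus (Times cN (Var rI)) (Var rRow)))))) (Var rPr))))
      (Assign rPr (Times (Var rPr) (Var rP)))"

definition init_units :: com where
  "init_units =
    Seq (Assign rPi (Const 1))
    (For rI cN
      (Seq (Seq (Assign rAcc (Var rPi)) (Assign rPr (Var rPn)))
      (Seq (For rRow cN init_row)
        (Seq (Store aE (Var rI) (Var rAcc)) (Assign rPi (Times (Var rPi) (Var rP)))))))"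

definition init_tuple :: com where
  "init_tuple =
    Seq (Assign rX (Div (Plus (Times cQ cQ) (Const 6)) (Const 7)))
   (Seq (Cond (Less (Plus (Div cN (Const 140)) (Const 1)) (Var rX)) (Assign rX (Plus (Div cN (Const 140)) (Const 1))) Skip)
   (Seq (Assign rK (Minus (Times (Const 2) (Var rX)) (Const 1))) (Assign rS (Var rY))))"

text \<open>The image digits are the coordinates of the lattice vector multiplied by
  \<open>F * D\<close>; the coefficients before them are skipped.\<close>

definition out_body :: com where
  "out_body =
    Seq (Assign rDg (Minus (Mod (Plus (Var rT) (Div (Var rP) (Const 2))) (Var rP)) (Div (Var rP) (Const 2))))
   (Seq (Assign rT (Div (Minus (Var rT) (Var rDg)) (Var rP)))
    (Cond (Less (Var rI) cN) Skip
      (Seq (Store aOut (Minus (Var rI) cN) (Var rDg)) (Store aOutDen (Minus (Var rI) cN) (Times (Var rF) (Var rD))))))"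

definition out_com :: com where
  "out_com = Seq (Assign rT (Var rBu)) (For rI (Times (Const 2) cN) out_body)"

definition svp_program :: com where
  "svp_program = Seq init_scale (Seq init_factor (Seq init_base (Seq init_top (Seq init_units (Seq init_tuple
     (Seq sieve_com out_com))))))"

section \<open>Parameters computed from the input\<close>

lemma prod_le_prod:
  fixes f :: "nat \<Rightarrow> int"
  assumes "\<And>k. 1 \<le> f k" "i \<le> l"
  shows "prod f {..<i} \<le> prod f {..<l}" "1 \<le> prod f {..<i}"
proof -
  have 1: "1 \<le> prod f {..<m}" for m
    by (rule prod_ge_1) (use assms(1) in auto)
  then show "1 \<le> prod f {..<i}" .
  show "prod f {..<i} \<le> prod f {..<l}"
    using assms(2)
  proof (induction l)
    case (Suc l)
    show ?case
    proof (cases "i = Suc l")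
      case False
      then have "prod f {..<i} \<le> prod f {..<l} * 1" using Suc by simp
      also have "\<dots> \<le> prod f {..<l} * f l" using 1[of l] assms(1)[of l] by (intro mult_left_mono) auto
      finally show ?thesis by simp
    qed simp
  qed simp
qed

locale svp_input =
  fixes n q :: nat and num den :: "nat \<Rightarrow> int"
  assumes q: "4 \<le> q" "q * q \<le> n" and den: "\<And>k. 1 \<le> den k"
begin

text \<open>
  By Cramer's rule a shortest vector has coefficients at most \<open>M ^ (n + 1)\<close>; after scaling by \<open>F\<close> these
  are negligible compared with its length, so that \<open>Ball \<sigma>\<close> measures length for small \<open>\<sigma>\<close>.
  The cap \<open>n div 140 + 1\<close> on the tuple size matters only for \<open>q\<close> close to \<open>sqrt n\<close>: it keeps the powers of \<open>x\<close>
  in the running time below \<open>q powr (3/35 * n)\<close>.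
\<close>

definition "D = prod den {..<n * n}"
text \<open>Bounds every entry of the integer matrix \<open>a\<close>, and is itself at most 2 to
  the power of the input length.\<close>

definition "m = (\<Prod>k<n * n. den k * (\<bar>num k\<bar> + 1))"
definition "M = int n * m"
definition "F = 64 * M ^ (n + 1)"
text \<open>The first \<open>\<sigma>\<close>. On the unit cube an image entry is at most
  \<open>F * M\<close>, and the other factor \<open>M\<close> is at least the number
  \<open>n\<close> of entries, which bounds the length.\<close>

definition "Y = F * M * M"
text \<open>Large enough for the digits: \<open>4 * n + 4 \<le> 8 * M\<close> and
  \<open>2 ^ J < 4 * (F * M)\<close>, so twice the largest coordinate in question is below
  \<open>64 * Y * Y\<close>.\<close>

definition "P = 64 * (Y * Y)"
definition "G = P ^ (2 * n)"
text \<open>After scaling by \<open>F\<close> a shortest vector has length at most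
  \<open>F * M\<close>, and it must lie in the ball of radius \<open>2 ^ (J - 1)\<close>, even for
  \<open>\<sigma> = 1\<close>.\<close>

definition "J = (LEAST j. 2 * (F * M) \<le> 2 ^ j)"
definition "x = min ((q * q + 6) div 7) (n div 140 + 1)"
definition "k = 2 * x - 1"
definition "lam = 1 + 2 * (real x * (321/256)) / (63/256)"
definition "Nb = nat \<lfloor>real x * lam powr (real n / real x)\<rfloor>"
definition "a r c = num (n * c + r) * (D div den (n * c + r))"
definition "A r c = F * a r c"
definition "b = (2 * int n + 4) * G ^ (J + 1) + int (5 ^ n * (2 * (Nb + 1)) ^ (2 * k))"

lemma n16: "16 \<le> n"
proof -
  have "4 * 4 \<le> q * q" using q(1) by (intro mult_le_mono) auto
  then show ?thesis using q(2) by simp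
qed

lemma factor1: "1 \<le> den i * (\<bar>num i\<bar> + 1)"
proof -
  have "1 * 1 \<le> den i * (\<bar>num i\<bar> + 1)" using den[of i] by (intro mult_mono) auto
  then show ?thesis by simp
qed

lemma m1: "1 \<le> m" unfolding m_def by (rule prod_ge_1) (use factor1 in auto)

lemma nM: "int n \<le> M" "16 \<le> M" "m \<le> M" "1 \<le> M"
proof -
  have "int n * 1 \<le> M" unfolding M_def using m1 by (intro mult_left_mono) auto
  then show "int n \<le> M" "16 \<le> M" "1 \<le> M" using n16 by auto
  have "1 * m \<le> M" unfolding M_def using n16 m1 by (intro mult_right_mono) auto
  then show "m \<le> M" by simp
qed

lemma D1: "1 \<le> D" unfolding D_def by (rule prod_ge_1) (use den in auto)

lemma den_dvd: "i < n * n \<Longrightarrow> den i dvd D"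
  unfolding D_def by (rule dvd_prodI) auto

text \<open>The factor of \<open>m\<close> at the entry's own position absorbs the numerator, and
  the remaining factors absorb \<open>D\<close> divided by its denominator.\<close>

lemma abs_a: assumes "r < n" "c < n" shows "\<bar>a r c\<bar> \<le> m"
proof -
  let ?i = "n * c + r"
  have i: "?i < n * n"
  proof -
    have "?i < n * c + n" using assms by simp
    also have "\<dots> = n * Suc c" by simp
    also have "\<dots> \<le> n * n" using assms by (intro mult_left_mono) auto
    finally show ?thesis .
  qed
  let ?S = "{..<n * n} - {?i}"
  have "D = den ?i * prod den ?S" unfolding D_def using i by (subst prod.remove[of _ ?i]) auto
  then have "D div den ?i = prod den ?S" using den[of ?i] by simp
  moreover have "1 \<le> prod den ?S" by (rule prod_ge_1) (use den in auto)
  ultimately have "\<bar>a r c\<bar> = \<bar>num ?i\<bar> * prod den ?S" by (simp add: a_def abs_mult)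
  also have "\<dots> \<le> (den ?i * (\<bar>num ?i\<bar> + 1)) * (\<Prod>k\<in>?S. den k * (\<bar>num k\<bar> + 1))"
  proof (rule mult_mono)
    have "1 * \<bar>num ?i\<bar> \<le> den ?i * (\<bar>num ?i\<bar> + 1)" using den[of ?i] by (intro mult_mono) auto
    then show "\<bar>num ?i\<bar> \<le> den ?i * (\<bar>num ?i\<bar> + 1)" by simp
    show "prod den ?S \<le> (\<Prod>k\<in>?S. den k * (\<bar>num k\<bar> + 1))"
    proof (rule prod_mono)
      fix k
      have "den k * 1 \<le> den k * (\<bar>num k\<bar> + 1)" using den[of k] by (intro mult_left_mono) auto
      then show "0 \<le> den k \<and> den k \<le> den k * (\<bar>num k\<bar> + 1)" using den[of k] by simp
    qed
    show "0 \<le> prod den ?S" using \<open>1 \<le> prod den ?S\<close> by simp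
    show "0 \<le> den ?i * (\<bar>num ?i\<bar> + 1)" using factor1[of ?i] by linarith
  qed
  also have "\<dots> = m" unfolding m_def using i by (subst (2) prod.remove[of _ ?i]) auto
  finally show ?thesis .
qed

lemma F64: "64 \<le> F" "1 \<le> F"
proof -
  have "1 \<le> M ^ (n + 1)" using nM by (intro one_le_power) auto
  then show "64 \<le> F" "1 \<le> F" by (simp_all add: F_def)
qed

lemma Y1: "F * M \<le> Y" "F \<le> Y" "M \<le> F * M" "1 \<le> Y" "M \<le> Y" "1 \<le> F * M"
proof -
  have "F * M * 1 \<le> Y" unfolding Y_def using nM F64 by (intro mult_left_mono) auto
  then show FM: "F * M \<le> Y" by simp
  have "F * 1 \<le> F * M" using nM F64 by (intro mult_left_mono) auto
  then show "F \<le> Y" using FM by simp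
  have "1 * M \<le> F * M" using nM F64 by (intro mult_right_mono) auto
  then show "M \<le> F * M" by simp
  then show "1 \<le> F * M" using nM(4) by linarith
  then show "1 \<le> Y" using FM by linarith
  show "M \<le> Y" using FM \<open>M \<le> F * M\<close> by linarith
qed

lemma PG: "Y \<le> P" "1 \<le> P" "64 \<le> P" "P \<le> G" "1 \<le> G" "P * P \<le> G" "even P"
proof -
  have "1 * Y \<le> Y * Y" using Y1 by (intro mult_right_mono) auto
  then have "64 * Y \<le> P" by (simp add: P_def)
  then show "Y \<le> P" using Y1(4) by linarith
  show "64 \<le> P" using \<open>64 * Y \<le> P\<close> Y1(4) by linarith
  then show "1 \<le> P" by linarith
  then show "1 \<le> G" unfolding G_def by simp
  have "P ^ 2 \<le> G" unfolding G_def using \<open>1 \<le> P\<close> n16 by (intro power_increasing) auto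
  then show PP: "P * P \<le> G" by (simp add: power2_eq_square)
  have "1 * P \<le> P * P" using \<open>1 \<le> P\<close> by (intro mult_right_mono) auto
  then show "P \<le> G" using PP by simp
  show "even P" by (simp add: P_def)
qed

lemma J: "2 * (F * M) \<le> 2 ^ J" "\<And>i. i < J \<Longrightarrow> 2 ^ i < 2 * (F * M)" "1 \<le> J" "2 ^ J < 4 * (F * M)"
proof -
  have "\<exists>j. 2 * (F * M) \<le> 2 ^ j"
  proof -
    have "y < 2 ^ nat y" if "0 \<le> y" for y :: int
      using that less_exp[of "nat y"] by (metis nat_0_le of_nat_less_iff of_nat_numeral of_nat_power)
    from this[of "2 * (F * M)"] show ?thesis using Y1 by (auto intro: less_imp_le)
  qed
  then show 1: "2 * (F * M) \<le> 2 ^ J" unfolding J_def by (rule LeastI_ex)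
  show 2: "2 ^ i < 2 * (F * M)" if "i < J" for i
    using not_less_Least[of i "\<lambda>j. 2 * (F * M) \<le> 2 ^ j"] that unfolding J_def by simp
  show 3: "1 \<le> J"
  proof (rule ccontr)
    assume "\<not> 1 \<le> J"
    then have "J = 0" by simp
    with 1 Y1 show False by simp
  qed
  have "2 ^ J = 2 * (2::int) ^ (J - 1)" using 3 by (cases J) auto
  then show "2 ^ J < 4 * (F * M)" using 2[of "J - 1"] 3 by simp
qed

lemma x1: "1 \<le> x" "k = 2 * x - 1" "1 \<le> k" "k \<le> n" "x \<le> n div 140 + 1" "x \<le> (q * q + 6) div 7"
proof -
  have "4 * 4 \<le> q * q" using q(1) by (intro mult_le_mono) auto
  then show "1 \<le> x" by (auto simp: x_def)
  then show "k = 2 * x - 1" "1 \<le> k" by (simp_all add: k_def)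
  show x: "x \<le> n div 140 + 1" "x \<le> (q * q + 6) div 7" by (simp_all add: x_def)
  then show "k \<le> n" using n16 by (simp add: k_def)
qed

lemma Nb_bounds: "real x * lam powr (real n / real x) < real Nb + 1" "real Nb \<le> real x * lam powr (real n / real x)"
proof -
  have "0 \<le> real x * lam powr (real n / real x)" by simp
  then show "real x * lam powr (real n / real x) < real Nb + 1" "real Nb \<le> real x * lam powr (real n / real x)"
    unfolding Nb_def by linarith+
qed

lemma b_bounds: "(2 * int n + 4) * G ^ (J + 1) \<le> b" "int (5 ^ n * (2 * (Nb + 1)) ^ (2 * k)) \<le> b"
  "G ^ (J + 1) \<le> b" "(2 * int n + 4) * G \<le> b" "int n * P * P \<le> b" "G \<le> b" "int n \<le> b" "1 \<le> b" "P \<le> b" "Y \<le> b"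
  "F * M \<le> b" "M \<le> b" "int (n * n) \<le> b"
proof -
  have GJ: "1 \<le> G ^ (J + 1)" using PG by (intro one_le_power) auto
  have 0: "0 \<le> (2 * int n + 4) * G ^ (J + 1)" using GJ by simp
  show 1: "(2 * int n + 4) * G ^ (J + 1) \<le> b" "int (5 ^ n * (2 * (Nb + 1)) ^ (2 * k)) \<le> b"
    unfolding b_def using 0 by simp_all
  have "1 * G ^ (J + 1) \<le> (2 * int n + 4) * G ^ (J + 1)" using GJ by (intro mult_right_mono) auto
  then show 2: "G ^ (J + 1) \<le> b" using 1 by linarith
  have "G ^ 1 \<le> G ^ (J + 1)" using PG by (intro power_increasing) auto
  then have G: "G \<le> G ^ (J + 1)" by simp
  then show "G \<le> b" using 2 by linarith
  have "(2 * int n + 4) * G \<le> (2 * int n + 4) * G ^ (J + 1)" using G by (intro mult_left_mono) auto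
  then show 3: "(2 * int n + 4) * G \<le> b" using 1 by linarith
  have "int n * (P * P) \<le> (2 * int n + 4) * G" using PG by (intro mult_mono) auto
  then show "int n * P * P \<le> b" using 3 by (simp add: mult.assoc)
  show Pb: "P \<le> b" using \<open>G \<le> b\<close> PG by linarith
  then show Yb: "Y \<le> b" using PG by linarith
  then show "F * M \<le> b" "M \<le> b" using Y1 by linarith+
  then show "int n \<le> b" "1 \<le> b" using nM by linarith+
  have "int n * int n \<le> M * M" using nM by (intro mult_mono) auto
  also have "\<dots> \<le> F * M * M" using Y1 nM by (intro mult_right_mono) auto
  finally show "int (n * n) \<le> b" using Yb unfolding Y_def by simp
qed

lemma image_bound: assumes "\<forall>i<n. \<bar>real_of_int (u i)\<bar> \<le> t" "r < n"
  shows "\<bar>real_of_int (image n A u r)\<bar> \<le> of_int (F * M) * t"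
proof -
  have t: "0 \<le> t" using assms(1) n16 by (metis abs_ge_zero not_numeral_le_zero order_trans not_gr_zero)
  have "\<bar>real_of_int (image n A u r)\<bar> \<le> (\<Sum>c<n. \<bar>real_of_int (A r c * u c)\<bar>)"
    unfolding image_def of_int_sum by (rule sum_abs)
  also have "\<dots> \<le> (\<Sum>c<n. of_int (F * m) * t)"
  proof (rule sum_mono)
    fix c assume c: "c \<in> {..<n}"
    have "\<bar>A r c\<bar> \<le> F * m" using abs_a[OF assms(2), of c] c F64 by (simp add: A_def abs_mult mult_left_mono)
    then have "\<bar>real_of_int (A r c)\<bar> \<le> of_int (F * m)" by linarith
    moreover have "0 \<le> real_of_int (F * m)" using F64 m1 by simp
    ultimately show "\<bar>real_of_int (A r c * u c)\<bar> \<le> of_int (F * m) * t"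
      using assms(1) c unfolding of_int_mult abs_mult by (intro mult_mono) auto
  qed
  also have "\<dots> = of_int (F * M) * t" by (simp add: M_def)
  finally show ?thesis .
qed

lemma image_L2: assumes "\<forall>i<n. \<bar>real_of_int (u i)\<bar> \<le> t"
  shows "L2_set (\<lambda>r. real_of_int (image n A u r)) {..<n} \<le> t * of_int Y"
proof -
  have t: "0 \<le> t" using assms(1) n16 by (metis abs_ge_zero not_numeral_le_zero order_trans not_gr_zero)
  have "L2_set (\<lambda>r. real_of_int (image n A u r)) {..<n} \<le> (\<Sum>r<n. \<bar>real_of_int (image n A u r)\<bar>)"
    by (rule L2_set_le_sum_abs)
  also have "\<dots> \<le> (\<Sum>r<n. of_int (F * M) * t)" by (intro sum_mono image_bound[OF assms]) auto
  also have "\<dots> = of_int (int n) * (of_int (F * M) * t)" by simp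
  also have "\<dots> \<le> of_int M * (of_int (F * M) * t)"
    using nM(1) t Y1(6) by (intro mult_right_mono) (auto simp del: of_int_mult)
  also have "\<dots> = t * of_int Y" by (simp add: Y_def)
  finally show ?thesis .
qed

end

locale svp_instance = svp_input +
  assumes indep: "\<And>u. u \<in> ivecs n \<Longrightarrow> u \<noteq> vzero \<Longrightarrow> \<exists>r<n. image n a u r \<noteq> 0"
begin

lemma image_A: "image n A u r = F * image n a u r"
  by (simp add: image_def A_def sum_distrib_left mult.assoc)

lemma sqn_A: "sqn n A u = F\<^sup>2 * sqn n a u"
  by (simp add: sqn_def image_A power_mult_distrib sum_distrib_left)

lemma sqn_a_pos: assumes "u \<in> ivecs n" "u \<noteq> vzero" shows "1 \<le> sqn n a u"
proof -
  obtain r where r: "r < n" "image n a u r \<noteq> 0" using indep[OF assms] by blast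
  have "(image n a u r)\<^sup>2 \<le> sqn n a u" unfolding sqn_def using r by (intro member_le_sum) auto
  moreover have "(image n a u r)\<^sup>2 > 0" using r by simp
  ultimately show ?thesis by linarith
qed

sublocale sieve n k J Nb A P G b Y x
proof
  show "(4 * int n + 4) * 2 ^ J * Y * 2 < P"
  proof -
    have FM: "0 < F * M" using Y1 by linarith
    have "(4 * int n + 4) * 2 ^ J \<le> (8 * M) * 2 ^ J" using nM by (intro mult_right_mono) auto
    also have "\<dots> < (8 * M) * (4 * (F * M))" using nM J(4) by (intro mult_strict_left_mono) auto
    also have "\<dots> = 32 * Y" by (simp add: Y_def mult_ac)
    finally have "(4 * int n + 4) * 2 ^ J * Y < 32 * Y * Y" using Y1 by (intro mult_strict_right_mono) auto
    then show ?thesis by (simp add: P_def mult_ac)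
  qed
  show "real x * (1 + 2 * (real x * (321/256)) / (63/256)) powr (real n / real x) < real Nb + 1"
    using Nb_bounds(1) unfolding lam_def .
  show "L2_set (\<lambda>r. real_of_int (image n A u r)) {..<n} \<le> t * of_int Y"
    if "\<forall>i<n. \<bar>real_of_int (u i)\<bar> \<le> t" for u t using that by (rule image_L2)
  show "0 < sqn n A u" if "u \<in> ivecs n" "u \<noteq> vzero" for u
  proof -
    have "0 < F\<^sup>2 * sqn n a u" using F64 sqn_a_pos[OF that] by (intro mult_pos_pos) auto
    then show ?thesis by (simp add: sqn_A)
  qed
qed (use n16 x1 PG Y1 b_bounds G_def in auto)

section \<open>Correctness of the preparation and of the output\<close>

definition input_ok :: "state \<Rightarrow> bool" where
  "input_ok s \<longleftrightarrow> s 0 0 = int n \<and> s 0 1 = int q \<and> (\<forall>i<n * n. s aNum i = num i \<and> s aDen i = den i)"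

lemma input_same: "input_ok s \<Longrightarrow> same X s s' \<Longrightarrow> X \<inter> {0, aNum, aDen} = {} \<Longrightarrow> input_ok s'"
  unfolding input_ok_def same_def by (metis disjoint_insert(2))

lemma init_scale_spec:
  assumes s: "I s" "input_ok s"
  shows "wp I init_scale (n * n * 7 + 10) (\<lambda>s'. same {rD, rM, rI} s s' \<and> s' rD 0 = D \<and> s' rM 0 = M) s"
  unfolding init_scale_def
proof (rule wp_seq')
  let ?R = "\<lambda>s'. same {rD, rM} s s' \<and> s' rD 0 = 1 \<and> s' rM 0 = int n"
  show "wp I (Seq (Assign rD (Const 1)) (Assign rM cN)) 3 ?R s"
    by (rule wp_vc[OF s(1)]) (use s(2) b_bounds in \<open>auto simp: state_simps lens_def input_ok_def\<close>)
  fix s1 assume s1: "I s1" "?R s1"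
  let ?f = "\<lambda>i. den i * (\<bar>num i\<bar> + 1)"
  let ?V = "\<lambda>i s'. i \<le> n * n \<and> same {rD, rM, rI} s s' \<and> s' rI 0 = int i \<and>
    s' rD 0 = prod den {..<i} \<and> s' rM 0 = int n * prod ?f {..<i}"
  show "wp I (For rI (Times cN cN) (Seq (Assign rD (Times (Var rD) (Cell aDen (Var rI))))
      (Assign rM (Times (Var rM) (Times (Cell aDen (Var rI)) (Plus (absE (Cell aNum (Var rI))) (Const 1)))))))
    (n * n * 7 + 3) (\<lambda>s'. same {rD, rM, rI} s s' \<and> s' rD 0 = D \<and> s' rM 0 = M) s1"
  proof (rule for_rule[where V = ?V and N = "n * n" and ?T1.0 = 3, OF s1(1) _ _ b_bounds(13)])
    have sm1: "same {rD, rM, rI} s s1" using s1(2) by (auto simp: same_def)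
    show "?V 0 (store_at s1 rI 0 0)" using s1(2) sm1 by (simp add: state_simps)
    show "aval (Times cN cN) s' = int (n * n)" if V: "?V i s'" for i s'
    proof -
      have "same {rD, rM, rI} s s'" using V by blast
      from same_reg[OF this, of 0 0] s(2) show ?thesis by (simp add: input_ok_def)
    qed
    show "wp I (Seq (Assign rD (Times (Var rD) (Cell aDen (Var rI))))
        (Assign rM (Times (Var rM) (Times (Cell aDen (Var rI)) (Plus (absE (Cell aNum (Var rI))) (Const 1)))))) 3
        (\<lambda>s'. s' rI 0 = int i \<and> ?V (Suc i) (store_at s' rI 0 (int (Suc i)))) s2"
      if i: "i < n * n" and V: "?V i s2" and I2: "I s2" for i s2
    proof (rule wp_vc[OF I2])
      have V': "same {rD, rM, rI} s s2" "s2 rI 0 = int i" "s2 rD 0 = prod den {..<i}" "s2 rM 0 = int n * prod ?f {..<i}"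
        using V by blast+
      have dn: "s2 aDen i = den i" "s2 aNum i = num i"
        using input_same[OF s(2) V'(1)] i by (auto simp: input_ok_def)
      have Db: "\<bar>prod den {..<Suc i}\<bar> \<le> b"
      proof -
        have "1 \<le> prod den {..<Suc i}" by (rule prod_le_prod(2)[OF den order.refl])
        moreover have "prod den {..<Suc i} \<le> D" unfolding D_def by (rule prod_le_prod(1)[OF den]) (use i in simp)
        moreover have "D \<le> m"
        proof -
          have "0 \<le> den i \<and> den i \<le> ?f i" for i
          proof -
            have "den i * 1 \<le> ?f i" using den[of i] by (intro mult_left_mono) auto
            then show ?thesis using den[of i] by simp
          qed
          then show ?thesis unfolding D_def m_def by (intro prod_mono) auto
        qed
        ultimately show ?thesis using nM(3) b_bounds(12) by linarith
      qed
      have Mb: "\<bar>int n * prod ?f {..<Suc i}\<bar> \<le> b"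
      proof -
        have 1: "1 \<le> prod ?f {..<Suc i}" by (rule prod_le_prod(2)[OF factor1 order.refl])
        have "prod ?f {..<Suc i} \<le> m" unfolding m_def by (rule prod_le_prod(1)[OF factor1]) (use i in simp)
        then have "int n * prod ?f {..<Suc i} \<le> M" unfolding M_def by (intro mult_left_mono) auto
        moreover have "0 \<le> int n * prod ?f {..<Suc i}" using 1 by simp
        ultimately show ?thesis using b_bounds(12) by linarith
      qed
      have a1: "aval (Times (Var rD) (Cell aDen (Var rI))) s2 = prod den {..<Suc i}"
        using V'(2,3) dn by simp
      have a2: "aval (Times (Var rM) (Times (Cell aDen (Var rI)) (Plus (absE (Cell aNum (Var rI))) (Const 1))))
          (store_at s2 rD 0 y) = int n * prod ?f {..<Suc i}" for y
        using V'(2,4) dn by (simp add: store_at_apply)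
      show "vc b (lens n Nb) (Seq (Assign rD (Times (Var rD) (Cell aDen (Var rI))))
        (Assign rM (Times (Var rM) (Times (Cell aDen (Var rI)) (Plus (absE (Cell aNum (Var rI))) (Const 1))))))
        (\<lambda>s'. s' rI 0 = int i \<and> ?V (Suc i) (store_at s' rI 0 (int (Suc i)))) s2"
        unfolding vc.simps a1 aval.simps(1) a2 using Db Mb V'(1,2) i
        by (simp add: lens_def state_simps del: of_nat_Suc prod.lessThan_Suc)
    qed simp
    show "same {rD, rM, rI} s s' \<and> s' rD 0 = D \<and> s' rM 0 = M" if "?V (n * n) s'" for s'
      using that by (simp add: D_def M_def m_def)
  qed simp_all
qed simp

lemma init_factor_spec:
  assumes s: "I s" "input_ok s" "s rM 0 = M"
  shows "wp I init_factor (n * 5 + 20) (\<lambda>s'. same {rF, rI} s s' \<and> s' rF 0 = F) s"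
  unfolding init_factor_def
proof (rule wp_seq')
  let ?R = "\<lambda>s'. same {rF} s s' \<and> s' rF 0 = 64"
  have 64: "64 \<le> b" using PG(3) b_bounds(9) by linarith
  show "wp I (Assign rF (Const 64)) 1 ?R s"
    by (rule wp_vc[OF s(1)]) (use 64 in \<open>auto simp: state_simps lens_def\<close>)
  fix s1 assume s1: "I s1" "?R s1"
  let ?V = "\<lambda>i s'. i \<le> n + 1 \<and> same {rF, rI} s s' \<and> s' rI 0 = int i \<and> s' rF 0 = 64 * M ^ i"
  show "wp I (For rI (Plus cN (Const 1)) (Assign rF (Times (Var rF) (Var rM)))) ((n + 1) * 5 + 3)
    (\<lambda>s'. same {rF, rI} s s' \<and> s' rF 0 = F) s1"
  proof (rule for_rule[where V = ?V and N = "n + 1" and ?T1.0 = 1, OF s1(1)])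
    show "int (n + 1) \<le> b" using b_bounds(4) PG(5) k1 b0(4) by linarith
    have sm1: "same {rF, rI} s s1" using s1(2) by (auto simp: same_def)
    show "?V 0 (store_at s1 rI 0 0)" using s1(2) sm1 by (simp add: state_simps)
    show "aval (Plus cN (Const 1)) s' = int (n + 1)" if V: "?V i s'" for i s'
    proof -
      have "same {rF, rI} s s'" using V by blast
      from same_reg[OF this, of 0 0] s(2) show ?thesis by (simp add: input_ok_def)
    qed
    show "wp I (Assign rF (Times (Var rF) (Var rM))) 1 (\<lambda>s'. s' rI 0 = int i \<and> ?V (Suc i) (store_at s' rI 0 (int (Suc i)))) s2"
      if i: "i < n + 1" and V: "?V i s2" and I2: "I s2" for i s2
    proof (rule wp_vc[OF I2])
      have V': "same {rF, rI} s s2" "s2 rI 0 = int i" "s2 rF 0 = 64 * M ^ i" using V by blast+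
      have a1: "aval (Times (Var rF) (Var rM)) s2 = 64 * M ^ Suc i"
        using V'(3) same_reg[OF V'(1), of rM 0] s(3) by simp
      have "64 * M ^ Suc i \<le> F" unfolding F_def using nM i by (intro mult_left_mono power_increasing) auto
      moreover have "0 \<le> 64 * M ^ Suc i" using nM by simp
      ultimately have bd: "\<bar>64 * M ^ Suc i\<bar> \<le> b" using Y1(2) b_bounds(10) by linarith
      show "vc b (lens n Nb) (Assign rF (Times (Var rF) (Var rM)))
          (\<lambda>s'. s' rI 0 = int i \<and> ?V (Suc i) (store_at s' rI 0 (int (Suc i)))) s2"
        unfolding vc.simps a1 aval.simps(1) using bd V'(1,2) i
        by (simp add: lens_def state_simps del: of_nat_Suc power_Suc)
    qed simp
    show "same {rF, rI} s s' \<and> s' rF 0 = F" if "?V (n + 1) s'" for s'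
      using that by (simp add: F_def)
  qed simp_all
qed simp

lemma init_base_spec:
  assumes s: "I s" "input_ok s" "s rM 0 = M" "s rF 0 = F"
  shows "wp I init_base (n * 7 + 20) (\<lambda>s'. same {rY, rP, rPn, rC5, rG, rI} s s' \<and> s' rY 0 = Y \<and> s' rP 0 = P \<and>
    s' rPn 0 = P ^ n \<and> s' rC5 0 = 5 ^ n \<and> s' rG 0 = G) s"
  unfolding init_base_def
proof (rule wp_seq')
  let ?R = "\<lambda>s'. same {rY, rP, rPn, rC5} s s' \<and> s' rY 0 = Y \<and> s' rP 0 = P \<and> s' rPn 0 = 1 \<and> s' rC5 0 = 1"
  have a1: "aval (Times (Times (Var rF) (Var rM)) (Var rM)) s = Y" using s(3,4) by (simp add: Y_def)
  have a2: "aval (Times (Const 64) (Times (Var rY) (Var rY))) (store_at s rY 0 Y) = P" by (simp add: store_at_apply P_def)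
  have bd: "\<bar>Y\<bar> \<le> b" "\<bar>P\<bar> \<le> b" "1 \<le> b" using Y1(4) PG(2) b_bounds(8-10) by linarith+
  show "wp I (Seq (Assign rY (Times (Times (Var rF) (Var rM)) (Var rM)))
        (Seq (Assign rP (Times (Const 64) (Times (Var rY) (Var rY)))) (Seq (Assign rPn (Const 1)) (Assign rC5 (Const 1))))) 7 ?R s"
  proof (rule wp_vc[OF s(1)])
    show "vc b (lens n Nb) (Seq (Assign rY (Times (Times (Var rF) (Var rM)) (Var rM)))
        (Seq (Assign rP (Times (Const 64) (Times (Var rY) (Var rY)))) (Seq (Assign rPn (Const 1)) (Assign rC5 (Const 1))))) ?R s"
      unfolding vc.simps a1 aval.simps(1) a2 using bd by (simp add: state_simps lens_def)
  qed simp
  fix s1 assume s1: "I s1" "?R s1"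
  have sm1: "same {rY, rP, rPn, rC5} s s1" using s1(2) by blast
  let ?Q = "\<lambda>s'. same {rY, rP, rPn, rC5, rG, rI} s s' \<and> s' rY 0 = Y \<and> s' rP 0 = P \<and>
    s' rPn 0 = P ^ n \<and> s' rC5 0 = 5 ^ n \<and> s' rG 0 = G"
  let ?V = "\<lambda>i s'. i \<le> n \<and> same {rPn, rC5, rI} s1 s' \<and> s' rI 0 = int i \<and> s' rPn 0 = P ^ i \<and> s' rC5 0 = 5 ^ i"
  let ?body = "Seq (Assign rPn (Times (Var rPn) (Var rP))) (Assign rC5 (Times (Var rC5) (Const 5)))"
  show "wp I (Seq (For rI cN ?body) (Assign rG (Times (Var rPn) (Var rPn)))) (n * 7 + 3 + 1 + 1) ?Q s1"
  proof (rule wp_seq'[where R = "?V n", OF _ _ order.refl])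
    show "wp I (For rI cN ?body) (n * 7 + 3) (?V n) s1"
    proof (rule for_rule[where V = ?V and N = n and ?T1.0 = 3, OF s1(1) _ _ b_bounds(7)])
      show "?V 0 (store_at s1 rI 0 0)" using s1(2) by (simp add: state_simps)
      show "aval cN s' = int n" if V: "?V i s'" for i s'
      proof -
        have "same {rPn, rC5, rI} s1 s'" using V by blast
        from same_reg[OF this, of 0 0] same_reg[OF sm1, of 0 0] s(2) show ?thesis by (simp add: input_ok_def)
      qed
      show "wp I ?body 3 (\<lambda>s'. s' rI 0 = int i \<and> ?V (Suc i) (store_at s' rI 0 (int (Suc i)))) s2"
        if i: "i < n" and V: "?V i s2" and I2: "I s2" for i s2
      proof (rule wp_vc[OF I2])
        have V': "same {rPn, rC5, rI} s1 s2" "s2 rI 0 = int i" "s2 rPn 0 = P ^ i" "s2 rC5 0 = 5 ^ i" using V by blast+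
        have a1: "aval (Times (Var rPn) (Var rP)) s2 = P ^ Suc i"
          using V'(3) same_reg[OF V'(1), of rP 0] s1(2) by simp
        have a2: "aval (Times (Var rC5) (Const 5)) (store_at s2 rPn 0 y) = 5 ^ Suc i" for y
          using V'(4) by (simp add: store_at_apply)
        have b1: "\<bar>P ^ Suc i\<bar> \<le> b"
        proof -
          have "P ^ Suc i \<le> G" unfolding G_def using PG(2) i by (intro power_increasing) auto
          moreover have "0 \<le> P ^ Suc i" using PG(2) by simp
          ultimately show ?thesis using b_bounds(6) by linarith
        qed
        have b2: "\<bar>(5::int) ^ Suc i\<bar> \<le> b"
        proof -
          have "(5::nat) ^ Suc i \<le> 5 ^ n" using i by (intro power_increasing) auto
          then have "int (5 ^ Suc i) \<le> b" using power_bound[of 1 0 "5 ^ Suc i"] by simp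
          then show ?thesis by simp
        qed
        show "vc b (lens n Nb) ?body (\<lambda>s'. s' rI 0 = int i \<and> ?V (Suc i) (store_at s' rI 0 (int (Suc i)))) s2"
          unfolding vc.simps a1 aval.simps(1) a2 using b1 b2 V'(1,2) i
          by (simp add: lens_def state_simps del: of_nat_Suc power_Suc)
      qed simp
      show "?V n s'" if "?V n s'" for s' using that .
    qed simp_all
    fix s2 assume s2: "I s2" "?V n s2"
    have sm2: "same {rPn, rC5, rI} s1 s2" using s2(2) by blast
    have sm: "same {rY, rP, rPn, rC5, rG, rI} s s2" by (rule same_trans[OF sm1 sm2]) auto
    have vals: "s2 rY 0 = Y" "s2 rP 0 = P" using same_reg[OF sm2, of rY 0] same_reg[OF sm2, of rP 0] s1(2) by simp_all
    have a: "aval (Times (Var rPn) (Var rPn)) s2 = G"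
      using s2(2) by (simp add: G_def mult_2 power_add)
    have Gb: "\<bar>G\<bar> \<le> b" using PG(5) b_bounds(6) by linarith
    show "wp I (Assign rG (Times (Var rPn) (Var rPn))) 1 ?Q s2"
    proof (rule wp_vc[OF s2(1)])
      show "vc b (lens n Nb) (Assign rG (Times (Var rPn) (Var rPn))) ?Q s2"
        unfolding vc.simps a aval.simps(1) using Gb sm vals s2(2) by (simp add: lens_def state_simps)
    qed simp
  qed
qed simp

lemma init_top_spec:
  assumes s: "I s" "s rM 0 = M" "s rF 0 = F" "s rG 0 = G"
  shows "wp I init_top (J * 5 + 20) (\<lambda>s'. same {rRT, rPT} s s' \<and> s' rRT 0 = 2 ^ J \<and> s' rPT 0 = G ^ J) s"
  unfolding init_top_def
proof (rule wp_seq')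
  let ?R = "\<lambda>s'. same {rRT, rPT} s s' \<and> s' rRT 0 = 1 \<and> s' rPT 0 = 1"
  show "wp I (Seq (Assign rRT (Const 1)) (Assign rPT (Const 1))) 3 ?R s"
    by (rule wp_vc[OF s(1)]) (use b_bounds(8) in \<open>auto simp: state_simps lens_def\<close>)
  fix s1 assume s1: "I s1" "?R s1"
  let ?e = "Less (Var rRT) (Times (Const 2) (Times (Var rF) (Var rM)))"
  let ?body = "Seq (Assign rRT (Times (Const 2) (Var rRT))) (Assign rPT (Times (Var rPT) (Var rG)))"
  let ?Q = "\<lambda>s'. same {rRT, rPT} s s' \<and> s' rRT 0 = 2 ^ J \<and> s' rPT 0 = G ^ J"
  let ?V = "\<lambda>r s'. r \<le> J \<and> same {rRT, rPT} s s' \<and> s' rRT 0 = 2 ^ (J - r) \<and> s' rPT 0 = G ^ (J - r)"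
  have cond: "aval ?e s' \<noteq> 0 \<longleftrightarrow> r > 0" if V: "?V r s'" for r s'
  proof -
    have sm: "same {rRT, rPT} s s'" "s' rRT 0 = 2 ^ (J - r)" "r \<le> J" using V by blast+
    have "aval ?e s' \<noteq> 0 \<longleftrightarrow> 2 ^ (J - r) < 2 * (F * M)"
      using sm(2) same_reg[OF sm(1), of rF 0] same_reg[OF sm(1), of rM 0] s(2,3) by simp
    also have "\<dots> \<longleftrightarrow> r > 0"
    proof (cases "r > 0")
      case True
      then have "J - r < J" using sm(3) by simp
      then show ?thesis using J(2) True by simp
    next
      case False
      then show ?thesis using J(1) by simp
    qed
    finally show ?thesis .
  qed
  show "wp I (While ?e ?body) (J * 5 + 1) ?Q s1"
  proof (rule wp_while[where V = ?V and N = J and ?T1.0 = 3])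
    show "?V J s1" using s1(2) by simp
    show "r > 0 \<and> wp I ?body 3 (?V (r - 1)) s2" if V: "?V r s2" and I2: "I s2" and c: "aval ?e s2 \<noteq> 0" for r s2
    proof
      show r: "r > 0" using cond[OF V] c by blast
      have V': "r \<le> J" "same {rRT, rPT} s s2" "s2 rRT 0 = 2 ^ (J - r)" "s2 rPT 0 = G ^ (J - r)" using V by blast+
      have Jr: "J - (r - 1) = Suc (J - r)" using r V'(1) by simp
      have a1: "aval (Times (Const 2) (Var rRT)) s2 = 2 ^ Suc (J - r)" using V'(3) by simp
      have a2: "aval (Times (Var rPT) (Var rG)) (store_at s2 rRT 0 y) = G ^ Suc (J - r)" for y
        using V'(4) same_reg[OF V'(2), of rG 0] s(4) by (simp add: store_at_apply)
      have b1: "\<bar>(2::int) ^ Suc (J - r)\<bar> \<le> b"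
      proof -
        have "(2::int) ^ (J - r) < 2 * (F * M)" by (rule J(2)) (use r V'(1) in simp)
        moreover have "4 * (F * M) \<le> P"
        proof -
          have "4 * (F * M) \<le> 64 * Y * 1" using Y1 by simp
          also have "\<dots> \<le> 64 * Y * Y" using Y1 by (intro mult_left_mono) auto
          finally show ?thesis by (simp add: P_def mult.assoc)
        qed
        ultimately have "(2::int) ^ Suc (J - r) \<le> b" using b_bounds(9) by simp
        then show ?thesis by simp
      qed
      have b2: "\<bar>G ^ Suc (J - r)\<bar> \<le> b"
      proof -
        have "G ^ Suc (J - r) \<le> G ^ (J + 1)" using PG(5) by (intro power_increasing) auto
        moreover have "0 \<le> G ^ Suc (J - r)" using PG(5) by simp
        ultimately show ?thesis using b_bounds(3) by linarith
      qed
      show "wp I ?body 3 (?V (r - 1)) s2"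
      proof (rule wp_vc[OF I2])
        show "vc b (lens n Nb) ?body (?V (r - 1)) s2"
          unfolding vc.simps a1 aval.simps(1) a2 Jr using b1 b2 V'(1,2)
          by (simp add: lens_def state_simps del: power_Suc)
      qed simp
    qed
    show "?Q s2" if V: "?V r s2" and "I s2" and c: "aval ?e s2 = 0" for r s2
    proof -
      have "r = 0" using cond[OF V] c by simp
      then show ?thesis using V by simp
    qed
  qed (use s1 in auto)
qed simp

lemma init_units_spec:
  assumes s: "I s" "input_ok s" "s rF 0 = F" "s rD 0 = D" "s rP 0 = P" "s rPn 0 = P ^ n"
  shows "wp I init_units (n * (n * 7 + 20) + 10)
    (\<lambda>s'. same {rPi, rAcc, rPr, rRow, rI, aE} s s' \<and> (\<forall>c<n. s' aE c = unit_pk n A P c)) s"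
  unfolding init_units_def
proof (rule wp_seq')
  let ?X = "{rPi, rAcc, rPr, rRow, rI, aE}"
  let ?R = "\<lambda>s'. same {rPi} s s' \<and> s' rPi 0 = 1"
  show "wp I (Assign rPi (Const 1)) 1 ?R s"
    by (rule wp_vc[OF s(1)]) (use b_bounds(8) in \<open>auto simp: state_simps lens_def\<close>)
  fix s1 assume s1: "I s1" "?R s1"
  have Pb: "\<bar>P ^ i\<bar> \<le> b" "\<bar>P ^ i\<bar> \<le> G" if "i \<le> 2 * n" for i
  proof -
    have "P ^ i \<le> G" unfolding G_def using PG(2) that by (intro power_increasing) auto
    moreover have "0 \<le> P ^ i" using PG(2) by simp
    ultimately show "\<bar>P ^ i\<bar> \<le> b" "\<bar>P ^ i\<bar> \<le> G" using b_bounds(6) by auto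
  qed
  let ?V = "\<lambda>c s'. c \<le> n \<and> same ?X s s' \<and> s' rI 0 = int c \<and> s' rPi 0 = P ^ c \<and> (\<forall>i<c. s' aE i = unit_pk n A P i)"
  show "wp I (For rI cN
      (Seq (Seq (Assign rAcc (Var rPi)) (Assign rPr (Var rPn)))
      (Seq (For rRow cN init_row)
        (Seq (Store aE (Var rI) (Var rAcc)) (Assign rPi (Times (Var rPi) (Var rP))))))) (n * (n * 7 + 3 + 3 + 3 + 2 + 4) + 3)
      (\<lambda>s'. same ?X s s' \<and> (\<forall>c<n. s' aE c = unit_pk n A P c)) s1"
  proof (rule for_rule[where V = ?V and N = n and ?T1.0 = "n * 7 + 3 + 3 + 3 + 2", OF s1(1) _ _ b_bounds(7)])
    have sm1: "same ?X s s1" using s1(2) by (auto simp: same_def)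
    show "?V 0 (store_at s1 rI 0 0)" using s1(2) sm1 by (simp add: state_simps)
    show "aval cN s' = int n" if V: "?V c s'" for c s'
    proof -
      have "same ?X s s'" using V by blast
      from same_reg[OF this, of 0 0] s(2) show ?thesis by (simp add: input_ok_def)
    qed
    fix c s2 assume c: "c < n" and V: "?V c s2" and I2: "I s2"
    have V': "same ?X s s2" "s2 rI 0 = int c" "s2 rPi 0 = P ^ c" "\<And>i. i < c \<Longrightarrow> s2 aE i = unit_pk n A P i" using V by blast+
    let ?Q = "\<lambda>s'. s' rI 0 = int c \<and> ?V (Suc c) (store_at s' rI 0 (int (Suc c)))"
    show "wp I (Seq (Seq (Assign rAcc (Var rPi)) (Assign rPr (Var rPn)))
      (Seq (For rRow cN init_row)
        (Seq (Store aE (Var rI) (Var rAcc)) (Assign rPi (Times (Var rPi) (Var rP))))))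
        (n * 7 + 3 + 3 + 3 + 2) ?Q s2"
    proof (rule wp_seq')
      let ?R3 = "\<lambda>s'. same {rAcc, rPr} s2 s' \<and> s' rAcc 0 = P ^ c \<and> s' rPr 0 = P ^ n"
      have Pn2: "s2 rPn 0 = P ^ n" using same_reg[OF V'(1), of rPn 0] s(6) by simp
      show "wp I (Seq (Assign rAcc (Var rPi)) (Assign rPr (Var rPn))) 3 ?R3 s2"
        by (rule wp_vc[OF I2]) (use V'(3) Pn2 Pb[of c] Pb[of n] c in \<open>auto simp: state_simps lens_def\<close>)
      fix s3 assume s3: "I s3" "?R3 s3"
      have sm23: "same {rAcc, rPr} s2 s3" using s3(2) by blast
      have sm3: "same ?X s s3" by (rule same_trans[OF V'(1) sm23]) auto
      let ?W = "\<lambda>r s'. r \<le> n \<and> same {rAcc, rPr, rRow} s2 s' \<and> s' rRow 0 = int r \<and>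
        s' rAcc 0 = P ^ c + (\<Sum>r'<r. A r' c * P ^ (n + r')) \<and> s' rPr 0 = P ^ (n + r) \<and> \<bar>s' rAcc 0\<bar> \<le> (1 + int r) * G"
      show "wp I (Seq (For rRow cN init_row)
        (Seq (Store aE (Var rI) (Var rAcc)) (Assign rPi (Times (Var rPi) (Var rP))))) (n * 7 + 3 + 3 + 1) ?Q s3"
      proof (rule wp_seq'[where R = "?W n", OF _ _ order.refl])
        show "wp I (For rRow cN init_row) (n * 7 + 3) (?W n) s3"
        proof (rule for_rule[where V = ?W and N = n and ?T1.0 = 3, OF s3(1) _ _ b_bounds(7)])
          have sm23': "same {rAcc, rPr, rRow} s2 s3" using sm23 by (auto simp: same_def)
          show "?W 0 (store_at s3 rRow 0 0)" using s3(2) sm23' Pb(2)[of c] c by (simp add: state_simps)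
          show "aval cN s' = int n" if W: "?W r s'" for r s'
          proof -
            have "same {rAcc, rPr, rRow} s2 s'" using W by blast
            from same_reg[OF this, of 0 0] same_reg[OF V'(1), of 0 0] s(2) show ?thesis by (simp add: input_ok_def)
          qed
          show "wp I init_row 3 (\<lambda>s'. s' rRow 0 = int r \<and> ?W (Suc r) (store_at s' rRow 0 (int (Suc r)))) s4"
            if r: "r < n" and W: "?W r s4" and I4: "I s4" for r s4
          proof (rule wp_vc[OF I4])
            have W': "same {rAcc, rPr, rRow} s2 s4" "s4 rRow 0 = int r" "s4 rAcc 0 = P ^ c + (\<Sum>r'<r. A r' c * P ^ (n + r'))"
                "s4 rPr 0 = P ^ (n + r)" "\<bar>s4 rAcc 0\<bar> \<le> (1 + int r) * G" using W by blast+
            have sm4: "same ?X s s4" by (rule same_trans[OF V'(1) W'(1)]) auto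
            have regs: "s4 rF 0 = F" "s4 rD 0 = D" "s4 rP 0 = P" "s4 rI 0 = int c" "s4 0 0 = int n"
              using same_reg[OF sm4, of rF 0] same_reg[OF sm4, of rD 0] same_reg[OF sm4, of rP 0]
                same_reg[OF W'(1), of rI 0] same_reg[OF sm4, of 0 0] s V'(2) by (simp_all add: input_ok_def)
            have ix: "n * c + r < n * n"
            proof -
              have "n * c + r < n * Suc c" using r by simp
              also have "\<dots> \<le> n * n" using c by (intro mult_left_mono) auto
              finally show ?thesis .
            qed
            have nd: "s4 aNum (n * c + r) = num (n * c + r)" "s4 aDen (n * c + r) = den (n * c + r)"
              using input_same[OF s(2) sm4] ix by (auto simp: input_ok_def)
            have nn: "nat (int n * int c + int r) = n * c + r" by (simp only: of_nat_mult[symmetric] of_nat_add[symmetric] nat_int)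
            have a1: "aval (Plus (Var rAcc) (Times (Times (Var rF)
                (Times (Cell aNum (Plus (Times cN (Var rI)) (Var rRow)))
                  (Div (Var rD) (Cell aDen (Plus (Times cN (Var rI)) (Var rRow)))))) (Var rPr))) s4 =
                P ^ c + (\<Sum>r'<Suc r. A r' c * P ^ (n + r'))"
              using W'(2-4) regs nd by (simp add: nn A_def a_def)
            have a2: "aval (Times (Var rPr) (Var rP)) (store_at s4 rAcc 0 y) = P ^ (n + Suc r)" for y
              using W'(4) regs by (simp add: store_at_apply)
            have Ab: "\<bar>A r c * P ^ (n + r)\<bar> \<le> G"
            proof -
              have "\<bar>A r c\<bar> \<le> F * m" using abs_a[OF r c] F64 by (simp add: A_def abs_mult mult_left_mono)
              also have "\<dots> \<le> F * M" using nM(3) F64 by (intro mult_left_mono) auto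
              also have "\<dots> \<le> P" using Y1(1) PG(1) by linarith
              finally have "\<bar>A r c\<bar> * \<bar>P ^ (n + r)\<bar> \<le> P * \<bar>P ^ (n + r)\<bar>" by (intro mult_right_mono) auto
              also have "\<dots> = \<bar>P ^ Suc (n + r)\<bar>" using PG(2) by (simp add: abs_mult)
              also have "\<dots> \<le> G" by (rule Pb(2)) (use r in simp)
              finally show ?thesis by (simp add: abs_mult)
            qed
            have vb: "\<bar>P ^ c + (\<Sum>r'<Suc r. A r' c * P ^ (n + r'))\<bar> \<le> (1 + int (Suc r)) * G"
            proof -
              have "(1 + int (Suc r)) * G = (1 + int r) * G + G" by (simp add: algebra_simps)
              moreover have "P ^ c + (\<Sum>r'<Suc r. A r' c * P ^ (n + r')) = s4 rAcc 0 + A r c * P ^ (n + r)"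
                using W'(3) by simp
              ultimately show ?thesis using W'(5) Ab by linarith
            qed
            have "(1 + int (Suc r)) * G \<le> (2 * int n + 4) * G" using r PG(5) by (intro mult_right_mono) auto
            then have vb2: "\<bar>P ^ c + (\<Sum>r'<Suc r. A r' c * P ^ (n + r'))\<bar> \<le> b" using vb b_bounds(4) by linarith
            have pb2: "\<bar>P ^ (n + Suc r)\<bar> \<le> b" by (rule Pb(1)) (use r in simp)
            show "vc b (lens n Nb) init_row (\<lambda>s'. s' rRow 0 = int r \<and> ?W (Suc r) (store_at s' rRow 0 (int (Suc r)))) s4"
              unfolding init_row_def vc.simps a1 aval.simps(1) a2 using vb vb2 pb2 W'(1,2) r
              by (simp add: lens_def state_simps del: of_nat_Suc sum.lessThan_Suc power_Suc add_Suc_right)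
          qed (simp add: init_row_def)
          show "?W n s'" if "?W n s'" for s' using that .
        qed simp_all
        fix s5 assume s5: "I s5" "?W n s5"
        have W': "same {rAcc, rPr, rRow} s2 s5" "s5 rAcc 0 = P ^ c + (\<Sum>r'<n. A r' c * P ^ (n + r'))"
            "\<bar>s5 rAcc 0\<bar> \<le> (1 + int n) * G" using s5(2) by blast+
        have sm5: "same ?X s s5" by (rule same_trans[OF V'(1) W'(1)]) auto
        have u: "s5 rAcc 0 = unit_pk n A P c" using W'(2) by (simp add: unit_pk_def)
        have regs: "s5 rP 0 = P" "s5 rI 0 = int c" "s5 rPi 0 = P ^ c"
          using same_reg[OF sm5, of rP 0] same_reg[OF W'(1), of rI 0] same_reg[OF W'(1), of rPi 0] s V'(2,3) by simp_all
        have E5: "s5 aE i = unit_pk n A P i" if "i < c" for i using same_reg[OF W'(1), of aE i] V'(4)[OF that] by simp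
        have ub: "\<bar>unit_pk n A P c\<bar> \<le> b"
        proof -
          have "(1 + int n) * G \<le> (2 * int n + 4) * G" using PG(5) by (intro mult_right_mono) auto
          then show ?thesis using W'(3) u b_bounds(4) by linarith
        qed
        have a1: "aval (Var rAcc) s5 = unit_pk n A P c" "aval (Var rI) s5 = int c" using u regs by simp_all
        have a2: "aval (Times (Var rPi) (Var rP)) (store_at s5 aE (int c) y) = P ^ Suc c" for y
          using regs by (simp add: store_at_apply)
        have pb: "\<bar>P ^ Suc c\<bar> \<le> b" by (rule Pb(1)) (use c in simp)
        obtain s6 where s6: "s6 = store_at (store_at s5 aE (int c) (unit_pk n A P c)) rPi 0 (P ^ Suc c)" by blast
        have sm6: "same ?X s s6" using sm5 by (simp add: s6 same_store)
        have E6: "s6 aE i = unit_pk n A P i" if "i < Suc c" for i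
          using that E5[of i] by (cases "i = c") (auto simp: s6 store_at_apply)
        have r6: "s6 rI 0 = int c" "s6 rPi 0 = P ^ Suc c" using regs by (simp_all add: s6 store_at_apply)
        have Q6: "?Q s6" using sm6 E6 r6 c by (simp add: state_simps del: of_nat_Suc power_Suc)
        show "wp I (Seq (Store aE (Var rI) (Var rAcc)) (Assign rPi (Times (Var rPi) (Var rP)))) 3 ?Q s5"
        proof (rule wp_vc[OF s5(1)])
          show "vc b (lens n Nb) (Seq (Store aE (Var rI) (Var rAcc)) (Assign rPi (Times (Var rPi) (Var rP)))) ?Q s5"
            unfolding vc.simps a1 a2 aval.simps(1) s6[symmetric] using Q6 ub pb c by (simp add: lens_def)
        qed simp
      qed
    qed simp
  next
    show "same ?X s s' \<and> (\<forall>c<n. s' aE c = unit_pk n A P c)" if "?V n s'" for s' using that by blast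
  qed simp_all
qed (simp add: algebra_simps)

lemma init_tuple_spec:
  assumes s: "I s" "input_ok s" "s rY 0 = Y"
  shows "wp I init_tuple 20 (\<lambda>s'. same {rX, rK, rS} s s' \<and> s' rK 0 = int k \<and> s' rS 0 = Y) s"
proof (rule wp_vc[OF s(1)])
  have nq: "s 0 0 = int n" "s 0 (Suc 0) = int q" using s(2) by (simp_all add: input_ok_def)
  have kx: "int k = 2 * int x - 1" using x1 by simp
  have xn: "int x \<le> int n" "1 \<le> int x" using x1(1,5) n16 by linarith+
  have Xdef: "int x = min ((int q * int q + 6) div 7) (int n div 140 + 1)"
    unfolding x_def by (simp add: zdiv_int of_nat_min)
  obtain X where X: "X = (int q * int q + 6) div 7" by blast
  obtain N where N: "N = int n div 140 + 1" by blast
  have Xb: "0 \<le> X" "X \<le> int n"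
  proof -
    have "int q * int q \<le> int n" using q(2) by (metis of_nat_le_iff of_nat_mult)
    moreover have "0 \<le> int q * int q" by simp
    ultimately show "0 \<le> X" "X \<le> int n" unfolding X using n16 by linarith+
  qed
  have Nb': "0 \<le> N" "N \<le> int n" unfolding N using n16 by linarith+
  have nb: "2 * int n + 4 \<le> b" by (rule b0(4))
  have Yb: "\<bar>Y\<bar> \<le> b" using Y1(4) b_bounds(10) by linarith
  have xm: "int x = (if N < X then N else X)" using Xdef X N by (simp add: min_def)
  have e1: "aval (Div (Plus (Times cQ cQ) (Const 6)) (Const 7)) s = X" using nq X by simp
  have e2: "aval (Plus (Div cN (Const 140)) (Const 1)) r = N" if "r 0 0 = int n" for r using that N by simp
  show "vc b (lens n Nb) init_tuple (\<lambda>s'. same {rX, rK, rS} s s' \<and> s' rK 0 = int k \<and> s' rS 0 = Y) s"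
  proof (cases "N < X")
    case True
    then show ?thesis
      unfolding init_tuple_def vc.simps e1 aval.simps(1) using Xb Nb' nb Yb nq s(3) xm kx xn
      by (simp add: state_simps lens_def N[symmetric])
  next
    case False
    then show ?thesis
      unfolding init_tuple_def vc.simps e1 aval.simps(1) using Xb Nb' nb Yb nq s(3) xm kx xn
      by (simp add: state_simps lens_def N[symmetric])
  qed
qed (simp add: init_tuple_def)

lemma out_spec:
  assumes s: "I s" "input_ok s" "s rBu 0 = pack u" "small u" "s rP 0 = P" "s rF 0 = F" "s rD 0 = D"
  shows "wp I out_com (2 * n * 14 + 10) (\<lambda>s'. \<forall>r<n. s' aOut r = image n A u r \<and> s' aOutDen r = F * D) s"
  unfolding out_com_def
proof (rule wp_seq')
  let ?f = "full n A u"
  let ?X = "{rT, rDg, rI, aOut, aOutDen}"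
  let ?R = "\<lambda>s'. same {rT} s s' \<and> s' rT 0 = pack u"
  have pl: "\<bar>pack u\<bar> \<le> b" using pack_less[OF s(4)] b0 by linarith
  show "wp I (Assign rT (Var rBu)) 1 ?R s"
    by (rule wp_vc[OF s(1)]) (use s(3) pl in \<open>auto simp: state_simps lens_def\<close>)
  fix s1 assume s1: "I s1" "?R s1"
  let ?V = "\<lambda>l s'. l \<le> 2 * n \<and> same ?X s s' \<and> s' rI 0 = int l \<and>
     s' rT 0 = enc P (\<lambda>i. ?f (l + i)) (2 * n - l) \<and>
     (\<forall>r. n + r < l \<longrightarrow> s' aOut r = image n A u r \<and> s' aOutDen r = F * D)"
  show "wp I (For rI (Times (Const 2) cN) out_body) (2 * n * (10 + 4) + 3)
     (\<lambda>s'. \<forall>r<n. s' aOut r = image n A u r \<and> s' aOutDen r = F * D) s1"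
  proof (rule for_rule[where V = ?V and N = "2 * n" and ?T1.0 = 10, OF s1(1)])
    show "int (2 * n) \<le> b" using b0 by simp
    have sm1: "same ?X s s1" using s1(2) by (auto simp: same_def)
    show "?V 0 (store_at s1 rI 0 0)" using s1(2) sm1 by (simp add: state_simps pk_def)
    show "aval (Times (Const 2) cN) s' = int (2 * n)" if V: "?V l s'" for l s'
    proof -
      have "same ?X s s'" using V by blast
      from same_reg[OF this, of 0 0] s(2) show ?thesis by (simp add: input_ok_def)
    qed
    fix l s2 assume l: "l < 2 * n" and V: "?V l s2" and I2: "I s2"
    have V': "same ?X s s2" "s2 rI 0 = int l" "s2 rT 0 = enc P (\<lambda>i. ?f (l + i)) (2 * n - l)"
        "\<And>r. n + r < l \<Longrightarrow> s2 aOut r = image n A u r \<and> s2 aOutDen r = F * D" using V by blast+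
    let ?Q = "\<lambda>s'. s' rI 0 = int l \<and> ?V (Suc l) (store_at s' rI 0 (int (Suc l)))"
    let ?g = "\<lambda>i. ?f (l + i)"
    obtain l' where l': "2 * n - l = Suc l'" using l by (metis Suc_diff_Suc)
    have l'': "2 * n - Suc l = l'" using l' by simp
    have sm: "2 * \<bar>?f l\<bar> < P" using s(4) l by (simp add: small_def)
    have c: "s2 0 0 = int n" "s2 rP 0 = P" "s2 rF 0 = F" "s2 rD 0 = D"
      using same_reg[OF V'(1), of 0 0] same_reg[OF V'(1), of rP 0] same_reg[OF V'(1), of rF 0] same_reg[OF V'(1), of rD 0]
        s by (simp_all add: input_ok_def)
    have T: "s2 rT 0 = enc P ?g (Suc l')" using V'(3) l' by simp
    have a1: "aval (Minus (Mod (Plus (Var rT) (Div (Var rP) (Const 2))) (Var rP)) (Div (Var rP) (Const 2))) s2 = ?f l"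
      using balanced_digit(1)[OF P(1), of ?g l'] sm T c by simp
    have a2: "aval (Div (Minus (Var rT) (Var rDg)) (Var rP)) (store_at s2 rDg 0 (?f l)) = enc P (\<lambda>i. ?f (Suc l + i)) l'"
      using balanced_digit(2)[OF P(1), of ?g l'] sm T c by (simp add: store_at_apply)
    have tb: "\<bar>enc P (\<lambda>i. ?f (Suc l + i)) l'\<bar> \<le> b"
    proof -
      have "\<bar>enc P (\<lambda>i. ?f (Suc l + i)) l'\<bar> < P ^ l'"
        by (rule enc_bound) (use s(4) l' PG(2) in \<open>auto simp: small_def\<close>)
      also have "\<dots> \<le> G" unfolding G_def using l' PG(2) by (intro power_increasing) auto
      finally show ?thesis using b_bounds(6) by linarith
    qed
    have fb: "\<bar>?f l\<bar> \<le> b" using sm b_bounds(9) by linarith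
    have FD: "\<bar>F * D\<bar> \<le> b" "0 < F * D"
    proof -
      have "D \<le> m"
      proof -
        have "0 \<le> den i \<and> den i \<le> den i * (\<bar>num i\<bar> + 1)" for i
        proof -
          have "den i * 1 \<le> den i * (\<bar>num i\<bar> + 1)" using den[of i] by (intro mult_left_mono) auto
          then show ?thesis using den[of i] by simp
        qed
        then show ?thesis unfolding D_def m_def by (intro prod_mono) auto
      qed
      then have "F * D \<le> F * M" using nM(3) F64 by (intro mult_left_mono) auto
      moreover show "0 < F * D" using F64 D1 by (intro mult_pos_pos) auto
      ultimately show "\<bar>F * D\<bar> \<le> b" using b_bounds(11) by linarith
    qed
    obtain s3 where s3: "s3 = store_at (store_at s2 rDg 0 (?f l)) rT 0 (enc P (\<lambda>i. ?f (Suc l + i)) l')" by blast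
    have r3: "s3 rI 0 = int l" "s3 0 0 = int n" "s3 rDg 0 = ?f l" "s3 rT 0 = enc P (\<lambda>i. ?f (Suc l + i)) l'"
        "s3 rF 0 = F" "s3 rD 0 = D" "\<And>r. s3 aOut r = s2 aOut r" "\<And>r. s3 aOutDen r = s2 aOutDen r"
      using V'(2) c by (simp_all add: s3 store_at_apply)
    have sm3: "same ?X s s3" using V'(1) by (simp add: s3 same_store)
    have body: "vc b (lens n Nb) (Cond (Less (Var rI) cN) Skip
        (Seq (Store aOut (Minus (Var rI) cN) (Var rDg)) (Store aOutDen (Minus (Var rI) cN) (Times (Var rF) (Var rD))))) ?Q s3"
    proof (cases "l < n")
      case True
      have "?Q s3" using r3 sm3 True l'' l by (simp add: state_simps del: of_nat_Suc)
      then show ?thesis using True r3 by simp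
    next
      case False
      then obtain r where r: "l = n + r" by (metis le_iff_add not_less)
      have rn: "r < n" using r l by simp
      have fl: "?f l = image n A u r" by (simp add: r full_def)
      let ?s4 = "store_at (store_at s3 aOut (int r) (?f l)) aOutDen (int r) (F * D)"
      have sm4: "same ?X s ?s4" using sm3 by (simp add: same_store)
      have O4: "?s4 aOut r' = image n A u r' \<and> ?s4 aOutDen r' = F * D" if "n + r' < Suc l" for r'
        using that V'(4)[of r'] r3(7,8) fl r by (cases "r' = r") (auto simp: store_at_apply)
      have "?Q ?s4"
      proof (intro conjI allI impI)
        show "?s4 rI 0 = int l" using r3 by (simp add: store_at_apply)
        show "same ?X s (store_at ?s4 rI 0 (int (Suc l)))" using sm4 by (simp add: same_store)
        show "store_at ?s4 rI 0 (int (Suc l)) rT 0 = enc P (\<lambda>i. ?f (Suc l + i)) (2 * n - Suc l)"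
          using r3 l'' by (simp add: store_at_apply)
        fix r' assume "n + r' < Suc l"
        from O4[OF this] show "store_at ?s4 rI 0 (int (Suc l)) aOut r' = image n A u r'"
          "store_at ?s4 rI 0 (int (Suc l)) aOutDen r' = F * D" by (simp_all add: store_at_apply)
      qed (use l in \<open>simp_all add: store_at_apply\<close>)
      then show ?thesis using False r3 r rn fb FD(1)
        by (simp add: lens_def store_at_apply)
    qed
    show "wp I out_body 10 ?Q s2"
    proof (rule wp_vc[OF I2])
      show "vc b (lens n Nb) out_body ?Q s2"
        unfolding out_body_def vc.simps(2,4) a1 aval.simps(1) a2 s3[symmetric]
        using body fb tb by (simp only: lens_def) simp
    qed (simp add: out_body_def)
  next
    show "\<forall>r<n. s' aOut r = image n A u r \<and> s' aOutDen r = F * D" if "?V (2 * n) s'" for s'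
      using that by simp
  qed simp_all
qed simp

end

section \<open>The program as a whole\<close>

lemma seq_step:
  assumes w: "wp J c T1 Q s" and step: "\<And>s'. J s' \<Longrightarrow> Q s' \<Longrightarrow> wp J c' T2 R s'" and T: "T1 + T2 + 1 \<le> T"
  shows "wp J (Seq c c') T R s"
  by (rule wp_seq'[OF w step T])

context svp_instance
begin

text \<open>The first basis vector bounds the length of a shortest one.\<close>

lemma unit_vec:
  defines "e \<equiv> \<lambda>i::nat. if i = 0 then 1 else 0 :: int"
  shows "e \<in> ivecs n" "e \<noteq> vzero" "sqn n a e \<le> M\<^sup>2"
proof -
  show "e \<in> ivecs n" "e \<noteq> vzero" using n16 by (auto simp: ivecs_def fun_eq_iff e_def)
  have im: "image n a e r = a r 0" for r
    unfolding image_def e_def using n16 by (simp add: if_distrib cong: if_cong)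
  have "sqn n a e = (\<Sum>r<n. (a r 0)\<^sup>2)" by (simp add: sqn_def im)
  also have "\<dots> \<le> (\<Sum>r<n. m\<^sup>2)"
  proof (rule sum_mono)
    fix r assume "r \<in> {..<n}"
    then have "\<bar>a r 0\<bar> \<le> \<bar>m\<bar>" using abs_a[of r 0] n16 m1 by simp
    then show "(a r 0)\<^sup>2 \<le> m\<^sup>2" by (simp only: abs_le_square_iff)
  qed
  also have "\<dots> = int n * m\<^sup>2 * 1" by simp
  also have "\<dots> \<le> int n * m\<^sup>2 * int n" using n16 by (intro mult_left_mono) auto
  also have "\<dots> = M\<^sup>2" by (simp add: M_def power2_eq_square mult_ac)
  finally show "sqn n a e \<le> M\<^sup>2" .
qed

definition "T_prog = T_sieve (2 * J) + n * n * 7 + n * (n * 7 + 20) + 100 * n + 5 * J + 200"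

lemma program_spec:
  assumes s: "I s" "input_ok s" "\<And>a i. 3 \<le> a \<Longrightarrow> s a i = 0"
    and z: "z \<in> ivecs n" "z \<noteq> vzero" and min: "\<And>u. u \<in> ivecs n \<Longrightarrow> u \<noteq> vzero \<Longrightarrow> sqn n a z \<le> sqn n a u"
    and zi: "\<And>i. i < n \<Longrightarrow> \<bar>z i\<bar> \<le> M ^ (n + 1)"
  shows "wp I svp_program T_prog (\<lambda>s'. \<exists>u\<in>ivecs n. u \<noteq> vzero \<and> sqn n a u = sqn n a z \<and>
    (\<forall>r<n. s' aOut r = image n A u r \<and> s' aOutDen r = F * D)) s"
    (is "wp I _ _ ?Q s")
proof -
  have e: "Y \<le> 2 ^ (2 * J)"
  proof -
    have 1: "F * M \<le> 2 ^ J" using J(1) Y1(6) by linarith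
    have 2: "M \<le> 2 ^ J" using 1 Y1(3) by linarith
    have "(F * M) * M \<le> 2 ^ J * 2 ^ J" by (rule mult_mono[OF 1 2]) (use nM in simp_all)
    then show ?thesis by (simp add: Y_def mult_2 power_add)
  qed
  have sqz1: "1 \<le> sqn n a z" by (rule sqn_a_pos[OF z])
  \<comment> \<open>A coefficient is at most \<open>M ^ (n + 1) = F / 64\<close>, whereas a nonzero
    vector of an integer lattice scaled by \<open>F\<close> has length at least
    \<open>F\<close>.\<close>
  have zi': "4096 * (z i)\<^sup>2 \<le> sq z" if "i < n" for i
  proof -
    have "64 * \<bar>z i\<bar> \<le> F" using zi[OF that] by (simp add: F_def)
    then have "(64 * \<bar>z i\<bar>)\<^sup>2 \<le> F\<^sup>2" by (intro power_mono) auto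
    then have "4096 * (z i)\<^sup>2 \<le> F\<^sup>2 * 1" by (simp add: power_mult_distrib)
    also have "\<dots> \<le> F\<^sup>2 * sqn n a z" using sqz1 by (intro mult_left_mono) auto
    finally show ?thesis by (simp add: sqn_A)
  qed
  have zJ: "sq z \<le> (2 ^ (J - 1))\<^sup>2"
  proof -
    have "sqn n a z \<le> M\<^sup>2" using min[OF unit_vec(1,2)] unit_vec(3) by linarith
    then have "F\<^sup>2 * sqn n a z \<le> F\<^sup>2 * M\<^sup>2" by (intro mult_left_mono) auto
    then have "sq z \<le> (F * M)\<^sup>2" by (simp add: sqn_A power_mult_distrib)
    also have "\<dots> \<le> (2 ^ (J - 1))\<^sup>2"
    proof (rule power_mono)
      have "2 ^ J = 2 * (2::int) ^ (J - 1)" using J(3) by (cases J) auto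
      then show "F * M \<le> 2 ^ (J - 1)" using J(1) by linarith
    qed (use Y1(6) in linarith)
    finally show ?thesis .
  qed
  have minA: "sq z \<le> sq u" if "u \<in> ivecs n" "u \<noteq> vzero" for u
    using min[OF that] by (simp add: sqn_A mult_left_mono)
  let ?X1 = "{rD, rM, rI}" and ?X2 = "{rD, rM, rI, rF}" and ?X3 = "{rD, rM, rI, rF, rY, rP, rPn, rC5, rG}"
    and ?X4 = "{rD, rM, rI, rF, rY, rP, rPn, rC5, rG, rRT, rPT}"
    and ?X5 = "{rD, rM, rI, rF, rY, rP, rPn, rC5, rG, rRT, rPT, rPi, rAcc, rPr, rRow, aE}"
    and ?X6 = "{rD, rM, rI, rF, rY, rP, rPn, rC5, rG, rRT, rPT, rPi, rAcc, rPr, rRow, aE, rX, rK, rS}"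
  define T7 where "T7 = T_sieve (2 * J) + (2 * n * 14 + 10) + 1"
  define T6 where "T6 = 20 + T7 + 1"
  define T5 where "T5 = (n * (n * 7 + 20) + 10) + T6 + 1"
  define T4 where "T4 = (J * 5 + 20) + T5 + 1"
  define T3 where "T3 = (n * 7 + 20) + T4 + 1"
  define T2 where "T2 = (n * 5 + 20) + T3 + 1"
  show ?thesis
    unfolding svp_program_def
  proof (rule seq_step[OF init_scale_spec[OF s(1,2)]])
    fix s1 assume I1: "I s1" and Q1: "same ?X1 s s1 \<and> s1 rD 0 = D \<and> s1 rM 0 = M"
    have sm1: "same ?X1 s s1" using Q1 by blast
    have i1: "input_ok s1" by (rule input_same[OF s(2) sm1]) simp
    show "wp I (Seq init_factor (Seq init_base (Seq init_top (Seq init_units (Seq init_tuple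
     (Seq sieve_com out_com)))))) T2 ?Q s1"
    proof (rule seq_step[OF init_factor_spec[OF I1 i1 conjunct2[OF conjunct2[OF Q1]]]])
      fix s2 assume I2: "I s2" and Q2: "same {rF, rI} s1 s2 \<and> s2 rF 0 = F"
      have q2: "same {rF, rI} s1 s2" using Q2 by blast
      have sm2: "same ?X2 s s2" by (rule same_trans[OF sm1 q2]) auto
      have i2: "input_ok s2" by (rule input_same[OF s(2) sm2]) simp
      have r2: "s2 rD 0 = D" "s2 rM 0 = M" "s2 rF 0 = F"
        using same_reg[OF q2, of rD 0] same_reg[OF q2, of rM 0] Q1 Q2 by simp_all
      show "wp I (Seq init_base (Seq init_top (Seq init_units (Seq init_tuple (Seq sieve_com out_com))))) T3 ?Q s2"
      proof (rule seq_step[OF init_base_spec[OF I2 i2 r2(2,3)]])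
        fix s3 assume I3: "I s3" and Q3: "same {rY, rP, rPn, rC5, rG, rI} s2 s3 \<and> s3 rY 0 = Y \<and> s3 rP 0 = P \<and>
           s3 rPn 0 = P ^ n \<and> s3 rC5 0 = 5 ^ n \<and> s3 rG 0 = G"
        have q3: "same {rY, rP, rPn, rC5, rG, rI} s2 s3" using Q3 by blast
        have sm3: "same ?X3 s s3" by (rule same_trans[OF sm2 q3]) auto
        have i3: "input_ok s3" by (rule input_same[OF s(2) sm3]) simp
        have r3: "s3 rD 0 = D" "s3 rM 0 = M" "s3 rF 0 = F" "s3 rG 0 = G" "s3 rP 0 = P" "s3 rPn 0 = P ^ n" "s3 rC5 0 = 5 ^ n" "s3 rY 0 = Y"
          using same_reg[OF q3, of rD 0] same_reg[OF q3, of rM 0] same_reg[OF q3, of rF 0] r2 Q3 by simp_all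
        show "wp I (Seq init_top (Seq init_units (Seq init_tuple (Seq sieve_com out_com)))) T4 ?Q s3"
        proof (rule seq_step[OF init_top_spec[OF I3 r3(2-4)]])
          fix s4 assume I4: "I s4" and Q4: "same {rRT, rPT} s3 s4 \<and> s4 rRT 0 = 2 ^ J \<and> s4 rPT 0 = G ^ J"
          have q4: "same {rRT, rPT} s3 s4" using Q4 by blast
          have sm4: "same ?X4 s s4" by (rule same_trans[OF sm3 q4]) auto
          have i4: "input_ok s4" by (rule input_same[OF s(2) sm4]) simp
          have k4: "s4 c 0 = s3 c 0" if "c \<notin> {rRT, rPT}" for c using same_reg[OF q4 that] .
          have r4: "s4 rD 0 = D" "s4 rF 0 = F" "s4 rG 0 = G" "s4 rP 0 = P" "s4 rPn 0 = P ^ n" "s4 rC5 0 = 5 ^ n" "s4 rY 0 = Y"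
            using r3 by (simp_all add: k4)
          show "wp I (Seq init_units (Seq init_tuple (Seq sieve_com out_com))) T5 ?Q s4"
          proof (rule seq_step[OF init_units_spec[OF I4 i4 r4(2,1,4,5)]])
            fix s5 assume I5: "I s5" and Q5: "same {rPi, rAcc, rPr, rRow, rI, aE} s4 s5 \<and> (\<forall>c<n. s5 aE c = unit_pk n A P c)"
            have q5: "same {rPi, rAcc, rPr, rRow, rI, aE} s4 s5" using Q5 by blast
            have sm5: "same ?X5 s s5" by (rule same_trans[OF sm4 q5]) auto
            have i5: "input_ok s5" by (rule input_same[OF s(2) sm5]) simp
            have k5: "s5 c 0 = s4 c 0" if "c \<notin> {rPi, rAcc, rPr, rRow, rI, aE}" for c using same_reg[OF q5 that] .
            have r5: "s5 rY 0 = Y" using r4 by (simp add: k5)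
            show "wp I (Seq init_tuple (Seq sieve_com out_com)) T6 ?Q s5"
            proof (rule seq_step[OF init_tuple_spec[OF I5 i5 r5]])
              fix s6 assume I6: "I s6" and Q6: "same {rX, rK, rS} s5 s6 \<and> s6 rK 0 = int k \<and> s6 rS 0 = Y"
              have q6: "same {rX, rK, rS} s5 s6" using Q6 by blast
              have sm6: "same ?X6 s s6" by (rule same_trans[OF sm5 q6]) auto
              have i6: "input_ok s6" by (rule input_same[OF s(2) sm6]) simp
              have k6: "s6 c i = s5 c i" if "c \<notin> {rX, rK, rS}" for c i using same_reg[OF q6 that] .
              have r6: "s6 rD 0 = D" "s6 rF 0 = F" "s6 rG 0 = G" "s6 rP 0 = P" "s6 rC5 0 = 5 ^ n" "s6 rRT 0 = 2 ^ J" "s6 rPT 0 = G ^ J"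
                using r4 Q4 by (simp_all add: k6 k5)
              have z6: "s6 c i = 0" if "3 \<le> c" "c \<notin> ?X6" for c i using same_reg[OF sm6 that(2), of i] s(3)[OF that(1)] by simp
              have par: "params s6"
                using i6 Q6 Q5 r6 by (simp add: params_def input_ok_def k6)
              have zs: "s6 rNm 0 = 0" "\<And>i. s6 aW i = 0" "\<And>i. s6 aZ i = 0" "s6 rBest 0 = 0" by (simp_all add: z6)
              show "wp I (Seq sieve_com out_com) T7 ?Q s6"
              proof (rule seq_step[OF sieve_spec[OF I6 par conjunct2[OF conjunct2[OF Q6]] r6(5) zs e z minA zi' zJ J(3)]])
                fix s7 assume I7: "I s7" and Q7: "same sieve_regs s6 s7 \<and>
                  (\<exists>u\<in>ivecs n. u \<noteq> vzero \<and> small u \<and> s7 rBu 0 = pack u \<and> sq u = sq z)"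
                have q7: "same sieve_regs s6 s7" using Q7 by blast
                have i7: "input_ok s7" by (rule input_same[OF i6 q7]) simp
                have r7: "s7 rP 0 = P" "s7 rF 0 = F" "s7 rD 0 = D"
                  using same_reg[OF q7, of rP 0] same_reg[OF q7, of rF 0] same_reg[OF q7, of rD 0] r6 by simp_all
                obtain u where u: "u \<in> ivecs n" "u \<noteq> vzero" "small u" "s7 rBu 0 = pack u" "sq u = sq z" using Q7 by blast
                have "F\<^sup>2 \<noteq> 0" using F64 by simp
                then have squ: "sqn n a u = sqn n a z" using u(5) unfolding sqn_A by (metis mult_left_cancel)
                show "wp I out_com (2 * n * 14 + 10) ?Q s7"
                  by (rule wp_mono[OF out_spec[OF I7 i7 u(4,3) r7] order.refl]) (use u(1,2) squ in blast)
              qed (simp_all add: T7_def)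
            qed (simp add: T6_def)
          qed (simp add: T5_def)
        qed (simp add: T4_def)
      qed (simp add: T3_def)
    qed (simp add: T2_def)
  qed (simp add: T_prog_def T2_def T3_def T4_def T5_def T6_def T7_def)
qed

end

section \<open>Exponents of the list length\<close>

definition lamb :: "nat \<Rightarrow> real" where "lamb x = 1 + 2 * (real x * (321/256)) / (63/256)"

lemma lamb_eq: "lamb x = 1 + 214/21 * real x"
  by (simp add: lamb_def)

lemma lamb_mono: "x \<le> y \<Longrightarrow> lamb x \<le> lamb y"
  by (simp add: lamb_eq)

text \<open>Reduces a bound with a fractional exponent to a comparison of integer powers, which for
  concrete \<open>q\<close> is plain arithmetic.\<close>

lemma powr_of_powers:
  assumes "y > 0" "q > 0" "d > 0" "y ^ d \<le> real q ^ c"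
  shows "y \<le> real q powr (real c / real d)"
proof -
  have "(y ^ d) powr (1 / real d) \<le> (real q ^ c) powr (1 / real d)"
    using assms by (intro powr_mono2) auto
  then show ?thesis using assms by (simp add: powr_realpow[symmetric] powr_powr)
qed

text \<open>
  With \<open>lamb X \<le> q powr r\<close>, the number of pairs of tuples examined is about \<open>q powr (r (6 - 3 / X) n)\<close>
  and the lists have length about \<open>q powr (r n / X)\<close>. For \<open>q < 16\<close> the exponents \<open>r\<close> were found numerically.
\<close>

lemma exponent:
  assumes "4 \<le> q"
  defines "X \<equiv> (q * q + 6) div 7"
  shows "\<exists>r>0. lamb X \<le> real q powr r \<and> r * (6 - 3 / real X) \<le> 452/35 \<and> r * real q ^ 2 \<le> 16 * real X"
proof (cases "q < 16")
  case True
  have small: ?thesis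
    if "0 < c" "0 < d" "lamb X ^ d \<le> real q ^ c" "real c / real d * (6 - 3 / real X) \<le> 452/35"
      "real c / real d * real q ^ 2 \<le> 16 * real X" for c d :: nat
  proof -
    have "0 < lamb X" by (simp add: lamb_eq add_pos_nonneg)
    then have "lamb X \<le> real q powr (real c / real d)" using that assms by (intro powr_of_powers) auto
    then show ?thesis using that by (intro exI[of _ "real c / real d"]) auto
  qed
  have "q = 4 \<or> q = 5 \<or> q = 6 \<or> q = 7 \<or> q = 8 \<or> q = 9 \<or> q = 10 \<or> q = 11 \<or> q = 12 \<or> q = 13 \<or> q = 14 \<or> q = 15"
    using True assms(1) by presburger
  then consider "q = 4" | "q = 5" | "q = 6" | "q = 7" | "q = 8" | "q = 9" | "q = 10" | "q = 11" | "q = 12" | "q = 13" | "q = 14" | "q = 15"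
    by blast
  then show ?thesis
  proof cases
    case 1 then show ?thesis by (intro small[of 5 2]) (simp_all add: X_def lamb_eq power_divide)
  next
    case 2 then show ?thesis by (intro small[of 7 3]) (simp_all add: X_def lamb_eq power_divide)
  next
    case 3 then show ?thesis by (intro small[of 7 3]) (simp_all add: X_def lamb_eq power_divide)
  next
    case 4 then show ?thesis by (intro small[of 9 4]) (simp_all add: X_def lamb_eq power_divide)
  next
    case 5 then show ?thesis by (intro small[of 9 4]) (simp_all add: X_def lamb_eq power_divide)
  next
    case 6 then show ?thesis by (intro small[of 11 5]) (simp_all add: X_def lamb_eq power_divide)
  next
    case 7 then show ?thesis by (intro small[of 11 5]) (simp_all add: X_def lamb_eq power_divide)
  next
    case 8 then show ?thesis by (intro small[of 11 5]) (simp_all add: X_def lamb_eq power_divide)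
  next
    case 9 then show ?thesis by (intro small[of 11 5]) (simp_all add: X_def lamb_eq power_divide)
  next
    case 10 then show ?thesis by (intro small[of 13 6]) (simp_all add: X_def lamb_eq power_divide)
  next
    case 11 then show ?thesis by (intro small[of 13 6]) (simp_all add: X_def lamb_eq power_divide)
  next
    case 12 then show ?thesis by (intro small[of 13 6]) (simp_all add: X_def lamb_eq power_divide)
  qed
next
  case False
  then have q16: "16 \<le> real q" by simp
  have sq: "256 \<le> real q * real q" using mult_mono[of 16 "real q" 16 "real q"] q16 by simp
  have X: "7 * X \<le> q * q + 6" "q * q \<le> 7 * X"
  proof -
    have "7 * (y div 7) \<le> y" "y \<le> 7 * (y div 7) + 6" for y :: nat by linarith+
    from this[of "q * q + 6"] show "7 * X \<le> q * q + 6" "q * q \<le> 7 * X" unfolding X_def by linarith+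
  qed
  have X1: "7 * real X \<le> real q * real q + 6"
  proof -
    have "real (7 * X) \<le> real (q * q + 6)" using X(1) by (simp only: of_nat_le_iff)
    then show ?thesis by simp
  qed
  have X2: "real q * real q \<le> 7 * real X"
  proof -
    have "real (q * q) \<le> real (7 * X)" using X(2) by (simp only: of_nat_le_iff)
    then show ?thesis by simp
  qed
  \<comment> \<open>As \<open>X \<le> (q * q + 6) / 7\<close> and \<open>214/147 < 3/2\<close>, the
    lower-order terms are absorbed from \<open>q = 16\<close> on. The constant 3/2 then costs
    \<open>q powr (3/20)\<close>, so \<open>r = 2 + 3/20\<close>. This leaves
    \<open>6 * r = 12.9\<close> below \<open>452/35\<close>, and \<open>r\<close> below
    \<open>16/7\<close>.\<close>
  have "lamb X \<le> 3/2 * (real q * real q)" unfolding lamb_eq using X1 sq by simp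
  also have "\<dots> \<le> real q powr (3/20) * (real q * real q)"
  proof (rule mult_right_mono)
    have "(16::real) ^ 3 \<le> real q ^ 3" using q16 by (intro power_mono) auto
    then have "(3/2::real) ^ 20 \<le> real q ^ 3" by (simp add: power_divide)
    then show "3/2 \<le> real q powr (3/20)" using powr_of_powers[of "3/2" q 20 3] q16 by simp
  qed simp
  also have "real q powr (3/20) * (real q * real q) = real q powr (43/20)"
  proof -
    have "real q powr (3/20) * real q powr 2 = real q powr (3/20 + 2)" by (rule powr_add[symmetric])
    moreover have "real q powr 2 = real q * real q" using q16 by (simp add: powr_numeral power2_eq_square)
    ultimately show ?thesis by simp
  qed
  finally have "lamb X \<le> real q powr (43/20)" .
  moreover have "43/20 * (6 - 3 / real X) \<le> 452/35"
  proof -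
    have gen: "43/20 * (6 - t) \<le> 452/35" if "0 \<le> t" for t :: real using that by simp
    show ?thesis by (rule gen) simp
  qed
  moreover have "43/20 * real q ^ 2 \<le> 16 * real X" using X2 by (simp add: power2_eq_square)
  ultimately show ?thesis by (intro exI[of _ "43/20"]) auto
qed

section \<open>Short vectors have small coefficients\<close>

text \<open>The Leibniz formula has \<open>N!\<close> summands, each at most \<open>m ^ N\<close>,
  and \<open>N! \<le> N ^ N\<close>.\<close>

lemma abs_det_le:
  fixes B :: "int mat"
  assumes B: "B \<in> carrier_mat N N" and le: "\<And>i j. i < N \<Longrightarrow> j < N \<Longrightarrow> \<bar>B $$ (i, j)\<bar> \<le> m" and m: "0 \<le> m"
  shows "\<bar>Determinant.det B\<bar> \<le> (int N * m) ^ N"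
proof -
  let ?P = "{p. p permutes {0..<N}}"
  have "\<bar>Determinant.det B\<bar> \<le> (\<Sum>p\<in>?P. \<bar>signof p * (\<Prod>i = 0..<N. B $$ (i, p i))\<bar>)"
    unfolding det_def'[OF B] by (rule sum_abs)
  also have "\<dots> \<le> (\<Sum>p\<in>?P. m ^ N)"
  proof (rule sum_mono)
    fix p assume "p \<in> ?P"
    then have p: "p i < N" if "i < N" for i using that permutes_in_image[of p "{0..<N}" i] by simp
    have "\<bar>signof p * (\<Prod>i = 0..<N. B $$ (i, p i))\<bar> = (\<Prod>i = 0..<N. \<bar>B $$ (i, p i)\<bar>)"
      by (simp add: abs_mult abs_prod sign_def)
    also have "\<dots> \<le> (\<Prod>i = 0..<N. m)" by (rule prod_mono) (use le p in auto)
    finally show "\<bar>signof p * (\<Prod>i = 0..<N. B $$ (i, p i))\<bar> \<le> m ^ N" by simp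
  qed
  also have "\<dots> = fact N * m ^ N" by (simp add: card_permutations)
  also have "\<dots> \<le> int N ^ N * m ^ N"
    using fact_le_power[where 'a = int, of N] m by (intro mult_right_mono) auto
  finally show ?thesis by (simp add: power_mult_distrib)
qed

context svp_instance
begin

text \<open>Applying the adjugate to the image of \<open>u\<close> yields \<open>u\<close> times the
  determinant. The latter is a nonzero integer, so it only enlarges \<open>u\<close>, and the
  entries of the adjugate are minors, bounded by \<open>abs_det_le\<close>.\<close>

lemma cramer_bound:
  assumes i: "i < n"
  shows "\<bar>u i\<bar> \<le> M ^ (n - 1) * (\<Sum>r<n. \<bar>image n a u r\<bar>)"
proof -
  define B where "B = Matrix.mat n n (\<lambda>(r, c). a r c)"
  define v where "v = Matrix.vec n u"
  have B: "B \<in> carrier_mat n n" and v: "v \<in> carrier_vec n" by (simp_all add: B_def v_def)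
  have Bw: "(B *\<^sub>v Matrix.vec n w) $ r = image n a w r" if "r < n" for w r
    using that by (simp add: B_def scalar_prod_def image_def atLeast0LessThan)
  have "Determinant.det B \<noteq> 0"
  proof
    assume "Determinant.det B = 0"
    then obtain w where w: "w \<in> carrier_vec n" "w \<noteq> 0\<^sub>v n" "B *\<^sub>v w = 0\<^sub>v n"
      using det_0_iff_vec_prod_zero[OF B] by blast
    let ?w = "\<lambda>i. if i < n then w $ i else 0"
    have ww: "w = Matrix.vec n ?w" using w(1) by (intro eq_vecI) auto
    have "?w \<in> ivecs n" by (simp add: ivecs_def)
    moreover have "?w \<noteq> vzero"
    proof
      assume "?w = vzero"
      then have "w $ i = 0" if "i < n" for i using that by (metis (full_types))
      then have "w = 0\<^sub>v n" using w(1) by (intro eq_vecI) auto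
      with w(2) show False by simp
    qed
    ultimately obtain r where r: "r < n" "image n a ?w r \<noteq> 0" using indep by blast
    have "(B *\<^sub>v Matrix.vec n ?w) $ r = image n a ?w r" by (rule Bw[OF r(1)])
    then show False using w(3) ww r by simp
  qed
  then have det1: "1 \<le> \<bar>Determinant.det B\<bar>" by linarith
  have adj: "\<bar>adj_mat B $$ (i, r)\<bar> \<le> M ^ (n - 1)" if r: "r < n" for r
  proof -
    have "adj_mat B $$ (i, r) = cofactor B r i" using i r B by (simp add: adj_mat_def)
    then have "\<bar>adj_mat B $$ (i, r)\<bar> = \<bar>Determinant.det (mat_delete B r i)\<bar>"
      by (simp add: Determinant.cofactor_def abs_mult power_abs)
    also have "\<dots> \<le> (int (n - 1) * m) ^ (n - 1)"
    proof (rule abs_det_le)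
      show "mat_delete B r i \<in> carrier_mat (n - 1) (n - 1)" by (rule mat_delete_carrier[OF B])
      fix i' j' assume ij: "i' < n - 1" "j' < n - 1"
      have "mat_delete B r i $$ (i', j') =
          a (if i' < r then i' else Suc i') (if j' < i then j' else Suc j')"
        using ij B by (simp add: mat_delete_def B_def)
      then show "\<bar>mat_delete B r i $$ (i', j')\<bar> \<le> m" using ij by (auto intro!: abs_a)
    qed (use m1 in simp)
    also have "\<dots> \<le> M ^ (n - 1)" unfolding M_def using m1 by (intro power_mono mult_right_mono) auto
    finally show ?thesis .
  qed
  have "adj_mat B *\<^sub>v (B *\<^sub>v v) = Determinant.det B \<cdot>\<^sub>v v"
  proof -
    have "adj_mat B *\<^sub>v (B *\<^sub>v v) = (adj_mat B * B) *\<^sub>v v"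
      by (rule assoc_mult_mat_vec[symmetric, OF adj_mat(1)[OF B] B v])
    also have "\<dots> = Determinant.det B \<cdot>\<^sub>v v"
      unfolding adj_mat(3)[OF B] using v
      by (intro eq_vecI) (simp_all add: scalar_prod_def mult.assoc if_distrib[of "\<lambda>x. x * _"] flip: sum_distrib_left cong: if_cong)
    finally show ?thesis .
  qed
  then have "Determinant.det B * u i = (adj_mat B *\<^sub>v (B *\<^sub>v v)) $ i" using i by (simp add: v_def)
  also have "\<dots> = (\<Sum>r<n. adj_mat B $$ (i, r) * image n a u r)"
  proof -
    have "(adj_mat B *\<^sub>v (B *\<^sub>v v)) $ i = (\<Sum>r<n. adj_mat B $$ (i, r) * (B *\<^sub>v v) $ r)"
      using i B adj_mat(1)[OF B] by (simp add: scalar_prod_def atLeast0LessThan)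
    then show ?thesis by (simp add: v_def Bw)
  qed
  finally have eq: "\<bar>Determinant.det B * u i\<bar> = \<bar>\<Sum>r<n. adj_mat B $$ (i, r) * image n a u r\<bar>" by simp
  have "1 * \<bar>u i\<bar> \<le> \<bar>Determinant.det B\<bar> * \<bar>u i\<bar>" using det1 by (intro mult_right_mono) auto
  then have "\<bar>u i\<bar> \<le> \<bar>\<Sum>r<n. adj_mat B $$ (i, r) * image n a u r\<bar>" using eq by (simp add: abs_mult)
  also have "\<dots> \<le> (\<Sum>r<n. \<bar>adj_mat B $$ (i, r) * image n a u r\<bar>)" by (rule sum_abs)
  also have "\<dots> \<le> (\<Sum>r<n. M ^ (n - 1) * \<bar>image n a u r\<bar>)"
    unfolding abs_mult using adj by (intro sum_mono mult_right_mono) auto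
  finally show ?thesis by (simp add: sum_distrib_left)
qed

text \<open>Squared lengths in an integer lattice are natural numbers, so a least one exists. It is
  at most that of a basis vector, which bounds each of the \<open>n \<le> M\<close> image entries by
  \<open>M\<close>; \<open>cramer_bound\<close> does the rest.\<close>

lemma shortest_exists:
  "\<exists>z\<in>ivecs n. z \<noteq> vzero \<and> (\<forall>u\<in>ivecs n. u \<noteq> vzero \<longrightarrow> sqn n a z \<le> sqn n a u) \<and> (\<forall>i<n. \<bar>z i\<bar> \<le> M ^ (n + 1))"
proof -
  have sq0: "0 \<le> sqn n a u" for u by (simp add: sqn_def sum_nonneg)
  obtain z where z: "z \<in> ivecs n \<and> z \<noteq> vzero"
      "\<And>u. u \<in> ivecs n \<and> u \<noteq> vzero \<Longrightarrow> nat (sqn n a z) \<le> nat (sqn n a u)"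
    using ex_has_least_nat[of "\<lambda>u. u \<in> ivecs n \<and> u \<noteq> vzero" _ "\<lambda>u. nat (sqn n a u)"] unit_vec(1,2) by blast
  have min: "sqn n a z \<le> sqn n a u" if "u \<in> ivecs n" "u \<noteq> vzero" for u
    using z(2)[of u] that sq0[of u] sq0[of z] by simp
  have sM: "sqn n a z \<le> M\<^sup>2" using min[OF unit_vec(1,2)] unit_vec(3) by linarith
  have im: "\<bar>image n a z r\<bar> \<le> M" if "r < n" for r
  proof -
    have "(image n a z r)\<^sup>2 \<le> sqn n a z" unfolding sqn_def using that by (intro member_le_sum) auto
    then have "(image n a z r)\<^sup>2 \<le> M\<^sup>2" using sM by linarith
    then have "\<bar>image n a z r\<bar> \<le> \<bar>M\<bar>" by (simp only: abs_le_square_iff)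
    then show ?thesis using nM by simp
  qed
  have "\<bar>z i\<bar> \<le> M ^ (n + 1)" if i: "i < n" for i
  proof -
    have "\<bar>z i\<bar> \<le> M ^ (n - 1) * (\<Sum>r<n. \<bar>image n a z r\<bar>)" by (rule cramer_bound[OF i])
    also have "\<dots> \<le> M ^ (n - 1) * (\<Sum>r<n. M)" using im nM by (intro mult_left_mono sum_mono) auto
    also have "\<dots> \<le> M ^ (n - 1) * (M * M)" using nM by (intro mult_left_mono) (auto intro: mult_right_mono)
    also have "\<dots> = M ^ (n - 1 + 2)" by (simp add: power_add power2_eq_square)
    also have "n - 1 + 2 = n + 1" using n16 by simp
    finally show ?thesis .
  qed
  then show ?thesis using z(1) min by (intro bexI[of _ z]) auto
qed

section \<open>Resource bounds\<close>

definition "H = 2 * (Nb + 1)"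

text \<open>A level has at most \<open>H ^ (2 * k)\<close> candidates, each compared with at most
  \<open>H ^ k\<close> tuples. One factor \<open>J\<close> is for the levels of a build and one for
  the number of builds. One factor \<open>n\<close> is for the loops over coordinates, and its
  square also covers the preparation of the matrix.\<close>

lemma T_prog_le: "T_prog \<le> 38000 * (J * J) * (n * n) * H ^ (3 * k)"
proof -
  define h where "h = H ^ k"
  define h3 where "h3 = H ^ (3 * k)"
  have H1: "1 \<le> H" "7 * Nb + 3 \<le> 4 * H" by (simp_all add: H_def)
  have CN: "CN = H ^ (2 * k)" by (simp add: CN_def H_def)
  have h3: "h3 = CN * h" unfolding h3_def h_def CN power_add[symmetric] by simp
  have h1: "1 \<le> h" "1 \<le> CN" "1 \<le> h3" unfolding h_def CN h3_def using H1 by simp_all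
  have HC: "H \<le> CN"
  proof -
    have "H ^ 1 \<le> H ^ (2 * k)" using H1 x1(3) by (intro power_increasing) auto
    then show ?thesis by (simp add: CN)
  qed
  have Ch: "CN \<le> h3" unfolding h3 using h1 by simp
  have kn: "k \<le> n" by (rule x1(4))
  have n: "16 \<le> n" by (rule n16)
  have nh: "n \<le> n * h" "n * 1 \<le> n * h3" using h1 by simp_all
  have chkb: "T_chkb + 4 \<le> 37 * n" using kn n by (simp add: T_chkb_def T_dec_def T_norm_def)
  have "h * (T_chkb + 4) \<le> h * (37 * n)" using chkb by (rule mult_le_mono2)
  then have chk: "T_chk \<le> 44 * (n * h)"
  proof -
    have "h * (37 * n) = 37 * (n * h)" by simp
    then show ?thesis
      using \<open>h * (T_chkb + 4) \<le> h * (37 * n)\<close> nh kn n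
      unfolding T_chk_def H_def[symmetric] h_def[symmetric] by linarith
  qed
  have cand: "T_cand + 4 \<le> 99 * (n * h)"
    unfolding T_cand_def T_dec_def T_grid_def T_norm_def using chk nh kn n by linarith
  have level: "T_level + 2 \<le> 125 * (n * h3)"
  proof -
    have "CN * (T_cand + 4) \<le> CN * (99 * (n * h))" using cand by (rule mult_le_mono2)
    also have "\<dots> = 99 * (n * h3)" by (simp add: h3 mult_ac)
    finally have 1: "CN * (T_cand + 4) \<le> 99 * (n * h3)" .
    have "1 * h3 \<le> n * h3" using n by (intro mult_le_mono1) simp
    then have "4 * H \<le> 4 * (n * h3)" using HC Ch by linarith
    then have "T_wb \<le> 4 * (n * h3) + 6" unfolding T_wb_def using H1(2) by linarith
    then show ?thesis unfolding T_level_def using 1 nh(2) h1(3) n by linarith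
  qed
  have J1: "1 \<le> J" by (rule J(3))
  have Jn: "n \<le> J * (n * h3)"
  proof -
    have "1 * (n * 1) \<le> J * (n * h3)" using J1 h1 by (intro mult_le_mono) auto
    then show ?thesis by simp
  qed
  have bld: "T_build \<le> 137 * (J * (n * h3))"
  proof -
    have "J * (T_level + 2) \<le> J * (125 * (n * h3))" using level by (rule mult_le_mono2)
    then have "J * (T_level + 2) \<le> 125 * (J * (n * h3))" by (simp add: mult_ac)
    then show ?thesis unfolding T_build_def using Jn kn n by linarith
  qed
  let ?W = "(J * J) * (n * n) * h3"
  have W1: "J * (J * (n * h3)) \<le> ?W"
  proof -
    have "J * J * (n * 1) * h3 \<le> J * J * (n * n) * h3" using n by (intro mult_le_mono) auto
    then show ?thesis by (simp add: mult_ac)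
  qed
  have W2: "J * (n * h3) \<le> J * (J * (n * h3))" using J1 by simp
  have W3: "n * n \<le> ?W" "J \<le> ?W"
  proof -
    have "1 * (n * n) * 1 \<le> ?W" using J1 h1 by (intro mult_le_mono) auto
    then show "n * n \<le> ?W" by simp
    have "J * 1 * (1 * 1) * 1 \<le> ?W" using J1 h1 n by (intro mult_le_mono) auto
    then show "J \<le> ?W" by simp
  qed
  have W4: "n \<le> ?W" using Jn W1 W2 by linarith
  have siev: "T_sieve (2 * J) \<le> 36700 * ?W"
  proof -
    have "T_build + 4 \<le> 138 * (J * (n * h3))" using bld Jn n by linarith
    then have "129 * (2 * J) * (T_build + 4) \<le> 129 * (2 * J) * (138 * (J * (n * h3)))" by (rule mult_le_mono2)
    then have "129 * (2 * J) * (T_build + 4) \<le> 35604 * (J * (J * (n * h3)))" by (simp add: mult_ac)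
    then show ?thesis unfolding T_sieve_def using bld W1 W2 W4 n by linarith
  qed
  have "n * (n * 7 + 20) = 7 * (n * n) + 20 * n" by (simp add: algebra_simps)
  moreover have "n * n * 7 = 7 * (n * n)" by simp
  ultimately have "T_prog \<le> 38000 * ?W"
    unfolding T_prog_def using siev W3 W4 n by linarith
  then show ?thesis by (simp add: h3_def mult.assoc)
qed

lemma lam_lamb: "lam = lamb x" by (simp add: lam_def lamb_def)

lemma lam_ge: "1 \<le> lam" using x1(1) by (simp add: lam_lamb lamb_eq)

lemma H_le: "real H \<le> 4 * real x * lam powr (real n / real x)"
proof -
  let ?l = "lam powr (real n / real x)"
  have "1 * 1 \<le> real x * ?l" using x1(1) lam_ge by (intro mult_mono ge_one_powr_ge_zero) auto
  then show ?thesis using Nb_bounds(2) by (simp add: H_def)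
qed

text \<open>Here \<open>3 * k = 3 + 6 * (x - 1)\<close>. Of the factors \<open>4 * x\<close> in the
  list bound, three go into a polynomial; the others are at most \<open>q ^ 2\<close> each and, by
  the cap on \<open>x\<close>, contribute \<open>12 * (x - 1) \<le> 3/35 * n\<close> to the
  exponent. This leaves \<open>13 - 3/35 = 452/35\<close> for the powers of \<open>lam\<close>. Both
  \<open>lam\<close> and \<open>6 - 3 / x\<close> increase with \<open>x\<close>, so the uncapped
  \<open>X\<close> of \<open>exponent\<close> may be used.\<close>

lemma H_time: "real (H ^ (3 * k)) \<le> (4 * real n) ^ 3 * real q powr (13 * real n)"
proof -
  define X where "X = (q * q + 6) div 7"
  obtain r where r: "0 < r" "lamb X \<le> real q powr r" "r * (6 - 3 / real X) \<le> 452/35"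
    using exponent[OF q(1)] unfolding X_def by blast
  have q1: "1 < real q" "0 < real q" using q(1) by simp_all
  have xX: "x \<le> X" "1 \<le> X" using x1(1,6) unfolding X_def by linarith+
  have k3: "3 * k = 3 + 6 * (x - 1)" using x1(1) by (simp add: k_def)
  let ?l = "lam powr (real n / real x)"
  have "real (H ^ (3 * k)) \<le> (4 * real x * ?l) ^ (3 * k)"
    unfolding of_nat_power using H_le by (intro power_mono) auto
  also have "\<dots> = (4 * real x) ^ 3 * (4 * real x) ^ (6 * (x - 1)) * ?l ^ (3 * k)"
    unfolding power_mult_distrib[of "4 * real x"] by (simp only: k3 power_add)
  also have "\<dots> \<le> (4 * real n) ^ 3 * real q powr (3/35 * real n) * real q powr (452/35 * real n)"
  proof (intro mult_mono)
    show "(4 * real x) ^ 3 \<le> (4 * real n) ^ 3" using x1(5) n16 by (intro power_mono mult_left_mono) auto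
    show "(4 * real x) ^ (6 * (x - 1)) \<le> real q powr (3/35 * real n)"
    proof -
      have "4 * x \<le> q * q"
      proof -
        have "16 \<le> q * q" using mult_le_mono[OF q(1) q(1)] by simp
        then show ?thesis using x1(6) by linarith
      qed
      then have "4 * real x \<le> real q ^ 2" by (simp add: power2_eq_square flip: of_nat_mult)
      then have "(4 * real x) ^ (6 * (x - 1)) \<le> (real q ^ 2) ^ (6 * (x - 1))" by (intro power_mono) auto
      also have "\<dots> = real q powr real (2 * (6 * (x - 1)))" using q1 by (simp only: power_mult[symmetric] powr_realpow)
      also have "\<dots> \<le> real q powr (3/35 * real n)"
      proof (rule powr_mono)
        have "140 * (x - 1) \<le> n" using x1(5) by linarith
        then have "real (140 * (x - 1)) \<le> real n" by (simp only: of_nat_le_iff)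
        then show "real (2 * (6 * (x - 1))) \<le> 3/35 * real n" by simp
      qed (use q1 in simp)
      finally show ?thesis .
    qed
    show "?l ^ (3 * k) \<le> real q powr (452/35 * real n)"
    proof -
      have "?l ^ (3 * k) = ?l powr real (3 * k)" using lam_ge by (intro powr_realpow[symmetric]) auto
      also have "\<dots> = lam powr (real n * (6 - 3 / real x))"
      proof -
        have "real (3 * k) = 6 * real x - 3" using k3 x1(1) by simp
        then have "real n / real x * real (3 * k) = real n * (6 - 3 / real x)"
          using x1(1) by (simp only:) (simp add: field_simps)
        then show ?thesis by (simp only: powr_powr)
      qed
      also have "\<dots> \<le> lam powr (real n * (6 - 3 / real X))"
        using lam_ge xX x1(1) by (intro powr_mono mult_left_mono diff_left_mono divide_left_mono) auto
      also have "\<dots> \<le> (real q powr r) powr (real n * (6 - 3 / real X))"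
      proof (rule powr_mono2)
        have "3 / real X \<le> 6" using xX(2) by (simp add: divide_le_eq)
        then show "0 \<le> real n * (6 - 3 / real X)" by simp
        show "lam \<le> real q powr r" using r(2) lamb_mono[OF xX(1)] by (simp add: lam_lamb)
      qed (use lam_ge in simp)
      also have "\<dots> = real q powr (real n * (r * (6 - 3 / real X)))" by (simp add: powr_powr mult_ac)
      also have "\<dots> \<le> real q powr (452/35 * real n)"
        using mult_left_mono[OF r(3), of "real n"] q1 by (intro powr_mono) (auto simp: mult.commute)
      finally show ?thesis .
    qed
  qed (auto intro!: mult_nonneg_nonneg)
  also have "\<dots> = (4 * real n) ^ 3 * real q powr (13 * real n)"
    unfolding mult.assoc powr_add[symmetric] by (simp add: distrib_right[symmetric])
  finally show ?thesis .
qed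

text \<open>Without the cap, \<open>exponent\<close> provides an \<open>r\<close> with
  \<open>r / x \<le> 16 / q ^ 2\<close>. If the cap is in force, \<open>n / x \<le> 140\<close> and
  the lists are of polynomial length anyway, which is the origin of the exponent 140.\<close>

lemma Nb_space: "real Nb \<le> real n * (12 * real n) ^ 140 * real q powr (16 * real n / (real q)\<^sup>2)"
proof -
  have q1: "1 < real q" "0 < real q" using q(1) by simp_all
  have xn: "real x \<le> real n" "1 \<le> real x" using x1(1,5) n16 by auto
  have n12: "1 \<le> (12 * real n) ^ 140" using n16 by (intro one_le_power) simp
  have qp: "1 \<le> real q powr (16 * real n / (real q)\<^sup>2)" using q1 by (intro ge_one_powr_ge_zero) auto
  have "lam powr (real n / real x) \<le> (12 * real n) ^ 140 * real q powr (16 * real n / (real q)\<^sup>2)"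
  proof (cases "x = (q * q + 6) div 7")
    case True
    obtain r where r: "0 < r" "lamb x \<le> real q powr r" "r * real q ^ 2 \<le> 16 * real x"
      using exponent[OF q(1)] unfolding True[symmetric] by blast
    have "lam powr (real n / real x) \<le> (real q powr r) powr (real n / real x)"
      using r(2) lam_ge by (intro powr_mono2) (auto simp: lam_lamb)
    also have "\<dots> = real q powr (r * (real n / real x))" by (rule powr_powr)
    also have "\<dots> \<le> real q powr (16 * real n / (real q)\<^sup>2)"
    proof (rule powr_mono)
      have "r * real q ^ 2 * real n \<le> 16 * real x * real n" using r(3) by (intro mult_right_mono) auto
      then show "r * (real n / real x) \<le> 16 * real n / (real q)\<^sup>2" using xn q1 by (simp add: field_simps)
    qed (use q1 in simp)
    also have "\<dots> \<le> (12 * real n) ^ 140 * real q powr (16 * real n / (real q)\<^sup>2)"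
      using mult_right_mono[OF n12, of "real q powr (16 * real n / (real q)\<^sup>2)"] by simp
    finally show ?thesis .
  next
    case False
    then have x: "x = n div 140 + 1" using x_def by linarith
    have "lam \<le> 12 * real n" using xn by (simp add: lam_lamb lamb_eq)
    have "n \<le> 140 * x" unfolding x using dividend_less_times_div[of 140 n] by simp
    then have "real n \<le> real (140 * x)" by (simp only: of_nat_le_iff)
    then have "real n / real x \<le> 140" using xn by (simp add: divide_le_eq)
    then have "lam powr (real n / real x) \<le> lam powr 140" using lam_ge by (intro powr_mono) auto
    also have "\<dots> = lam ^ 140" using lam_ge by (simp add: powr_numeral)
    also have "\<dots> \<le> (12 * real n) ^ 140" using \<open>lam \<le> 12 * real n\<close> lam_ge by (intro power_mono) auto
    also have "\<dots> \<le> (12 * real n) ^ 140 * real q powr (16 * real n / (real q)\<^sup>2)"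
      using mult_left_mono[OF qp, of "(12 * real n) ^ 140"] by simp
    finally show ?thesis .
  qed
  then have "real x * lam powr (real n / real x) \<le> real n * ((12 * real n) ^ 140 * real q powr (16 * real n / (real q)\<^sup>2))"
    using xn by (intro mult_mono) auto
  then show ?thesis using Nb_bounds(2) by (simp add: mult.assoc)
qed

end

context svp_input
begin

lemma abs_input: assumes "i < n * n" shows "\<bar>num i\<bar> \<le> m" "\<bar>den i\<bar> \<le> m"
proof -
  have "den i * (\<bar>num i\<bar> + 1) dvd m" unfolding m_def using assms by (intro dvd_prodI) auto
  then have le: "den i * (\<bar>num i\<bar> + 1) \<le> m" using m1 by (intro zdvd_imp_le) auto
  have "1 * \<bar>num i\<bar> \<le> den i * (\<bar>num i\<bar> + 1)" "den i * 1 \<le> den i * (\<bar>num i\<bar> + 1)"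
    using den[of i] by (intro mult_mono; simp)+
  then show "\<bar>num i\<bar> \<le> m" "\<bar>den i\<bar> \<le> m" using le den[of i] by linarith+
qed

lemma real_a:
  assumes "r < n" "c < n"
  shows "real_of_int (a r c) = of_int D * (of_int (num (n * c + r)) / of_int (den (n * c + r)))"
proof -
  have "n * c + r < n * Suc c" using assms by simp
  also have "\<dots> \<le> n * n" using assms by (intro mult_le_mono2) simp
  finally show ?thesis using den_dvd[of "n * c + r"] by (simp add: a_def real_of_int_div)
qed

text \<open>Up to the constant, \<open>F * M\<close> is a product of \<open>n + 2\<close> factors
  \<open>M\<close>, each of at most \<open>2 * \<beta>\<close> bits.\<close>

lemma J_le:
  assumes m: "m \<le> 2 ^ \<beta>" and n: "n \<le> \<beta>"
  shows "J \<le> 3 * \<beta>\<^sup>2"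
proof -
  have nb: "int n \<le> 2 ^ \<beta>"
  proof -
    have "n < 2 ^ \<beta>" using less_exp[of \<beta>] n by linarith
    then have "int n < int (2 ^ \<beta>)" by (simp only: of_nat_less_iff)
    then show ?thesis by simp
  qed
  have "M \<le> 2 ^ \<beta> * 2 ^ \<beta>" unfolding M_def using m1 by (intro mult_mono nb m) auto
  then have M: "M \<le> 2 ^ (2 * \<beta>)" by (simp add: mult_2 power_add)
  have "M ^ (n + 1) * M \<le> (2 ^ (2 * \<beta>)) ^ (n + 1) * 2 ^ (2 * \<beta>)" using nM by (intro mult_mono power_mono M) auto
  then have "2 * (F * M) \<le> 2 ^ 7 * ((2 ^ (2 * \<beta>)) ^ (n + 1) * 2 ^ (2 * \<beta>))" by (simp add: F_def)
  also have "\<dots> = 2 ^ (7 + (2 * \<beta> * (n + 1) + 2 * \<beta>))" by (simp only: power_add power_mult)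
  finally have "J \<le> 7 + (2 * \<beta> * (n + 1) + 2 * \<beta>)" unfolding J_def by (rule Least_le)
  also have "\<dots> \<le> 7 + (2 * \<beta> * (\<beta> + 1) + 2 * \<beta>)" using n by (intro add_mono mult_le_mono) auto
  also have "\<dots> = 7 + 4 * \<beta> + 2 * \<beta>\<^sup>2" by (simp add: power2_eq_square)
  also have "\<dots> \<le> 3 * \<beta>\<^sup>2"
  proof -
    have "16 * \<beta> \<le> \<beta>\<^sup>2" unfolding power2_eq_square using n n16 by (intro mult_le_mono) auto
    then show ?thesis using n n16 by linarith
  qed
  finally show ?thesis .
qed

end

context svp_instance
begin

text \<open>The square of \<open>J\<close> gives \<open>9 * \<beta> ^ 4\<close>, the square of
  \<open>n\<close> gives \<open>\<beta> ^ 2\<close>, and the cube in \<open>H_time\<close> gives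
  \<open>64 * \<beta> ^ 3\<close>; the constant is \<open>38000 * 9 * 64\<close>.\<close>

lemma T_prog_bound:
  assumes J: "J \<le> 3 * \<beta>\<^sup>2" and n: "n \<le> \<beta>"
  shows "real T_prog \<le> 21888000 * real \<beta> ^ 9 * real q powr (13 * real n)"
proof -
  have "real T_prog \<le> real (38000 * (J * J) * (n * n)) * real (H ^ (3 * k))"
    using T_prog_le unfolding of_nat_mult[symmetric] by (simp only: of_nat_le_iff)
  also have "\<dots> \<le> real (38000 * ((3 * \<beta>\<^sup>2) * (3 * \<beta>\<^sup>2)) * (\<beta> * \<beta>)) * ((4 * real \<beta>) ^ 3 * real q powr (13 * real n))"
  proof (rule mult_mono)
    show "real (38000 * (J * J) * (n * n)) \<le> real (38000 * ((3 * \<beta>\<^sup>2) * (3 * \<beta>\<^sup>2)) * (\<beta> * \<beta>))"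
      unfolding of_nat_le_iff using J n by (intro mult_le_mono) auto
    have "(4 * real n) ^ 3 * real q powr (13 * real n) \<le> (4 * real \<beta>) ^ 3 * real q powr (13 * real n)"
      using n by (intro mult_right_mono power_mono) auto
    then show "real (H ^ (3 * k)) \<le> (4 * real \<beta>) ^ 3 * real q powr (13 * real n)" using H_time by linarith
  qed auto
  also have "\<dots> = 21888000 * real \<beta> ^ 9 * real q powr (13 * real n)"
  proof -
    have gen: "38000 * ((3 * t\<^sup>2) * (3 * t\<^sup>2)) * (t * t) * ((4 * t) ^ 3 * Q) = 21888000 * t ^ 9 * Q" for t Q :: real
    proof -
      have "t ^ 9 = t\<^sup>2 * t\<^sup>2 * (t * t) * t ^ 3"
        unfolding power2_eq_square[of t, symmetric] power_add[symmetric] by simp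
      then show ?thesis by (simp add: power_mult_distrib)
    qed
    show ?thesis by (simp only: of_nat_mult of_nat_power of_nat_numeral gen)
  qed
  finally show ?thesis .
qed

lemma sum_lens: "(\<Sum>a<48. lens n Nb a) = 2 * (n * n) + 3 * n + 2 * Nb + 44"
  by (simp add: lens_def lessThan_nat_numeral)

lemma space_bound:
  "real (\<Sum>a<48. lens n Nb a) \<le> real ((2 * 12 ^ 140 + 60) * n ^ 141) * real q powr (16 * real n / (real q)\<^sup>2)"
proof -
  define C :: nat where "C = 12 ^ 140"
  let ?Q = "real q powr (16 * real n / (real q)\<^sup>2)"
  have Q: "1 \<le> ?Q" using q(1) by (intro ge_one_powr_ge_zero) auto
  have "2 * (n * n) + 3 * n + 44 \<le> 60 * (n * n)"
  proof -
    have "16 * n \<le> n * n" using n16 by (intro mult_le_mono1)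
    then show ?thesis using n16 by linarith
  qed
  also have "\<dots> \<le> 60 * n ^ 141"
    using power_increasing[of 2 141 n] n16 by (simp add: power2_eq_square)
  finally have 1: "real (2 * (n * n) + 3 * n + 44) \<le> real (60 * n ^ 141) * 1"
    unfolding mult_1_right of_nat_le_iff .
  have "real (60 * n ^ 141) * 1 \<le> real (60 * n ^ 141) * ?Q" using Q by (intro mult_left_mono) auto
  with 1 have 2: "real (2 * (n * n) + 3 * n + 44) \<le> real (60 * n ^ 141) * ?Q" by linarith
  have "(12 * real n) ^ 140 = real C * real n ^ 140" unfolding C_def by (simp only: power_mult_distrib of_nat_power of_nat_numeral)
  then have "real n * (12 * real n) ^ 140 = real (C * n ^ 141)"
    using power_Suc[of "real n" 140] by (simp add: mult.left_commute)
  then have 3: "real Nb \<le> real (C * n ^ 141) * ?Q" using Nb_space by simp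
  have "real (\<Sum>a<48. lens n Nb a) = real (2 * (n * n) + 3 * n + 44) + 2 * real Nb" unfolding sum_lens by simp
  also have "\<dots> \<le> real (60 * n ^ 141) * ?Q + 2 * (real (C * n ^ 141) * ?Q)" using 2 3 by linarith
  also have "\<dots> = real ((2 * C + 60) * n ^ 141) * ?Q" by (simp add: algebra_simps)
  finally show ?thesis unfolding C_def .
qed

lemma H_bits: "int H \<le> 2 ^ (2 * (n * n))"
proof -
  have xn: "real x \<le> real n" "1 \<le> real x" using x1(1,5) n16 by auto
  have l: "lam \<le> 12 * real n" using xn by (simp add: lam_lamb lamb_eq)
  have "lam powr (real n / real x) \<le> lam powr real n"
    using xn lam_ge by (intro powr_mono) (simp_all add: divide_le_eq mult_left_le)
  also have "\<dots> = lam ^ n" using lam_ge by (simp add: powr_realpow)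
  also have "\<dots> \<le> (12 * real n) ^ n" using l lam_ge by (intro power_mono) auto
  finally have "real H \<le> 4 * real n * (12 * real n) ^ n"
    using H_le mult_mono[of "4 * real x" "4 * real n" "lam powr (real n / real x)" "(12 * real n) ^ n"] xn by simp
  also have "\<dots> = real (4 * n * (12 * n) ^ n)" by simp
  finally have "H \<le> 4 * n * (12 * n) ^ n" by (simp only: of_nat_le_iff)
  also have "\<dots> \<le> 2 ^ (n + 2) * (2 ^ (n + 4)) ^ n"
  proof (intro mult_mono power_mono)
    have "4 * n \<le> 2 ^ n * 4" "12 * n \<le> 2 ^ n * 16" using less_exp[of n] by linarith+
    then show "4 * n \<le> 2 ^ (n + 2)" "12 * n \<le> 2 ^ (n + 4)" by (simp_all add: power_add)
  qed auto
  also have "\<dots> = 2 ^ (n + 2 + (n + 4) * n)" by (simp only: power_add power_mult)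
  also have "\<dots> \<le> 2 ^ (2 * (n * n))"
  proof (rule power_increasing)
    have "16 * n \<le> n * n" using n16 by (intro mult_le_mono1)
    moreover have "(n + 4) * n = n * n + 4 * n" by (simp add: algebra_simps)
    ultimately show "n + 2 + (n + 4) * n \<le> 2 * (n * n)" using n16 by linarith
  qed simp
  finally have "int H \<le> int (2 ^ (2 * (n * n)))" by (simp only: of_nat_le_iff)
  then show ?thesis by simp
qed

text \<open>The cells of \<open>aW\<close> have \<open>J + 1\<close> digits to base
  \<open>G\<close>, each made of \<open>2 * n\<close> digits to base \<open>P\<close> of at most
  \<open>10 * J\<close> bits. That is of order \<open>J ^ 2 * n\<close>, hence
  \<open>\<beta> ^ 5\<close>.\<close>

lemma bits_bound:
  assumes J': "J \<le> 3 * \<beta>\<^sup>2" and n: "n \<le> \<beta>"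
  shows "int_bits b \<le> 401 * \<beta> ^ 5"
proof -
  have two: "(2::int) ^ i \<le> 2 ^ j" if "i \<le> j" for i j :: nat using that by (intro power_increasing) auto
  have FM: "F * M \<le> 2 ^ J" "M \<le> 2 ^ J" using J(1) Y1(3,6) by linarith+
  have "(F * M) * M \<le> 2 ^ J * 2 ^ J" by (rule mult_mono[OF FM]) (use nM in simp_all)
  then have Y: "Y \<le> 2 ^ (2 * J)" by (simp add: Y_def mult_2 power_add)
  have "P \<le> 2 ^ 6 * (2 ^ (2 * J) * 2 ^ (2 * J))"
    unfolding P_def using Y1(4) by (intro mult_mono Y) auto
  also have "\<dots> = 2 ^ (6 + (2 * J + 2 * J))" by (simp only: power_add)
  also have "\<dots> \<le> 2 ^ (10 * J)" by (rule two) (use J(3) in linarith)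
  finally have P: "P \<le> 2 ^ (10 * J)" .
  have "G ^ (J + 1) = P ^ (2 * n * (J + 1))" by (simp only: G_def power_mult)
  also have "\<dots> \<le> (2 ^ (10 * J)) ^ (2 * n * (J + 1))" using PG(2) by (intro power_mono P) auto
  also have "\<dots> = 2 ^ (20 * (J * n) * (J + 1))" by (simp add: power_mult[symmetric] algebra_simps)
  finally have G: "G ^ (J + 1) \<le> 2 ^ (20 * (J * n) * (J + 1))" .
  have n2: "2 * int n + 4 \<le> 2 ^ (n + 2)"
  proof -
    have "2 * int n + 4 \<le> 2 ^ n * 4" using of_nat_less_two_power[of n, where 'a = int] n16 by linarith
    then show ?thesis by (simp add: power_add)
  qed
  have "(2 * int n + 4) * G ^ (J + 1) \<le> 2 ^ (n + 2) * 2 ^ (20 * (J * n) * (J + 1))"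
    using PG(5) by (intro mult_mono n2 G) auto
  also have "\<dots> = 2 ^ (n + 2 + 20 * (J * n) * (J + 1))" by (simp only: power_add)
  also have "\<dots> \<le> 2 ^ (362 * \<beta> ^ 5)"
  proof (rule two)
    have \<beta>: "1 \<le> \<beta>" using n n16 by simp
    have "J * n * (J + 1) \<le> (3 * \<beta>\<^sup>2 * \<beta>) * (2 * (3 * \<beta>\<^sup>2))" using J' J(3) n by (intro mult_le_mono) auto
    also have "\<dots> = 18 * \<beta> ^ 5"
    proof -
      have "\<beta> ^ (2 + 1 + 2) = \<beta>\<^sup>2 * \<beta> * \<beta>\<^sup>2" by (simp only: power_add power_one_right)
      then show ?thesis by simp
    qed
    finally have "J * n * (J + 1) \<le> 18 * \<beta> ^ 5" .
    moreover have "\<beta> ^ 1 \<le> \<beta> ^ 5" using \<beta> by (intro power_increasing) auto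
    ultimately show "n + 2 + 20 * (J * n) * (J + 1) \<le> 362 * \<beta> ^ 5" using n n16 by simp
  qed
  finally have b1: "(2 * int n + 4) * G ^ (J + 1) \<le> 2 ^ (362 * \<beta> ^ 5)" .
  have "int (5 ^ n * (2 * (Nb + 1)) ^ (2 * k)) = 5 ^ n * int H ^ (2 * k)" by (simp add: H_def)
  also have "\<dots> \<le> (2 ^ 3) ^ n * (2 ^ (2 * (n * n))) ^ (2 * k)"
    by (intro mult_mono power_mono H_bits) auto
  also have "\<dots> = 2 ^ (3 * n + 2 * (n * n) * (2 * k))" by (simp only: power_add power_mult)
  also have "\<dots> \<le> 2 ^ (362 * \<beta> ^ 5)"
  proof (rule two)
    have \<beta>: "1 \<le> \<beta>" using n n16 by simp
    have "3 * n + 2 * (n * n) * (2 * k) \<le> 3 * \<beta> ^ 1 + 2 * (\<beta> * \<beta>) * (2 * \<beta>)"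
      using n x1(4) by (intro add_mono mult_le_mono) auto
    also have "2 * (\<beta> * \<beta>) * (2 * \<beta>) = 4 * \<beta> ^ 3" by (simp add: power3_eq_cube)
    also have "3 * \<beta> ^ 1 + 4 * \<beta> ^ 3 \<le> 3 * \<beta> ^ 5 + 4 * \<beta> ^ 5"
      using \<beta> by (intro add_mono mult_le_mono power_increasing) auto
    finally show "3 * n + 2 * (n * n) * (2 * k) \<le> 362 * \<beta> ^ 5" by linarith
  qed
  finally have b2: "int (5 ^ n * (2 * (Nb + 1)) ^ (2 * k)) \<le> 2 ^ (362 * \<beta> ^ 5)" .
  have "b \<le> 2 ^ 1 * 2 ^ (362 * \<beta> ^ 5)" unfolding b_def using add_mono[OF b1 b2] by (simp only: power_one_right mult_2)
  also have "\<dots> = 2 ^ (1 + 362 * \<beta> ^ 5)" by (simp only: power_add)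
  also have "\<dots> < 2 ^ (400 * \<beta> ^ 5)"
  proof (rule power_strict_increasing)
    have "1 \<le> \<beta> ^ 5" using n n16 by simp
    then show "1 + 362 * \<beta> ^ 5 < 400 * \<beta> ^ 5" by linarith
  qed simp
  finally have "\<bar>b\<bar> < 2 ^ (400 * \<beta> ^ 5)" using b_bounds(8) by simp
  then have "int_bits b \<le> Suc (400 * \<beta> ^ 5)" by (rule int_bits_le)
  moreover have "1 \<le> \<beta> ^ 5" using n n16 by simp
  ultimately show ?thesis by linarith
qed

lemma svp_program_correct:
  assumes s: "\<And>a i. s a i = (if a = 0 \<and> i = 0 then int n else if a = 0 \<and> i = 1 then int q
      else if a = 1 \<and> i < n * n then num i else if a = 2 \<and> i < n * n then den i else 0)"
    and \<beta>: "m \<le> 2 ^ \<beta>" "n \<le> \<beta>"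
  shows "runs_in_time svp_program s (21888000 * real \<beta> ^ 9 * real q powr (13 * real n))"
    and "runs_in_space svp_program s
      (real ((2 * 12 ^ 140 + 60) * n ^ 141) * real q powr (16 * real n / (real q)\<^sup>2))"
    and "words_bounded_by svp_program s (401 * \<beta> ^ 5)"
    and "\<exists>s'. final_state svp_program s = return_pmf s' \<and> (\<exists>u\<in>ivecs n. u \<noteq> vzero \<and>
      (\<forall>w\<in>ivecs n. w \<noteq> vzero \<longrightarrow> sqn n a u \<le> sqn n a w) \<and>
      (\<forall>r<n. s' 3 r = image n A u r \<and> s' 4 r = F * D))"
proof -
  have Js: "J \<le> 3 * \<beta>\<^sup>2" by (rule J_le[OF \<beta>])
  obtain z where z: "z \<in> ivecs n" "z \<noteq> vzero"
      "\<And>u. u \<in> ivecs n \<Longrightarrow> u \<noteq> vzero \<Longrightarrow> sqn n a z \<le> sqn n a u" "\<And>i. i < n \<Longrightarrow> \<bar>z i\<bar> \<le> M ^ (n + 1)"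
    using shortest_exists by blast
  have qn: "q \<le> n"
  proof -
    have "1 * q \<le> q * q" using q(1) by (intro mult_le_mono1) simp
    then show ?thesis using q(2) by linarith
  qed
  have mb: "m \<le> b" using nM(3) b_bounds(12) by linarith
  have "\<bar>s a i\<bar> \<le> b" for a i
  proof -
    have "\<bar>num i\<bar> \<le> b" "\<bar>den i\<bar> \<le> b" if "i < n * n" using abs_input[OF that] mb by linarith+
    moreover have "int n \<le> b" "int q \<le> b" "0 \<le> b" using b_bounds(7,8) qn by linarith+
    ultimately show ?thesis unfolding s by auto
  qed
  moreover have "s a i = 0" if "lens n Nb a \<le> i" for a i
    using that n16 unfolding s by (auto simp: lens_def split: if_splits)
  ultimately have "inbounds b (lens n Nb) s" by (simp add: inbounds_def)
  moreover have "input_ok s" by (simp add: input_ok_def s)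
  moreover have "s a i = 0" if "3 \<le> a" for a i using that by (simp add: s)
  ultimately have "wp (inbounds b (lens n Nb)) svp_program T_prog (\<lambda>s'. \<exists>u\<in>ivecs n. u \<noteq> vzero \<and> sqn n a u = sqn n a z \<and>
    (\<forall>r<n. s' 3 r = image n A u r \<and> s' 4 r = F * D)) s"
    using z by (intro program_spec) auto
  note w = wp_program[OF this]
  show "runs_in_time svp_program s (21888000 * real \<beta> ^ 9 * real q powr (13 * real n))"
    using w(1) order_trans[OF _ T_prog_bound[OF Js \<beta>(2)]] unfolding runs_in_time_def by blast
  show "runs_in_space svp_program s
      (real ((2 * 12 ^ 140 + 60) * n ^ 141) * real q powr (16 * real n / (real q)\<^sup>2))"
  proof (rule inbounds_space[where m = 48])
    show "lens n Nb a = 0" if "48 \<le> a" for a using that by (simp add: lens_def)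
  qed (rule w(3) space_bound; assumption?)+
  show "words_bounded_by svp_program s (401 * \<beta> ^ 5)"
    by (rule inbounds_words[OF w(3)]) (use bits_bound[OF Js \<beta>(2)] b_bounds(8) in auto)
  show "\<exists>s'. final_state svp_program s = return_pmf s' \<and> (\<exists>u\<in>ivecs n. u \<noteq> vzero \<and>
      (\<forall>w\<in>ivecs n. w \<noteq> vzero \<longrightarrow> sqn n a u \<le> sqn n a w) \<and>
      (\<forall>r<n. s' 3 r = image n A u r \<and> s' 4 r = F * D))"
  proof -
    obtain s' u where s': "final_state svp_program s = return_pmf s'"
        "u \<in> ivecs n" "u \<noteq> vzero" "sqn n a u = sqn n a z" "\<forall>r<n. s' 3 r = image n A u r \<and> s' 4 r = F * D"
      using w(2) by blast
    have "\<forall>w\<in>ivecs n. w \<noteq> vzero \<longrightarrow> sqn n a u \<le> sqn n a w" unfolding s'(4) using z(3) by blast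
    then show ?thesis using s' by blast
  qed
qed

end

section \<open>Rational bases\<close>

text \<open>The input arrays list the matrix column by column: entry \<open>(i, j)\<close> stands at
  \<open>n * j + i\<close>.\<close>

lemma sum_mod_div: "(\<Sum>k<n * n. g (k mod n) (k div n)) = (\<Sum>i<n. \<Sum>j<n. g i j)"
  for g :: "nat \<Rightarrow> nat \<Rightarrow> 'a::comm_monoid_add"
proof -
  have lt: "n * j + i < n * n" if "i < n" "j < n" for i j
  proof -
    have "n * j + i < n * Suc j" using that by simp
    also have "\<dots> \<le> n * n" using that by (intro mult_le_mono2) simp
    finally show ?thesis .
  qed
  have "(\<Sum>k<n * n. g (k mod n) (k div n)) = (\<Sum>(i, j)\<in>{..<n} \<times> {..<n}. g i j)"
    by (rule sum.reindex_bij_witness[where i = "\<lambda>(i, j). n * j + i" and j = "\<lambda>k. (k mod n, k div n)"])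
      (auto simp: lt less_mult_imp_div_less intro!: mod_less_divisor gr0I)
  then show ?thesis by (simp add: sum.cartesian_product)
qed

lemma factor_le_bits: "\<bar>d\<bar> * (\<bar>c\<bar> + 1) \<le> 2 ^ (int_bits c + int_bits d)"
proof -
  have "\<bar>d\<bar> * (\<bar>c\<bar> + 1) \<le> 2 ^ int_bits d * 2 ^ int_bits c"
    using abs_less_int_bits[of c] abs_less_int_bits[of d] by (intro mult_mono) auto
  then show ?thesis by (simp add: power_add mult.commute)
qed

lemma prod_le_basis_bits:
  "(\<Prod>k<n * n. \<bar>snd (quotient_of (B $$ (k mod n, k div n)))\<bar> * (\<bar>fst (quotient_of (B $$ (k mod n, k div n)))\<bar> + 1))
    \<le> 2 ^ basis_bits n B"
proof -
  let ?g = "\<lambda>i j. int_bits (fst (quotient_of (B $$ (i, j)))) + int_bits (snd (quotient_of (B $$ (i, j))))"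
  have "(\<Prod>k<n * n. \<bar>snd (quotient_of (B $$ (k mod n, k div n)))\<bar> * (\<bar>fst (quotient_of (B $$ (k mod n, k div n)))\<bar> + 1))
      \<le> (\<Prod>k<n * n. 2 ^ ?g (k mod n) (k div n))"
    by (intro prod_mono conjI factor_le_bits) auto
  also have "\<dots> = 2 ^ (\<Sum>k<n * n. ?g (k mod n) (k div n))" by (rule power_sum[symmetric])
  also have "(\<Sum>k<n * n. ?g (k mod n) (k div n)) = basis_bits n B"
    unfolding basis_bits_def by (rule sum_mod_div)
  finally show ?thesis .
qed

text \<open>Lets polynomials in the dimension be charged to the length of the input.\<close>

lemma le_basis_bits: "n \<le> basis_bits n B"
proof -
  have "(\<Sum>i<n. \<Sum>j<n. 1) \<le> basis_bits n B"
    unfolding basis_bits_def by (intro sum_mono) (simp add: int_bits_def)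
  then have "n * n \<le> basis_bits n B" by simp
  then show ?thesis by (rule le_trans[OF le_square])
qed

text \<open>The integer matrix \<open>a\<close> is \<open>D\<close> times the basis, so images under
  \<open>a\<close> are lattice vectors scaled by \<open>D\<close>. Independence over the reals
  yields the trivial kernel over the integers that \<open>svp_instance\<close> asks for.\<close>

lemma lattice_instance:
  fixes n q :: nat and B :: "rat mat"
  defines "Br \<equiv> map_mat real_of_rat B"
  defines "num \<equiv> \<lambda>k. fst (quotient_of (B $$ (k mod n, k div n)))"
    and "den \<equiv> \<lambda>k. snd (quotient_of (B $$ (k mod n, k div n)))"
  assumes q: "4 \<le> q" "q * q \<le> n" and B: "B \<in> carrier_mat n n" and indep: "cols_lin_indep Br"
  shows "svp_instance n q num den"
    and "\<And>u r. r < n \<Longrightarrow> (Br *\<^sub>v map_vec of_int (Matrix.vec n u)) $ r =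
      of_int (image n (svp_input.a n num den) u r) / of_int (svp_input.D n den)"
proof -
  have den: "1 \<le> den k" for k
    using quotient_of_denom_pos'[of "B $$ (k mod n, k div n)"] by (simp add: den_def)
  interpret svp_input n q num den by unfold_locales (use q den in auto)
  have entry: "real_of_int (a r c) = of_int D * (Br $$ (r, c))" if rc: "r < n" "c < n" for r c
  proof -
    obtain p d where pd: "quotient_of (B $$ (r, c)) = (p, d)" by (cases "quotient_of (B $$ (r, c))")
    then have "B $$ (r, c) = of_int p / of_int d" by (rule quotient_of_div)
    then have "Br $$ (r, c) = of_int p / of_int d" using B rc by (simp add: Br_def of_rat_divide)
    moreover have "num (n * c + r) = p" "den (n * c + r) = d" using rc pd by (simp_all add: num_def den_def)
    ultimately show ?thesis using real_a[OF rc] by simp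
  qed
  have im: "(Br *\<^sub>v map_vec of_int (Matrix.vec n u)) $ r = of_int (image n a u r) / of_int D" if r: "r < n" for u r
  proof -
    have "of_int (image n a u r) = (\<Sum>c<n. of_int D * (Br $$ (r, c) * of_int (u c)))"
      unfolding image_def of_int_sum of_int_mult by (intro sum.cong HOL.refl) (simp add: entry r)
    also have "\<dots> = of_int D * (Br *\<^sub>v map_vec of_int (Matrix.vec n u)) $ r"
      using r B by (simp add: Br_def scalar_prod_def atLeast0LessThan sum_distrib_left)
    finally show ?thesis using D1 by simp
  qed
  then show "\<And>u r. r < n \<Longrightarrow> (Br *\<^sub>v map_vec of_int (Matrix.vec n u)) $ r =
      of_int (image n (svp_input.a n num den) u r) / of_int (svp_input.D n den)" .
  show "svp_instance n q num den"
  proof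
    show "\<exists>r<n. image n a u r \<noteq> 0" if u: "u \<in> ivecs n" "u \<noteq> vzero" for u
    proof (rule ccontr)
      assume "\<not> (\<exists>r<n. image n a u r \<noteq> 0)"
      then have "Br *\<^sub>v map_vec of_int (Matrix.vec n u) = 0\<^sub>v n"
        using im[of _ u] B by (intro eq_vecI) (simp_all add: Br_def)
      then have z: "map_vec real_of_int (Matrix.vec n u) = 0\<^sub>v n"
        using indep B unfolding cols_lin_indep_def by (auto simp: Br_def)
      have "u i = 0" for i
      proof (cases "i < n")
        case True
        have "map_vec real_of_int (Matrix.vec n u) $ i = 0" unfolding z using True by simp
        then show ?thesis using True by simp
      qed (use u(1) in \<open>simp add: ivecs_def\<close>)
      with u(2) show False by auto
    qed
  qed
qed

theorem theorem14:
  shows "\<exists>(P :: com) (f :: nat \<Rightarrow> real) (p_time :: nat poly) (p_space :: nat poly) (p_word :: nat poly).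
    f \<in> o(\<lambda>n. real n) \<and>
    (\<forall>(n :: nat) (q :: nat) (L :: real vec set) (B :: rat mat).
       4 \<le> q \<and> real q \<le> sqrt (real n) \<and> is_lattice_basis n B L \<longrightarrow>
         solves_svp P n q B L \<and>
         runs_in_time P (input_state n q B)
           (real (poly p_time (basis_bits n B)) * real q powr (13 * real n + f n)) \<and>
         runs_in_space P (input_state n q B)
           (real (poly p_space n) * real q powr (16 * real n / (real q)\<^sup>2)) \<and>
         words_bounded_by P (input_state n q B) (poly p_word (basis_bits n B)))"
proof -
  have main: "solves_svp svp_program n q B L \<and>
      runs_in_time svp_program (input_state n q B)
        (21888000 * real (basis_bits n B) ^ 9 * real q powr (13 * real n)) \<and>
      runs_in_space svp_program (input_state n q B)
        (real ((2 * 12 ^ 140 + 60) * n ^ 141) * real q powr (16 * real n / (real q)\<^sup>2)) \<and>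
      words_bounded_by svp_program (input_state n q B) (401 * basis_bits n B ^ 5)"
    if q: "4 \<le> q" "real q \<le> sqrt (real n)" and L: "is_lattice_basis n B L" for n q L B
  proof -
    define Br where "Br = map_mat real_of_rat B"
    define num where "num k = fst (quotient_of (B $$ (k mod n, k div n)))" for k
    define den where "den k = snd (quotient_of (B $$ (k mod n, k div n)))" for k
    have B: "B \<in> carrier_mat n n" "cols_lin_indep Br" "L = lattice Br"
      using L by (simp_all add: is_lattice_basis_def Br_def)
    have "(real q)\<^sup>2 \<le> (sqrt (real n))\<^sup>2" using q by (intro power_mono) auto
    then have "real (q * q) \<le> real n" by (simp add: power2_eq_square)
    then have qq: "q * q \<le> n" by (simp only: of_nat_le_iff)
    note inst = lattice_instance[OF q(1) qq B(1) B(2)[unfolded Br_def], folded Br_def num_def[abs_def] den_def[abs_def]]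
    interpret svp_instance n q num den by (rule inst(1))
    have Bu: "(Br *\<^sub>v map_vec of_int (Matrix.vec n u)) $ r = of_int (image n a u r) / of_int D" if "r < n" for u r
      by (rule inst(2)[OF that])
    have bits: "m \<le> 2 ^ basis_bits n B"
      using prod_le_basis_bits[where n = n and B = B, folded num_def den_def] den[THEN order_trans[OF zero_le_one]]
      by (simp add: m_def)
    have "input_state n q B a i = (if a = 0 \<and> i = 0 then int n else if a = 0 \<and> i = 1 then int q
        else if a = 1 \<and> i < n * n then num i else if a = 2 \<and> i < n * n then den i else 0)" for a i
      by (simp add: input_state_def num_def den_def)
    note correct = svp_program_correct[OF this bits le_basis_bits]
    obtain s' u where s': "final_state svp_program (input_state n q B) = return_pmf s'"
      and u: "u \<in> ivecs n" "u \<noteq> vzero" "\<And>w. w \<in> ivecs n \<Longrightarrow> w \<noteq> vzero \<Longrightarrow> sqn n a u \<le> sqn n a w"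
      and out: "\<And>r. r < n \<Longrightarrow> s' 3 r = image n A u r" "\<And>r. r < n \<Longrightarrow> s' 4 r = F * D"
      using correct(4) by blast
    define vec_of where "vec_of w = Br *\<^sub>v map_vec of_int (Matrix.vec n w)" for w
    have dim: "dim_vec (vec_of w) = n" for w using B(1) by (simp add: vec_of_def Br_def)
    have norm: "euclidean_norm (vec_of w) = sqrt (of_int (sqn n a w)) / of_int D" for w
    proof -
      have "vec_of w \<bullet> vec_of w = (\<Sum>r<n. (of_int (image n a w r) / of_int D)\<^sup>2)"
        using Bu[of _ w] by (simp add: scalar_prod_def dim atLeast0LessThan power2_eq_square vec_of_def[symmetric])
      also have "\<dots> = of_int (sqn n a w) / (of_int D)\<^sup>2"
        by (simp add: sqn_def power_divide sum_divide_distrib)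
      finally show ?thesis using D1 by (simp add: euclidean_norm_def real_sqrt_divide)
    qed
    have mem: "vec_of w \<in> L" for w
      unfolding B(3) lattice_def vec_of_def using B(1) by (auto simp: Br_def)
    have nz: "vec_of w \<noteq> 0\<^sub>v n" if w: "w \<in> ivecs n" "w \<noteq> vzero" for w
    proof
      assume "vec_of w = 0\<^sub>v n"
      then have "euclidean_norm (vec_of w) = 0" by (simp add: euclidean_norm_def)
      then show False using norm[of w] sqn_a_pos[OF w] D1 by simp
    qed
    have surj: "\<exists>w\<in>ivecs n. w \<noteq> vzero \<and> v = vec_of w" if v: "v \<in> L - {0\<^sub>v n}" for v
    proof -
      obtain z :: "int vec" where z: "z \<in> carrier_vec n" "v = Br *\<^sub>v map_vec of_int z"
        using v B by (auto simp: lattice_def Br_def)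
      let ?w = "\<lambda>i. if i < n then z $ i else 0"
      have "Matrix.vec n ?w = z" using z(1) by (intro eq_vecI) auto
      then have vw: "v = vec_of ?w" using z(2) by (simp add: vec_of_def)
      have "vec_of vzero = 0\<^sub>v n"
        using Bu[of _ vzero] dim[of vzero] by (intro eq_vecI) (simp_all add: vec_of_def[symmetric] image_def)
      then have "?w \<noteq> vzero" using v vw by auto
      then show ?thesis using vw by (intro bexI[of _ ?w]) (auto simp: ivecs_def)
    qed
    have "lambda1 n L = euclidean_norm (vec_of u)"
      unfolding lambda1_def
    proof (rule cInf_eq_minimum)
      show "euclidean_norm (vec_of u) \<in> euclidean_norm ` (L - {0\<^sub>v n})" using mem nz[OF u(1,2)] by blast
      fix y assume "y \<in> euclidean_norm ` (L - {0\<^sub>v n})"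
      then obtain w where w: "w \<in> ivecs n" "w \<noteq> vzero" "y = euclidean_norm (vec_of w)" using surj by blast
      show "euclidean_norm (vec_of u) \<le> y"
        unfolding w(3) norm using u(3)[OF w(1,2)] D1 by (intro divide_right_mono) auto
    qed
    moreover have "Matrix.vec n (\<lambda>i. of_int (s' 3 i) / of_int (s' 4 i)) = vec_of u"
    proof (rule eq_vecI)
      fix i assume "i < dim_vec (vec_of u)"
      then have i: "i < n" by (simp add: dim)
      have "F \<noteq> 0" using F64 by simp
      then show "Matrix.vec n (\<lambda>i. of_int (s' 3 i) / of_int (s' 4 i)) $ i = vec_of u $ i"
        using i Bu[OF i, of u] by (simp add: out[OF i] image_A vec_of_def[symmetric])
    qed (simp add: dim)
    ultimately have "svp_solution n L (Matrix.vec n (\<lambda>i. of_int (s' 3 i) / of_int (s' 4 i)))"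
      using mem nz[OF u(1,2)] by (simp add: svp_solution_def)
    moreover have "0 < s' 4 i" if "i < n" for i using out(2)[OF that] F64 D1 by simp
    ultimately have "outputs_svp_solution n L s'" by (simp add: outputs_svp_solution_def)
    \<comment> \<open>The distribution of final states is a point mass at a correct state, so the
      success probability is 1.\<close>
    then have "solves_svp svp_program n q B L" by (simp add: solves_svp_def s')
    then show ?thesis using correct(1-3) by blast
  qed
  \<comment> \<open>The lower-order term is taken to be zero: all factors beyond
    \<open>q powr (13 * n)\<close> are polynomial in the input length and belong to the time
    polynomial.\<close>
  have *: "(\<lambda>_. 0) \<in> o(\<lambda>n. real n)" by simp
  have time: "real (poly (monom 21888000 9) \<beta>) = 21888000 * real \<beta> ^ 9" for \<beta> :: nat by (simp add: poly_monom)
  show ?thesis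
    by (rule exI[of _ svp_program], rule exI[of _ "\<lambda>_. 0"], rule exI[of _ "monom 21888000 9"],
        rule exI[of _ "monom (2 * 12 ^ 140 + 60) 141"], rule exI[of _ "monom 401 5"])
      (use main * in \<open>simp only: time add_0_right, simp only: poly_monom, blast\<close>)
qed

end
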